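(* Let $\mathbf{M}$ be a connected W*-algebra object in $\mathrm{TLJ}(\delta)$ whose associated fair and balanced $\delta$-graph is $(\Gamma,w,* )$, i.e. $\mathbf{M}\cong\mathbf{G}_\Gamma$. Then the tracial subalgebra object $\mathbf{M}_{tr}$ has associated fair and balanced $\delta$-graph the tracial cover $\Gamma_{tr}$, i.e. $\mathbf{M}_{tr}\cong\mathbf{G}_{\Gamma_{tr}}$ as W*-algebra objects.
   Context: **Fair and balanced $\delta$-graphs.** A fair and balanced $\delta$-graph is a locally finite directed graph $\Gamma$ (multiple edges and self-loops allowed) with edge weights $w:E(\Gamma)\to\mathbb{R}_{>0}$ and a distinguished vertex $*$, such that (i) there is an involution $e\mapsto\overline e$ of $E(\Gamma)$ with $s(\overline e)=t(e)$, $t(\overline e)=s(e)$ and $w(e)w(\overline e)=1$; (ii) $\sum_{s(e)=x}w(e)=\delta$ for every vertex $x$. Here $s,t$ denote source and target. A path is a (possibly empty) sequence of edges $e_1,\dots,e_k$ with $s(e_i)=t(e_{i-1})$, of weight $w(e_1)\cdots w(e_k)$; a loop based at $v$ is a path from $v$ to $v$. **Tracial cover.** $\Gamma_{tr}$ has as vertices the pairs $[\lambda,v]$ with $v\in V(\Gamma)$ and $\lambda$ the weight of some path from $*$ to $v$; the edges from $[\lambda,v]$ to $[\lambda',v']$ correspond to the edges $e$ of $\Gamma$ with $s(e)=v$, $t(e)=v'$, $w(e)=\lambda'/\lambda$, and carry weight $w(e)$. The involution is induced by that of $\Gamma$ (the edge from $[\lambda,v]$ to $[\lambda',v']$ given by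 $e$ is sent to the edge from $[\lambda',v']$ to $[\lambda,v]$ given by $\overline e$), and the distinguished vertex is $[1,*]$. **$\mathrm{TLJ}(\delta)$ and the algebra object of a graph.** Let $\delta=q+q^{-1}$, $0<q\le1$. $\mathrm{TLJ}(\delta)$ is the unitary tensor category obtained as the unitary Karoubi (idempotent and direct sum) completion of the category with objects $n\in\mathbb{Z}_{\ge0}$, tensor product $n\otimes m=n+m$, morphisms $n\to m$ the linear combinations of (unshaded) Temperley–Lieb diagrams, closed circles being replaced by the factor $\delta$; duals are $\overline n=n$ with nested cups and caps. A $*$-algebra object in $\mathrm{Vec}(\mathcal{C})$, for a unitary tensor category $\mathcal{C}$, is a linear functor $\mathbf{M}:\mathcal{C}^{op}\to\mathrm{Vec}$ with a unital lax monoidal structure $m_{a,b}:\mathbf{M}(a)\otimes\mathbf{M}(b)\to\mathbf{M}(a\otimes b)$ and conjugate-linear maps $j_a:\mathbf{M}(a)\to\mathbf{M}(\overline a)$ that are conjugate natural, involutive and satisfy $j_{a\otimes b}(m_{a,b}(u\otimes v))=m_{\overline b,\overline a}(j_b(v)\otimes j_a(u))$; it is a W*-algebra object if its $\mathcal{C}$-module category of finitely generated projective modules is a W*-category, and connected if $\mathbf{M}(\mathbb{1})\cong\mathbb{C}$. By De Commer–Yamashita, connected W*-algebra objects in $\mathrm{TLJ}(\delta)$ correspond to fair and balanced $\delta$-graphs with distinguished vertex via $\Gamma\mapsto\mathbf{G}_\Gamma$, where $\mathbf{G}_\Gamma$ is determined by: $\mathbf{G}_\Gamma(n)=\mathbb{C}[L_n]$,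 with $L_n$ the set of loops $e_1\cdots e_n$ of length $n$ based at $*$; if $\cup_i:n\to n+2$ is the diagram creating a pair of strands right after the $i$-th strand, then $\mathbf{G}_\Gamma(\cup_i):\mathbb{C}[L_{n+2}]\to\mathbb{C}[L_n]$ sends $e_1\cdots e_{n+2}$ to $\delta_{e_{i+1}=\overline{e_{i+2}}}\,w(e_{i+1})^{1/2}\,e_1\cdots e_ie_{i+3}\cdots e_{n+2}$, and for the adjoint $\cup_i^*:n+2\to n$, $\mathbf{G}_\Gamma(\cup_i^* )$ sends $e_1\cdots e_n$ to $\sum_{s(e)=t(e_i)}w(e)^{1/2}e_1\cdots e_i\,e\,\overline e\,e_{i+1}\cdots e_n$ (with $t(e_0):=*$); the multiplication is concatenation of loops; the $*$-structure is the conjugate-linear extension of $j_n(\ell)=w(\overline\ell)^{1/2}\overline\ell$, where $\overline\ell=\overline{e_n}\cdots\overline{e_1}$ and $w(\ell)=\prod_iw(e_i)$. **Tracial subalgebra.** For a connected W*-algebra object $\mathbf{M}$, with standard duality morphisms $\mathrm{coev}_a:\mathbb{1}\to a\otimes\overline a$, $\mathrm{ev}_a:\overline a\otimes a\to\mathbb{1}$, put ${}_a\langle f,g\rangle=\mathbf{M}(\mathrm{coev}_a)(m_{a,\overline a}(f\otimes j_a(g)))$ and $\langle g|f\rangle_a=\mathbf{M}(\mathrm{ev}_a^* )(m_{\overline a,a}(j_a(g)\otimes f))$ for $f,g\in\mathbf{M}(a)$ (values in $\mathbf{M}(\mathbb{1})=\mathbb{C}$); both are inner products. Let $\Delta_a$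 be the unique operator on $\mathbf{M}(a)$ with ${}_a\langle f,g\rangle=\langle g|\Delta_a(f)\rangle_a$. Then $\mathbf{M}_{tr}(a)=\{v\in\mathbf{M}(a):\Delta_a(v)=v\}$, with the structure restricted from $\mathbf{M}$. *)

theory Defs
  imports
    Complex_Main
    "HOL-Library.Disjoint_Sets"
    "HOL-Library.FuncSet"
    "HOL-Library.Poly_Mapping"
    "Graph_Theory.Graph_Theory"
begin

section \<open>Finitely supported linear combinations\<close>

text \<open>
  The free complex vector space on \<open>'a\<close> is \<open>'a \<Rightarrow>\<^sub>0 complex\<close>.
\<close>

definition pm_scale :: "complex \<Rightarrow> ('a \<Rightarrow>\<^sub>0 complex) \<Rightarrow> ('a \<Rightarrow>\<^sub>0 complex)" where
  "pm_scale c = Poly_Mapping.map ((*) c)"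

definition lin_ext :: "('a \<Rightarrow> ('b \<Rightarrow>\<^sub>0 complex)) \<Rightarrow> ('a \<Rightarrow>\<^sub>0 complex) \<Rightarrow> ('b \<Rightarrow>\<^sub>0 complex)" where
  "lin_ext F f = (\<Sum>x\<in>Poly_Mapping.keys f. pm_scale (Poly_Mapping.lookup f x) (F x))"

definition conj_ext :: "('a \<Rightarrow> ('b \<Rightarrow>\<^sub>0 complex)) \<Rightarrow> ('a \<Rightarrow>\<^sub>0 complex) \<Rightarrow> ('b \<Rightarrow>\<^sub>0 complex)" where
  "conj_ext F f = (\<Sum>x\<in>Poly_Mapping.keys f. pm_scale (cnj (Poly_Mapping.lookup f x)) (F x))"

definition bilin_ext ::
    "('a \<Rightarrow> 'b \<Rightarrow> ('c \<Rightarrow>\<^sub>0 complex)) \<Rightarrow> ('a \<Rightarrow>\<^sub>0 complex) \<Rightarrow> ('b \<Rightarrow>\<^sub>0 complex) \<Rightarrow> ('c \<Rightarrow>\<^sub>0 complex)" where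
  "bilin_ext F f g = lin_ext (\<lambda>x. lin_ext (F x) g) f"


section \<open>Temperley--Lieb diagrams\<close>

text \<open>
  The boundary points of a diagram \<open>n \<rightarrow> m\<close> are \<open>(0, i)\<close> with \<open>i < n\<close> (source side) and
  \<open>(1, j)\<close> with \<open>j < m\<close> (target side), both numbered from left to right; a diagram is the set of its
  strands, a strand being the set of its two end points.
\<close>

type_synonym point = "nat \<times> nat"
type_synonym diagram = "point set set"

text \<open>
  Planarity is tested along the boundary circle, which runs through the source points from left to
  right and then through the target points from right to left.
\<close>

definition circle_pos :: "nat \<Rightarrow> nat \<Rightarrow> point \<Rightarrow> nat" where
  "circle_pos n m = (\<lambda>(l, i). if l = 0 then i else n + (m - 1 - i))"

definition tl_diagrams :: "nat \<Rightarrow> nat \<Rightarrow> diagram set" where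
  "tl_diagrams n m = {D.
     partition_on ({0} \<times> {..<n} \<union> {1} \<times> {..<m}) D \<and>
     (\<forall>A\<in>D. card A = 2) \<and>
     \<not> (\<exists>P Q R S. {P, R} \<in> D \<and> {Q, S} \<in> D \<and>
          circle_pos n m P < circle_pos n m Q \<and>
          circle_pos n m Q < circle_pos n m R \<and>
          circle_pos n m R < circle_pos n m S)}"

text \<open>
  Stacking \<open>D : n \<rightarrow> m\<close> and \<open>E : m \<rightarrow> k\<close>: after raising the points of \<open>E\<close> by one level, the
  strings and closed circles of the stacked picture are the connected components of the union. A
  component is a closed circle iff it stays in the middle level \<open>1\<close>; the end points of the others
  are those on the levels \<open>0\<close> and \<open>2\<close>.
\<close>

definition components :: "diagram \<Rightarrow> diagram \<Rightarrow> diagram" where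
  "components D E =
     (let U = D \<union> (\<lambda>A. (\<lambda>(l, i). (Suc l, i)) ` A) ` E
      in \<Union>U // {(P, Q). \<exists>A\<in>U. P \<in> A \<and> Q \<in> A}\<^sup>*)"

definition stack :: "diagram \<Rightarrow> diagram \<Rightarrow> diagram" where
  "stack D E = (\<lambda>C. (\<lambda>(l, i). (l div 2, i)) ` {P \<in> C. fst P \<noteq> 1}) ` components D E - {{}}"

definition circles :: "diagram \<Rightarrow> diagram \<Rightarrow> nat" where
  "circles D E = card {C \<in> components D E. \<forall>P\<in>C. fst P = 1}"

definition id_diagram :: "nat \<Rightarrow> diagram" where
  "id_diagram n = {{(0, i), (1, i)} | i. i < n}"

text \<open>The nested cups \<open>0 \<rightarrow> n + n\<close>.\<close>

definition nested_cups :: "nat \<Rightarrow> diagram" where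
  "nested_cups n = {{(1, i), (1, 2 * n - 1 - i)} | i. i < n}"

text \<open>The diagram \<open>n \<rightarrow> n + 2\<close> creating a pair of strands right after the \<open>i\<close>-th strand.\<close>

definition cup_diagram :: "nat \<Rightarrow> nat \<Rightarrow> diagram" where
  "cup_diagram i n =
     {{(0, k), (1, k)} | k. k < i} \<union> {{(0, k), (1, k + 2)} | k. i \<le> k \<and> k < n} \<union> {{(1, i), (1, i + 1)}}"

text \<open>Horizontal juxtaposition of \<open>D : n \<rightarrow> m\<close> (on the left) and \<open>E\<close>.\<close>

definition juxtapose :: "nat \<Rightarrow> nat \<Rightarrow> diagram \<Rightarrow> diagram \<Rightarrow> diagram" where
  "juxtapose n m D E = D \<union> (\<lambda>A. (\<lambda>(l, i). (l, i + (if l = 0 then n else m))) ` A) ` E"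

text \<open>Reflection exchanging source and target, and left-right reflection of a diagram \<open>n \<rightarrow> m\<close>.\<close>

definition flip :: "diagram \<Rightarrow> diagram" where
  "flip D = (\<lambda>A. (\<lambda>(l, i). (1 - l, i)) ` A) ` D"

definition mirror :: "nat \<Rightarrow> nat \<Rightarrow> diagram \<Rightarrow> diagram" where
  "mirror n m D = (\<lambda>A. (\<lambda>(l, i). (l, (if l = 0 then n else m) - 1 - i)) ` A) ` D"


section \<open>The unitary tensor category TLJ\<close>

text \<open>
  The unitary Karoubi completion is modelled by its objects \<open>(S, p)\<close>: \<open>S\<close> is a formal finite
  direct sum \<open>\<Oplus> n\<close> over \<open>(i, n) \<in> S\<close>, where \<open>i\<close> is an index label, and \<open>p\<close> is an orthogonal
  projection on it. Morphisms are matrices of combinations of diagrams, written as combinations of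
  elementary matrices \<open>(x, D, y)\<close>, where \<open>D\<close> is a diagram from the summand \<open>x\<close> to the summand \<open>y\<close>.

  The labels of one object are words of a common length. A tensor product is labelled by the
  concatenated words and a conjugate by the reversed words. The tensor product is thereby strictly
  associative and unital, and \<open>obj_bar (obj_tensor a b) = obj_tensor (obj_bar b) (obj_bar a)\<close> and
  \<open>obj_bar (obj_bar a) = a\<close> hold strictly, so that no coherence isomorphisms are needed.
\<close>

type_synonym summand = "nat list \<times> nat"
type_synonym tl_mor = "(summand \<times> diagram \<times> summand) \<Rightarrow>\<^sub>0 complex"
type_synonym tlj_object = "summand set \<times> tl_mor"

definition summand_tensor :: "summand \<Rightarrow> summand \<Rightarrow> summand" where
  "summand_tensor x y = (fst x @ fst y, snd x + snd y)"

definition summand_bar :: "summand \<Rightarrow> summand" where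
  "summand_bar x = (rev (fst x), snd x)"

definition matrices :: "summand set \<Rightarrow> summand set \<Rightarrow> tl_mor set" where
  "matrices S T =
     {f. Poly_Mapping.keys f \<subseteq> {(x, D, y). x \<in> S \<and> y \<in> T \<and> D \<in> tl_diagrams (snd x) (snd y)}}"

definition mor_comp :: "real \<Rightarrow> tl_mor \<Rightarrow> tl_mor \<Rightarrow> tl_mor" where
  "mor_comp \<delta> = bilin_ext (\<lambda>(y', E, z) (x, D, y).
     if y = y' then Poly_Mapping.single (x, stack D E, z) (of_real (\<delta> ^ circles D E)) else 0)"

definition mor_tensor :: "tl_mor \<Rightarrow> tl_mor \<Rightarrow> tl_mor" where
  "mor_tensor = bilin_ext (\<lambda>(x, D, y) (x', E, y').
     Poly_Mapping.single (summand_tensor x x', juxtapose (snd x) (snd y) D E, summand_tensor y y') 1)"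

definition mor_star :: "tl_mor \<Rightarrow> tl_mor" where
  "mor_star = conj_ext (\<lambda>(x, D, y). Poly_Mapping.single (y, flip D, x) 1)"

definition mor_bar :: "tl_mor \<Rightarrow> tl_mor" where
  "mor_bar = conj_ext (\<lambda>(x, D, y).
     Poly_Mapping.single (summand_bar x, mirror (snd x) (snd y) D, summand_bar y) 1)"

definition tlj_objects :: "real \<Rightarrow> tlj_object set" where
  "tlj_objects \<delta> = {(S, p).
     finite S \<and> inj_on fst S \<and> (\<exists>l. \<forall>x\<in>S. length (fst x) = l) \<and>
     p \<in> matrices S S \<and> mor_comp \<delta> p p = p \<and> mor_star p = p}"

definition tlj_hom :: "real \<Rightarrow> tlj_object \<Rightarrow> tlj_object \<Rightarrow> tl_mor set" where
  "tlj_hom \<delta> a b =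
     {f \<in> matrices (fst a) (fst b). mor_comp \<delta> (snd b) f = f \<and> mor_comp \<delta> f (snd a) = f}"

definition tlj_id :: "tlj_object \<Rightarrow> tl_mor" where
  "tlj_id a = snd a"

definition obj_tensor :: "tlj_object \<Rightarrow> tlj_object \<Rightarrow> tlj_object" where
  "obj_tensor a b =
     ((\<lambda>(x, y). summand_tensor x y) ` (fst a \<times> fst b), mor_tensor (snd a) (snd b))"

definition obj_bar :: "tlj_object \<Rightarrow> tlj_object" where
  "obj_bar a = (summand_bar ` fst a, mor_bar (snd a))"

text \<open>The object \<open>n\<close> of the Temperley--Lieb category, and the tensor unit.\<close>

definition tl_object :: "nat \<Rightarrow> tlj_object" where
  "tl_object n = ({([], n)}, Poly_Mapping.single (([], n), id_diagram n, ([], n)) 1)"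

definition tlj_unit :: tlj_object where
  "tlj_unit = tl_object 0"

text \<open>
  Standard duality: nested cups and caps, summand by summand, compressed by the projection of the
  object.
\<close>

definition coev :: "real \<Rightarrow> tlj_object \<Rightarrow> tl_mor" where
  "coev \<delta> a = mor_comp \<delta> (tlj_id (obj_tensor a (obj_bar a)))
     (\<Sum>x\<in>fst a. Poly_Mapping.single (([], 0), nested_cups (snd x), summand_tensor x (summand_bar x)) 1)"

definition ev :: "real \<Rightarrow> tlj_object \<Rightarrow> tl_mor" where
  "ev \<delta> a = mor_star (coev \<delta> (obj_bar a))"


section \<open>Star-algebra objects in Vec(TLJ)\<close>

text \<open>
  The spaces \<open>M(a)\<close> are subspaces of one ambient complex vector space \<open>'v\<close> with scalar
  multiplication \<open>vscale M\<close>. For \<open>f : a \<rightarrow> b\<close>, \<open>act M a b f\<close> is the map \<open>M(f) : M(b) \<rightarrow> M(a)\<close>.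
\<close>

record 'v alg_object =
  vscale :: "complex \<Rightarrow> 'v \<Rightarrow> 'v"
  space_at :: "tlj_object \<Rightarrow> 'v set"
  act :: "tlj_object \<Rightarrow> tlj_object \<Rightarrow> tl_mor \<Rightarrow> 'v \<Rightarrow> 'v"
  mult :: "tlj_object \<Rightarrow> tlj_object \<Rightarrow> 'v \<Rightarrow> 'v \<Rightarrow> 'v"
  unit_vec :: 'v
  invol :: "tlj_object \<Rightarrow> 'v \<Rightarrow> 'v"

definition lin_map ::
    "(complex \<Rightarrow> 'v \<Rightarrow> 'v) \<Rightarrow> 'v set \<Rightarrow> (complex \<Rightarrow> 'w \<Rightarrow> 'w) \<Rightarrow> 'w set \<Rightarrow>
     ('v::ab_group_add \<Rightarrow> 'w::ab_group_add) \<Rightarrow> bool" where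
  "lin_map s V t W f \<longleftrightarrow>
     (\<forall>u\<in>V. f u \<in> W) \<and>
     (\<forall>u\<in>V. \<forall>v\<in>V. f (u + v) = f u + f v) \<and>
     (\<forall>c. \<forall>u\<in>V. f (s c u) = t c (f u))"

definition antilin_map ::
    "(complex \<Rightarrow> 'v \<Rightarrow> 'v) \<Rightarrow> 'v set \<Rightarrow> (complex \<Rightarrow> 'w \<Rightarrow> 'w) \<Rightarrow> 'w set \<Rightarrow>
     ('v::ab_group_add \<Rightarrow> 'w::ab_group_add) \<Rightarrow> bool" where
  "antilin_map s V t W f \<longleftrightarrow> lin_map s V (\<lambda>c. t (cnj c)) W f"

locale star_algebra =
  fixes \<delta> :: real and M :: "'v::ab_group_add alg_object"
  assumes vector_space: "vector_space (vscale M)"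
    and subspace: "a \<in> tlj_objects \<delta> \<Longrightarrow> module.subspace (vscale M) (space_at M a)"
    \<comment> \<open>linear contravariant functor\<close>
    and act_linear: "\<lbrakk>a \<in> tlj_objects \<delta>; b \<in> tlj_objects \<delta>; f \<in> tlj_hom \<delta> a b\<rbrakk> \<Longrightarrow>
        lin_map (vscale M) (space_at M b) (vscale M) (space_at M a) (act M a b f)"
    and act_add: "\<lbrakk>a \<in> tlj_objects \<delta>; b \<in> tlj_objects \<delta>; f \<in> tlj_hom \<delta> a b; g \<in> tlj_hom \<delta> a b;
        u \<in> space_at M b\<rbrakk> \<Longrightarrow> act M a b (f + g) u = act M a b f u + act M a b g u"
    and act_scale: "\<lbrakk>a \<in> tlj_objects \<delta>; b \<in> tlj_objects \<delta>; f \<in> tlj_hom \<delta> a b; u \<in> space_at M b\<rbrakk> \<Longrightarrow>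
        act M a b (pm_scale c f) u = vscale M c (act M a b f u)"
    and act_id: "\<lbrakk>a \<in> tlj_objects \<delta>; u \<in> space_at M a\<rbrakk> \<Longrightarrow> act M a a (tlj_id a) u = u"
    and act_comp: "\<lbrakk>a \<in> tlj_objects \<delta>; b \<in> tlj_objects \<delta>; c' \<in> tlj_objects \<delta>;
        f \<in> tlj_hom \<delta> a b; g \<in> tlj_hom \<delta> b c'; u \<in> space_at M c'\<rbrakk> \<Longrightarrow>
        act M a c' (mor_comp \<delta> g f) u = act M a b f (act M b c' g u)"
    \<comment> \<open>unital lax monoidal structure\<close>
    and mult_linear_left: "\<lbrakk>a \<in> tlj_objects \<delta>; b \<in> tlj_objects \<delta>; v \<in> space_at M b\<rbrakk> \<Longrightarrow>
        lin_map (vscale M) (space_at M a) (vscale M) (space_at M (obj_tensor a b)) (\<lambda>u. mult M a b u v)"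
    and mult_linear_right: "\<lbrakk>a \<in> tlj_objects \<delta>; b \<in> tlj_objects \<delta>; u \<in> space_at M a\<rbrakk> \<Longrightarrow>
        lin_map (vscale M) (space_at M b) (vscale M) (space_at M (obj_tensor a b)) (\<lambda>v. mult M a b u v)"
    and mult_natural: "\<lbrakk>a \<in> tlj_objects \<delta>; a' \<in> tlj_objects \<delta>; b \<in> tlj_objects \<delta>; b' \<in> tlj_objects \<delta>;
        f \<in> tlj_hom \<delta> a a'; g \<in> tlj_hom \<delta> b b'; u \<in> space_at M a'; v \<in> space_at M b'\<rbrakk> \<Longrightarrow>
        act M (obj_tensor a b) (obj_tensor a' b') (mor_tensor f g) (mult M a' b' u v) =
        mult M a b (act M a a' f u) (act M b b' g v)"
    and mult_assoc: "\<lbrakk>a \<in> tlj_objects \<delta>; b \<in> tlj_objects \<delta>; c' \<in> tlj_objects \<delta>;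
        u \<in> space_at M a; v \<in> space_at M b; w \<in> space_at M c'\<rbrakk> \<Longrightarrow>
        mult M (obj_tensor a b) c' (mult M a b u v) w = mult M a (obj_tensor b c') u (mult M b c' v w)"
    and unit_mem: "unit_vec M \<in> space_at M tlj_unit"
    and mult_unit_left: "\<lbrakk>a \<in> tlj_objects \<delta>; u \<in> space_at M a\<rbrakk> \<Longrightarrow> mult M tlj_unit a (unit_vec M) u = u"
    and mult_unit_right: "\<lbrakk>a \<in> tlj_objects \<delta>; u \<in> space_at M a\<rbrakk> \<Longrightarrow> mult M a tlj_unit u (unit_vec M) = u"
    \<comment> \<open>star structure\<close>
    and invol_antilinear: "a \<in> tlj_objects \<delta> \<Longrightarrow>
        antilin_map (vscale M) (space_at M a) (vscale M) (space_at M (obj_bar a)) (invol M a)"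
    and invol_natural: "\<lbrakk>a \<in> tlj_objects \<delta>; b \<in> tlj_objects \<delta>; f \<in> tlj_hom \<delta> a b; u \<in> space_at M b\<rbrakk> \<Longrightarrow>
        invol M a (act M a b f u) = act M (obj_bar a) (obj_bar b) (mor_bar f) (invol M b u)"
    and invol_invol: "\<lbrakk>a \<in> tlj_objects \<delta>; u \<in> space_at M a\<rbrakk> \<Longrightarrow> invol M (obj_bar a) (invol M a u) = u"
    and invol_mult: "\<lbrakk>a \<in> tlj_objects \<delta>; b \<in> tlj_objects \<delta>; u \<in> space_at M a; v \<in> space_at M b\<rbrakk> \<Longrightarrow>
        invol M (obj_tensor a b) (mult M a b u v) =
        mult M (obj_bar b) (obj_bar a) (invol M b v) (invol M a u)"

definition connected_algebra :: "'v::ab_group_add alg_object \<Rightarrow> bool" where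
  "connected_algebra M \<longleftrightarrow> (\<exists>u. u \<noteq> 0 \<and> space_at M tlj_unit = {vscale M c u | c. True})"

definition star_algebra_iso ::
    "real \<Rightarrow> 'v::ab_group_add alg_object \<Rightarrow> 'w::ab_group_add alg_object \<Rightarrow>
     (tlj_object \<Rightarrow> 'v \<Rightarrow> 'w) \<Rightarrow> bool" where
  "star_algebra_iso \<delta> M N \<phi> \<longleftrightarrow>
     (\<forall>a\<in>tlj_objects \<delta>.
        lin_map (vscale M) (space_at M a) (vscale N) (space_at N a) (\<phi> a) \<and>
        bij_betw (\<phi> a) (space_at M a) (space_at N a)) \<and>
     (\<forall>a\<in>tlj_objects \<delta>. \<forall>b\<in>tlj_objects \<delta>. \<forall>f\<in>tlj_hom \<delta> a b. \<forall>u\<in>space_at M b.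
        \<phi> a (act M a b f u) = act N a b f (\<phi> b u)) \<and>
     (\<forall>a\<in>tlj_objects \<delta>. \<forall>b\<in>tlj_objects \<delta>. \<forall>u\<in>space_at M a. \<forall>v\<in>space_at M b.
        \<phi> (obj_tensor a b) (mult M a b u v) = mult N a b (\<phi> a u) (\<phi> b v)) \<and>
     \<phi> tlj_unit (unit_vec M) = unit_vec N \<and>
     (\<forall>a\<in>tlj_objects \<delta>. \<forall>u\<in>space_at M a. \<phi> (obj_bar a) (invol M a u) = invol N a (\<phi> a u))"


section \<open>W*-categories\<close>

text \<open>\<open>cmp K A B C g f\<close> is the composite of \<open>f : A \<rightarrow> B\<close> and \<open>g : B \<rightarrow> C\<close>.\<close>

record ('o, 'v) star_cat =
  obs :: "'o set"
  hom :: "'o \<Rightarrow> 'o \<Rightarrow> 'v set"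
  smul :: "complex \<Rightarrow> 'v \<Rightarrow> 'v"
  cmp :: "'o \<Rightarrow> 'o \<Rightarrow> 'o \<Rightarrow> 'v \<Rightarrow> 'v \<Rightarrow> 'v"
  idn :: "'o \<Rightarrow> 'v"
  dag :: "'o \<Rightarrow> 'o \<Rightarrow> 'v \<Rightarrow> 'v"

locale star_category =
  fixes K :: "('o, 'v::ab_group_add) star_cat"
  assumes vector_space: "vector_space (smul K)"
    and subspace: "\<lbrakk>A \<in> obs K; B \<in> obs K\<rbrakk> \<Longrightarrow> module.subspace (smul K) (hom K A B)"
    and cmp_linear_left: "\<lbrakk>A \<in> obs K; B \<in> obs K; C \<in> obs K; f \<in> hom K A B\<rbrakk> \<Longrightarrow>
        lin_map (smul K) (hom K B C) (smul K) (hom K A C) (\<lambda>g. cmp K A B C g f)"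
    and cmp_linear_right: "\<lbrakk>A \<in> obs K; B \<in> obs K; C \<in> obs K; g \<in> hom K B C\<rbrakk> \<Longrightarrow>
        lin_map (smul K) (hom K A B) (smul K) (hom K A C) (\<lambda>f. cmp K A B C g f)"
    and cmp_assoc: "\<lbrakk>A \<in> obs K; B \<in> obs K; C \<in> obs K; D \<in> obs K;
        f \<in> hom K A B; g \<in> hom K B C; h \<in> hom K C D\<rbrakk> \<Longrightarrow>
        cmp K A B D (cmp K B C D h g) f = cmp K A C D h (cmp K A B C g f)"
    and idn_mem: "A \<in> obs K \<Longrightarrow> idn K A \<in> hom K A A"
    and cmp_idn_left: "\<lbrakk>A \<in> obs K; B \<in> obs K; f \<in> hom K A B\<rbrakk> \<Longrightarrow> cmp K A B B (idn K B) f = f"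
    and cmp_idn_right: "\<lbrakk>A \<in> obs K; B \<in> obs K; f \<in> hom K A B\<rbrakk> \<Longrightarrow> cmp K A A B f (idn K A) = f"
    and dag_antilinear: "\<lbrakk>A \<in> obs K; B \<in> obs K\<rbrakk> \<Longrightarrow>
        antilin_map (smul K) (hom K A B) (smul K) (hom K B A) (dag K A B)"
    and dag_dag: "\<lbrakk>A \<in> obs K; B \<in> obs K; f \<in> hom K A B\<rbrakk> \<Longrightarrow> dag K B A (dag K A B f) = f"
    and dag_cmp: "\<lbrakk>A \<in> obs K; B \<in> obs K; C \<in> obs K; f \<in> hom K A B; g \<in> hom K B C\<rbrakk> \<Longrightarrow>
        dag K A C (cmp K A B C g f) = cmp K C B A (dag K A B f) (dag K B C g)"

definition end_spectrum :: "('o, 'v::ab_group_add) star_cat \<Rightarrow> 'o \<Rightarrow> 'v \<Rightarrow> complex set" where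
  "end_spectrum K A x = {z. \<not> (\<exists>y\<in>hom K A A.
     cmp K A A A (x - smul K z (idn K A)) y = idn K A \<and>
     cmp K A A A y (x - smul K z (idn K A)) = idn K A)}"

definition banach_norm :: "(complex \<Rightarrow> 'v \<Rightarrow> 'v) \<Rightarrow> 'v::ab_group_add set \<Rightarrow> ('v \<Rightarrow> real) \<Rightarrow> bool" where
  "banach_norm s X nrm \<longleftrightarrow>
     (\<forall>x\<in>X. nrm x \<ge> 0 \<and> (nrm x = 0 \<longleftrightarrow> x = 0)) \<and>
     (\<forall>x\<in>X. \<forall>y\<in>X. nrm (x + y) \<le> nrm x + nrm y) \<and>
     (\<forall>c. \<forall>x\<in>X. nrm (s c x) = cmod c * nrm x) \<and>
     (\<forall>u :: nat \<Rightarrow> 'v. (\<forall>n. u n \<in> X) \<and> (\<forall>e>0. \<exists>N. \<forall>m\<ge>N. \<forall>n\<ge>N. nrm (u m - u n) < e) \<longrightarrow>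
        (\<exists>x\<in>X. (\<lambda>n. nrm (u n - x)) \<longlonglongrightarrow> 0))"

definition functional_norm :: "'v set \<Rightarrow> ('v \<Rightarrow> real) \<Rightarrow> ('v \<Rightarrow> complex) \<Rightarrow> real" where
  "functional_norm X nrm \<phi> = Sup {cmod (\<phi> x) | x. x \<in> X \<and> nrm x \<le> 1}"

text \<open>
  A predual of \<open>X\<close>, identified with a space \<open>P\<close> of bounded functionals on \<open>X\<close>: evaluation is an
  isometry of \<open>X\<close> onto the dual of \<open>P\<close>. It is not demanded that \<open>P\<close> be complete, since its
  completion has the same dual.
\<close>

definition has_predual :: "(complex \<Rightarrow> 'v \<Rightarrow> 'v) \<Rightarrow> 'v::ab_group_add set \<Rightarrow> ('v \<Rightarrow> real) \<Rightarrow> bool" where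
  "has_predual s X nrm \<longleftrightarrow> (\<exists>P :: ('v \<Rightarrow> complex) set.
     (\<lambda>x. 0) \<in> P \<and>
     (\<forall>\<phi>\<in>P. \<forall>\<psi>\<in>P. (\<lambda>x. \<phi> x + \<psi> x) \<in> P) \<and>
     (\<forall>c. \<forall>\<phi>\<in>P. (\<lambda>x. c * \<phi> x) \<in> P) \<and>
     (\<forall>\<phi>\<in>P. lin_map s X (*) UNIV \<phi> \<and> (\<exists>C. \<forall>x\<in>X. cmod (\<phi> x) \<le> C * nrm x)) \<and>
     (\<forall>x\<in>X. nrm x = Sup {cmod (\<phi> x) | \<phi>. \<phi> \<in> P \<and> functional_norm X nrm \<phi> \<le> 1}) \<and>
     (\<forall>F :: ('v \<Rightarrow> complex) \<Rightarrow> complex.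
        (\<forall>\<phi>\<in>P. \<forall>\<psi>\<in>P. F (\<lambda>x. \<phi> x + \<psi> x) = F \<phi> + F \<psi>) \<and>
        (\<forall>c. \<forall>\<phi>\<in>P. F (\<lambda>x. c * \<phi> x) = c * F \<phi>) \<and>
        (\<exists>C. \<forall>\<phi>\<in>P. cmod (F \<phi>) \<le> C * functional_norm X nrm \<phi>) \<longrightarrow>
        (\<exists>x\<in>X. \<forall>\<phi>\<in>P. F \<phi> = \<phi> x)))"

text \<open>
  The C*-conditions include positivity of \<open>f\<^sup>* f\<close>; being self-adjoint, it is positive iff its
  spectrum is nonnegative.
\<close>

definition W_star_category :: "('o, 'v::ab_group_add) star_cat \<Rightarrow> bool" where
  "W_star_category K \<longleftrightarrow> star_category K \<and>
     (\<exists>nrm :: 'o \<Rightarrow> 'o \<Rightarrow> 'v \<Rightarrow> real.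
       (\<forall>A\<in>obs K. \<forall>B\<in>obs K. banach_norm (smul K) (hom K A B) (nrm A B)) \<and>
       (\<forall>A\<in>obs K. \<forall>B\<in>obs K. \<forall>C\<in>obs K. \<forall>f\<in>hom K A B. \<forall>g\<in>hom K B C.
          nrm A C (cmp K A B C g f) \<le> nrm B C g * nrm A B f) \<and>
       (\<forall>A\<in>obs K. \<forall>B\<in>obs K. \<forall>f\<in>hom K A B.
          nrm A A (cmp K A B A (dag K A B f) f) = (nrm A B f)\<^sup>2) \<and>
       (\<forall>A\<in>obs K. \<forall>B\<in>obs K. \<forall>f\<in>hom K A B.
          end_spectrum K A (cmp K A B A (dag K A B f) f) \<subseteq> {of_real r | r. r \<ge> 0}) \<and>
       (\<forall>A\<in>obs K. \<forall>B\<in>obs K. has_predual (smul K) (hom K A B) (nrm A B)))"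


section \<open>W*-algebra objects\<close>

text \<open>
  Writing \<open>b'\<close> for the conjugate of \<open>b\<close>, morphisms \<open>a \<otimes> M \<rightarrow> b \<otimes> M\<close> of free modules are
  identified, by adjunction and duality, with the elements of \<open>M(b' \<otimes> a)\<close>. Composition contracts
  the adjacent pair \<open>b \<otimes> b'\<close>, and the adjoint of \<open>f\<close> is \<open>j(f) \<in> M(a' \<otimes> b)\<close>.
\<close>

definition free_hom :: "'v alg_object \<Rightarrow> tlj_object \<Rightarrow> tlj_object \<Rightarrow> 'v set" where
  "free_hom M a b = space_at M (obj_tensor (obj_bar b) a)"

definition free_comp ::
    "real \<Rightarrow> 'v alg_object \<Rightarrow> tlj_object \<Rightarrow> tlj_object \<Rightarrow> tlj_object \<Rightarrow> 'v \<Rightarrow> 'v \<Rightarrow> 'v" where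
  "free_comp \<delta> M a b c g f =
     act M (obj_tensor (obj_bar c) a)
       (obj_tensor (obj_tensor (obj_bar c) b) (obj_tensor (obj_bar b) a))
       (mor_tensor (tlj_id (obj_bar c)) (mor_tensor (coev \<delta> b) (tlj_id a)))
       (mult M (obj_tensor (obj_bar c) b) (obj_tensor (obj_bar b) a) g f)"

definition free_id :: "real \<Rightarrow> 'v alg_object \<Rightarrow> tlj_object \<Rightarrow> 'v" where
  "free_id \<delta> M a = act M (obj_tensor (obj_bar a) a) tlj_unit (ev \<delta> a) (unit_vec M)"

definition free_dag :: "'v alg_object \<Rightarrow> tlj_object \<Rightarrow> tlj_object \<Rightarrow> 'v \<Rightarrow> 'v" where
  "free_dag M a b f = invol M (obj_tensor (obj_bar b) a) f"

text \<open>
  Finitely generated projective modules: the objects \<open>(a, r)\<close> are the ranges of the orthogonal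
  projections \<open>r\<close> on free modules \<open>a \<otimes> M\<close>.
\<close>

definition fgp_modules ::
    "real \<Rightarrow> 'v alg_object \<Rightarrow> (tlj_object \<times> 'v, 'v) star_cat" where
  "fgp_modules \<delta> M =
     \<lparr>obs = {(a, r). a \<in> tlj_objects \<delta> \<and> r \<in> free_hom M a a \<and>
               free_comp \<delta> M a a a r r = r \<and> free_dag M a a r = r},
      hom = (\<lambda>(a, r) (b, s). {f \<in> free_hom M a b.
               free_comp \<delta> M a b b s f = f \<and> free_comp \<delta> M a a b f r = f}),
      smul = vscale M,
      cmp = (\<lambda>(a, r) (b, s) (c, t). free_comp \<delta> M a b c),
      idn = (\<lambda>(a, r). r),
      dag = (\<lambda>(a, r) (b, s). free_dag M a b)\<rparr>"

locale W_star_algebra = star_algebra +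
  assumes W_star: "W_star_category (fgp_modules \<delta> M)"

definition W_star_isomorphic ::
    "real \<Rightarrow> 'v::ab_group_add alg_object \<Rightarrow> 'w::ab_group_add alg_object \<Rightarrow> bool" where
  "W_star_isomorphic \<delta> M N \<longleftrightarrow>
     W_star_algebra \<delta> M \<and> W_star_algebra \<delta> N \<and> (\<exists>\<phi>. star_algebra_iso \<delta> M N \<phi>)"


section \<open>The tracial subalgebra\<close>

definition unit_coeff :: "'v alg_object \<Rightarrow> 'v \<Rightarrow> complex" where
  "unit_coeff M u = (THE c. u = vscale M c (unit_vec M))"

definition left_inner :: "real \<Rightarrow> 'v alg_object \<Rightarrow> tlj_object \<Rightarrow> 'v \<Rightarrow> 'v \<Rightarrow> complex" where
  "left_inner \<delta> M a f g = unit_coeff M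
     (act M tlj_unit (obj_tensor a (obj_bar a)) (coev \<delta> a) (mult M a (obj_bar a) f (invol M a g)))"

text \<open>\<open>right_inner \<delta> M a g f\<close> is linear in its last argument \<open>f\<close>.\<close>

definition right_inner :: "real \<Rightarrow> 'v alg_object \<Rightarrow> tlj_object \<Rightarrow> 'v \<Rightarrow> 'v \<Rightarrow> complex" where
  "right_inner \<delta> M a g f = unit_coeff M
     (act M tlj_unit (obj_tensor (obj_bar a) a) (mor_star (ev \<delta> a))
        (mult M (obj_bar a) a (invol M a g) f))"

definition modular_op :: "real \<Rightarrow> 'v::ab_group_add alg_object \<Rightarrow> tlj_object \<Rightarrow> 'v \<Rightarrow> 'v" where
  "modular_op \<delta> M a = (THE T. T \<in> extensional (space_at M a) \<and>
     lin_map (vscale M) (space_at M a) (vscale M) (space_at M a) T \<and>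
     (\<forall>f\<in>space_at M a. \<forall>g\<in>space_at M a. left_inner \<delta> M a f g = right_inner \<delta> M a g (T f)))"

definition tracial_subalgebra :: "real \<Rightarrow> 'v::ab_group_add alg_object \<Rightarrow> 'v alg_object" where
  "tracial_subalgebra \<delta> M =
     M\<lparr>space_at := (\<lambda>a. {v \<in> space_at M a. modular_op \<delta> M a v = v})\<rparr>"


section \<open>Fair and balanced graphs\<close>

record ('a, 'e) weighted_graph =
  dgraph :: "('a, 'e) pre_digraph"
  wt :: "'e \<Rightarrow> real"
  ebar :: "'e \<Rightarrow> 'e"
  base :: 'a

locale fair_balanced = wf_digraph "dgraph \<Gamma>"
  for \<delta> :: real and \<Gamma> :: "('a, 'e) weighted_graph" +
  assumes base_vert: "base \<Gamma> \<in> verts (dgraph \<Gamma>)"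
    and locally_finite: "x \<in> verts (dgraph \<Gamma>) \<Longrightarrow>
        finite (out_arcs (dgraph \<Gamma>) x) \<and> finite (in_arcs (dgraph \<Gamma>) x)"
    and wt_pos: "e \<in> arcs (dgraph \<Gamma>) \<Longrightarrow> wt \<Gamma> e > 0"
    and ebar_arc: "e \<in> arcs (dgraph \<Gamma>) \<Longrightarrow> ebar \<Gamma> e \<in> arcs (dgraph \<Gamma>)"
    and ebar_ebar: "e \<in> arcs (dgraph \<Gamma>) \<Longrightarrow> ebar \<Gamma> (ebar \<Gamma> e) = e"
    and tail_ebar: "e \<in> arcs (dgraph \<Gamma>) \<Longrightarrow> tail (dgraph \<Gamma>) (ebar \<Gamma> e) = head (dgraph \<Gamma>) e"
    and head_ebar: "e \<in> arcs (dgraph \<Gamma>) \<Longrightarrow> head (dgraph \<Gamma>) (ebar \<Gamma> e) = tail (dgraph \<Gamma>) e"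
    and wt_ebar: "e \<in> arcs (dgraph \<Gamma>) \<Longrightarrow> wt \<Gamma> e * wt \<Gamma> (ebar \<Gamma> e) = 1"
    and balanced: "x \<in> verts (dgraph \<Gamma>) \<Longrightarrow> (\<Sum>e\<in>out_arcs (dgraph \<Gamma>) x. wt \<Gamma> e) = \<delta>"

definition path_wt :: "('a, 'e) weighted_graph \<Rightarrow> 'e list \<Rightarrow> real" where
  "path_wt \<Gamma> p = prod_list (map (wt \<Gamma>) p)"

definition path_bar :: "('a, 'e) weighted_graph \<Rightarrow> 'e list \<Rightarrow> 'e list" where
  "path_bar \<Gamma> p = rev (map (ebar \<Gamma>) p)"

definition loops :: "('a, 'e) weighted_graph \<Rightarrow> nat \<Rightarrow> 'e list set" where
  "loops \<Gamma> n = {p. length p = n \<and> pre_digraph.awalk (dgraph \<Gamma>) (base \<Gamma>) p (base \<Gamma>)}"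

definition tracial_cover_verts :: "('a, 'e) weighted_graph \<Rightarrow> (real \<times> 'a) set" where
  "tracial_cover_verts \<Gamma> =
     {(r, v). v \<in> verts (dgraph \<Gamma>) \<and> 
        (\<exists>p. pre_digraph.awalk (dgraph \<Gamma>) (base \<Gamma>) p v \<and> r = path_wt \<Gamma> p)}"

definition tracial_cover ::
    "('a, 'e) weighted_graph \<Rightarrow> (real \<times> 'a, (real \<times> 'a) \<times> 'e \<times> (real \<times> 'a)) weighted_graph" where
  "tracial_cover \<Gamma> =
     \<lparr>dgraph =
        \<lparr>verts = tracial_cover_verts \<Gamma>,
         arcs = {((r, v), e, (r', v')).
           (r, v) \<in> tracial_cover_verts \<Gamma> \<and> (r', v') \<in> tracial_cover_verts \<Gamma> \<and>
           e \<in> arcs (dgraph \<Gamma>) \<and> tail (dgraph \<Gamma>) e = v \<and> head (dgraph \<Gamma>) e = v' \<and>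
           wt \<Gamma> e = r' / r},
         tail = (\<lambda>(x, e, y). x),
         head = (\<lambda>(x, e, y). y)\<rparr>,
      wt = (\<lambda>(x, e, y). wt \<Gamma> e),
      ebar = (\<lambda>(x, e, y). (y, ebar \<Gamma> e, x)),
      base = (1, base \<Gamma>)\<rparr>"


section \<open>The algebra object of a graph\<close>

text \<open>
  The functor is given on all diagrams at once by its state sum: the matrix coefficient of
  \<open>D : n \<rightarrow> m\<close> between a loop labelling the target points and a loop labelling the source points
  vanishes unless the two ends of every through strand carry the same edge and the left end of
  every turning strand carries the reverse of its right end; it is then the product of
  \<open>w(e)\<^bsup>1/2\<^esup>\<close> over the edges \<open>e\<close> at the left ends of the turning strands. Lemmas
  \<open>graph_act_cup\<close> and \<open>graph_act_cap\<close> below evaluate it on the diagrams which generate the category.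
\<close>

definition label :: "'e list \<Rightarrow> 'e list \<Rightarrow> point \<Rightarrow> 'e" where
  "label p q = (\<lambda>(l, i). if l = 0 then p ! i else q ! i)"

definition admissible :: "('a, 'e) weighted_graph \<Rightarrow> diagram \<Rightarrow> (point \<Rightarrow> 'e) \<Rightarrow> bool" where
  "admissible \<Gamma> D lab \<longleftrightarrow>
     (\<forall>i j. {(0, i), (1, j)} \<in> D \<longrightarrow> lab (0, i) = lab (1, j)) \<and>
     (\<forall>l i j. i < j \<and> {(l, i), (l, j)} \<in> D \<longrightarrow> lab (l, i) = ebar \<Gamma> (lab (l, j)))"

definition left_ends :: "diagram \<Rightarrow> point set" where
  "left_ends D = {(l, i). \<exists>j>i. {(l, i), (l, j)} \<in> D}"

definition state :: "('a, 'e) weighted_graph \<Rightarrow> diagram \<Rightarrow> (point \<Rightarrow> 'e) \<Rightarrow> real" where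
  "state \<Gamma> D lab =
     (if admissible \<Gamma> D lab then \<Prod>P\<in>left_ends D. sqrt (wt \<Gamma> (lab P)) else 0)"

text \<open>
  \<open>\<complex>[L\<^sub>n]\<close> for the summand \<open>x\<close> of degree \<open>n = snd x\<close> is spanned by the pairs \<open>(x, p)\<close>, \<open>p\<close> a loop of
  length \<open>n\<close>.
\<close>

definition graph_act ::
    "('a, 'e) weighted_graph \<Rightarrow> tl_mor \<Rightarrow> (summand \<times> 'e list \<Rightarrow>\<^sub>0 complex) \<Rightarrow>
     (summand \<times> 'e list \<Rightarrow>\<^sub>0 complex)" where
  "graph_act \<Gamma> = bilin_ext (\<lambda>(x, D, y) (y', q).
     if y = y' then \<Sum>p\<in>loops \<Gamma> (snd x). Poly_Mapping.single (x, p) (of_real (state \<Gamma> D (label p q)))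
     else 0)"

text \<open>On the object \<open>(S, p)\<close> the value is the range of the idempotent induced by \<open>p\<close>.\<close>

definition graph_algebra ::
    "('a, 'e) weighted_graph \<Rightarrow> (summand \<times> 'e list \<Rightarrow>\<^sub>0 complex) alg_object" where
  "graph_algebra \<Gamma> =
     \<lparr>vscale = pm_scale,
      space_at = (\<lambda>(S, p). {u. Poly_Mapping.keys u \<subseteq> {(x, q). x \<in> S \<and> q \<in> loops \<Gamma> (snd x)} \<and>
                                graph_act \<Gamma> p u = u}),
      act = (\<lambda>a b f. graph_act \<Gamma> f),
      mult = (\<lambda>a b. bilin_ext (\<lambda>(x, p) (y, q). Poly_Mapping.single (summand_tensor x y, p @ q) 1)),
      unit_vec = Poly_Mapping.single (([], 0), []) 1,
      invol = (\<lambda>a. conj_ext (\<lambda>(x, p).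
        Poly_Mapping.single (summand_bar x, path_bar \<Gamma> p) (of_real (sqrt (path_wt \<Gamma> (path_bar \<Gamma> p))))))\<rparr>"


lemma pm_scale_1 [simp]: "pm_scale 1 f = f"
  by (rule poly_mapping_eqI) (simp add: pm_scale_def Poly_Mapping.map.rep_eq when_def)

lemma bilin_ext_single [simp]:
  "bilin_ext F (Poly_Mapping.single x 1) (Poly_Mapping.single y 1) = F x y"
  by (simp add: bilin_ext_def lin_ext_def)

lemma (in fair_balanced) finite_loops: "finite (loops \<Gamma> n)"
proof -
  have "finite {p. length p = n \<and> awalk u p v}" for u v
  proof (induction n arbitrary: u)
    case 0
    have "{p. length p = 0 \<and> awalk u p v} \<subseteq> {[]}" by auto
    then show ?case by (rule finite_subset) simp
  next
    case (Suc n)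
    show ?case
    proof (cases "u \<in> verts (dgraph \<Gamma>)")
      case True
      have "{p. length p = Suc n \<and> awalk u p v} \<subseteq>
        (\<Union>e\<in>out_arcs (dgraph \<Gamma>) u. (#) e ` {p. length p = n \<and> awalk (head (dgraph \<Gamma>) e) p v})"
        by (auto simp: length_Suc_conv awalk_Cons_iff)
      moreover have "finite (\<Union>e\<in>out_arcs (dgraph \<Gamma>) u. (#) e ` {p. length p = n \<and> awalk (head (dgraph \<Gamma>) e) p v})"
        using Suc.IH locally_finite[OF True] by blast
      ultimately show ?thesis by (rule finite_subset)
    next
      case False
      then have "{p. length p = Suc n \<and> awalk u p v} = {}" by auto
      then show ?thesis by (metis finite.emptyI)
    qed
  qed
  then show ?thesis by (simp add: loops_def)
qed

lemma (in fair_balanced) loops_insert_iff: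
  assumes "i \<le> length p"
  shows "take i p @ [e, ebar \<Gamma> e] @ drop i p \<in> loops \<Gamma> (length p + 2) \<longleftrightarrow>
    p \<in> loops \<Gamma> (length p) \<and> e \<in> out_arcs (dgraph \<Gamma>) (awlast (base \<Gamma>) (take i p))"
    (is "?L \<longleftrightarrow> ?R")
proof
  assume ?L
  then have *: "awalk (base \<Gamma>) (take i p @ [e, ebar \<Gamma> e] @ drop i p) (base \<Gamma>)"
    by (simp add: loops_def)
  obtain v where v: "awalk (base \<Gamma>) (take i p) v" "awalk v ([e, ebar \<Gamma> e] @ drop i p) (base \<Gamma>)"
    using * by auto
  then have e: "e \<in> arcs (dgraph \<Gamma>)" "tail (dgraph \<Gamma>) e = v"
    by (auto simp: awalk_Cons_iff)
  have "awalk v (drop i p) (base \<Gamma>)"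
    using v(2) e by (auto simp: awalk_Cons_iff head_ebar)
  with v(1) have "awalk (base \<Gamma>) (take i p @ drop i p) (base \<Gamma>)"
    by (rule awalk_appendI)
  moreover have "awlast (base \<Gamma>) (take i p) = v" using v(1) by auto
  ultimately show ?R using e by (simp add: loops_def)
next
  assume R: ?R
  then have "awalk (base \<Gamma>) (take i p @ drop i p) (base \<Gamma>)" by (simp add: loops_def)
  then obtain v where v: "awalk (base \<Gamma>) (take i p) v" "awalk v (drop i p) (base \<Gamma>)"
    by (auto simp del: append_take_drop_id)
  have e: "e \<in> arcs (dgraph \<Gamma>)" "tail (dgraph \<Gamma>) e = v"
    using R v(1) by auto
  have "awalk v [e, ebar \<Gamma> e] v"
    using e tail_ebar head_ebar ebar_arc by (auto simp: awalk_Cons_iff awalk_Nil_iff)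
  then have "awalk v ([e, ebar \<Gamma> e] @ drop i p) (base \<Gamma>)"
    using v(2) by (rule awalk_appendI)
  with v(1) have "awalk (base \<Gamma>) (take i p @ [e, ebar \<Gamma> e] @ drop i p) (base \<Gamma>)"
    by (rule awalk_appendI)
  then show ?L using assms by (simp add: loops_def)
qed

lemma admissible_cup:
  assumes "i \<le> n"
  shows "admissible \<Gamma> (cup_diagram i n) lab \<longleftrightarrow>
    (\<forall>k<i. lab (0, k) = lab (1, k)) \<and> (\<forall>k. i \<le> k \<and> k < n \<longrightarrow> lab (0, k) = lab (1, k + 2)) \<and>
    lab (1, i) = ebar \<Gamma> (lab (1, i + 1))"
  unfolding admissible_def cup_diagram_def
  by (auto simp: doubleton_eq_iff) 

lemma left_ends_cup: "left_ends (cup_diagram i n) = {(1, i)}"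
  unfolding left_ends_def cup_diagram_def by (auto simp: doubleton_eq_iff)

lemma flip_cup_diagram: "flip (cup_diagram i n) =
     {{(1, k), (0, k)} | k. k < i} \<union> {{(1, k), (0, k + 2)} | k. i \<le> k \<and> k < n} \<union> {{(0, i), (0, i + 1)}}"
  unfolding flip_def cup_diagram_def setcompr_eq_image image_Un image_image by auto

lemma admissible_cap:
  assumes "i \<le> n"
  shows "admissible \<Gamma> (flip (cup_diagram i n)) lab \<longleftrightarrow>
    (\<forall>k<i. lab (0, k) = lab (1, k)) \<and> (\<forall>k. i \<le> k \<and> k < n \<longrightarrow> lab (0, k + 2) = lab (1, k)) \<and>
    lab (0, i) = ebar \<Gamma> (lab (0, i + 1))"
  unfolding admissible_def flip_cup_diagram
  by (auto simp: doubleton_eq_iff) 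

lemma left_ends_cap: "left_ends (flip (cup_diagram i n)) = {(0, i)}"
  unfolding left_ends_def flip_cup_diagram by (auto simp: doubleton_eq_iff)


text \<open>Creating and annihilating a pair of strands, on the objects \<open>n\<close> of the Temperley--Lieb category.\<close>

lemma (in fair_balanced) graph_act_cup:
  assumes i: "i \<le> n" and q: "q \<in> loops \<Gamma> (n + 2)"
  shows "graph_act \<Gamma> (Poly_Mapping.single (([], n), cup_diagram i n, ([], n + 2)) 1)
           (Poly_Mapping.single (([], n + 2), q) 1) =
         (if q ! i = ebar \<Gamma> (q ! (i + 1))
          then Poly_Mapping.single (([], n), take i q @ drop (i + 2) q) (of_real (sqrt (wt \<Gamma> (q ! i))))
          else 0)"
proof -
  let ?r = "take i q @ drop (i + 2) q"
  have len: "length q = n + 2" using q by (simp add: loops_def)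
  have r: "?r \<in> loops \<Gamma> n" if c: "q ! i = ebar \<Gamma> (q ! (i + 1))"
  proof -
    have "q ! (i + 1) \<in> arcs (dgraph \<Gamma>)"
      using q i by (auto simp: loops_def awalk_def)
    then have c': "q ! (i + 1) = ebar \<Gamma> (q ! i)" using c ebar_ebar by simp
    have "q = take i q @ [q ! i, q ! (i + 1)] @ drop (i + 2) q"
      using i len by (simp add: Cons_nth_drop_Suc)
    then have "take i ?r @ [q ! i, ebar \<Gamma> (q ! i)] @ drop i ?r = q"
      using i len c' by simp
    then show ?thesis using loops_insert_iff[of i ?r "q ! i"] q i len by simp
  qed
  have st: "state \<Gamma> (cup_diagram i n) (label p q) =
      (if p = ?r \<and> q ! i = ebar \<Gamma> (q ! (i + 1)) then sqrt (wt \<Gamma> (q ! i)) else 0)"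
    if "p \<in> loops \<Gamma> n" for p
  proof -
    have lp: "length p = n" using that by (simp add: loops_def)
    have "p = ?r \<longleftrightarrow> (\<forall>k<i. p ! k = q ! k) \<and> (\<forall>k. i \<le> k \<and> k < n \<longrightarrow> p ! k = q ! (k + 2))"
      using i len lp by (auto simp: list_eq_iff_nth_eq nth_append not_less)
    then have "admissible \<Gamma> (cup_diagram i n) (label p q) \<longleftrightarrow> p = ?r \<and> q ! i = ebar \<Gamma> (q ! (i + 1))"
      by (simp add: admissible_cup[OF i] label_def)
    then show ?thesis
      by (simp add: state_def left_ends_cup label_def)
  qed
  have "graph_act \<Gamma> (Poly_Mapping.single (([], n), cup_diagram i n, ([], n + 2)) 1)
           (Poly_Mapping.single (([], n + 2), q) 1) =
        (\<Sum>p\<in>loops \<Gamma> n. Poly_Mapping.single (([], n), p) (of_real (state \<Gamma> (cup_diagram i n) (label p q))))"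
    by (simp add: graph_act_def)
  also have "\<dots> = (\<Sum>p\<in>loops \<Gamma> n. if p = ?r then
      (if q ! i = ebar \<Gamma> (q ! (i + 1)) then Poly_Mapping.single (([], n), ?r) (of_real (sqrt (wt \<Gamma> (q ! i)))) else 0)
      else 0)"
    by (rule sum.cong) (auto simp: st)
  also have "\<dots> = (if q ! i = ebar \<Gamma> (q ! (i + 1))
          then Poly_Mapping.single (([], n), ?r) (of_real (sqrt (wt \<Gamma> (q ! i)))) else 0)"
    using r by (simp add: finite_loops)
  finally show ?thesis .
qed

lemma (in fair_balanced) graph_act_cap:
  assumes i: "i \<le> n" and q: "q \<in> loops \<Gamma> n"
  shows "graph_act \<Gamma> (Poly_Mapping.single (([], n + 2), flip (cup_diagram i n), ([], n)) 1)
           (Poly_Mapping.single (([], n), q) 1) =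
         (\<Sum>e\<in>out_arcs (dgraph \<Gamma>) (awlast (base \<Gamma>) (take i q)).
            Poly_Mapping.single (([], n + 2), take i q @ [e, ebar \<Gamma> e] @ drop i q)
              (of_real (sqrt (wt \<Gamma> e))))"
proof -
  let ?O = "out_arcs (dgraph \<Gamma>) (awlast (base \<Gamma>) (take i q))"
  let ?h = "\<lambda>e. take i q @ [e, ebar \<Gamma> e] @ drop i q"
  have len: "length q = n" using q by (simp add: loops_def)
  have h: "?h e \<in> loops \<Gamma> (n + 2) \<longleftrightarrow> e \<in> ?O" for e
    using loops_insert_iff[of i q e] i q len by simp
  have inj: "inj_on ?h ?O" by (auto simp: inj_on_def)
  have c: "admissible \<Gamma> (flip (cup_diagram i n)) (label p q) \<longleftrightarrow> p = ?h (p ! i)"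
    if p: "p \<in> loops \<Gamma> (n + 2)" for p
  proof -
    have lp: "length p = n + 2" using p by (simp add: loops_def)
    have "p ! i \<in> arcs (dgraph \<Gamma>)" "p ! (i + 1) \<in> arcs (dgraph \<Gamma>)"
      using p i by (auto simp: loops_def awalk_def)
    then have e: "p ! i = ebar \<Gamma> (p ! (i + 1)) \<longleftrightarrow> p ! (i + 1) = ebar \<Gamma> (p ! i)"
      using ebar_ebar by metis
    have "p = take i p @ [p ! i, p ! (i + 1)] @ drop (i + 2) p"
      using i lp by (simp add: Cons_nth_drop_Suc)
    then have "p = ?h (p ! i) \<longleftrightarrow>
        take i p @ [p ! i, p ! (i + 1)] @ drop (i + 2) p = take i q @ [p ! i, ebar \<Gamma> (p ! i)] @ drop i q"
      by metis
    also have "\<dots> \<longleftrightarrow> take i p = take i q \<and> p ! (i + 1) = ebar \<Gamma> (p ! i) \<and> drop (i + 2) p = drop i q"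
      using i len lp by (subst append_eq_append_conv) auto
    also have "take i p = take i q \<longleftrightarrow> (\<forall>k<i. p ! k = q ! k)"
      using i len lp by (auto simp: list_eq_iff_nth_eq)
    also have "drop (i + 2) p = drop i q \<longleftrightarrow> (\<forall>k. i \<le> k \<and> k < n \<longrightarrow> p ! (k + 2) = q ! k)"
    proof -
      have "drop (i + 2) p = drop i q \<longleftrightarrow> (\<forall>k<n - i. p ! (i + 2 + k) = q ! (i + k))"
        using i len lp by (auto simp: list_eq_iff_nth_eq)
      also have "\<dots> \<longleftrightarrow> (\<forall>k. i \<le> k \<and> k < n \<longrightarrow> p ! (k + 2) = q ! k)"
      proof (intro iffI allI impI)
        fix k assume "\<forall>k<n - i. p ! (i + 2 + k) = q ! (i + k)" "i \<le> k \<and> k < n"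
        then show "p ! (k + 2) = q ! k"
          by (auto dest!: spec[of _ "k - i"] simp: algebra_simps)
      next
        fix k assume "\<forall>k. i \<le> k \<and> k < n \<longrightarrow> p ! (k + 2) = q ! k" "k < n - i"
        then show "p ! (i + 2 + k) = q ! (i + k)"
          by (auto dest!: spec[of _ "i + k"] simp: algebra_simps)
      qed
      finally show ?thesis .
    qed
    finally show ?thesis
      using e by (auto simp: admissible_cap[OF i] label_def)
  qed
  have "graph_act \<Gamma> (Poly_Mapping.single (([], n + 2), flip (cup_diagram i n), ([], n)) 1)
           (Poly_Mapping.single (([], n), q) 1) =
        (\<Sum>p\<in>loops \<Gamma> (n + 2). Poly_Mapping.single (([], n + 2), p)
           (of_real (state \<Gamma> (flip (cup_diagram i n)) (label p q))))"
    by (simp add: graph_act_def)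
  also have "\<dots> = (\<Sum>p\<in>?h ` ?O. Poly_Mapping.single (([], n + 2), p)
           (of_real (state \<Gamma> (flip (cup_diagram i n)) (label p q))))"
  proof (rule sum.mono_neutral_right)
    show "finite (loops \<Gamma> (n + 2))" by (rule finite_loops)
    show "?h ` ?O \<subseteq> loops \<Gamma> (n + 2)" using h by blast
    show "\<forall>p\<in>loops \<Gamma> (n + 2) - ?h ` ?O. Poly_Mapping.single (([], n + 2), p)
           (of_real (state \<Gamma> (flip (cup_diagram i n)) (label p q)) :: complex) = 0"
    proof
      fix p assume p: "p \<in> loops \<Gamma> (n + 2) - ?h ` ?O"
      have "p \<noteq> ?h (p ! i)"
      proof
        assume eq: "p = ?h (p ! i)"
        then have "?h (p ! i) \<in> loops \<Gamma> (n + 2)" using p by (simp only: DiffD1)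
        then have "p ! i \<in> ?O" by (simp only: h)
        then have "?h (p ! i) \<in> ?h ` ?O" by (rule imageI)
        with eq have "p \<in> ?h ` ?O" by (simp only:)
        with p show False by (rule DiffD2)
      qed
      then show "Poly_Mapping.single (([], n + 2), p)
           (of_real (state \<Gamma> (flip (cup_diagram i n)) (label p q)) :: complex) = 0"
        using c p by (simp add: state_def)
    qed
  qed
  also have "\<dots> = (\<Sum>e\<in>?O. Poly_Mapping.single (([], n + 2), ?h e)
           (of_real (state \<Gamma> (flip (cup_diagram i n)) (label (?h e) q))))"
    using inj by (simp add: sum.reindex)
  also have "\<dots> = (\<Sum>e\<in>?O. Poly_Mapping.single (([], n + 2), ?h e) (of_real (sqrt (wt \<Gamma> e))))"
  proof (rule sum.cong[OF refl])
    fix e assume e: "e \<in> ?O"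
    have "?h e ! i = e" using i len by (simp add: nth_append)
    moreover have "admissible \<Gamma> (flip (cup_diagram i n)) (label (?h e) q)"
      using c[of "?h e"] h e calculation by simp
    ultimately have "state \<Gamma> (flip (cup_diagram i n)) (label (?h e) q) = sqrt (wt \<Gamma> e)"
      by (simp add: state_def left_ends_cap label_def)
    then show "Poly_Mapping.single (([], n + 2), ?h e)
           (of_real (state \<Gamma> (flip (cup_diagram i n)) (label (?h e) q)) :: complex) =
         Poly_Mapping.single (([], n + 2), ?h e) (of_real (sqrt (wt \<Gamma> e)))" by simp
  qed
  finally show ?thesis .
qed

end

theory Submission
  imports Defs
begin

text \<open>
  In the basis of loops, the left inner product of \<open>G\<^sub>\<Gamma>(n)\<close> is the standard one, whereas a loop \<open>p\<close> has
  norm \<open>1 / w(p)\<close> for the right one. Hence the modular operator multiplies \<open>p\<close> by \<open>w(p)\<close>, and the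
  tracial part is spanned by the loops of weight \<open>1\<close>, that is, by the loops which lift to closed
  loops of the tracial cover. Forgetting the weights in the vertices of the cover thus embeds the
  algebra object of the cover in that of \<open>\<Gamma>\<close>, with the same image as \<open>M\<^sub>t\<^sub>r\<close>. The embedding is
  compatible with a diagram because the diagram is planar: the points enclosed by a strand are
  paired among themselves, so that the edges enclosed have total weight \<open>1\<close> and the lifted labels of
  the two ends of the strand match whenever the labels do. The axioms of a star-algebra object are
  inherited along such an embedding, and so is the W*-property, all spaces being finite-dimensional.

  For this the tensor products, conjugates and composites of morphisms of TLJ have to be morphisms
  again. That a composite diagram is planar is seen from words: if the strands of a pairing are
  labelled by involutions of a set, then a planar pairing has the same product of labels along
  its source and along its target, and for a crossing some labelling violates this.
\<close>


section \<open>Finitely supported linear combinations\<close>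

text \<open>The obstacle is that a vertex of the cover remembers the weight of the whole path
  leading to it, while a state sum only compares the labels at the two ends of a strand. This
  nonlocal memory is controlled by one cancellation argument for words in a monoid of maps, with two
  choices of letters: reflections of the integers, which detect crossings, and multiplications by
  edge weights, which compute the memory.

  The tracial part and the algebra of the cover are never compared directly. Each is embedded in the
  algebra of \<open>\<Gamma>\<close>, whose axioms belong to the hypotheses, and the isomorphism is
  one embedding followed by the inverse of the other.

  Finite dimension enters the transfer of the W*-property twice. An inverse of an element of the
  image lies in the image again, since an injective map of a finite-dimensional space to itself is
  onto; this keeps spectra nonnegative. And the image is closed both for the norm and for the weak*
  topology, since functionals of the predual separate it from outside points; therefore the norm and
  the predual can simply be restricted.\<close>

lemma lookup_pm_scale [simp]: "Poly_Mapping.lookup (pm_scale c f) x = c * Poly_Mapping.lookup f x"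
  by (simp add: pm_scale_def Poly_Mapping.map.rep_eq when_def)

lemma pm_scale_zero [simp]: "pm_scale c 0 = 0" "pm_scale 0 f = 0"
  by (auto intro: poly_mapping_eqI)

lemma pm_scale_scale [simp]: "pm_scale c (pm_scale d f) = pm_scale (c * d) f"
  by (auto intro: poly_mapping_eqI)

lemma pm_scale_single [simp]: "pm_scale c (Poly_Mapping.single x d) = Poly_Mapping.single x (c * d)"
  by (auto intro!: poly_mapping_eqI simp: lookup_single when_def)

lemma pm_scale_add: "pm_scale c (f + g) = pm_scale c f + pm_scale c g"
  by (auto intro!: poly_mapping_eqI simp: lookup_add algebra_simps)

lemma pm_scale_add_left: "pm_scale (c + d) f = pm_scale c f + pm_scale d f"
  by (auto intro!: poly_mapping_eqI simp: lookup_add algebra_simps)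

lemma pm_scale_sum: "pm_scale c (\<Sum>x\<in>A. F x) = (\<Sum>x\<in>A. pm_scale c (F x))"
  by (induction A rule: infinite_finite_induct) (auto simp: pm_scale_add)

lemma keys_pm_scale: "Poly_Mapping.keys (pm_scale c f) \<subseteq> Poly_Mapping.keys f"
  by (auto simp: in_keys_iff)

lemma vector_space_pm_scale: "vector_space pm_scale"
  by unfold_locales (auto simp: pm_scale_add pm_scale_add_left)

lemma lin_ext_superset:
  assumes "finite A" "Poly_Mapping.keys f \<subseteq> A"
  shows "lin_ext F f = (\<Sum>x\<in>A. pm_scale (Poly_Mapping.lookup f x) (F x))"
  unfolding lin_ext_def
  by (rule sum.mono_neutral_left) (use assms in \<open>auto simp: in_keys_iff\<close>)

lemma lin_ext_zero [simp]: "lin_ext F 0 = 0"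
  by (simp add: lin_ext_def)

lemma lin_ext_add: "lin_ext F (f + g) = lin_ext F f + lin_ext F g"
proof -
  let ?A = "Poly_Mapping.keys f \<union> Poly_Mapping.keys g"
  have "Poly_Mapping.keys (f + g) \<subseteq> ?A" by (rule Poly_Mapping.keys_add)
  then show ?thesis
    by (simp add: lin_ext_superset[of ?A] lookup_add pm_scale_add_left sum.distrib)
qed

lemma lin_ext_scale: "lin_ext F (pm_scale c f) = pm_scale c (lin_ext F f)"
  using keys_pm_scale[of c f]
  by (simp add: lin_ext_superset[of "Poly_Mapping.keys f"] pm_scale_sum)

lemma lin_ext_sum: "lin_ext F (\<Sum>x\<in>A. f x) = (\<Sum>x\<in>A. lin_ext F (f x))"
  by (induction A rule: infinite_finite_induct) (auto simp: lin_ext_add)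

lemma lin_ext_single [simp]: "lin_ext F (Poly_Mapping.single x c) = pm_scale c (F x)"
  by (cases "c = 0") (auto simp: lin_ext_def)

lemma lin_ext_cong:
  "(\<And>x. x \<in> Poly_Mapping.keys f \<Longrightarrow> F x = G x) \<Longrightarrow> lin_ext F f = lin_ext G f"
  unfolding lin_ext_def by (rule sum.cong) auto

lemma lin_ext_unit [simp]: "lin_ext (\<lambda>x. Poly_Mapping.single x 1) f = f"
  by (auto intro!: poly_mapping_eqI
      simp: lin_ext_def lookup_sum lookup_single when_def in_keys_iff)

lemma lin_ext_fun_zero [simp]: "lin_ext (\<lambda>x. 0) f = 0"
  by (simp add: lin_ext_def)

lemma lin_ext_fun_add: "lin_ext (\<lambda>x. F x + G x) f = lin_ext F f + lin_ext G f"
  by (simp add: lin_ext_def pm_scale_add sum.distrib)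

lemma lin_ext_fun_scale: "lin_ext (\<lambda>x. pm_scale c (F x)) f = pm_scale c (lin_ext F f)"
  by (simp add: lin_ext_def pm_scale_sum mult.commute)

lemma lin_ext_fun_sum: "lin_ext (\<lambda>x. \<Sum>y\<in>A. F x y) f = (\<Sum>y\<in>A. lin_ext (\<lambda>x. F x y) f)"
  by (induction A rule: infinite_finite_induct) (auto simp: lin_ext_fun_add)

lemma lin_ext_lin_ext: "lin_ext G (lin_ext F f) = lin_ext (\<lambda>x. lin_ext G (F x)) f"
  by (simp add: lin_ext_def[of F] lin_ext_def[of "\<lambda>x. lin_ext G (F x)"] lin_ext_sum lin_ext_scale)

lemma lin_ext_swap: "lin_ext (\<lambda>x. lin_ext (F x) g) f = lin_ext (\<lambda>y. lin_ext (\<lambda>x. F x y) f) g"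
proof -
  have "lin_ext (\<lambda>x. lin_ext (F x) g) f = (\<Sum>x\<in>Poly_Mapping.keys f. \<Sum>y\<in>Poly_Mapping.keys g.
      pm_scale (Poly_Mapping.lookup f x * Poly_Mapping.lookup g y) (F x y))"
    by (simp add: lin_ext_def pm_scale_sum)
  also have "\<dots> = lin_ext (\<lambda>y. lin_ext (\<lambda>x. F x y) f) g"
    by (subst sum.swap) (simp add: lin_ext_def pm_scale_sum mult.commute)
  finally show ?thesis .
qed

lemma keys_sum_subset: "(\<And>x. x \<in> A \<Longrightarrow> Poly_Mapping.keys (f x) \<subseteq> B) \<Longrightarrow> Poly_Mapping.keys (\<Sum>x\<in>A. f x) \<subseteq> B"
  by (induction A rule: infinite_finite_induct)
     (auto dest!: subsetD[OF Poly_Mapping.keys_add])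

lemma keys_lin_ext:
  "(\<And>x. x \<in> Poly_Mapping.keys f \<Longrightarrow> Poly_Mapping.keys (F x) \<subseteq> B) \<Longrightarrow> Poly_Mapping.keys (lin_ext F f) \<subseteq> B"
  unfolding lin_ext_def by (rule keys_sum_subset) (meson keys_pm_scale subset_trans)

lemma lookup_lin_ext:
  "Poly_Mapping.lookup (lin_ext F f) y =
     (\<Sum>x\<in>Poly_Mapping.keys f. Poly_Mapping.lookup f x * Poly_Mapping.lookup (F x) y)"
  by (simp add: lin_ext_def lookup_sum)

text \<open>Reduces antilinear extension to linear extension (\<open>conj_ext_eq\<close>), so that
  \<open>conj_ext\<close> needs no calculus of its own.\<close>

definition pm_cnj :: "('a \<Rightarrow>\<^sub>0 complex) \<Rightarrow> ('a \<Rightarrow>\<^sub>0 complex)" where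
  "pm_cnj = Poly_Mapping.map cnj"

lemma lookup_pm_cnj [simp]: "Poly_Mapping.lookup (pm_cnj f) x = cnj (Poly_Mapping.lookup f x)"
  by (simp add: pm_cnj_def Poly_Mapping.map.rep_eq when_def)

lemma keys_pm_cnj [simp]: "Poly_Mapping.keys (pm_cnj f) = Poly_Mapping.keys f"
  by (auto simp: in_keys_iff)

lemma pm_cnj_pm_cnj [simp]: "pm_cnj (pm_cnj f) = f"
  by (auto intro: poly_mapping_eqI)

lemma pm_cnj_single [simp]: "pm_cnj (Poly_Mapping.single x c) = Poly_Mapping.single x (cnj c)"
  by (auto intro!: poly_mapping_eqI simp: lookup_single when_def)

lemma pm_cnj_scale: "pm_cnj (pm_scale c f) = pm_scale (cnj c) (pm_cnj f)"
  by (auto intro!: poly_mapping_eqI)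

lemma pm_cnj_sum: "pm_cnj (\<Sum>x\<in>A. f x) = (\<Sum>x\<in>A. pm_cnj (f x))"
  by (auto intro!: poly_mapping_eqI simp: lookup_sum)

lemma pm_cnj_lin_ext: "pm_cnj (lin_ext F f) = lin_ext (\<lambda>x. pm_cnj (F x)) (pm_cnj f)"
  by (simp add: lin_ext_def pm_cnj_sum pm_cnj_scale)

lemma conj_ext_eq: "conj_ext F f = lin_ext F (pm_cnj f)"
  by (simp add: conj_ext_def lin_ext_def)

lemma bilin_ext_single_scaled [simp]:
  "bilin_ext F (Poly_Mapping.single x c) (Poly_Mapping.single y d) = pm_scale (c * d) (F x y)"
  by (simp add: bilin_ext_def)

lemma bilin_ext_add_left: "bilin_ext F (f + g) h = bilin_ext F f h + bilin_ext F g h"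
  by (simp add: bilin_ext_def lin_ext_add)

lemma bilin_ext_add_right: "bilin_ext F h (f + g) = bilin_ext F h f + bilin_ext F h g"
  by (simp add: bilin_ext_def lin_ext_add lin_ext_fun_add)

lemma bilin_ext_scale_left: "bilin_ext F (pm_scale c f) h = pm_scale c (bilin_ext F f h)"
  by (simp add: bilin_ext_def lin_ext_scale)

lemma bilin_ext_scale_right: "bilin_ext F h (pm_scale c f) = pm_scale c (bilin_ext F h f)"
  by (simp add: bilin_ext_def lin_ext_scale lin_ext_fun_scale)

lemma bilin_ext_zero [simp]: "bilin_ext F 0 h = 0" "bilin_ext F g 0 = 0"
  by (simp_all add: bilin_ext_def)

lemma bilin_ext_sum_left: "bilin_ext F (\<Sum>x\<in>A. f x) h = (\<Sum>x\<in>A. bilin_ext F (f x) h)"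
  by (simp add: bilin_ext_def lin_ext_sum)

lemma bilin_ext_sum_right: "bilin_ext F h (\<Sum>x\<in>A. f x) = (\<Sum>x\<in>A. bilin_ext F h (f x))"
  by (induction A rule: infinite_finite_induct) (auto simp: bilin_ext_add_right)

lemma keys_bilin_ext:
  "(\<And>x y. x \<in> Poly_Mapping.keys f \<Longrightarrow> y \<in> Poly_Mapping.keys g \<Longrightarrow> Poly_Mapping.keys (F x y) \<subseteq> B) \<Longrightarrow>
   Poly_Mapping.keys (bilin_ext F f g) \<subseteq> B"
  unfolding bilin_ext_def by (intro keys_lin_ext) 

lemma bilin_ext_cong:
  "(\<And>x y. x \<in> Poly_Mapping.keys f \<Longrightarrow> y \<in> Poly_Mapping.keys g \<Longrightarrow> F x y = G x y) \<Longrightarrow>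
   bilin_ext F f g = bilin_ext G f g"
  unfolding bilin_ext_def by (intro lin_ext_cong) auto

lemma bilin_ext_swap: "bilin_ext F f g = bilin_ext (\<lambda>y x. F x y) g f"
  unfolding bilin_ext_def by (rule lin_ext_swap)

lemma bilin_ext_lin_left: "bilin_ext F (lin_ext A f) g = lin_ext (\<lambda>x. bilin_ext F (A x) g) f"
  by (simp add: bilin_ext_def lin_ext_lin_ext)

lemma bilin_ext_lin_right: "bilin_ext F g (lin_ext A f) = lin_ext (\<lambda>x. bilin_ext F g (A x)) f"
  by (subst (1 2) bilin_ext_swap) (rule bilin_ext_lin_left)

lemma lin_ext_bilin: "lin_ext A (bilin_ext F f g) = bilin_ext (\<lambda>x y. lin_ext A (F x y)) f g"
  by (simp add: bilin_ext_def lin_ext_lin_ext)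

text \<open>Both sides are trilinear, so it is enough to compare them on basis elements. Restricting
  these to the keys lets properties of the actual diagrams enter, such as having points on two
  levels only.\<close>

lemma bilin_ext_assoc:
  assumes "\<And>x y z. x \<in> Poly_Mapping.keys f \<Longrightarrow> y \<in> Poly_Mapping.keys g \<Longrightarrow> z \<in> Poly_Mapping.keys h \<Longrightarrow>
    bilin_ext B (Poly_Mapping.single z 1) (C y x) = bilin_ext D (E z y) (Poly_Mapping.single x 1)"
  shows "bilin_ext B h (bilin_ext C g f) = bilin_ext D (bilin_ext E h g) f"
proof -
  have "bilin_ext B h (bilin_ext C g f) =
     lin_ext (\<lambda>z. bilin_ext B (Poly_Mapping.single z 1) (bilin_ext C g f)) h"
    using bilin_ext_lin_left[of B "\<lambda>z. Poly_Mapping.single z 1" h] by simp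
  also have "\<dots> = lin_ext (\<lambda>z. lin_ext (\<lambda>y. lin_ext (\<lambda>x. bilin_ext B (Poly_Mapping.single z 1) (C y x)) f) g) h"
    by (simp only: bilin_ext_def[of C] bilin_ext_lin_right)
  also have "\<dots> = lin_ext (\<lambda>z. lin_ext (\<lambda>y. lin_ext (\<lambda>x. bilin_ext D (E z y) (Poly_Mapping.single x 1)) f) g) h"
    by (intro lin_ext_cong assms)
  also have "\<dots> = lin_ext (\<lambda>z. lin_ext (\<lambda>y. bilin_ext D (E z y) f) g) h"
    using bilin_ext_lin_right[of D _ "\<lambda>z. Poly_Mapping.single z 1" f] by simp
  also have "\<dots> = bilin_ext D (bilin_ext E h g) f"
    by (simp only: bilin_ext_def[of E] bilin_ext_lin_left)
  finally show ?thesis .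
qed

text \<open>Both sides expand to a fourfold sum in which only the two middle indices
  \<open>y\<close> and \<open>x'\<close> have to change places. This serves the interchange law of
  tensor product and composition.\<close>

lemma bilin_ext_interchange:
  assumes "\<And>x y x' y'. x \<in> Poly_Mapping.keys f \<Longrightarrow> y \<in> Poly_Mapping.keys g \<Longrightarrow>
      x' \<in> Poly_Mapping.keys f' \<Longrightarrow> y' \<in> Poly_Mapping.keys g' \<Longrightarrow>
      bilin_ext B (T x y) (T' x' y') = bilin_ext T'' (C x x') (C' y y')"
  shows "bilin_ext B (bilin_ext T f g) (bilin_ext T' f' g') = bilin_ext T'' (bilin_ext C f f') (bilin_ext C' g g')"
proof -
  have L: "bilin_ext A (bilin_ext K f g) h = lin_ext (\<lambda>x. lin_ext (\<lambda>y. bilin_ext A (K x y) h) g) f"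
    for A K f g h by (simp only: bilin_ext_def[of K] bilin_ext_lin_left)
  have R: "bilin_ext A h (bilin_ext K f g) = lin_ext (\<lambda>x. lin_ext (\<lambda>y. bilin_ext A h (K x y)) g) f"
    for A K f g h by (simp only: bilin_ext_def[of K] bilin_ext_lin_right)
  have "bilin_ext B (bilin_ext T f g) (bilin_ext T' f' g') =
     lin_ext (\<lambda>x. lin_ext (\<lambda>y. lin_ext (\<lambda>x'. lin_ext (\<lambda>y'. bilin_ext B (T x y) (T' x' y')) g') f') g) f"
    by (subst L, subst R) (rule refl)
  also have "\<dots> = lin_ext (\<lambda>x. lin_ext (\<lambda>y. lin_ext (\<lambda>x'. lin_ext (\<lambda>y'. bilin_ext T'' (C x x') (C' y y')) g') f') g) f"
    by (intro lin_ext_cong assms)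
  also have "\<dots> = lin_ext (\<lambda>x. lin_ext (\<lambda>x'. lin_ext (\<lambda>y. lin_ext (\<lambda>y'. bilin_ext T'' (C x x') (C' y y')) g') g) f') f"
    by (subst lin_ext_swap[of _ f' g]) (rule refl)
  also have "\<dots> = bilin_ext T'' (bilin_ext C f f') (bilin_ext C' g g')"
    by (subst L, subst R) (rule refl)
  finally show ?thesis .
qed


section \<open>Connected components of a family of sets\<close>

definition link :: "'a set set \<Rightarrow> ('a \<times> 'a) set" where
  "link U = {(P, Q). \<exists>A\<in>U. P \<in> A \<and> Q \<in> A}"

text \<open>\<open>components\<close> for an arbitrary family of sets: it is also applied to three
  layers at once, and to families whose members are themselves components.\<close>

definition comps :: "'a set set \<Rightarrow> 'a set set" where
  "comps U = \<Union>U // (link U)\<^sup>*"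

lemma linkI: "A \<in> U \<Longrightarrow> P \<in> A \<Longrightarrow> Q \<in> A \<Longrightarrow> (P, Q) \<in> link U"
  by (auto simp: link_def)

lemma linkE: "(P, Q) \<in> link U \<Longrightarrow> (\<And>A. A \<in> U \<Longrightarrow> P \<in> A \<Longrightarrow> Q \<in> A \<Longrightarrow> thesis) \<Longrightarrow> thesis"
  by (auto simp: link_def)

lemma link_mono: "U \<subseteq> V \<Longrightarrow> link U \<subseteq> link V"
  by (auto simp: link_def)

lemma link_rtrancl_mono: "U \<subseteq> V \<Longrightarrow> (P, Q) \<in> (link U)\<^sup>* \<Longrightarrow> (P, Q) \<in> (link V)\<^sup>*"
  using rtrancl_mono[OF link_mono] by blast

lemma link_rtrancl_sym: "(P, Q) \<in> (link U)\<^sup>* \<Longrightarrow> (Q, P) \<in> (link U)\<^sup>*"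
  by (rule symD[OF sym_rtrancl]) (auto simp: link_def sym_def)

lemma link_closed:
  assumes "(P, Q) \<in> (link U)\<^sup>*" "P \<in> C" "\<And>A. A \<in> U \<Longrightarrow> A \<inter> C \<noteq> {} \<Longrightarrow> A \<subseteq> C"
  shows "Q \<in> C"
  using assms(1,2)
proof (induction rule: rtrancl_induct)
  case (step Q R)
  then show ?case using assms(3) by (fastforce simp: link_def)
qed

text \<open>Avoids representatives of quotient classes: closure under the members that are met makes
  a set a union of classes, and connectedness leaves only one.\<close>

lemma comps_iff:
  "C \<in> comps U \<longleftrightarrow> C \<noteq> {} \<and> C \<subseteq> \<Union>U \<and> (\<forall>A\<in>U. A \<inter> C \<noteq> {} \<longrightarrow> A \<subseteq> C) \<and>
     (\<forall>P\<in>C. \<forall>Q\<in>C. (P, Q) \<in> (link U)\<^sup>*)"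
    (is "_ \<longleftrightarrow> ?R")
proof
  assume "C \<in> comps U"
  then obtain P where P: "P \<in> \<Union>U" "C = (link U)\<^sup>* `` {P}"
    by (auto simp: comps_def quotient_def)
  have "Q \<in> \<Union>U" if "(P, Q) \<in> (link U)\<^sup>*" for Q
    using that P(1) by (induction rule: rtrancl_induct) (auto simp: link_def)
  moreover have "A \<subseteq> C" if A: "A \<in> U" "A \<inter> C \<noteq> {}" for A
  proof
    fix R assume "R \<in> A"
    obtain Q where "Q \<in> A" "(P, Q) \<in> (link U)\<^sup>*" using A P(2) by auto
    then show "R \<in> C" using linkI[OF A(1) \<open>Q \<in> A\<close> \<open>R \<in> A\<close>] P(2) by (simp add: rtrancl_into_rtrancl)
  qed
  moreover have "(Q, R) \<in> (link U)\<^sup>*" if "Q \<in> C" "R \<in> C" for Q R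
    using that P(2) link_rtrancl_sym[of P Q U] rtrancl_trans[of Q P _ R] by simp
  moreover have "C \<noteq> {}" using P(2) by auto
  moreover have "C \<subseteq> \<Union>U" using P(2) calculation(1) by blast
  ultimately show ?R by simp
next
  assume R: ?R
  then obtain P where P: "P \<in> C" by auto
  have "C = (link U)\<^sup>* `` {P}"
  proof
    show "C \<subseteq> (link U)\<^sup>* `` {P}" using R P by auto
    show "(link U)\<^sup>* `` {P} \<subseteq> C" using R link_closed[OF _ P, of _ U] by (simp add: subset_iff)
  qed
  moreover have "P \<in> \<Union>U" using P R by auto
  ultimately show "C \<in> comps U"
    unfolding comps_def by (simp add: quotientI)
qed

lemma comps_subset: "C \<in> comps U \<Longrightarrow> C \<subseteq> \<Union>U"
  by (simp add: comps_iff)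

lemma comps_nonempty: "C \<in> comps U \<Longrightarrow> C \<noteq> {}"
  by (simp add: comps_iff)

lemma comps_closed: "C \<in> comps U \<Longrightarrow> A \<in> U \<Longrightarrow> A \<inter> C \<noteq> {} \<Longrightarrow> A \<subseteq> C"
  by (simp add: comps_iff)

lemma comps_connected: "C \<in> comps U \<Longrightarrow> P \<in> C \<Longrightarrow> Q \<in> C \<Longrightarrow> (P, Q) \<in> (link U)\<^sup>*"
  by (simp add: comps_iff)

lemma comps_link: "C \<in> comps U \<Longrightarrow> P \<in> C \<Longrightarrow> (P, Q) \<in> (link U)\<^sup>* \<Longrightarrow> Q \<in> C"
  by (rule link_closed) (auto dest: comps_closed)

lemma Union_comps: "\<Union>(comps U) = \<Union>U"
proof
  show "\<Union>(comps U) \<subseteq> \<Union>U" using comps_subset by blast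
  show "\<Union>U \<subseteq> \<Union>(comps U)"
  proof
    fix P assume "P \<in> \<Union>U"
    then have "(link U)\<^sup>* `` {P} \<in> comps U" by (auto simp: comps_def quotient_def)
    then show "P \<in> \<Union>(comps U)" by blast
  qed
qed

lemma comps_disjoint: "C \<in> comps U \<Longrightarrow> C' \<in> comps U \<Longrightarrow> P \<in> C \<Longrightarrow> P \<in> C' \<Longrightarrow> C = C'"
  by (meson comps_connected comps_link subset_antisym subsetI)


lemma finite_comps: "finite (\<Union>U) \<Longrightarrow> finite (comps U)"
  by (rule finite_subset[of _ "Pow (\<Union>U)"]) (use comps_subset in blast, simp)

text \<open>The form in which a guessed list of components is verified. Each member of
  \<open>X\<close> is a component by \<open>comps_iff\<close>; since \<open>X\<close> covers all
  points, disjointness of components leaves no room for another.\<close>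

lemma comps_eqI:
  assumes "\<Union>X = \<Union>U" "{} \<notin> X"
    "\<And>A C. A \<in> U \<Longrightarrow> C \<in> X \<Longrightarrow> A \<inter> C \<noteq> {} \<Longrightarrow> A \<subseteq> C"
    "\<And>C P Q. C \<in> X \<Longrightarrow> P \<in> C \<Longrightarrow> Q \<in> C \<Longrightarrow> (P, Q) \<in> (link U)\<^sup>*"
  shows "comps U = X"
proof
  show X: "X \<subseteq> comps U"
  proof
    fix C assume C: "C \<in> X"
    then have "C \<noteq> {}" "C \<subseteq> \<Union>U" using assms(1,2) by auto
    then show "C \<in> comps U"
      unfolding comps_iff using assms(3)[OF _ C] assms(4)[OF C] by simp
  qed
  show "comps U \<subseteq> X"
  proof
    fix C assume C: "C \<in> comps U"
    then obtain P where P: "P \<in> C" "P \<in> \<Union>U" using comps_nonempty comps_subset by blast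
    then obtain C' where "C' \<in> X" "P \<in> C'" using assms(1) by auto
    then show "C \<in> X" using comps_disjoint[OF C, of C' P] X P by auto
  qed
qed

lemma link_image:
  assumes "(P, Q) \<in> (link U)\<^sup>*" shows "(h P, h Q) \<in> (link ((`) h ` U))\<^sup>*"
  using assms
proof (induction rule: rtrancl_induct)
  case (step Q R)
  then have "(h Q, h R) \<in> link ((`) h ` U)" by (auto simp: link_def)
  with step.IH show ?case by (rule rtrancl_into_rtrancl)
qed simp

lemma comps_image:
  assumes "inj_on h (\<Union>U)"
  shows "comps ((`) h ` U) = (`) h ` comps U"
proof (rule comps_eqI)
  show "\<Union> ((`) h ` comps U) = \<Union> ((`) h ` U)"
    using Union_comps[of U] by (simp flip: image_Union)
  show "{} \<notin> (`) h ` comps U" using comps_nonempty by auto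
next
  fix A C assume *: "A \<in> (`) h ` U" "C \<in> (`) h ` comps U" "A \<inter> C \<noteq> {}"
  then obtain B K where B: "B \<in> U" "A = h ` B" and K: "K \<in> comps U" "C = h ` K" by auto
  then have "B \<subseteq> \<Union>U" "K \<subseteq> \<Union>U" using comps_subset by auto
  then have "h ` (B \<inter> K) = h ` B \<inter> h ` K" using assms by (simp add: inj_on_image_Int)
  then have "B \<inter> K \<noteq> {}" using * B K by auto
  then have "B \<subseteq> K" using B K comps_closed by blast
  then show "A \<subseteq> C" using B K by auto
next
  fix C P Q assume "C \<in> (`) h ` comps U" "P \<in> C" "Q \<in> C"
  then obtain K P' Q' where "K \<in> comps U" "P' \<in> K" "Q' \<in> K" "P = h P'" "Q = h Q'" by auto
  then show "(P, Q) \<in> (link ((`) h ` U))\<^sup>*"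
    using link_image[of P' Q' U h] comps_connected[of K U P' Q'] by simp
qed

lemma comps_Un_disjoint:
  assumes "\<Union>U \<inter> \<Union>V = {}"
  shows "comps (U \<union> V) = comps U \<union> comps V"
proof (rule comps_eqI)
  show "\<Union> (comps U \<union> comps V) = \<Union> (U \<union> V)"
    by (simp add: Union_comps)
  show "{} \<notin> comps U \<union> comps V" using comps_nonempty by auto
  fix A C assume "A \<in> U \<union> V" "C \<in> comps U \<union> comps V" "A \<inter> C \<noteq> {}"
  then show "A \<subseteq> C" using assms comps_closed[of C U A] comps_closed[of C V A] comps_subset[of C] by blast
next
  fix C P Q assume "C \<in> comps U \<union> comps V" "P \<in> C" "Q \<in> C"
  then show "(P, Q) \<in> (link (U \<union> V))\<^sup>*"
    using link_rtrancl_mono[of U "U \<union> V" P Q] link_rtrancl_mono[of V "U \<union> V" P Q]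
      comps_connected[of C U P Q] comps_connected[of C V P Q] by auto
qed

text \<open>Stacking erases the middle level \<open>I\<close> from each component. The components of
  which nothing remains, and which are therefore dropped, are the closed circles.\<close>

definition trim :: "'a set \<Rightarrow> 'a set set \<Rightarrow> 'a set set" where
  "trim I X = (\<lambda>C. C - I) ` X - {{}}"

text \<open>
  Forgetting points which \<open>V\<close> does not touch commutes with adding \<open>V\<close>: this makes stacking associative.
\<close>

lemma comps_trim:
  assumes "I \<inter> \<Union>V = {}"
  shows "comps (trim I (comps U) \<union> V) = trim I (comps (U \<union> V))"
proof (rule comps_eqI)
  let ?U' = "trim I (comps U) \<union> V"
  have "\<Union> (trim I X) = \<Union>X - I" for X by (auto simp: trim_def)
  then show "\<Union> (trim I (comps (U \<union> V))) = \<Union> ?U'"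
    using assms by (auto simp: Union_comps)
  show "{} \<notin> trim I (comps (U \<union> V))" by (simp add: trim_def)
next
  fix A C assume *: "A \<in> trim I (comps U) \<union> V" "C \<in> trim I (comps (U \<union> V))" "A \<inter> C \<noteq> {}"
  then obtain K where K: "K \<in> comps (U \<union> V)" "C = K - I" by (auto simp: trim_def)
  show "A \<subseteq> C"
  proof (cases "A \<in> V")
    case True
    then show ?thesis using * K assms comps_closed[of K "U \<union> V" A] by blast
  next
    case False
    then obtain B where B: "B \<in> comps U" "A = B - I" using * by (auto simp: trim_def)
    obtain P where P: "P \<in> B" "P \<in> K" using * B K by auto
    have "B \<subseteq> K"
    proof
      fix Q assume "Q \<in> B"
      then have "(P, Q) \<in> (link (U \<union> V))\<^sup>*"
        using comps_connected[OF B(1) P(1)] by (intro link_rtrancl_mono[of U "U \<union> V"]) auto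
      then show "Q \<in> K" by (rule comps_link[OF K(1) P(2)])
    qed
    then show ?thesis using B K by auto
  qed
next
  let ?R = "link (trim I (comps U) \<union> V)"
  fix C P Q assume C: "C \<in> trim I (comps (U \<union> V))" "P \<in> C" "Q \<in> C"
  then obtain K where "K \<in> comps (U \<union> V)" "C = K - I" by (auto simp: trim_def)
  then have PQ: "(P, Q) \<in> (link (U \<union> V))\<^sup>*" "P \<notin> I" "Q \<notin> I"
    using C comps_connected[of K "U \<union> V" P Q] by auto
  have same: "(S, T) \<in> ?R\<^sup>*" if ST: "(S, T) \<in> (link U)\<^sup>*" "S \<notin> I" "T \<notin> I" for S T
  proof (cases "S = T")
    case False
    with ST(1) obtain S' where "(S, S') \<in> link U" by (meson converse_rtranclE)
    then have "S \<in> \<Union>U" by (auto simp: link_def)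
    then obtain K where K: "K \<in> comps U" "S \<in> K" using Union_comps[of U] by blast
    have "T \<in> K" using K ST(1) by (rule comps_link)
    then have "K - I \<in> trim I (comps U)" using K ST by (auto simp: trim_def)
    then have "(S, T) \<in> ?R" using K \<open>T \<in> K\<close> ST by (intro linkI[of "K - I"]) auto
    then show ?thesis by blast
  qed simp
  \<comment> \<open>Invariant along a chain from \<open>P\<close>: the current point is reached
    inside \<open>U\<close> from some \<open>Q'\<close> outside \<open>I\<close>, and
    \<open>Q'\<close> is reached in the reduced family. A step through \<open>V\<close> starts
    outside \<open>I\<close>, so the detour through \<open>U\<close> made so far can be contracted
    to a link of the reduced family.\<close>
  have "\<exists>Q'. Q' \<notin> I \<and> (P, Q') \<in> ?R\<^sup>* \<and> (Q', Q) \<in> (link U)\<^sup>*"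
    using PQ(1)
  proof (induction rule: rtrancl_induct)
    case base
    show ?case using PQ(2) by blast
  next
    case (step Q R)
    then obtain Q' where Q': "Q' \<notin> I" "(P, Q') \<in> ?R\<^sup>*" "(Q', Q) \<in> (link U)\<^sup>*" by blast
    show ?case
    proof (cases "(Q, R) \<in> link U")
      case True
      with Q' show ?thesis by (blast intro: rtrancl_into_rtrancl)
    next
      case False
      from step.hyps(2) obtain A where A: "A \<in> U \<union> V" "Q \<in> A" "R \<in> A" by (rule linkE)
      with False have "A \<in> V" using linkI by fast
      then have "Q \<notin> I" "R \<notin> I" using assms A by auto
      then have "(P, Q) \<in> ?R\<^sup>*" using Q' same rtrancl_trans by metis
      moreover have "(Q, R) \<in> ?R" using A \<open>A \<in> V\<close> by (intro linkI[of A]) auto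
      ultimately show ?thesis using \<open>R \<notin> I\<close> by (blast intro: rtrancl_into_rtrancl)
    qed
  qed
  then show "(P, Q) \<in> ?R\<^sup>*" using same PQ(3) by (meson rtrancl_trans)
qed

text \<open>A component contained in \<open>I\<close> meets no member of \<open>V\<close>, so chains
  starting in it use \<open>U\<close> alone. Thus the circles closed up in one level are not
  affected by a layer which does not touch that level.\<close>

lemma comps_internal:
  assumes "I \<inter> \<Union>V = {}"
  shows "{C \<in> comps (U \<union> V). C \<subseteq> I} = {C \<in> comps U. C \<subseteq> I}"
proof (intro Collect_cong iffI; elim conjE)
  fix C assume C: "C \<in> comps (U \<union> V)" "C \<subseteq> I"
  have "C \<subseteq> \<Union>U" using C(2) assms comps_subset[OF C(1)] by blast
  moreover have "(P, Q) \<in> (link U)\<^sup>*" if "(P, Q) \<in> (link (U \<union> V))\<^sup>*" "P \<in> C" for P Q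
    using that
  proof (induction rule: rtrancl_induct)
    case (step Q R)
    then have "Q \<in> C" using comps_link[OF C(1)] link_rtrancl_mono[of U "U \<union> V"] by simp
    from step.hyps(2) obtain A where A: "A \<in> U \<union> V" "Q \<in> A" "R \<in> A" by (rule linkE)
    then have "A \<in> U" using \<open>Q \<in> C\<close> C(2) assms by auto
    then have "(Q, R) \<in> link U" using A by (auto intro: linkI)
    then show ?case using step by auto
  qed simp
  ultimately show "C \<in> comps U \<and> C \<subseteq> I"
    using C(2) comps_closed[OF C(1)] comps_connected[OF C(1)] comps_nonempty[OF C(1)]
    by (simp add: comps_iff)
next
  fix C assume C: "C \<in> comps U" "C \<subseteq> I"
  then have "A \<inter> C = {}" if "A \<in> V" for A using that assms by auto
  then show "C \<in> comps (U \<union> V) \<and> C \<subseteq> I"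
    using C(2) comps_closed[OF C(1)] comps_connected[OF C(1)] comps_nonempty[OF C(1)] comps_subset[OF C(1)]
      link_rtrancl_mono[of U "U \<union> V"] by (auto simp: comps_iff)
qed

text \<open>A component inside \<open>I \<union> J\<close> either lies in \<open>I\<close> and
  disappears, or leaves a nonempty remainder inside \<open>J\<close>; distinct components leave
  distinct remainders because they are disjoint. This is the circle count behind
  associativity.\<close>

lemma card_comps_trim:
  assumes "finite (\<Union>U)"
  shows "card {C \<in> trim I (comps U). C \<subseteq> J} + card {C \<in> comps U. C \<subseteq> I} = card {C \<in> comps U. C \<subseteq> I \<union> J}"
proof -
  let ?A = "{C \<in> comps U. C \<subseteq> I \<union> J \<and> \<not> C \<subseteq> I}"
  have fin: "finite (comps U)" by (rule finite_comps[OF assms])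
  have "{C \<in> trim I (comps U). C \<subseteq> J} = (\<lambda>C. C - I) ` ?A"
    by (auto simp: trim_def image_iff; blast)
  moreover have "inj_on (\<lambda>C. C - I) ?A"
  proof (rule inj_onI)
    fix C C' assume *: "C \<in> ?A" "C' \<in> ?A" "C - I = C' - I"
    then obtain P where "P \<in> C - I" by auto
    then show "C = C'" using * comps_disjoint[of C U C' P] by auto
  qed
  ultimately have "card {C \<in> trim I (comps U). C \<subseteq> J} = card ?A" by (simp add: card_image)
  moreover have "{C \<in> comps U. C \<subseteq> I \<union> J} = ?A \<union> {C \<in> comps U. C \<subseteq> I}" by auto
  moreover have "card (?A \<union> {C \<in> comps U. C \<subseteq> I}) = card ?A + card {C \<in> comps U. C \<subseteq> I}"
    using fin by (intro card_Un_disjoint) auto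
  ultimately show ?thesis by simp
qed

text \<open>
  The spanning tree bound. It shows that a component of two glued pairings has at most two ends.
\<close>

lemma card_connected_le:
  assumes C: "C \<in> comps U" and fin: "finite (\<Union>U)" and two: "\<And>A. A \<in> U \<Longrightarrow> card A = 2"
  shows "card C \<le> card {A \<in> U. A \<subseteq> C} + 1"
proof -
  have finU: "finite U" using fin by (rule finite_UnionD)
  have finC: "finite C" using comps_subset[OF C] fin finite_subset by blast
  obtain P where P: "P \<in> C" using comps_nonempty[OF C] by blast
  \<comment> \<open>A largest part of \<open>C\<close> that contains \<open>P\<close> and satisfies
    the bound is all of \<open>C\<close>: otherwise some member of \<open>U\<close> leaves it, and
    adding the far end adds one point and at least one edge.\<close>
  let ?good = "\<lambda>K. P \<in> K \<and> K \<subseteq> C \<and> card K \<le> card {A \<in> U. A \<subseteq> K} + 1"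
  have "?good {P}" using P by simp
  moreover have "\<forall>K. ?good K \<longrightarrow> card K < Suc (card C)"
    using finC by (auto simp: less_Suc_eq_le intro: card_mono)
  ultimately obtain K where K: "?good K" and max: "\<And>K'. ?good K' \<Longrightarrow> card K' \<le> card K"
    using ex_has_greatest_nat[of ?good "{P}" card "Suc (card C)"] by blast
  have "K = C"
  proof (rule ccontr)
    assume "K \<noteq> C"
    then obtain Q where Q: "Q \<in> C" "Q \<notin> K" using K by auto
    then have "(P, Q) \<in> (link U)\<^sup>*" using comps_connected[OF C] P by blast
    then have "\<exists>A\<in>U. A \<inter> K \<noteq> {} \<and> \<not> A \<subseteq> K" using link_closed[of P Q U K] K Q by blast
    then obtain A where A: "A \<in> U" "A \<inter> K \<noteq> {}" "\<not> A \<subseteq> K" by blast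
    then obtain a b where ab: "a \<in> A" "a \<in> K" "b \<in> A" "b \<notin> K" by auto
    then have "A = {a, b}" using two[OF A(1)] by (auto simp: card_2_iff)
    have finK: "finite K" using K finC finite_subset by blast
    let ?K = "insert b K"
    have "A \<subseteq> C" using A K comps_closed[OF C] by blast
    have "insert A {A \<in> U. A \<subseteq> K} \<subseteq> {A \<in> U. A \<subseteq> ?K}" using A ab \<open>A = {a, b}\<close> by auto
    then have "card (insert A {A \<in> U. A \<subseteq> K}) \<le> card {A \<in> U. A \<subseteq> ?K}"
      using finU by (intro card_mono) auto
    moreover have "card (insert A {A \<in> U. A \<subseteq> K}) = Suc (card {A \<in> U. A \<subseteq> K})"
      using finU A by (intro card_insert_disjoint) auto
    ultimately have "?good ?K" using K ab \<open>A \<subseteq> C\<close> finK by auto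
    from max[OF this] show False using finK ab by simp
  qed
  then show ?thesis using K by simp
qed


section \<open>Stacking diagrams\<close>

definition raise :: "point \<Rightarrow> point" where
  "raise = (\<lambda>(l, i). (Suc l, i))"

definition up :: "diagram \<Rightarrow> diagram" where
  "up E = (`) raise ` E"

definition level :: "nat \<Rightarrow> point set" where
  "level l = {P. fst P = l}"

text \<open>Once the middle level is erased only the levels 0 and 2 remain; halving renumbers them
  as source and target.\<close>

definition halve :: "point \<Rightarrow> point" where
  "halve = (\<lambda>(l, i). (l div 2, i))"

lemma inj_raise: "inj raise"
  by (auto simp: raise_def inj_on_def)

lemma fst_raise [simp]: "fst (raise P) = Suc (fst P)"
  by (cases P) (simp add: raise_def)

lemma mem_level [simp]: "P \<in> level l \<longleftrightarrow> fst P = l"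
  by (simp add: level_def)

lemma Union_up: "\<Union>(up E) = raise ` \<Union>E"
  by (auto simp: up_def)

lemma up_Un: "up (D \<union> E) = up D \<union> up E"
  by (simp add: up_def image_Un)

lemma components_eq: "components D E = comps (D \<union> up E)"
  by (simp add: components_def comps_def link_def up_def raise_def Let_def)

text \<open>Separates what \<open>stack\<close> does in one go: forming components, erasing the
  middle level, renumbering. The renumbering can then be undone while a further layer is
  added.\<close>

lemma stack_eq: "stack D E = (`) halve ` trim (level 1) (comps (D \<union> up E))"
proof -
  have "{P \<in> C. fst P \<noteq> 1} = C - level 1" for C by auto
  moreover have "(\<lambda>C. f ` (C - I)) ` X - {{}} = (`) f ` ((\<lambda>C. C - I) ` X - {{}})"
    for f :: "point \<Rightarrow> point" and X I
  proof -
    have "(`) f ` Y - {{}} = (`) f ` (Y - {{}})" for Y by auto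
    from this[of "(\<lambda>C. C - I) ` X"] show ?thesis by (simp only: image_image)
  qed
  ultimately show ?thesis
    unfolding stack_def components_eq trim_def halve_def by (simp only:)
qed

lemma circles_eq: "circles D E = card {C \<in> comps (D \<union> up E). C \<subseteq> level 1}"
  unfolding circles_def components_eq by (rule arg_cong[of _ _ card]) auto

lemma stacked_pointE:
  assumes "P \<in> \<Union>(comps (A \<union> up B))"
  obtains "P \<in> \<Union>A" | Q where "Q \<in> \<Union>B" "P = raise Q"
  using assms unfolding Union_comps Union_Un_distrib Union_up by blast

lemma trim_trim: "trim J (trim I X) = trim (I \<union> J) X"
proof -
  have *: "C - (I \<union> J) = (C - I) - J" for C by auto
  show ?thesis unfolding trim_def * by auto
qed

lemma image_trim:
  assumes "\<And>P. h P \<in> J \<longleftrightarrow> P \<in> I"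
  shows "(`) h ` trim I X = trim J ((`) h ` X)"
proof -
  have *: "h ` (C - I) = h ` C - J" for C using assms by auto
  have "(`) h ` (Y - {{}}) = (`) h ` Y - {{}}" for Y by auto
  then show ?thesis unfolding trim_def by (simp only: image_image *)
qed

lemma Union_trim: "\<Union>(trim I X) = \<Union>X - I"
  by (auto simp: trim_def)

lemma card_image_sub:
  assumes "inj_on h (\<Union>X)" "\<And>P. h P \<in> J \<longleftrightarrow> P \<in> I"
  shows "card {C \<in> (`) h ` X. C \<subseteq> J} = card {C \<in> X. C \<subseteq> I}"
proof -
  have "{C \<in> (`) h ` X. C \<subseteq> J} = (`) h ` {C \<in> X. C \<subseteq> I}" using assms(2) by auto
  moreover have "inj_on ((`) h) {C \<in> X. C \<subseteq> I}" 
  proof (rule inj_onI)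
    fix B C assume *: "B \<in> {C \<in> X. C \<subseteq> I}" "C \<in> {C \<in> X. C \<subseteq> I}" "h ` B = h ` C"
    then have "B \<subseteq> \<Union>X" "C \<subseteq> \<Union>X" by auto
    with *(3) show "B = C" using assms(1) by (simp add: inj_on_image_eq_iff)
  qed
  ultimately show ?thesis by (simp add: card_image)
qed

lemma image_image_id: "(\<And>P. P \<in> \<Union>X \<Longrightarrow> f P = g P) \<Longrightarrow> (`) f ` X = (`) g ` X"
  by (intro image_cong refl) auto

lemma image_image_comp: "(`) f ` (`) g ` X = (`) (f \<circ> g) ` X"
  by (simp add: image_image image_comp)

lemma image_image_ident: "(\<And>P. P \<in> \<Union>X \<Longrightarrow> f P = P) \<Longrightarrow> (`) f ` X = X"
  using image_image_id[of X f id] by simp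

section \<open>Associativity of stacking\<close>

lemma comps_up: "comps (up E) = up (comps E)"
  unfolding up_def by (rule comps_image) (use inj_raise in \<open>auto intro: inj_on_subset\<close>)

text \<open>What the associativity of stacking rests on: the levels of the points, and finiteness
  for counting circles.\<close>

definition two_level :: "diagram \<Rightarrow> bool" where
  "two_level D \<longleftrightarrow> finite (\<Union>D) \<and> (\<forall>P\<in>\<Union>D. fst P = 0 \<or> fst P = 1)"

context
  fixes D E F :: diagram
  assumes D: "two_level D" and E: "two_level E" and F: "two_level F"
begin

text \<open>All three diagrams stacked at once occupy the levels 0 to 3. \<open>lo\<close> places
  the picture with \<open>D\<close> and \<open>E\<close> already composed on the levels 0, 2, 3, and
  \<open>hi\<close> the one with \<open>E\<close> and \<open>F\<close> composed on 0, 1, 3;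
  \<open>third\<close> renumbers the outer levels 0 and 3 as 0 and 1.\<close>

private definition third :: "point \<Rightarrow> point" where "third = (\<lambda>(l, i). (l div 3, i))"
private definition lo :: "point \<Rightarrow> point" where "lo = (\<lambda>(l, i). (if l = 0 then 0 else Suc l, i))"
private definition hi :: "point \<Rightarrow> point" where "hi = (\<lambda>(l, i). (if l \<le> 1 then l else Suc l, i))"

private abbreviation "W \<equiv> D \<union> up E \<union> up (up F)"

private lemma inj_lo: "inj lo" by (auto simp: lo_def inj_on_def split: if_splits)
private lemma inj_hi: "inj hi" by (auto simp: hi_def inj_on_def split: if_splits)
private lemma lo_level: "lo P \<in> level 2 \<longleftrightarrow> P \<in> level 1" by (cases P) (auto simp: lo_def)
private lemma hi_level: "hi P \<in> level 1 \<longleftrightarrow> P \<in> level 1" by (cases P) (auto simp: hi_def)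

private lemma lev2: "two_level A \<Longrightarrow> P \<in> \<Union>A \<Longrightarrow> fst P = 0 \<or> fst P = 1" for A P
  unfolding two_level_def by blast

private lemma stack_points: "two_level A \<Longrightarrow> two_level B \<Longrightarrow> P \<in> \<Union>(trim (level 1) (comps (A \<union> up B))) \<Longrightarrow>
    fst P = 0 \<or> fst P = 2" for A B P
proof -
  assume *: "two_level A" "two_level B" "P \<in> \<Union>(trim (level 1) (comps (A \<union> up B)))"
  then have "P \<in> \<Union>(comps (A \<union> up B))" "fst P \<noteq> 1" unfolding Union_trim by auto
  from this(1) show "fst P = 0 \<or> fst P = 2"
  proof (cases rule: stacked_pointE)
    case 1
    then show ?thesis using lev2[OF *(1), of P] \<open>fst P \<noteq> 1\<close> by simp
  next
    case (2 Q)
    then show ?thesis using lev2[OF *(2), of Q] \<open>fst P \<noteq> 1\<close> by auto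
  qed
qed

private lemma lo_stack: "(`) lo ` stack D E = trim (level 1) (comps (D \<union> up E))"
  unfolding stack_eq image_image_comp
proof (rule image_image_ident)
  fix P assume "P \<in> \<Union> (trim (level 1) (comps (D \<union> up E)))"
  then have "fst P = 0 \<or> fst P = 2" using D E stack_points by blast
  then show "(lo \<circ> halve) P = P" by (cases P) (auto simp: lo_def halve_def)
qed

text \<open>By \<open>comps_trim\<close>, because \<open>F\<close> sits on the levels 2 and 3 and
  does not touch the erased level 1.\<close>

private lemma lo_comps: "(`) lo ` comps (stack D E \<union> up F) = trim (level 1) (comps W)"
proof -
  have "(`) lo ` up F = up (up F)"
    unfolding up_def image_image_comp
    by (rule image_image_id) (auto simp: lo_def raise_def)
  then have "(`) lo ` comps (stack D E \<union> up F) = comps (trim (level 1) (comps (D \<union> up E)) \<union> up (up F))"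
    using inj_lo by (subst comps_image[symmetric]) (auto simp: image_Un lo_stack intro: inj_on_subset)
  also have "\<dots> = trim (level 1) (comps W)"
    by (rule comps_trim) (auto simp: Union_up)
  finally show ?thesis .
qed

text \<open>Here \<open>D\<close> is the family added last; it sits on the levels 0 and 1 and avoids
  the erased level 2.\<close>

private lemma hi_comps: "(`) hi ` comps (D \<union> up (stack E F)) = trim (level 2) (comps W)"
proof -
  let ?T = "trim (level 1) (comps (E \<union> up F))"
  have "(`) hi ` D = D"
    using lev2[OF D] by (intro image_image_ident) (force simp: hi_def)
  moreover have "(`) hi ` up (stack E F) = up ?T"
    unfolding up_def stack_eq image_image_comp
  proof (rule image_image_id)
    fix P assume "P \<in> \<Union> (trim (level 1) (comps (E \<union> (`) raise ` F)))"
    then have "fst P = 0 \<or> fst P = 2" using E F stack_points[of E F P] by (simp add: up_def)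
    then show "(hi \<circ> (raise \<circ> halve)) P = raise P"
      by (cases P) (auto simp: hi_def halve_def raise_def)
  qed
  moreover have "up ?T = trim (level 2) (comps (up E \<union> up (up F)))"
    unfolding up_def[of ?T]
    by (subst image_trim[of raise "level 2" "level 1"])
       (auto simp: comps_up[unfolded up_def, symmetric] up_def image_Un)
  ultimately have "(`) hi ` comps (D \<union> up (stack E F)) = comps (trim (level 2) (comps (up E \<union> up (up F))) \<union> D)"
    using inj_hi by (subst comps_image[symmetric]) (auto simp: image_Un Un_commute intro: inj_on_subset)
  also have "\<dots> = trim (level 2) (comps ((up E \<union> up (up F)) \<union> D))"
    by (rule comps_trim) (use lev2[OF D] in fastforce)
  also have "(up E \<union> up (up F)) \<union> D = W" by auto
  finally show ?thesis .
qed

text \<open>Either bracketing is the family of components of the triple picture \<open>W\<close>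
  with the levels 1 and 2 erased, in one order or the other.\<close>

lemma stack_assoc: "stack (stack D E) F = stack D (stack E F)"
proof -
  let ?K = "comps (stack D E \<union> up F)" and ?K' = "comps (D \<union> up (stack E F))"
  have lev: "fst P \<le> 2" if "P \<in> \<Union>(comps (A \<union> up B))" "\<forall>P\<in>\<Union>A. fst P \<le> 1" "\<forall>P\<in>\<Union>B. fst P \<le> 1" for P A B
    using that(1)
  proof (cases rule: stacked_pointE)
    case 1
    then have "fst P \<le> 1" using that(2) by blast
    then show ?thesis by simp
  next
    case (2 Q)
    then have "fst Q \<le> 1" using that(3) by blast
    then show ?thesis using 2 by simp
  qed
  have st: "\<forall>P\<in>\<Union>(stack A B). fst P \<le> 1" if "two_level A" "two_level B" for A B
  proof
    fix P assume "P \<in> \<Union>(stack A B)"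
    then obtain Q where Q: "P = halve Q" "Q \<in> \<Union> (trim (level 1) (comps (A \<union> up B)))"
      unfolding stack_eq by blast
    then show "fst P \<le> 1" using stack_points[OF that Q(2)] by (cases Q) (auto simp: halve_def)
  qed
  have le: "\<forall>P\<in>\<Union>A. fst P \<le> 1" if "two_level A" for A 
  proof
    fix P assume "P \<in> \<Union>A"
    from lev2[OF that this] show "fst P \<le> 1" by auto
  qed
  have "stack (stack D E) F = (`) third ` (`) lo ` trim (level 1) ?K"
    unfolding stack_eq[of "stack D E"] image_image_comp
  proof (rule image_image_id)
    fix P assume P: "P \<in> \<Union> (trim (level 1) ?K)"
    then have "fst P \<le> 2" using lev[of P "stack D E" F] st[OF D E] le[OF F] by (simp add: Union_trim)
    then show "halve P = (third \<circ> lo) P" using P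
      by (cases P) (auto simp: Union_trim halve_def third_def lo_def)
  qed
  also have "\<dots> = (`) third ` trim (level 2) (trim (level 1) (comps W))"
    by (subst image_trim[OF lo_level]) (simp only: lo_comps)
  also have "\<dots> = (`) third ` trim (level 1) (trim (level 2) (comps W))"
    by (simp add: trim_trim Un_commute)
  also have "\<dots> = (`) third ` (`) hi ` trim (level 1) ?K'"
    by (subst image_trim[OF hi_level]) (simp only: hi_comps)
  also have "\<dots> = stack D (stack E F)"
    unfolding stack_eq[of D] image_image_comp
  proof (rule image_image_id)
    fix P assume P: "P \<in> \<Union> (trim (level 1) ?K')"
    then have "fst P \<le> 2" using lev[of P D "stack E F"] st[OF E F] le[OF D] by (simp add: Union_trim)
    then show "(third \<circ> hi) P = halve P" using P
      by (cases P) (auto simp: Union_trim halve_def third_def hi_def)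
  qed
  finally show ?thesis .
qed

text \<open>Either sum counts the components of \<open>W\<close> inside the levels 1 and 2. The
  first composition removes those within a single level, the second composition removes the
  others.\<close>

lemma circles_assoc: "circles (stack D E) F + circles D E = circles D (stack E F) + circles E F"
proof -
  have fin: "finite (\<Union>W)" using D E F by (auto simp: two_level_def Union_up)
  have "circles (stack D E) F = card {C \<in> trim (level 1) (comps W). C \<subseteq> level 2}"
    unfolding circles_eq lo_comps[symmetric] by (rule card_image_sub[OF inj_on_subset[OF inj_lo subset_UNIV] lo_level, symmetric])
  moreover have "circles D E = card {C \<in> comps W. C \<subseteq> level 1}"
    unfolding circles_eq by (subst comps_internal) (auto simp: Union_up)
  ultimately have L: "circles (stack D E) F + circles D E = card {C \<in> comps W. C \<subseteq> level 1 \<union> level 2}"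
    using card_comps_trim[OF fin] by simp
  have "circles D (stack E F) = card {C \<in> trim (level 2) (comps W). C \<subseteq> level 1}"
    unfolding circles_eq hi_comps[symmetric] by (rule card_image_sub[OF inj_on_subset[OF inj_hi subset_UNIV] hi_level, symmetric])
  moreover have "circles E F = card {C \<in> comps W. C \<subseteq> level 2}"
  proof -
    have "circles E F = card {C \<in> comps (up (E \<union> up F)). C \<subseteq> level 2}"
      unfolding circles_eq comps_up unfolding up_def
      by (rule card_image_sub[OF inj_on_subset[OF inj_raise subset_UNIV], symmetric]) auto
    also have "\<dots> = card {C \<in> comps ((up E \<union> up (up F)) \<union> D). C \<subseteq> level 2}"
      using lev2[OF D] by (subst comps_internal) (auto simp: up_Un, fastforce)
    also have "(up E \<union> up (up F)) \<union> D = W" by auto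
    finally show ?thesis .
  qed
  ultimately have "circles D (stack E F) + circles E F = card {C \<in> comps W. C \<subseteq> level 2 \<union> level 1}"
    using card_comps_trim[OF fin] by simp
  with L show ?thesis by (simp add: Un_commute)
qed

end

section \<open>Planar pairings, and stacking with an identity\<close>

definition points :: "nat \<Rightarrow> nat \<Rightarrow> point set" where
  "points n m = {0} \<times> {..<n} \<union> {1} \<times> {..<m}"

lemma mem_points: "(l, i) \<in> points n m \<longleftrightarrow> l = 0 \<and> i < n \<or> l = 1 \<and> i < m"
  by (auto simp: points_def)

lemma tl_Union: "D \<in> tl_diagrams n m \<Longrightarrow> \<Union>D = points n m"
  by (auto simp: tl_diagrams_def partition_on_def points_def)

lemma tl_mem:
  assumes "D \<in> tl_diagrams n m" "A \<in> D" "P \<in> A" shows "P \<in> points n m"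
  unfolding tl_Union[OF assms(1), symmetric] using assms(2,3) by (rule UnionI)

lemma tl_cover: "D \<in> tl_diagrams n m \<Longrightarrow> P \<in> points n m \<Longrightarrow> \<exists>A\<in>D. P \<in> A"
  by (drule tl_Union) blast

lemma tl_two_level: "D \<in> tl_diagrams n m \<Longrightarrow> two_level D"
  unfolding two_level_def by (simp add: tl_Union) (auto simp: points_def)

lemma tl_card: "D \<in> tl_diagrams n m \<Longrightarrow> A \<in> D \<Longrightarrow> card A = 2"
  by (simp add: tl_diagrams_def)

lemma tl_disjoint: "D \<in> tl_diagrams n m \<Longrightarrow> A \<in> D \<Longrightarrow> B \<in> D \<Longrightarrow> A \<inter> B \<noteq> {} \<Longrightarrow> A = B"
  using disjointD[of D A B] by (auto simp: tl_diagrams_def partition_on_def)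

lemma tl_nonempty: "D \<in> tl_diagrams n m \<Longrightarrow> {} \<notin> D"
  by (simp add: tl_diagrams_def partition_on_def)

lemma tl_noncrossing:
  "D \<in> tl_diagrams n m \<Longrightarrow> {P, R} \<in> D \<Longrightarrow> {Q, S} \<in> D \<Longrightarrow>
   circle_pos n m P < circle_pos n m Q \<Longrightarrow> circle_pos n m Q < circle_pos n m R \<Longrightarrow>
   circle_pos n m R < circle_pos n m S \<Longrightarrow> False"
  unfolding tl_diagrams_def by blast

lemma tl_diagramsI:
  assumes "\<Union>D = points n m" "\<And>A. A \<in> D \<Longrightarrow> card A = 2"
    "\<And>A B. A \<in> D \<Longrightarrow> B \<in> D \<Longrightarrow> A \<inter> B \<noteq> {} \<Longrightarrow> A = B"
    "\<And>P Q R S. {P, R} \<in> D \<Longrightarrow> {Q, S} \<in> D \<Longrightarrow>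
       circle_pos n m P < circle_pos n m Q \<Longrightarrow> circle_pos n m Q < circle_pos n m R \<Longrightarrow>
       circle_pos n m R < circle_pos n m S \<Longrightarrow> False"
  shows "D \<in> tl_diagrams n m"
proof -
  have "{} \<notin> D" using assms(2)[of "{}"] by auto
  then have "partition_on (points n m) D"
    using assms(1) disjointI[of D] assms(3) unfolding partition_on_def by metis
  then show ?thesis using assms(2,4) unfolding tl_diagrams_def points_def by blast
qed

lemma stack_id_right:
  assumes D: "D \<in> tl_diagrams n m"
  shows "stack D (id_diagram m) = D" "circles D (id_diagram m) = 0"
proof -
  \<comment> \<open>The component of a strand \<open>A\<close>: the identity prolongs each end of
    \<open>A\<close> on level 1 to level 2. Erasing level 1 and halving turns it back into
    \<open>A\<close>, so it is never a closed circle.\<close>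
  let ?f = "\<lambda>A. A \<union> {(2, i) | i. (1, i) \<in> A}"
  have up_id: "up (id_diagram m) = {{(1, i), (2, i)} | i. i < m}"
    unfolding up_def id_diagram_def setcompr_eq_image image_image by (simp add: raise_def numeral_2_eq_2)
  have pts: "fst P = 0 \<or> fst P = 1" "fst P = 1 \<Longrightarrow> snd P < m" if "A \<in> D" "P \<in> A" for A P
    using tl_mem[OF D that] by (auto simp: points_def)
  have C: "comps (D \<union> up (id_diagram m)) = ?f ` D"
  proof (rule comps_eqI)
    show "\<Union> (?f ` D) = \<Union> (D \<union> up (id_diagram m))"
    proof
      show "\<Union> (?f ` D) \<subseteq> \<Union> (D \<union> up (id_diagram m))"
      proof
        fix P assume "P \<in> \<Union> (?f ` D)"
        then obtain A where A: "A \<in> D" "P \<in> ?f A" by blast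
        show "P \<in> \<Union> (D \<union> up (id_diagram m))"
        proof (cases "P \<in> A")
          case False
          then obtain i where i: "P = (2, i)" "(1, i) \<in> A" using A(2) by blast
          then have "{(1, i), (2, i)} \<in> up (id_diagram m)" using pts(2)[OF A(1) i(2)] up_id by auto
          then show ?thesis using i by blast
        qed (use A in blast)
      qed
      show "\<Union> (D \<union> up (id_diagram m)) \<subseteq> \<Union> (?f ` D)"
      proof
        fix P assume "P \<in> \<Union> (D \<union> up (id_diagram m))"
        then consider "P \<in> \<Union>D" | i where "i < m" "P = (1, i) \<or> P = (2, i)"
          unfolding up_id by auto
        then show "P \<in> \<Union> (?f ` D)"
        proof cases
          case 2
          then obtain A where "A \<in> D" "(1, i) \<in> A" using tl_cover[OF D, of "(1, i)"] by (auto simp: mem_points)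
          then show ?thesis using 2 by auto
        qed auto
      qed
    qed
    show "{} \<notin> ?f ` D" using tl_nonempty[OF D] by auto
  next
    fix A C assume A: "A \<in> D \<union> up (id_diagram m)" "C \<in> ?f ` D" "A \<inter> C \<noteq> {}"
    then obtain B where B: "B \<in> D" "C = ?f B" by auto
    show "A \<subseteq> C"
    proof (cases "A \<in> D")
      case True
      moreover have "(2, i) \<notin> A" for i using pts(1)[OF True, of "(2, i)"] by auto
      ultimately have "A \<inter> B \<noteq> {}" using A(3) B by auto
      then show ?thesis using tl_disjoint[OF D True B(1)] B by auto
    next
      case False
      then obtain i where "i < m" "A = {(1, i), (2, i)}" using A unfolding up_id by auto
      then show ?thesis using A B pts(1)[OF B(1), of "(2, i)"] by auto
    qed
  next
    fix C P Q assume C: "C \<in> ?f ` D" "P \<in> C" "Q \<in> C"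
    let ?L = "link (D \<union> up (id_diagram m))"
    obtain B where B: "B \<in> D" "C = ?f B" using C by auto
    have "\<exists>P'\<in>B. (P, P') \<in> ?L\<^sup>*" if PC: "P \<in> C" for P
    proof (cases "P \<in> B")
      case False
      then obtain i where i: "P = (2, i)" "(1, i) \<in> B" using B(2) PC by auto
      then have "i < m" using pts(2)[OF B(1), of "(1, i)"] by simp
      then have "(P, (1, i)) \<in> ?L" using i up_id by (intro linkI[of "{(1, i), (2, i)}"]) auto
      then show ?thesis using i by blast
    qed auto
    then obtain P' Q' where *: "P' \<in> B" "Q' \<in> B" "(P, P') \<in> ?L\<^sup>*" "(Q, Q') \<in> ?L\<^sup>*" using C by meson
    moreover have "(P', Q') \<in> ?L" using * B by (intro linkI[of B]) auto
    ultimately show "(P, Q) \<in> ?L\<^sup>*"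
      using link_rtrancl_sym by (meson rtrancl.rtrancl_into_rtrancl rtrancl_trans)
  qed
  have f: "halve ` (?f A - level 1) = A" if AD: "A \<in> D" for A
  proof
    show "halve ` (?f A - level 1) \<subseteq> A"
    proof
      fix P assume "P \<in> halve ` (?f A - level 1)"
      then obtain Q where "P = halve Q" "Q \<in> ?f A - level 1" by (rule imageE)
      then have Q: "Q \<in> ?f A" "fst Q \<noteq> 1" "P = halve Q" by simp_all
      from Q(1) consider "Q \<in> A" | i where "Q = (2, i)" "(1, i) \<in> A" by blast
      then show "P \<in> A"
      proof cases
        case 1
        then show ?thesis using pts(1)[OF AD 1] Q by (cases Q) (auto simp: halve_def)
      qed (simp add: Q(3) halve_def)
    qed
    show "A \<subseteq> halve ` (?f A - level 1)"
    proof
      fix P assume P: "P \<in> A"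
      obtain l i where li: "P = (l, i)" by (cases P)
      consider "l = 0" | "l = 1" using pts(1)[OF AD P] li by auto
      then show "P \<in> halve ` (?f A - level 1)"
      proof cases
        case 1
        then show ?thesis using P li by (intro image_eqI[of _ _ "(0, i)"]) (auto simp: halve_def)
      next
        case 2
        then show ?thesis using P li by (intro image_eqI[of _ _ "(2, i)"]) (auto simp: halve_def)
      qed
    qed
  qed
  have ne: "?f A - level 1 \<noteq> {}" if "A \<in> D" for A
  proof
    assume "?f A - level 1 = {}"
    with f[OF that] have "halve ` {} = A" by (simp only:)
    then show False using that tl_nonempty[OF D] by simp
  qed
  have "trim (level 1) (?f ` D) = (\<lambda>A. ?f A - level 1) ` D"
    unfolding trim_def using ne by (simp only: image_image) (rule Diff_triv, blast)
  then have "stack D (id_diagram m) = (\<lambda>A. halve ` (?f A - level 1)) ` D"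
    unfolding stack_eq C by (simp only: image_image)
  also have "\<dots> = D" using f by simp
  finally show "stack D (id_diagram m) = D" .
  have "\<not> ?f A \<subseteq> level 1" if "A \<in> D" for A using ne[OF that] by (simp only: Diff_eq_empty_iff not_False_eq_True)
  then have "{C \<in> ?f ` D. C \<subseteq> level 1} = {}" by blast
  then show "circles D (id_diagram m) = 0" unfolding circles_eq C by (simp only: card.empty)
qed

lemma stack_id_left:
  assumes D: "D \<in> tl_diagrams n m"
  shows "stack (id_diagram n) D = D" "circles (id_diagram n) D = 0"
proof -
  \<comment> \<open>The component of a strand \<open>A\<close> now living on the levels 1 and 2: the
    identity below prolongs its ends on level 1 down to level 0.\<close>
  let ?f = "\<lambda>A. raise ` A \<union> {(0, i) | i. (0, i) \<in> A}"
  have up_id: "id_diagram n = {{(0, i), (1, i)} | i. i < n}"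
    by (simp add: id_diagram_def)
  have pts: "fst P = 0 \<or> fst P = 1" "fst P = 0 \<Longrightarrow> snd P < n" if "A \<in> D" "P \<in> A" for A P
    using tl_mem[OF D that] by (auto simp: points_def)
  have C: "comps (id_diagram n \<union> up D) = ?f ` D"
  proof (rule comps_eqI)
    show "\<Union> (?f ` D) = \<Union> (id_diagram n \<union> up D)"
    proof
      show "\<Union> (?f ` D) \<subseteq> \<Union> (id_diagram n \<union> up D)"
      proof
        fix P assume "P \<in> \<Union> (?f ` D)"
        then obtain A where A: "A \<in> D" "P \<in> ?f A" by blast
        show "P \<in> \<Union> (id_diagram n \<union> up D)"
        proof (cases "P \<in> raise ` A")
          case False
          then obtain i where i: "P = (0, i)" "(0, i) \<in> A" using A(2) by blast
          then have "{(0, i), (1, i)} \<in> id_diagram n" using pts(2)[OF A(1) i(2)] up_id by auto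
          then show ?thesis using i by blast
        qed (use A in \<open>auto simp: up_def\<close>)
      qed
      show "\<Union> (id_diagram n \<union> up D) \<subseteq> \<Union> (?f ` D)"
      proof
        fix P assume "P \<in> \<Union> (id_diagram n \<union> up D)"
        then consider "P \<in> \<Union>(up D)" | i where "i < n" "P = (0, i) \<or> P = (1, i)"
          unfolding up_id by auto
        then show "P \<in> \<Union> (?f ` D)"
        proof cases
          case 2
          then obtain A where "A \<in> D" "(0, i) \<in> A" using tl_cover[OF D, of "(0, i)"] by (auto simp: mem_points)
          moreover from this have "(1, i) \<in> raise ` A" by (force simp: raise_def)
          ultimately show ?thesis using 2 by auto
        qed (auto simp: up_def)
      qed
    qed
    show "{} \<notin> ?f ` D" using tl_nonempty[OF D] by auto
  next
    fix A C assume A: "A \<in> id_diagram n \<union> up D" "C \<in> ?f ` D" "A \<inter> C \<noteq> {}"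
    then obtain B where B: "B \<in> D" "C = ?f B" by auto
    show "A \<subseteq> C"
    proof (cases "A \<in> up D")
      case True
      then obtain K where K: "K \<in> D" "A = raise ` K" by (auto simp: up_def)
      obtain P where "P \<in> A" "P \<in> C" using A by auto
      then have PK: "P \<in> raise ` K" using K by simp
      then have "P \<noteq> (0, i)" for i by (auto simp: raise_def)
      then have "P \<in> raise ` B" using B(2) \<open>P \<in> C\<close> by blast
      with PK obtain Q R where "Q \<in> K" "R \<in> B" "raise Q = raise R" by auto
      then have "Q \<in> K \<inter> B" using inj_raise by (simp add: inj_eq)
      then have "K \<inter> B \<noteq> {}" by blast
      then show ?thesis using tl_disjoint[OF D K(1) B(1)] B K by auto
    next
      case False
      then obtain i where i: "i < n" "A = {(0, i), (1, i)}" using A unfolding up_id by auto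
      have "(1, i) \<in> raise ` B \<longleftrightarrow> (0, i) \<in> B" by (force simp: raise_def)
      moreover have "(0, i) \<notin> raise ` B" by (auto simp: raise_def)
      ultimately show ?thesis using A B i by auto
    qed
  next
    fix C P Q assume C: "C \<in> ?f ` D" "P \<in> C" "Q \<in> C"
    let ?L = "link (id_diagram n \<union> up D)"
    obtain B where B: "B \<in> D" "C = ?f B" using C by auto
    have "\<exists>P'\<in>raise ` B. (P, P') \<in> ?L\<^sup>*" if PC: "P \<in> C" for P
    proof (cases "P \<in> raise ` B")
      case False
      then obtain i where i: "P = (0, i)" "(0, i) \<in> B" using B(2) PC by auto
      then have "i < n" using pts(2)[OF B(1), of "(0, i)"] by simp
      then have "(P, (1, i)) \<in> ?L" using i up_id by (intro linkI[of "{(0, i), (1, i)}"]) auto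
      moreover have "(1, i) \<in> raise ` B" using i by (force simp: raise_def)
      ultimately show ?thesis by blast
    qed auto
    then obtain P' Q' where *: "P' \<in> raise ` B" "Q' \<in> raise ` B" "(P, P') \<in> ?L\<^sup>*" "(Q, Q') \<in> ?L\<^sup>*" using C by meson
    moreover have "(P', Q') \<in> ?L" using * B by (intro linkI[of "raise ` B"]) (auto simp: up_def)
    ultimately show "(P, Q) \<in> ?L\<^sup>*"
      using link_rtrancl_sym by (meson rtrancl.rtrancl_into_rtrancl rtrancl_trans)
  qed
  have f: "halve ` (?f A - level 1) = A" if AD: "A \<in> D" for A
  proof
    show "halve ` (?f A - level 1) \<subseteq> A"
    proof
      fix P assume "P \<in> halve ` (?f A - level 1)"
      then obtain Q where "P = halve Q" "Q \<in> ?f A - level 1" by (rule imageE)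
      then have Q: "Q \<in> ?f A" "fst Q \<noteq> 1" "P = halve Q" by simp_all
      from Q(1) consider R where "Q = raise R" "R \<in> A" | i where "Q = (0, i)" "(0, i) \<in> A" by blast
      then show "P \<in> A"
      proof cases
        case (1 R)
        then show ?thesis using pts(1)[OF AD 1(2)] Q by (cases R) (auto simp: halve_def raise_def)
      qed (simp add: Q(3) halve_def)
    qed
    show "A \<subseteq> halve ` (?f A - level 1)"
    proof
      fix P assume P: "P \<in> A"
      obtain l i where li: "P = (l, i)" by (cases P)
      consider "l = 0" | "l = 1" using pts(1)[OF AD P] li by auto
      then show "P \<in> halve ` (?f A - level 1)"
      proof cases
        case 1
        then show ?thesis using P li by (intro image_eqI[of _ _ "(0, i)"]) (auto simp: halve_def)
      next
        case 2
        then have "raise P = (2, i)" using li by (simp add: raise_def)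
        then have "P = halve (raise P)" "raise P \<notin> level 1" using li 2 by (auto simp: halve_def)
        then show ?thesis using P by blast
      qed
    qed
  qed
  have ne: "?f A - level 1 \<noteq> {}" if "A \<in> D" for A
  proof
    assume "?f A - level 1 = {}"
    with f[OF that] have "halve ` {} = A" by (simp only:)
    then show False using that tl_nonempty[OF D] by simp
  qed
  have "trim (level 1) (?f ` D) = (\<lambda>A. ?f A - level 1) ` D"
    unfolding trim_def using ne by (simp only: image_image) (rule Diff_triv, blast)
  then have "stack (id_diagram n) D = (\<lambda>A. halve ` (?f A - level 1)) ` D"
    unfolding stack_eq C by (simp only: image_image)
  also have "\<dots> = D" using f by simp
  finally show "stack (id_diagram n) D = D" .
  have "\<not> ?f A \<subseteq> level 1" if "A \<in> D" for A using ne[OF that] by (simp only: Diff_eq_empty_iff not_False_eq_True)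
  then have "{C \<in> ?f ` D. C \<subseteq> level 1} = {}" by blast
  then show "circles (id_diagram n) D = 0" unfolding circles_eq C by (simp only: card.empty)
qed

section \<open>Juxtaposition and left-right reflection of stacked diagrams\<close>

definition shift :: "nat \<Rightarrow> nat \<Rightarrow> nat \<Rightarrow> point \<Rightarrow> point" where
  "shift n m k = (\<lambda>(l, i). (l, i + (if l = 0 then n else if l = 1 then m else k)))"

text \<open>Like \<open>shift\<close> it acts on three levels, so that it applies to a whole stacked
  picture. The subtraction is truncated, which is why injectivity is only available on
  \<open>points3\<close>.\<close>

definition reflect :: "nat \<Rightarrow> nat \<Rightarrow> nat \<Rightarrow> point \<Rightarrow> point" where
  "reflect n m k = (\<lambda>(l, i). (l, (if l = 0 then n else if l = 1 then m else k) - 1 - i))"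

definition points3 :: "nat \<Rightarrow> nat \<Rightarrow> nat \<Rightarrow> point set" where
  "points3 n m k = {(l, i). l = 0 \<and> i < n \<or> l = 1 \<and> i < m \<or> l = 2 \<and> i < k}"

lemma finite_points3: "finite (points3 n m k)"
  by (rule finite_subset[of _ "{..2} \<times> {..<n + m + k}"]) (auto simp: points3_def)

lemma fst_shift [simp]: "fst (shift n m k P) = fst P"
  by (cases P) (simp add: shift_def)

lemma fst_reflect [simp]: "fst (reflect n m k P) = fst P"
  by (cases P) (simp add: reflect_def)

lemma inj_shift: "inj (shift n m k)"
  by (auto simp: shift_def inj_on_def)

lemma inj_on_reflect: "inj_on (reflect n m k) (points3 n m k)"
  by (auto simp: reflect_def inj_on_def points3_def split: if_splits)

lemma mem_raise_points: "P \<in> raise ` points m k \<longleftrightarrow> fst P = 1 \<and> snd P < m \<or> fst P = 2 \<and> snd P < k"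
proof
  assume "P \<in> raise ` points m k"
  then show "fst P = 1 \<and> snd P < m \<or> fst P = 2 \<and> snd P < k"
    by (auto simp: raise_def points_def)
next
  assume *: "fst P = 1 \<and> snd P < m \<or> fst P = 2 \<and> snd P < k"
  then have "(fst P - 1, snd P) \<in> points m k" "P = raise (fst P - 1, snd P)"
    by (auto simp: points_def raise_def prod_eq_iff)
  then show "P \<in> raise ` points m k" by blast
qed

lemma Union_stacked:
  assumes "D \<in> tl_diagrams n m" "E \<in> tl_diagrams m k"
  shows "\<Union>(D \<union> up E) = points3 n m k"
proof -
  have "\<Union>(D \<union> up E) = points n m \<union> raise ` points m k"
    unfolding Union_Un_distrib Union_up tl_Union[OF assms(1)] tl_Union[OF assms(2)] ..
  also have "\<dots> = points3 n m k"
    by (rule set_eqI) (auto simp: mem_raise_points mem_points points3_def)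
  finally show ?thesis .
qed

text \<open>\<open>k\<close> is free because a single diagram has no points on level 2; it is chosen
  later to suit the picture in which the diagram is the lower layer.\<close>

lemma juxtapose_eq:
  assumes "D' \<in> tl_diagrams n' m'"
  shows "juxtapose n m D D' = D \<union> (`) (shift n m k) ` D'"
proof -
  have "(\<lambda>(l, i). (l, i + (if l = 0 then n else m))) ` A = shift n m k ` A" if A: "A \<in> D'" for A
  proof (rule image_cong[OF refl])
    fix P assume "P \<in> A"
    then have "P \<in> points n' m'" using tl_mem[OF assms A] by simp
    then show "(\<lambda>(l, i). (l, i + (if l = 0 then n else m))) P = shift n m k P"
      by (auto simp: points_def shift_def)
  qed
  then have "(\<lambda>A. (\<lambda>(l, i). (l, i + (if l = 0 then n else m))) ` A) ` D' = (`) (shift n m k) ` D'"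
    by (rule image_cong[OF refl])
  then show ?thesis unfolding juxtapose_def by (simp only:)
qed

lemma mirror_eq:
  assumes "D \<in> tl_diagrams n m"
  shows "mirror n m D = (`) (reflect n m k) ` D"
proof -
  have "(\<lambda>(l, i). (l, (if l = 0 then n else m) - 1 - i)) ` A = reflect n m k ` A" if A: "A \<in> D" for A
  proof (rule image_cong[OF refl])
    fix P assume "P \<in> A"
    then have "P \<in> points n m" using tl_mem[OF assms A] by simp
    then show "(\<lambda>(l, i). (l, (if l = 0 then n else m) - 1 - i)) P = reflect n m k P"
      by (auto simp: points_def reflect_def)
  qed
  then show ?thesis unfolding mirror_def by (rule image_cong[OF refl])
qed

lemma up_image:
  assumes "D \<in> tl_diagrams n m" "\<And>P. P \<in> points n m \<Longrightarrow> raise (f P) = g (raise P)"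
  shows "up ((`) f ` D) = (`) g ` up D"
  unfolding up_def image_image_comp
  by (rule image_image_id) (simp add: tl_Union[OF assms(1)] assms(2) del: Union_iff)

text \<open>The two stacked pictures stand side by side without a common point, so no component
  extends from one to the other.\<close>

lemma stacked_juxtapose:
  assumes D: "D \<in> tl_diagrams n m" and E: "E \<in> tl_diagrams m k"
    and D': "D' \<in> tl_diagrams n' m'" and E': "E' \<in> tl_diagrams m' k'"
  shows "comps (juxtapose n m D D' \<union> up (juxtapose m k E E')) =
    comps (D \<union> up E) \<union> (`) (shift n m k) ` comps (D' \<union> up E')"
proof -
  have "up ((`) (shift m k 0) ` E') = (`) (shift n m k) ` up E'"
    by (rule up_image[OF E']) (auto simp: shift_def raise_def points_def)
  then have "juxtapose n m D D' \<union> up (juxtapose m k E E') =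
      (D \<union> up E) \<union> (`) (shift n m k) ` (D' \<union> up E')"
    unfolding juxtapose_eq[OF D', of n m D k] juxtapose_eq[OF E', of m k E 0] up_Un image_Un by auto
  moreover have "\<Union>(D \<union> up E) \<inter> \<Union>((`) (shift n m k) ` (D' \<union> up E')) = {}"
  proof -
    have "\<Union>((`) (shift n m k) ` (D' \<union> up E')) = shift n m k ` points3 n' m' k'"
      unfolding Union_stacked[OF D' E', symmetric] by (rule image_Union[symmetric])
    then show ?thesis unfolding Union_stacked[OF D E]
      by (auto simp: points3_def shift_def)
  qed
  ultimately show ?thesis
    using comps_image[OF inj_on_subset[OF inj_shift subset_UNIV], of n m k "D' \<union> up E'"]
    by (simp only: comps_Un_disjoint)
qed

lemma trim_Un: "trim I (X \<union> Y) = trim I X \<union> trim I Y"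
  by (auto simp: trim_def)

lemma stack_points3:
  assumes "D \<in> tl_diagrams n m" "E \<in> tl_diagrams m k" "P \<in> \<Union>(trim (level 1) (comps (D \<union> up E)))"
  shows "fst P = 0 \<and> snd P < n \<or> fst P = 2 \<and> snd P < k"
  using assms(3) unfolding Union_trim Union_comps Union_stacked[OF assms(1,2)] by (auto simp: points3_def)

lemma stack_juxtapose:
  assumes D: "D \<in> tl_diagrams n m" and E: "E \<in> tl_diagrams m k"
    and D': "D' \<in> tl_diagrams n' m'" and E': "E' \<in> tl_diagrams m' k'"
  shows "stack (juxtapose n m D D') (juxtapose m k E E') = juxtapose n k (stack D E) (stack D' E')"
proof -
  let ?T = "trim (level 1) (comps (D' \<union> up E'))"
  have "stack (juxtapose n m D D') (juxtapose m k E E') =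
      stack D E \<union> (`) halve ` (`) (shift n m k) ` ?T"
    unfolding stack_eq stacked_juxtapose[OF assms] trim_Un image_Un
    by (subst image_trim[of "shift n m k" "level 1" "level 1"]) simp_all
  also have "(`) halve ` (`) (shift n m k) ` ?T = (`) (\<lambda>(l, i). (l, i + (if l = 0 then n else k))) ` (`) halve ` ?T"
    unfolding image_image_comp
  proof (rule image_image_id)
    fix P assume "P \<in> \<Union>?T"
    from stack_points3[OF D' E' this]
    show "(halve \<circ> shift n m k) P = ((\<lambda>(l, i). (l, i + (if l = 0 then n else k))) \<circ> halve) P"
      by (cases P) (auto simp: halve_def shift_def)
  qed
  finally show ?thesis unfolding juxtapose_def stack_eq[of D' E'] .
qed

lemma circles_juxtapose:
  assumes D: "D \<in> tl_diagrams n m" and E: "E \<in> tl_diagrams m k"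
    and D': "D' \<in> tl_diagrams n' m'" and E': "E' \<in> tl_diagrams m' k'"
  shows "circles (juxtapose n m D D') (juxtapose m k E E') = circles D E + circles D' E'"
proof -
  let ?S = "shift n m k"
  let ?A = "{C \<in> comps (D \<union> up E). C \<subseteq> level 1}"
  let ?B = "{C \<in> (`) ?S ` comps (D' \<union> up E'). C \<subseteq> level 1}"
  have "finite ?A" "finite ?B"
    using finite_comps[of "D \<union> up E"] finite_comps[of "D' \<union> up E'"] finite_points3
    unfolding Union_stacked[OF D E] Union_stacked[OF D' E'] by auto
  \<comment> \<open>A nonempty component cannot belong to both pictures, since on each level the
    second begins where the first ends.\<close>
  moreover have "?A \<inter> ?B = {}"
  proof (rule ccontr)
    assume "?A \<inter> ?B \<noteq> {}"
    then obtain C C' where C: "C \<in> comps (D \<union> up E)" "C' \<in> comps (D' \<union> up E')" "C = ?S ` C'" by auto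
    obtain P where P: "P \<in> C" using comps_nonempty[OF C(1)] by blast
    then obtain Q where Q: "Q \<in> C'" "P = ?S Q" using C by blast
    have "P \<in> points3 n m k" "Q \<in> points3 n' m' k'"
      using comps_subset[OF C(1)] comps_subset[OF C(2)] P Q(1)
      unfolding Union_stacked[OF D E] Union_stacked[OF D' E'] by auto
    then show False using Q by (auto simp: points3_def shift_def)
  qed
  ultimately have "card (?A \<union> ?B) = card ?A + card ?B" by (rule card_Un_disjoint)
  moreover have "?A \<union> ?B = {C \<in> comps (D \<union> up E) \<union> (`) ?S ` comps (D' \<union> up E'). C \<subseteq> level 1}" by blast
  moreover have "card ?B = circles D' E'"
    unfolding circles_eq by (rule card_image_sub[OF inj_on_subset[OF inj_shift subset_UNIV]]) simp
  ultimately show ?thesis unfolding circles_eq stacked_juxtapose[OF assms] by simp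
qed

lemma stacked_mirror:
  assumes D: "D \<in> tl_diagrams n m" and E: "E \<in> tl_diagrams m k"
  shows "comps (mirror n m D \<union> up (mirror m k E)) = (`) (reflect n m k) ` comps (D \<union> up E)"
proof -
  have "up ((`) (reflect m k 0) ` E) = (`) (reflect n m k) ` up E"
    by (rule up_image[OF E]) (auto simp: reflect_def raise_def points_def)
  then have "mirror n m D \<union> up (mirror m k E) = (`) (reflect n m k) ` (D \<union> up E)"
    unfolding mirror_eq[OF D, of k] mirror_eq[OF E, of 0] by (simp only: image_Un)
  then show ?thesis
    using comps_image[of "reflect n m k" "D \<union> up E"] inj_on_reflect Union_stacked[OF D E] by simp
qed

lemma stack_mirror:
  assumes D: "D \<in> tl_diagrams n m" and E: "E \<in> tl_diagrams m k"
  shows "stack (mirror n m D) (mirror m k E) = mirror n k (stack D E)"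
proof -
  let ?T = "trim (level 1) (comps (D \<union> up E))"
  have "stack (mirror n m D) (mirror m k E) = (`) halve ` (`) (reflect n m k) ` ?T"
    unfolding stack_eq stacked_mirror[OF assms]
    by (subst image_trim[of "reflect n m k" "level 1" "level 1"]) simp_all
  also have "\<dots> = (`) (\<lambda>(l, i). (l, (if l = 0 then n else k) - 1 - i)) ` (`) halve ` ?T"
    unfolding image_image_comp
  proof (rule image_image_id)
    fix P assume "P \<in> \<Union>?T"
    from stack_points3[OF D E this]
    show "(halve \<circ> reflect n m k) P = ((\<lambda>(l, i). (l, (if l = 0 then n else k) - 1 - i)) \<circ> halve) P"
      by (cases P) (auto simp: halve_def reflect_def)
  qed
  finally show ?thesis unfolding mirror_def stack_eq[of D E] .
qed

lemma circles_mirror: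
  assumes D: "D \<in> tl_diagrams n m" and E: "E \<in> tl_diagrams m k"
  shows "circles (mirror n m D) (mirror m k E) = circles D E"
  unfolding circles_eq stacked_mirror[OF assms]
  by (rule card_image_sub) (simp_all add: Union_comps Union_stacked[OF assms] inj_on_reflect del: Union_iff Union_Un_distrib)

subsection \<open>Planarity\<close>

text \<open>Inverse of \<open>circle_pos\<close>: the point at place \<open>t\<close> of the
  boundary circle.\<close>

definition pos_point :: "nat \<Rightarrow> nat \<Rightarrow> nat \<Rightarrow> point" where
  "pos_point n m t = (if t < n then (0, t) else (1, n + m - 1 - t))"

lemma pos_point_circle_pos: "P \<in> points n m \<Longrightarrow> pos_point n m (circle_pos n m P) = P"
  by (auto simp: pos_point_def circle_pos_def points_def)

lemma circle_pos_pos_point: "t < n + m \<Longrightarrow> circle_pos n m (pos_point n m t) = t"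
  by (auto simp: pos_point_def circle_pos_def)

lemma circle_pos_less: "P \<in> points n m \<Longrightarrow> circle_pos n m P < n + m"
  by (auto simp: circle_pos_def points_def)

lemma pos_point_mem: "t < n + m \<Longrightarrow> pos_point n m t \<in> points n m"
  by (auto simp: pos_point_def points_def)

text \<open>Turns a diagram into a fixed-point-free involution of its boundary points, the form in
  which cancellation of words is proved.\<close>

definition mate :: "diagram \<Rightarrow> point \<Rightarrow> point" where
  "mate D P = (THE Q. Q \<noteq> P \<and> {P, Q} \<in> D)"

context
  fixes D :: diagram and n m :: nat
  assumes D: "D \<in> tl_diagrams n m"
begin

lemma tl_pair: "A \<in> D \<Longrightarrow> \<exists>P Q. A = {P, Q} \<and> P \<noteq> Q"
  using tl_card[OF D] by (simp add: card_2_iff)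

lemma mate_eq:
  assumes "{P, Q} \<in> D"
  shows "mate D P = Q" "P \<noteq> Q"
proof -
  show "P \<noteq> Q" using tl_card[OF D assms] by auto
  show "mate D P = Q" unfolding mate_def
  proof (rule the_equality)
    show "Q \<noteq> P \<and> {P, Q} \<in> D" using assms \<open>P \<noteq> Q\<close> by simp
    fix R assume "R \<noteq> P \<and> {P, R} \<in> D"
    then show "R = Q" using tl_disjoint[OF D, of "{P, R}" "{P, Q}"] assms by (auto simp: doubleton_eq_iff)
  qed
qed

lemma mate_mem:
  assumes "P \<in> points n m"
  shows "{P, mate D P} \<in> D"
proof -
  obtain A where A: "A \<in> D" "P \<in> A" using tl_cover[OF D assms] by blast
  then obtain Q where "A = {P, Q}" using tl_pair[OF A(1)] by (auto simp: insert_commute)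
  then show ?thesis using mate_eq A by simp
qed

lemma mate_point: "P \<in> points n m \<Longrightarrow> mate D P \<in> points n m"
  using mate_mem tl_mem[OF D] by blast

lemma mate_mate: "P \<in> points n m \<Longrightarrow> mate D (mate D P) = P"
  using mate_mem[of P] mate_eq[of "mate D P" P] by (simp add: insert_commute)

lemma mate_neq: "P \<in> points n m \<Longrightarrow> mate D P \<noteq> P"
  using mate_eq(2)[OF mate_mem] by metis

end

text \<open>The monoid of self-maps of a type stands in for a group. Its letters will be reflections
  of the integers, to detect crossings, and multiplications by weights, to compute path
  weights.\<close>

definition word :: "(nat \<Rightarrow> 'b \<Rightarrow> 'b) \<Rightarrow> nat list \<Rightarrow> 'b \<Rightarrow> 'b" where
  "word \<sigma> xs = foldr (\<lambda>x f. \<sigma> x \<circ> f) xs id"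

lemma word_Nil [simp]: "word \<sigma> [] = id"
  by (simp add: word_def)

lemma word_Cons [simp]: "word \<sigma> (x # xs) = \<sigma> x \<circ> word \<sigma> xs"
  by (simp add: word_def)

lemma word_append: "word \<sigma> (xs @ ys) = word \<sigma> xs \<circ> word \<sigma> ys"
  by (induction xs) (simp_all add: o_assoc)

lemma word_map: "word \<sigma> (map f xs) = word (\<lambda>x. \<sigma> (f x)) xs"
  by (induction xs) simp_all

lemma word_cong: "(\<And>x. x \<in> set xs \<Longrightarrow> \<sigma> x = \<tau> x) \<Longrightarrow> word \<sigma> xs = word \<tau> xs"
  by (induction xs) simp_all

lemma word_id: "(\<And>x. x \<in> set xs \<Longrightarrow> \<sigma> x = id) \<Longrightarrow> word \<sigma> xs = id"
  by (induction xs) simp_all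

lemma word_upt_split:
  assumes "i \<le> t" "t < j"
  shows "word \<sigma> [i..<j] = word \<sigma> [i..<t] \<circ> \<sigma> t \<circ> word \<sigma> [Suc t..<j]"
proof -
  have "[i..<j] = [i..<t] @ t # [Suc t..<j]"
    using assms by (metis le_add_diff_inverse less_imp_le_nat upt_add_eq_append upt_conv_Cons)
  then show ?thesis by (simp add: word_append o_assoc)
qed

lemma word_rev_inverse:
  assumes "\<And>x. x \<in> set xs \<Longrightarrow> \<sigma> x \<circ> \<sigma> x = id"
  shows "word \<sigma> (rev xs) \<circ> word \<sigma> xs = id"
  using assms
proof (induction xs)
  case (Cons x xs)
  have "word \<sigma> (rev (x # xs)) \<circ> word \<sigma> (x # xs) = word \<sigma> (rev xs) \<circ> (\<sigma> x \<circ> \<sigma> x) \<circ> word \<sigma> xs"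
    by (simp add: word_append o_assoc)
  also have "\<sigma> x \<circ> \<sigma> x = id" by (rule Cons.prems) simp
  also have "word \<sigma> (rev xs) \<circ> id \<circ> word \<sigma> xs = word \<sigma> (rev xs) \<circ> word \<sigma> xs" by (simp only: comp_id)
  also have "\<dots> = id" by (rule Cons.IH) (rule Cons.prems, simp)
  finally show ?case .
qed simp

text \<open>Induction on the length. The mate \<open>c\<close> of the first place \<open>a\<close>
  divides the interval into the places before and after \<open>c\<close>; as no arc crosses the one
  from \<open>a\<close> to \<open>c\<close>, each part is closed under the pairing. Both words
  vanish by induction, and then the letters at \<open>a\<close> and \<open>c\<close> cancel.\<close>

lemma word_noncrossing_interval:
  assumes "\<And>t. a \<le> t \<Longrightarrow> t < b \<Longrightarrow> a \<le> \<pi> t \<and> \<pi> t < b"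
    and "\<And>t. a \<le> t \<Longrightarrow> t < b \<Longrightarrow> \<pi> (\<pi> t) = t \<and> \<pi> t \<noteq> t \<and> \<sigma> t \<circ> \<sigma> (\<pi> t) = id"
    and "\<And>s t. a \<le> s \<Longrightarrow> s < t \<Longrightarrow> t < \<pi> s \<Longrightarrow> \<pi> s < \<pi> t \<Longrightarrow> \<pi> t < b \<Longrightarrow> False"
  shows "word \<sigma> [a..<b] = id"
  using assms
proof (induction "b - a" arbitrary: a b rule: less_induct)
  case less
  show ?case
  proof (cases "a < b")
    case True
    define c where "c = \<pi> a"
    have c: "a < c" "c < b" "\<pi> c = a"
      using less.prems(1,2)[of a] True by (auto simp: c_def)
    have inner: "a < \<pi> t \<and> \<pi> t < c" if t: "a < t" "t < c" for t
    proof -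
      have p: "a \<le> \<pi> t" "\<pi> t < b" "\<pi> (\<pi> t) = t" using less.prems(1,2)[of t] t c by auto
      then have "\<pi> t \<noteq> a" "\<pi> t \<noteq> c" using t c c_def by auto
      moreover have "\<not> c < \<pi> t" using less.prems(3)[of a t] t p c_def by auto
      ultimately show ?thesis using p by linarith
    qed
    have outer: "c < \<pi> t \<and> \<pi> t < b" if t: "c < t" "t < b" for t
    proof -
      have p: "a \<le> \<pi> t" "\<pi> t < b" "\<pi> (\<pi> t) = t" using less.prems(1,2)[of t] t c by auto
      then have "\<pi> t \<noteq> a" "\<pi> t \<noteq> c" using t c c_def by auto
      moreover have "\<not> (a < \<pi> t \<and> \<pi> t < c)" using inner[of "\<pi> t"] p t by auto
      ultimately show ?thesis using p by linarith
    qed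
    have 1: "word \<sigma> [Suc a..<c] = id"
    proof (rule less.hyps)
      show "c - Suc a < b - a" using c by linarith
      show "Suc a \<le> \<pi> t \<and> \<pi> t < c" if "Suc a \<le> t" "t < c" for t using inner[of t] that by auto
      show "\<pi> (\<pi> t) = t \<and> \<pi> t \<noteq> t \<and> \<sigma> t \<circ> \<sigma> (\<pi> t) = id" if "Suc a \<le> t" "t < c" for t
        using less.prems(2)[of t] that c by auto
      show False if "Suc a \<le> s" "s < t" "t < \<pi> s" "\<pi> s < \<pi> t" "\<pi> t < c" for s t
        using less.prems(3)[of s t] that c by auto
    qed
    have 2: "word \<sigma> [Suc c..<b] = id"
    proof (rule less.hyps)
      show "b - Suc c < b - a" using c by linarith
      show "Suc c \<le> \<pi> t \<and> \<pi> t < b" if "Suc c \<le> t" "t < b" for t using outer[of t] that by auto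
      show "\<pi> (\<pi> t) = t \<and> \<pi> t \<noteq> t \<and> \<sigma> t \<circ> \<sigma> (\<pi> t) = id" if "Suc c \<le> t" "t < b" for t
        using less.prems(2)[of t] that c by auto
      show False if "Suc c \<le> s" "s < t" "t < \<pi> s" "\<pi> s < \<pi> t" "\<pi> t < b" for s t
        using less.prems(3)[of s t] that c by auto
    qed
    have "word \<sigma> [a..<b] = word \<sigma> [a..<c] \<circ> \<sigma> c \<circ> word \<sigma> [Suc c..<b]"
      using c by (intro word_upt_split) auto
    also have "word \<sigma> [a..<c] = word \<sigma> [a..<a] \<circ> \<sigma> a \<circ> word \<sigma> [Suc a..<c]"
      using c by (intro word_upt_split) auto
    finally have "word \<sigma> [a..<b] = \<sigma> a \<circ> \<sigma> c"
      by (simp only: 1 2 upt_conv_Nil le_refl word_Nil comp_id id_comp)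
    also have "\<dots> = id" using less.prems(2)[of a] True unfolding c_def by blast
    finally show ?thesis .
  qed simp
qed

context
  fixes D :: diagram and n m :: nat and \<sigma> :: "nat \<Rightarrow> 'b \<Rightarrow> 'b"
  assumes D: "D \<in> tl_diagrams n m"
    and \<sigma>: "\<And>P Q. {P, Q} \<in> D \<Longrightarrow> \<sigma> (circle_pos n m P) \<circ> \<sigma> (circle_pos n m Q) = id"
begin

private definition "pmate t = circle_pos n m (mate D (pos_point n m t))"

private lemma pmate:
  assumes "t < n + m"
  shows "pmate t < n + m" "pmate (pmate t) = t" "pmate t \<noteq> t" "\<sigma> t \<circ> \<sigma> (pmate t) = id"
    "{pos_point n m t, pos_point n m (pmate t)} \<in> D"
proof -
  let ?P = "pos_point n m t"
  have P: "?P \<in> points n m" using pos_point_mem[OF assms] .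
  note M = mate_point[OF D P] mate_mate[OF D P] mate_neq[OF D P] mate_mem[OF D P]
  show "pmate t < n + m" using M(1) by (simp add: pmate_def circle_pos_less)
  have pp: "pos_point n m (pmate t) = mate D ?P" using M(1) by (simp add: pmate_def pos_point_circle_pos)
  show "pmate (pmate t) = t" using M(2) assms unfolding pmate_def[of "pmate t"] pp
    by (simp add: circle_pos_pos_point)
  show "pmate t \<noteq> t" using M(3) pp by auto
  show "\<sigma> t \<circ> \<sigma> (pmate t) = id" using \<sigma>[OF M(4)] assms by (simp add: pmate_def circle_pos_pos_point)
  show "{?P, pos_point n m (pmate t)} \<in> D" using M(4) pp by simp
qed

private lemma pmate_noncrossing:
  assumes "s < t" "t < pmate s" "pmate s < pmate t" "pmate t < n + m"
  shows False
proof -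
  have st: "s < n + m" "t < n + m" using assms by auto
  show False
    by (rule tl_noncrossing[OF D pmate(5)[OF st(1)] pmate(5)[OF st(2)]])
       (use assms st pmate(1) in \<open>simp_all add: circle_pos_pos_point\<close>)
qed

lemma word_tl_circle: "word \<sigma> [0..<n + m] = id"
  by (rule word_noncrossing_interval[of _ _ pmate]) (use pmate pmate_noncrossing in auto)

text \<open>The open interval between the ends of a strand carries a noncrossing pairing of its own,
  as a strand leaving it would cross the given one. For edge weights this will compare heights at
  the two ends, where \<open>word_tl_circle\<close> compares only total weights.\<close>

lemma word_tl_chord:
  assumes "{P, R} \<in> D" "circle_pos n m P < circle_pos n m R"
  shows "word \<sigma> [Suc (circle_pos n m P)..<circle_pos n m R] = id"
proof -
  let ?p = "circle_pos n m P" and ?r = "circle_pos n m R"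
  have PR: "P \<in> points n m" "R \<in> points n m" using tl_mem[OF D assms(1)] by auto
  have r: "?r < n + m" "?p < n + m" using circle_pos_less PR by auto
  have pr: "pmate ?p = ?r"
    using mate_eq[OF D assms(1)] by (simp add: pmate_def pos_point_circle_pos PR)
  have rp: "pmate ?r = ?p" using pmate(2)[OF r(2)] pr by simp
  have inner: "?p < pmate t \<and> pmate t < ?r" if t: "?p < t" "t < ?r" for t
  proof -
    have tN: "t < n + m" using t r by simp
    have "pmate t \<noteq> ?p" "pmate t \<noteq> ?r" using pmate(2)[OF tN] t pr rp by auto
    moreover have "\<not> ?r < pmate t" using pmate_noncrossing[of ?p t] t pr pmate(1)[OF tN] by auto
    moreover have "\<not> pmate t < ?p"
      using pmate_noncrossing[of "pmate t" ?p] t pr pmate(2)[OF tN] r by auto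
    ultimately show ?thesis by linarith
  qed
  show ?thesis
  proof (rule word_noncrossing_interval[of _ _ pmate])
    show "Suc ?p \<le> pmate t \<and> pmate t < ?r" if "Suc ?p \<le> t" "t < ?r" for t using inner[of t] that by auto
    show "pmate (pmate t) = t \<and> pmate t \<noteq> t \<and> \<sigma> t \<circ> \<sigma> (pmate t) = id" if "Suc ?p \<le> t" "t < ?r" for t
      using pmate[of t] that r by auto
    show False if "Suc ?p \<le> s" "s < t" "t < pmate s" "pmate s < pmate t" "pmate t < ?r" for s t
      using pmate_noncrossing[of s t] that r by auto
  qed
qed

end

lemma map_rev_positions: "map (\<lambda>t. n + m - 1 - t) [n..<n + m] = rev [0..<m]"
  by (rule nth_equalityI) (auto simp: rev_nth)

text \<open>The boundary circle passes through the target from right to left, hence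
  \<open>rev\<close>.\<close>

lemma word_circle_split:
  "word (\<lambda>t. \<rho> (pos_point n m t)) [0..<n + m] = word (\<lambda>i. \<rho> (0, i)) [0..<n] \<circ> word (\<lambda>i. \<rho> (1, i)) (rev [0..<m])"
proof -
  have "[0..<n + m] = [0..<n] @ [n..<n + m]" using upt_add_eq_append[of 0 n m] by simp
  moreover have "word (\<lambda>t. \<rho> (pos_point n m t)) [0..<n] = word (\<lambda>i. \<rho> (0, i)) [0..<n]"
    by (rule word_cong) (simp add: pos_point_def)
  moreover have "word (\<lambda>t. \<rho> (pos_point n m t)) [n..<n + m] = word (\<lambda>i. \<rho> (1, i)) (rev [0..<m])"
  proof -
    have "word (\<lambda>t. \<rho> (pos_point n m t)) [n..<n + m] = word (\<lambda>t. \<rho> (1, n + m - 1 - t)) [n..<n + m]"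
      by (rule word_cong) (simp add: pos_point_def)
    also have "\<dots> = word (\<lambda>i. \<rho> (1, i)) (map (\<lambda>t. n + m - 1 - t) [n..<n + m])"
      by (simp only: word_map)
    finally show ?thesis by (simp only: map_rev_positions)
  qed
  ultimately show ?thesis by (simp only: word_append)
qed

text \<open>The word around the circle is trivial, and the backward word of the target is inverse to
  its forward word because the letters are involutions.\<close>

lemma word_tl_source_target:
  assumes D: "D \<in> tl_diagrams n m"
    and \<rho>: "\<And>A P Q. A \<in> D \<Longrightarrow> P \<in> A \<Longrightarrow> Q \<in> A \<Longrightarrow> \<rho> P = \<rho> Q"
    and inv: "\<And>P. \<rho> P \<circ> \<rho> P = id"
  shows "word (\<lambda>i. \<rho> (0, i)) [0..<n] = word (\<lambda>i. \<rho> (1, i)) [0..<m]" (is "?S = ?T")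
proof -
  have "word (\<lambda>t. \<rho> (pos_point n m t)) [0..<n + m] = id"
  proof (rule word_tl_circle[OF D])
    fix P Q assume PQ: "{P, Q} \<in> D"
    then have "P \<in> points n m" "Q \<in> points n m" using tl_mem[OF D PQ] by auto
    then show "\<rho> (pos_point n m (circle_pos n m P)) \<circ> \<rho> (pos_point n m (circle_pos n m Q)) = id"
      using \<rho>[OF PQ, of P Q] inv[of P] by (simp add: pos_point_circle_pos)
  qed
  then have "?S \<circ> word (\<lambda>i. \<rho> (1, i)) (rev [0..<m]) = id" by (simp only: word_circle_split)
  then have "?S \<circ> word (\<lambda>i. \<rho> (1, i)) (rev [0..<m]) \<circ> ?T = ?T" by simp
  moreover have "word (\<lambda>i. \<rho> (1, i)) (rev [0..<m]) \<circ> ?T = id"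
    by (rule word_rev_inverse) (rule inv)
  ultimately show ?thesis by (simp add: comp_assoc)
qed

text \<open>Two reflections of the integers generate an infinite dihedral group, in which the word of
  a crossing is nontrivial.\<close>

lemma word_crossing:
  fixes \<sigma> :: "nat \<Rightarrow> int \<Rightarrow> int"
  assumes "p < q" "q < r" "r < s" "s < N"
    and "\<sigma> p = uminus" "\<sigma> r = uminus" "\<sigma> q = (\<lambda>x. 1 - x)" "\<sigma> s = (\<lambda>x. 1 - x)"
    and "\<And>t. t \<notin> {p, q, r, s} \<Longrightarrow> \<sigma> t = id"
  shows "word \<sigma> [0..<N] \<noteq> id"
proof -
  have i: "word \<sigma> [i..<j] = id" if "\<And>t. i \<le> t \<Longrightarrow> t < j \<Longrightarrow> t \<notin> {p, q, r, s}" for i j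
    by (rule word_id) (use that assms(9) in auto)
  have "word \<sigma> [0..<N] = word \<sigma> [0..<p] \<circ> \<sigma> p \<circ> (word \<sigma> [Suc p..<q] \<circ> \<sigma> q \<circ>
      (word \<sigma> [Suc q..<r] \<circ> \<sigma> r \<circ> (word \<sigma> [Suc r..<s] \<circ> \<sigma> s \<circ> word \<sigma> [Suc s..<N])))"
  proof -
    have 1: "word \<sigma> [0..<N] = word \<sigma> [0..<p] \<circ> \<sigma> p \<circ> word \<sigma> [Suc p..<N]"
      using assms(1-4) by (intro word_upt_split) auto
    have 2: "word \<sigma> [Suc p..<N] = word \<sigma> [Suc p..<q] \<circ> \<sigma> q \<circ> word \<sigma> [Suc q..<N]"
      using assms(1-4) by (intro word_upt_split) auto
    have 3: "word \<sigma> [Suc q..<N] = word \<sigma> [Suc q..<r] \<circ> \<sigma> r \<circ> word \<sigma> [Suc r..<N]"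
      using assms(1-4) by (intro word_upt_split) auto
    have 4: "word \<sigma> [Suc r..<N] = word \<sigma> [Suc r..<s] \<circ> \<sigma> s \<circ> word \<sigma> [Suc s..<N]"
      using assms(1-4) by (intro word_upt_split) auto
    show ?thesis unfolding 1 unfolding 2 unfolding 3 unfolding 4 ..
  qed
  also have "\<dots> = \<sigma> p \<circ> (\<sigma> q \<circ> (\<sigma> r \<circ> \<sigma> s))"
    using assms(1-4) by (simp add: i)
  \<comment> \<open>The four letters of a crossing compose to the translation by -2, so already the
    point 0 is moved.\<close>
  finally have "word \<sigma> [0..<N] 0 = - (1 - (- (1 - 0)))" by (simp add: assms(5-8))
  then show ?thesis by auto
qed

section \<open>Composites of planar diagrams are planar\<close>

context
  fixes D E :: diagram and n m k :: nat
  assumes D: "D \<in> tl_diagrams n m" and E: "E \<in> tl_diagrams m k"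
begin

private abbreviation "U \<equiv> D \<union> up E"

private lemma two: "A \<in> U \<Longrightarrow> card A = 2"
  using tl_card[OF D] tl_card[OF E] inj_raise
  by (auto simp: up_def card_image inj_on_subset[OF inj_raise subset_UNIV])

text \<open>The members of \<open>F\<close> contained in \<open>C\<close> partition the points of
  \<open>C\<close> covered by \<open>F\<close> into pairs.\<close>

private lemma card_strands:
  assumes "finite C" "\<And>A. A \<in> F \<Longrightarrow> card A = 2" "\<And>A B. A \<in> F \<Longrightarrow> B \<in> F \<Longrightarrow> A \<inter> B \<noteq> {} \<Longrightarrow> A = B"
    "\<And>A. A \<in> F \<Longrightarrow> A \<inter> C \<noteq> {} \<Longrightarrow> A \<subseteq> C"
  shows "2 * card {A \<in> F. A \<subseteq> C} = card (C \<inter> \<Union>F)"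
proof -
  have "C \<inter> \<Union>F = \<Union>{A \<in> F. A \<subseteq> C}" using assms(4) by blast
  moreover have "card (\<Union>{A \<in> F. A \<subseteq> C}) = sum card {A \<in> F. A \<subseteq> C}"
  proof (rule card_Union_disjoint)
    show "pairwise disjnt {A \<in> F. A \<subseteq> C}"
    proof (rule pairwiseI)
      fix A B assume "A \<in> {A \<in> F. A \<subseteq> C}" "B \<in> {A \<in> F. A \<subseteq> C}" "A \<noteq> B"
      then show "disjnt A B" using assms(3)[of A B] by (auto simp: disjnt_def)
    qed
    show "finite A" if "A \<in> {A \<in> F. A \<subseteq> C}" for A using that assms(1) finite_subset by blast
  qed
  moreover have "sum card {A \<in> F. A \<subseteq> C} = (\<Sum>A\<in>{A \<in> F. A \<subseteq> C}. 2)"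
    by (rule sum.cong) (use assms(2) in auto)
  ultimately show ?thesis by simp
qed

text \<open>Let \<open>C\<close> have \<open>a\<close>, \<open>b\<close>, \<open>c\<close> points on
  the levels 0, 1, 2, and \<open>t = a + c\<close> ends. It contains \<open>(a + b) / 2\<close>
  strands of \<open>D\<close> and \<open>(b + c) / 2\<close> of \<open>E\<close>, so the spanning
  tree bound reads \<open>b + t \<le> b + t / 2 + 1\<close> and gives \<open>t \<le> 2\<close>.
  Since \<open>a + b\<close> and \<open>b + c\<close> are even, so is \<open>t\<close>; being
  positive, it is 2.\<close>

private lemma card_ends:
  assumes C: "C \<in> comps U" and ne: "C - level 1 \<noteq> {}"
  shows "card (C - level 1) = 2"
proof -
  have Cp: "C \<subseteq> points3 n m k" using comps_subset[OF C] Union_stacked[OF D E] by simp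
  have finC: "finite C" using Cp finite_points3 finite_subset by blast
  have finU: "finite (\<Union>U)" unfolding Union_stacked[OF D E] by (rule finite_points3)
  let ?D = "{A \<in> D. A \<subseteq> C}" and ?E = "{A \<in> up E. A \<subseteq> C}"
  have "card C \<le> card {A \<in> U. A \<subseteq> C} + 1" by (rule card_connected_le[OF C finU two])
  also have "{A \<in> U. A \<subseteq> C} = ?D \<union> ?E" by blast
  finally have le: "card C \<le> card ?D + card ?E + 1"
    using card_Un_le[of ?D ?E] by linarith
  have f1: "2 * card ?D = card (C \<inter> \<Union>D)"
    by (rule card_strands[OF finC]) (use two tl_disjoint[OF D] comps_closed[OF C] in auto)
  have f2: "C \<inter> \<Union>D = (C \<inter> level 0) \<union> (C \<inter> level 1)"
    unfolding tl_Union[OF D] using Cp by (auto simp: points3_def points_def)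
  have upE: "A = B" if AB0: "A \<in> up E" "B \<in> up E" "A \<inter> B \<noteq> {}" for A B
  proof -
    obtain A' B' where AB: "A' \<in> E" "B' \<in> E" "A = raise ` A'" "B = raise ` B'"
      using AB0(1,2) unfolding up_def by blast
    then have "raise ` (A' \<inter> B') \<noteq> {}" using AB0(3) by (simp add: image_Int[OF inj_raise])
    then have "A' = B'" using tl_disjoint[OF E AB(1,2)] by blast
    then show ?thesis using AB by simp
  qed
  have f3: "2 * card ?E = card (C \<inter> \<Union>(up E))"
    by (rule card_strands[OF finC]) (use two upE comps_closed[OF C] in auto)
  have f4: "C \<inter> \<Union>(up E) = (C \<inter> level 1) \<union> (C \<inter> level 2)"
    unfolding Union_up tl_Union[OF E]
  proof (rule set_eqI)
    fix P show "P \<in> C \<inter> raise ` points m k \<longleftrightarrow> P \<in> (C \<inter> level 1) \<union> (C \<inter> level 2)"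
      unfolding Int_iff Un_iff mem_raise_points mem_level using Cp by (auto simp: points3_def)
  qed
  have f5: "card ((C \<inter> level 0) \<union> (C \<inter> level 1)) = card (C \<inter> level 0) + card (C \<inter> level 1)"
    using finC by (intro card_Un_disjoint) auto
  have f6: "card ((C \<inter> level 1) \<union> (C \<inter> level 2)) = card (C \<inter> level 1) + card (C \<inter> level 2)"
    using finC by (intro card_Un_disjoint) auto
  have f7: "C - level 1 = (C \<inter> level 0) \<union> (C \<inter> level 2)"
    using Cp by (auto simp: points3_def)
  have f8: "card ((C \<inter> level 0) \<union> (C \<inter> level 2)) = card (C \<inter> level 0) + card (C \<inter> level 2)"
    using finC by (intro card_Un_disjoint) auto
  have f9: "card C = card (C \<inter> level 1) + card (C - level 1)"
    using finC by (metis card_Int_Diff)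
  have f10: "card (C - level 1) > 0" using ne finC by (simp add: card_gt_0_iff)
  have arith: "t = 2" if "2 * x = a + b" "2 * y = b + c" "t = a + c" "t > 0" "d = b + t" "d \<le> x + y + 1"
    for a b c d t x y :: nat using that by presburger
  show ?thesis
  proof (rule arith)
    show "2 * card ?D = card (C \<inter> level 0) + card (C \<inter> level 1)" using f1 f2 f5 by simp
    show "2 * card ?E = card (C \<inter> level 1) + card (C \<inter> level 2)" using f3 f4 f6 by simp
    show "card (C - level 1) = card (C \<inter> level 0) + card (C \<inter> level 2)" using f7 f8 by simp
  qed (rule f10 f9 le)+
qed

private lemma halve_inj: "inj_on halve {P. fst P = 0 \<or> fst P = 2}"
  by (auto simp: inj_on_def halve_def)

private lemma outer_subset: "C \<in> comps U \<Longrightarrow> C - level 1 \<subseteq> {P. fst P = 0 \<or> fst P = 2}"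
  using comps_subset[of C U] unfolding Union_stacked[OF D E] by (auto simp: points3_def)

private lemma stackE:
  assumes "A \<in> stack D E"
  obtains C where "C \<in> comps U" "A = halve ` (C - level 1)" "C - level 1 \<noteq> {}"
  using assms unfolding stack_eq trim_def by blast

lemma stack_tl: "stack D E \<in> tl_diagrams n k"
proof (rule tl_diagramsI)
  have "\<Union>(stack D E) = halve ` (points3 n m k - level 1)"
    unfolding stack_eq image_Union[symmetric] Union_trim Union_comps Union_stacked[OF D E] ..
  also have "\<dots> = points n k"
  proof
    show "halve ` (points3 n m k - level 1) \<subseteq> points n k" by (auto simp: points3_def halve_def points_def)
    show "points n k \<subseteq> halve ` (points3 n m k - level 1)"
    proof
      fix P assume "P \<in> points n k"
      then have "(2 * fst P, snd P) \<in> points3 n m k - level 1" "P = halve (2 * fst P, snd P)"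
        by (auto simp: points_def points3_def halve_def)
      then show "P \<in> halve ` (points3 n m k - level 1)" by blast
    qed
  qed
  finally show "\<Union>(stack D E) = points n k" .
next
  fix A assume "A \<in> stack D E"
  then obtain C where C: "C \<in> comps U" "A = halve ` (C - level 1)" "C - level 1 \<noteq> {}" by (rule stackE)
  have "card A = card (C - level 1)"
    unfolding C(2) by (rule card_image[OF inj_on_subset[OF halve_inj outer_subset[OF C(1)]]])
  then show "card A = 2" using card_ends[OF C(1,3)] by simp
next
  fix A B assume AB: "A \<in> stack D E" "B \<in> stack D E" "A \<inter> B \<noteq> {}"
  obtain C where C: "C \<in> comps U" "A = halve ` (C - level 1)" using AB(1) by (rule stackE)
  obtain C' where C': "C' \<in> comps U" "B = halve ` (C' - level 1)" using AB(2) by (rule stackE)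
  obtain P Q where PQ: "P \<in> C - level 1" "Q \<in> C' - level 1" "halve P = halve Q" using AB(3) C C' by blast
  then have "P = Q" using halve_inj outer_subset[OF C(1)] outer_subset[OF C'(1)] by (meson inj_onD subsetD)
  then have "C = C'" using comps_disjoint[OF C(1) C'(1)] PQ by blast
  then show "A = B" using C C' by simp
next
  let ?pos = "circle_pos n k"
  fix P Q R S assume PR: "{P, R} \<in> stack D E" and QS: "{Q, S} \<in> stack D E"
    and lt: "?pos P < ?pos Q" "?pos Q < ?pos R" "?pos R < ?pos S"
  obtain C where C: "C \<in> comps U" "{P, R} = halve ` (C - level 1)" using PR by (rule stackE)
  obtain C' where C': "C' \<in> comps U" "{Q, S} = halve ` (C' - level 1)" using QS by (rule stackE)
  have pts: "halve ` (K - level 1) \<subseteq> points n k" if "K \<in> comps U" for K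
    using comps_subset[OF that] unfolding Union_stacked[OF D E] by (auto simp: points3_def halve_def points_def)
  have in_pts: "P \<in> points n k" "R \<in> points n k" "Q \<in> points n k" "S \<in> points n k"
    using pts[OF C(1)] pts[OF C'(1)] unfolding C(2)[symmetric] C'(2)[symmetric] by auto
  \<comment> \<open>Inverse of \<open>halve\<close> on the outer levels: it reads boundary points of
    the composite as points of the stacked picture.\<close>
  define raise2 :: "point \<Rightarrow> point" where "raise2 = (\<lambda>(l, i). (2 * l, i))"
  have halve_iff: "raise2 X \<in> K \<longleftrightarrow> X \<in> halve ` (K - level 1)" if "K \<in> comps U" "X \<in> points n k" for K X
  proof
    assume "raise2 X \<in> K"
    then have "raise2 X \<in> K - level 1" "X = halve (raise2 X)"
      using that(2) by (auto simp: raise2_def halve_def points_def)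
    then show "X \<in> halve ` (K - level 1)" by blast
  next
    assume "X \<in> halve ` (K - level 1)"
    then obtain Y where Y: "Y \<in> K - level 1" "X = halve Y" by blast
    then have "fst Y = 0 \<or> fst Y = 2" using outer_subset[OF that(1)] by blast
    then have "raise2 X = Y" using Y(2) by (cases Y) (auto simp: raise2_def halve_def)
    then show "raise2 X \<in> K" using Y by simp
  qed
  \<comment> \<open>Label the whole stacked picture: the components of the two allegedly crossing
    strands get the two reflections, all other points the identity. Labels are constant along the
    strands of both layers, so the words along the levels 0, 1 and 2 agree.\<close>
  define \<rho> :: "point \<Rightarrow> int \<Rightarrow> int" where
    "\<rho> X = (if X \<in> C then uminus else if X \<in> C' then (\<lambda>x. 1 - x) else id)" for X
  have inv: "\<rho> X \<circ> \<rho> X = id" for X by (auto simp: \<rho>_def)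
  have const: "\<rho> X = \<rho> Y" if "A \<in> U" "X \<in> A" "Y \<in> A" for A X Y
  proof -
    have "X \<in> K \<longleftrightarrow> Y \<in> K" if "K \<in> comps U" for K
      using comps_closed[OF that \<open>A \<in> U\<close>] \<open>X \<in> A\<close> \<open>Y \<in> A\<close> by blast
    then show ?thesis using C(1) C'(1) by (simp add: \<rho>_def)
  qed
  have "word (\<lambda>i. \<rho> (0, i)) [0..<n] = word (\<lambda>i. \<rho> (1, i)) [0..<m]"
  proof (rule word_tl_source_target[OF D])
    show "\<rho> X = \<rho> Y" if "A \<in> D" "X \<in> A" "Y \<in> A" for A X Y
      by (rule const[of A]) (use that in auto)
  qed (rule inv)
  moreover have "word (\<lambda>i. \<rho> (raise (0, i))) [0..<m] = word (\<lambda>i. \<rho> (raise (1, i))) [0..<k]"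
  proof (rule word_tl_source_target[OF E, of "\<lambda>X. \<rho> (raise X)"])
    fix A X Y assume "A \<in> E" "X \<in> A" "Y \<in> A"
    then show "\<rho> (raise X) = \<rho> (raise Y)"
      by (intro const[of "raise ` A"]) (auto simp: up_def)
  qed (rule inv)
  ultimately have eq: "word (\<lambda>i. \<rho> (raise2 (0, i))) [0..<n] = word (\<lambda>i. \<rho> (raise2 (1, i))) [0..<k]"
    by (simp add: raise_def raise2_def numeral_2_eq_2)
  have "word (\<lambda>i. \<rho> (raise2 (1, i))) [0..<k] \<circ> word (\<lambda>i. \<rho> (raise2 (1, i))) (rev [0..<k]) = id"
    using word_rev_inverse[of "rev [0..<k]" "\<lambda>i. \<rho> (raise2 (1, i))"] inv by simp
  then have "word (\<lambda>t. \<rho> (raise2 (pos_point n k t))) [0..<n + k] = id"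
    using word_circle_split[of "\<lambda>X. \<rho> (raise2 X)" n k] eq by simp
  \<comment> \<open>Places beyond the boundary are given the identity, as
    \<open>word_crossing\<close> speaks about all natural numbers.\<close>
  moreover define \<sigma> where "\<sigma> t = (if t < n + k then \<rho> (raise2 (pos_point n k t)) else id)" for t
  moreover have "word (\<lambda>t. \<rho> (raise2 (pos_point n k t))) [0..<n + k] = word \<sigma> [0..<n + k]"
    by (rule word_cong) (simp add: \<sigma>_def)
  ultimately have "word \<sigma> [0..<n + k] = id" by simp
  moreover have "word \<sigma> [0..<n + k] \<noteq> id"
  proof (rule word_crossing[OF lt circle_pos_less[OF in_pts(4)]])
    have PQ: "P \<noteq> Q" "P \<noteq> S" "R \<noteq> Q" "R \<noteq> S" using lt by auto
    have r: "\<rho> (raise2 X) = (if X \<in> {P, R} then uminus else if X \<in> {Q, S} then (\<lambda>x. 1 - x) else id)"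
      if "X \<in> points n k" for X
      unfolding \<rho>_def halve_iff[OF C(1) that] halve_iff[OF C'(1) that] C(2)[symmetric] C'(2)[symmetric] ..
    have s: "\<sigma> (?pos X) = (if X \<in> {P, R} then uminus else if X \<in> {Q, S} then (\<lambda>x. 1 - x) else id)"
      if "X \<in> points n k" for X
      using r[OF that] by (simp add: \<sigma>_def circle_pos_less[OF that] pos_point_circle_pos[OF that])
    show "\<sigma> (?pos P) = uminus" "\<sigma> (?pos R) = uminus" "\<sigma> (?pos Q) = (\<lambda>x. 1 - x)" "\<sigma> (?pos S) = (\<lambda>x. 1 - x)"
      using PQ by (simp_all add: s in_pts)
    fix t assume t: "t \<notin> {?pos P, ?pos Q, ?pos R, ?pos S}"
    show "\<sigma> t = id"
    proof (cases "t < n + k")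
      case True
      have "pos_point n k t \<notin> {P, Q, R, S}" using t circle_pos_pos_point[OF True] by auto
      then show ?thesis using r[OF pos_point_mem[OF True]] True by (simp add: \<sigma>_def)
    qed (simp add: \<sigma>_def)
  qed
  ultimately show False by contradiction
qed

end

section \<open>Reflections, juxtaposition and the basic diagrams\<close>

lemma tl_pointD: "D \<in> tl_diagrams n m \<Longrightarrow> P \<in> \<Union>D \<Longrightarrow> fst P = 0 \<and> snd P < n \<or> fst P = 1 \<and> snd P < m"
  unfolding tl_Union by (auto simp: points_def)

lemma juxtapose_image: "juxtapose n m D E = D \<union> (`) (\<lambda>(l, i). (l, i + (if l = 0 then n else m))) ` E"
  by (simp add: juxtapose_def)

lemma mirror_image: "mirror n m D = (`) (\<lambda>(l, i). (l, (if l = 0 then n else m) - 1 - i)) ` D"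
  by (simp add: mirror_def)

lemma flip_image: "flip D = (`) (\<lambda>(l, i). (1 - l, i)) ` D"
  by (simp add: flip_def)

lemma juxtapose_assoc:
  "juxtapose (n + n') (m + m') (juxtapose n m D D') D'' = juxtapose n m D (juxtapose n' m' D' D'')"
proof -
  have "(`) (\<lambda>(l, i). (l, i + (if l = 0 then n + n' else m + m'))) ` D'' =
    (`) (\<lambda>(l, i). (l, i + (if l = 0 then n else m))) ` (`) (\<lambda>(l, i). (l, i + (if l = 0 then n' else m'))) ` D''"
    unfolding image_image_comp by (rule image_image_id) auto
  then show ?thesis unfolding juxtapose_image image_Un by (simp only: Un_assoc)
qed

lemma juxtapose_empty_left: "juxtapose 0 0 {} D = D"
  unfolding juxtapose_image by (simp only: Un_empty_left) (rule image_image_ident, auto)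

lemma juxtapose_empty_right: "juxtapose n m D {} = D"
  by (simp add: juxtapose_image)

lemma id_diagram_0: "id_diagram 0 = {}"
  by (simp add: id_diagram_def)

lemma flip_juxtapose:
  assumes "D \<in> tl_diagrams n m" "E \<in> tl_diagrams n' m'"
  shows "flip (juxtapose n m D E) = juxtapose m n (flip D) (flip E)"
  unfolding flip_image juxtapose_image image_Un image_image_comp
  by (intro arg_cong2[of _ _ _ _ "(\<union>)"] refl image_image_id) (drule tl_pointD[OF assms(2)], auto)

lemma flip_mirror:
  assumes "D \<in> tl_diagrams n m"
  shows "flip (mirror n m D) = mirror m n (flip D)"
  unfolding flip_image mirror_image image_image_comp
  by (rule image_image_id) (drule tl_pointD[OF assms], auto)

lemma flip_flip:
  assumes "D \<in> tl_diagrams n m"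
  shows "flip (flip D) = D"
  unfolding flip_image image_image_comp
  by (rule image_image_ident) (drule tl_pointD[OF assms], auto)

lemma mirror_mirror:
  assumes "D \<in> tl_diagrams n m"
  shows "mirror n m (mirror n m D) = D"
  unfolding mirror_image image_image_comp
  by (rule image_image_ident) (drule tl_pointD[OF assms], auto)

lemma mirror_juxtapose:
  assumes "D \<in> tl_diagrams n m" "E \<in> tl_diagrams n' m'"
  shows "mirror (n + n') (m + m') (juxtapose n m D E) = juxtapose n' m' (mirror n' m' E) (mirror n m D)"
proof -
  have "(`) (\<lambda>(l, i). (l, (if l = 0 then n + n' else m + m') - 1 - i)) ` D =
     (`) (\<lambda>(l, i). (l, i + (if l = 0 then n' else m'))) ` (`) (\<lambda>(l, i). (l, (if l = 0 then n else m) - 1 - i)) ` D"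
    unfolding image_image_comp by (rule image_image_id) (drule tl_pointD[OF assms(1)], auto)
  moreover have "(`) (\<lambda>(l, i). (l, (if l = 0 then n + n' else m + m') - 1 - i)) `
      (`) (\<lambda>(l, i). (l, i + (if l = 0 then n else m))) ` E =
     (`) (\<lambda>(l, i). (l, (if l = 0 then n' else m') - 1 - i)) ` E"
    unfolding image_image_comp by (rule image_image_id) (drule tl_pointD[OF assms(2)], auto)
  ultimately show ?thesis unfolding mirror_image juxtapose_image image_Un by (simp only: Un_commute)
qed

lemma flip_id_diagram: "flip (id_diagram n) = id_diagram n"
  unfolding flip_def id_diagram_def setcompr_eq_image image_image by (simp add: insert_commute)

text \<open>Both identities and nested cups pair the points whose positions add up to \<open>2 n - 1\<close>.\<close>

lemma symmetric_pairing_noncrossing: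
  assumes "\<And>P Q. {P, Q} \<in> D \<Longrightarrow> pos P + pos Q = (c::nat)" "{P, R} \<in> D" "{Q, S} \<in> D"
    "pos P < pos Q" "pos Q < pos R" "pos R < pos S"
  shows False
  using assms(1)[OF assms(2)] assms(1)[OF assms(3)] assms(4-6) by simp

lemma id_diagram_tl: "id_diagram n \<in> tl_diagrams n n"
proof (rule tl_diagramsI)
  show "\<Union> (id_diagram n) = points n n"
    by (auto simp: id_diagram_def points_def)
  fix A assume A: "A \<in> id_diagram n"
  then show "card A = 2" by (auto simp: id_diagram_def)
  fix B assume "B \<in> id_diagram n" "A \<inter> B \<noteq> {}"
  then show "A = B" using A by (auto simp: id_diagram_def)
next
  have "circle_pos n n P + circle_pos n n Q = 2 * n - 1" if "{P, Q} \<in> id_diagram n" for P Q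
    using that by (auto simp: id_diagram_def circle_pos_def doubleton_eq_iff)
  then show False if "{P, R} \<in> id_diagram n" "{Q, S} \<in> id_diagram n"
      "circle_pos n n P < circle_pos n n Q" "circle_pos n n Q < circle_pos n n R"
      "circle_pos n n R < circle_pos n n S" for P Q R S
    using symmetric_pairing_noncrossing[of "id_diagram n" "circle_pos n n"] that by metis
qed

lemma nested_cups_tl: "nested_cups n \<in> tl_diagrams 0 (n + n)"
proof (rule tl_diagramsI)
  show "\<Union> (nested_cups n) = points 0 (n + n)"
  proof
    show "\<Union> (nested_cups n) \<subseteq> points 0 (n + n)" by (auto simp: nested_cups_def points_def)
    show "points 0 (n + n) \<subseteq> \<Union> (nested_cups n)"
    proof
      fix P assume "P \<in> points 0 (n + n)"
      then obtain i where i: "P = (1, i)" "i < 2 * n" by (auto simp: points_def)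
      show "P \<in> \<Union> (nested_cups n)"
      proof (cases "i < n")
        case True
        then show ?thesis unfolding nested_cups_def using i by blast
      next
        case False
        then have "P \<in> {(1, 2 * n - 1 - i), (1, 2 * n - 1 - (2 * n - 1 - i))}" "2 * n - 1 - i < n"
          using i by auto
        then show ?thesis unfolding nested_cups_def by blast
      qed
    qed
  qed
  fix A assume A: "A \<in> nested_cups n"
  then show "card A = 2" by (auto simp: nested_cups_def card_insert_if)
  fix B assume "B \<in> nested_cups n" "A \<inter> B \<noteq> {}"
  then show "A = B" using A by (auto simp: nested_cups_def)
next
  have "circle_pos 0 (n + n) P + circle_pos 0 (n + n) Q = 2 * n - 1" if "{P, Q} \<in> nested_cups n" for P Q
    using that by (auto simp: nested_cups_def circle_pos_def doubleton_eq_iff)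
  then show False if "{P, R} \<in> nested_cups n" "{Q, S} \<in> nested_cups n"
      "circle_pos 0 (n + n) P < circle_pos 0 (n + n) Q" "circle_pos 0 (n + n) Q < circle_pos 0 (n + n) R"
      "circle_pos 0 (n + n) R < circle_pos 0 (n + n) S" for P Q R S
    using symmetric_pairing_noncrossing[of "nested_cups n" "circle_pos 0 (n + n)"] that by metis
qed

lemma image_pairE:
  assumes "D \<in> tl_diagrams n m" "{P, Q} \<in> (`) h ` D"
  obtains P' Q' where "{P', Q'} \<in> D" "P = h P'" "Q = h Q'"
proof -
  obtain A where A: "A \<in> D" "{P, Q} = h ` A" using assms(2) by blast
  obtain X Y where XY: "A = {X, Y}" using tl_pair[OF assms(1) A(1)] by blast
  then have "P = h X \<and> Q = h Y \<or> P = h Y \<and> Q = h X" using A(2) by (auto simp: doubleton_eq_iff)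
  then show thesis using that[of X Y] that[of Y X] A(1) XY by (auto simp: insert_commute)
qed

lemma image_tl_pairing:
  assumes D: "D \<in> tl_diagrams n m" and inj: "inj_on h (points n m)"
  shows "A \<in> (`) h ` D \<Longrightarrow> card A = 2"
    "A \<in> (`) h ` D \<Longrightarrow> B \<in> (`) h ` D \<Longrightarrow> A \<inter> B \<noteq> {} \<Longrightarrow> A = B"
proof -
  have sub: "A \<subseteq> points n m" if "A \<in> D" for A using tl_mem[OF D that] by blast
  show "card A = 2" if A: "A \<in> (`) h ` D"
  proof -
    obtain K where K: "K \<in> D" "A = h ` K" using A by blast
    then show ?thesis using tl_card[OF D K(1)] card_image[OF inj_on_subset[OF inj sub[OF K(1)]]] by simp
  qed
  show "A = B" if AB: "A \<in> (`) h ` D" "B \<in> (`) h ` D" "A \<inter> B \<noteq> {}"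
  proof -
    obtain K L where K: "K \<in> D" "A = h ` K" "L \<in> D" "B = h ` L" using AB by blast
    then have "h ` (K \<inter> L) \<noteq> {}" using AB(3) inj_on_image_Int[OF inj sub sub] by simp
    then show ?thesis using tl_disjoint[OF D K(1,3)] K by auto
  qed
qed

lemma mirror_tl:
  assumes D: "D \<in> tl_diagrams n m"
  shows "mirror n m D \<in> tl_diagrams n m"
proof (rule tl_diagramsI)
  let ?h = "\<lambda>(l, i). (l, (if l = 0 then n else m) - 1 - i)"
  have inj: "inj_on ?h (points n m)" by (auto simp: inj_on_def points_def)
  show "\<Union>(mirror n m D) = points n m"
  proof -
    have "\<Union>(mirror n m D) = ?h ` points n m" unfolding mirror_image image_Union[symmetric] tl_Union[OF D] ..
    also have "\<dots> = points n m"
    proof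
      show "?h ` points n m \<subseteq> points n m" by (auto simp: points_def)
      show "points n m \<subseteq> ?h ` points n m"
      proof
        fix P assume "P \<in> points n m"
        then have "?h P \<in> points n m" "P = ?h (?h P)" by (auto simp: points_def)
        then show "P \<in> ?h ` points n m" by blast
      qed
    qed
    finally show ?thesis .
  qed
  show "card A = 2" if "A \<in> mirror n m D" for A
    using image_tl_pairing(1)[OF D inj] that unfolding mirror_image .
  show "A = B" if "A \<in> mirror n m D" "B \<in> mirror n m D" "A \<inter> B \<noteq> {}" for A B
    using image_tl_pairing(2)[OF D inj] that unfolding mirror_image .
  let ?p = "circle_pos n m"
  fix P Q R S assume PR0: "{P, R} \<in> mirror n m D" and QS0: "{Q, S} \<in> mirror n m D"
    and lt: "?p P < ?p Q" "?p Q < ?p R" "?p R < ?p S"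
  from PR0[unfolded mirror_image] obtain P' R' where PR: "{P', R'} \<in> D" "P = ?h P'" "R = ?h R'"
    by (rule image_pairE[OF D])
  from QS0[unfolded mirror_image] obtain Q' S' where QS: "{Q', S'} \<in> D" "Q = ?h Q'" "S = ?h S'"
    by (rule image_pairE[OF D])
  have pts: "P' \<in> points n m" "R' \<in> points n m" "Q' \<in> points n m" "S' \<in> points n m"
    using tl_mem[OF D PR(1)] tl_mem[OF D QS(1)] by auto
  have h: "?p (?h X) = (if ?p X < n then n - 1 - ?p X else 2 * n + m - 1 - ?p X)" "?p X < n + m"
    if "X \<in> points n m" for X
    using that by (auto simp: points_def circle_pos_def)
  define p q r s where pqrs: "p = ?p P'" "q = ?p Q'" "r = ?p R'" "s = ?p S'"
  \<comment> \<open>On the boundary circle the mirror is the reflection sending \<open>x\<close> to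
    \<open>n - 1 - x\<close> modulo \<open>n + m\<close>: it reverses the source block and the
    target block separately.\<close>
  define f where "f x = (if x < n then n - 1 - x else 2 * n + m - 1 - x)" for x
  have f: "f p < f q" "f q < f r" "f r < f s" and N: "p < n + m" "q < n + m" "r < n + m" "s < n + m"
    using lt h[OF pts(1)] h[OF pts(2)] h[OF pts(3)] h[OF pts(4)] unfolding PR QS pqrs f_def by auto
  have o: "y < x" if "f x < f y" "x < n \<longleftrightarrow> y < n" "x < n + m" "y < n + m" for x y
    using that by (simp add: f_def split: if_splits)
  have o2: "x < n" if "f x < f y" "y < n" "x < n + m" for x y
    using that by (simp add: f_def split: if_splits)
  \<comment> \<open>A reflection reverses the cyclic order, so the four places occur in one of the
    four rotations of \<open>s < r < q < p\<close>. In each of them the two strands of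
    \<open>D\<close> cross.\<close>
  have "s < r \<and> r < q \<and> q < p \<or> p < s \<and> s < r \<and> r < q \<or> q < p \<and> p < s \<and> s < r \<or> r < q \<and> q < p \<and> p < s"
    using o[OF f(1)] o[OF f(2)] o[OF f(3)] o2[OF f(1)] o2[OF f(2)] o2[OF f(3)] N
    by (cases "p < n"; cases "q < n"; cases "r < n"; cases "s < n") auto
  then show False
    using tl_noncrossing[OF D, of S' Q' R' P'] tl_noncrossing[OF D, of P' R' S' Q']
      tl_noncrossing[OF D, of Q' S' P' R'] tl_noncrossing[OF D, of R' P' Q' S'] PR(1) QS(1)
    unfolding pqrs by (auto simp: insert_commute)
qed

lemma juxtapose_tl:
  assumes D: "D \<in> tl_diagrams n m" and E: "E \<in> tl_diagrams n' m'"
  shows "juxtapose n m D E \<in> tl_diagrams (n + n') (m + m')"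
proof (rule tl_diagramsI)
  let ?h = "\<lambda>(l, i). (l, i + (if l = 0 then n else m))"
  have inj: "inj_on ?h (points n' m')" by (auto simp: inj_on_def)
  have UE: "\<Union>((`) ?h ` E) = ?h ` points n' m'" unfolding image_Union[symmetric] tl_Union[OF E] ..
  have disj: "points n m \<inter> ?h ` points n' m' = {}" by (auto simp: points_def)
  show "\<Union>(juxtapose n m D E) = points (n + n') (m + m')"
  proof -
    have "\<Union>(juxtapose n m D E) = points n m \<union> ?h ` points n' m'"
      unfolding juxtapose_image Union_Un_distrib UE tl_Union[OF D] ..
    also have "\<dots> = points (n + n') (m + m')"
    proof
      show "points n m \<union> ?h ` points n' m' \<subseteq> points (n + n') (m + m')" by (auto simp: points_def)
      show "points (n + n') (m + m') \<subseteq> points n m \<union> ?h ` points n' m'"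
      proof
        fix P assume P: "P \<in> points (n + n') (m + m')"
        show "P \<in> points n m \<union> ?h ` points n' m'"
        proof (cases "P \<in> points n m")
          case False
          let ?Q = "(fst P, snd P - (if fst P = 0 then n else m))"
          have "?Q \<in> points n' m'" "P = ?h ?Q" using P False by (auto simp: points_def)
          then show ?thesis by blast
        qed simp
      qed
    qed
    finally show ?thesis .
  qed
  have sub: "A \<subseteq> points n m" if "A \<in> D" for A using tl_mem[OF D that] by blast
  have sub': "A \<subseteq> ?h ` points n' m'" if "A \<in> (`) ?h ` E" for A using that UE by blast
  show "card A = 2" if "A \<in> juxtapose n m D E" for A
    using that tl_card[OF D] image_tl_pairing(1)[OF E inj] unfolding juxtapose_image by blast
  show "A = B" if AB: "A \<in> juxtapose n m D E" "B \<in> juxtapose n m D E" "A \<inter> B \<noteq> {}" for A B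
  proof -
    consider "A \<in> D" "B \<in> D" | "A \<in> (`) ?h ` E" "B \<in> (`) ?h ` E" |
      "A \<in> D" "B \<in> (`) ?h ` E" | "A \<in> (`) ?h ` E" "B \<in> D"
      using AB(1,2) unfolding juxtapose_image by blast
    then show ?thesis
    proof cases
      case 1
      then show ?thesis using tl_disjoint[OF D] AB(3) by blast
    next
      case 2
      then show ?thesis using image_tl_pairing(2)[OF E inj] AB(3) by blast
    next
      case 3
      then show ?thesis using sub[of A] sub'[of B] disj AB(3) by blast
    next
      case 4
      then show ?thesis using sub[of B] sub'[of A] disj AB(3) by blast
    qed
  qed
  let ?p = "circle_pos (n + n') (m + m')"
  fix P Q R S assume PR: "{P, R} \<in> juxtapose n m D E" and QS: "{Q, S} \<in> juxtapose n m D E"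
    and lt: "?p P < ?p Q" "?p Q < ?p R" "?p R < ?p S"
  \<comment> \<open>Around the enlarged circle, the points of \<open>E\<close> form one block
    inserted between the source and the target of \<open>D\<close>. A strand of one diagram
    therefore cannot cross a strand of the other.\<close>
  have pD: "?p X = (if circle_pos n m X < n then circle_pos n m X else circle_pos n m X + n' + m')"
    if "X \<in> points n m" for X
    using that by (auto simp: points_def circle_pos_def)
  have pE: "?p (?h X) = circle_pos n' m' X + n \<and> circle_pos n' m' X < n' + m'" if "X \<in> points n' m'" for X
    using that by (auto simp: points_def circle_pos_def)
  have split: "{X, Y} \<in> D \<and> X \<in> points n m \<and> Y \<in> points n m \<or>
      (\<exists>X' Y'. {X', Y'} \<in> E \<and> X = ?h X' \<and> Y = ?h Y' \<and> X' \<in> points n' m' \<and> Y' \<in> points n' m')"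
    if XY: "{X, Y} \<in> juxtapose n m D E" for X Y
  proof (cases "{X, Y} \<in> D")
    case True
    then show ?thesis using tl_mem[OF D True] by simp
  next
    case False
    then have "{X, Y} \<in> (`) ?h ` E" using XY unfolding juxtapose_image by blast
    then obtain X' Y' where *: "{X', Y'} \<in> E" "X = ?h X'" "Y = ?h Y'" by (rule image_pairE[OF E])
    then have "X' \<in> points n' m'" "Y' \<in> points n' m'" using tl_mem[OF E *(1)] by auto
    then show ?thesis using * by blast
  qed
  from split[OF PR] split[OF QS] show False
  proof (elim disjE exE conjE)
    assume *: "{P, R} \<in> D" "{Q, S} \<in> D" "P \<in> points n m" "R \<in> points n m" "Q \<in> points n m" "S \<in> points n m"
    show False
      by (rule tl_noncrossing[OF D *(1,2)]) (use lt in \<open>simp_all add: pD * split: if_splits\<close>)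
  next
    fix X Y assume *: "{P, R} \<in> D" "P \<in> points n m" "R \<in> points n m"
      and XY: "Q = ?h X" "S = ?h Y" "X \<in> points n' m'" "Y \<in> points n' m'"
    show False using lt pE[OF XY(3)] pE[OF XY(4)] pD[OF *(2)] pD[OF *(3)] unfolding XY(1,2)
      by (auto split: if_splits)
  next
    fix X Y assume *: "{Q, S} \<in> D" "Q \<in> points n m" "S \<in> points n m"
      and XY: "P = ?h X" "R = ?h Y" "X \<in> points n' m'" "Y \<in> points n' m'"
    show False using lt pE[OF XY(3)] pE[OF XY(4)] pD[OF *(2)] pD[OF *(3)] unfolding XY(1,2)
      by (auto split: if_splits)
  next
    fix X Y X' Y' assume *: "{X, Y} \<in> E" "{X', Y'} \<in> E"
      and XY: "P = ?h X" "R = ?h Y" "X \<in> points n' m'" "Y \<in> points n' m'"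
        "Q = ?h X'" "S = ?h Y'" "X' \<in> points n' m'" "Y' \<in> points n' m'"
    show False
      by (rule tl_noncrossing[OF E *(1,2)])
         (use lt pE[OF XY(3)] pE[OF XY(4)] pE[OF XY(7)] pE[OF XY(8)] in \<open>simp_all add: XY(1,2,5,6)\<close>)
  qed
qed


section \<open>The category TLJ\<close>

definition comp_basis :: "real \<Rightarrow> summand \<times> diagram \<times> summand \<Rightarrow> summand \<times> diagram \<times> summand \<Rightarrow> tl_mor" where
  "comp_basis \<delta> = (\<lambda>(y', E, z) (x, D, y).
     if y = y' then Poly_Mapping.single (x, stack D E, z) (of_real (\<delta> ^ circles D E)) else 0)"

definition tensor_basis :: "summand \<times> diagram \<times> summand \<Rightarrow> summand \<times> diagram \<times> summand \<Rightarrow> tl_mor" where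
  "tensor_basis = (\<lambda>(x, D, y) (x', E, y').
     Poly_Mapping.single (summand_tensor x x', juxtapose (snd x) (snd y) D E, summand_tensor y y') 1)"

definition star_basis :: "summand \<times> diagram \<times> summand \<Rightarrow> tl_mor" where
  "star_basis = (\<lambda>(x, D, y). Poly_Mapping.single (y, flip D, x) 1)"

definition bar_basis :: "summand \<times> diagram \<times> summand \<Rightarrow> tl_mor" where
  "bar_basis = (\<lambda>(x, D, y).
     Poly_Mapping.single (summand_bar x, mirror (snd x) (snd y) D, summand_bar y) 1)"

lemma mor_comp_eq: "mor_comp \<delta> = bilin_ext (comp_basis \<delta>)"
  by (simp add: mor_comp_def comp_basis_def)

lemma mor_tensor_eq: "mor_tensor = bilin_ext tensor_basis"
  by (simp add: mor_tensor_def tensor_basis_def)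

lemma mor_star_eq: "mor_star f = lin_ext star_basis (pm_cnj f)"
  by (simp add: mor_star_def star_basis_def conj_ext_eq)

lemma mor_bar_eq: "mor_bar f = lin_ext bar_basis (pm_cnj f)"
  by (simp add: mor_bar_def bar_basis_def conj_ext_eq)

lemma bilin_ext_of_lin:
  "bilin_ext T (lin_ext A f) (lin_ext B g) = bilin_ext (\<lambda>x y. bilin_ext T (A x) (B y)) f g"
proof -
  have "bilin_ext T (lin_ext A f) (lin_ext B g) = lin_ext (\<lambda>x. bilin_ext T (A x) (lin_ext B g)) f"
    by (rule bilin_ext_lin_left)
  also have "\<dots> = lin_ext (\<lambda>x. lin_ext (\<lambda>y. bilin_ext T (A x) (B y)) g) f"
    by (simp only: bilin_ext_lin_right)
  finally show ?thesis by (simp only: bilin_ext_def[of "\<lambda>x y. bilin_ext T (A x) (B y)"])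
qed

lemma pm_cnj_zero [simp]: "pm_cnj 0 = 0"
  by (auto intro: poly_mapping_eqI)

lemma pm_cnj_bilin_ext: "pm_cnj (bilin_ext F f g) = bilin_ext (\<lambda>x y. pm_cnj (F x y)) (pm_cnj f) (pm_cnj g)"
  by (simp only: bilin_ext_def pm_cnj_lin_ext)

lemma snd_summand_tensor [simp]: "snd (summand_tensor x y) = snd x + snd y"
  by (simp add: summand_tensor_def)

lemma snd_summand_bar [simp]: "snd (summand_bar x) = snd x"
  by (simp add: summand_bar_def)

lemma summand_bar_bar [simp]: "summand_bar (summand_bar x) = x"
  by (simp add: summand_bar_def)

lemma summand_bar_inject [simp]: "summand_bar x = summand_bar y \<longleftrightarrow> x = y"
  by (metis summand_bar_bar)

lemma summand_bar_tensor: "summand_bar (summand_tensor x y) = summand_tensor (summand_bar y) (summand_bar x)"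
  by (simp add: summand_bar_def summand_tensor_def)

lemma summand_tensor_assoc:
  "summand_tensor (summand_tensor x y) z = summand_tensor x (summand_tensor y z)"
  by (simp add: summand_tensor_def)

lemma summand_tensor_unit [simp]: "summand_tensor ([], 0) x = x" "summand_tensor x ([], 0) = x"
  by (simp_all add: summand_tensor_def)

lemma matricesD:
  "f \<in> matrices S T \<Longrightarrow> (x, D, y) \<in> Poly_Mapping.keys f \<Longrightarrow> x \<in> S \<and> y \<in> T \<and> D \<in> tl_diagrams (snd x) (snd y)"
  unfolding matrices_def by blast

lemma matricesI:
  "(\<And>x D y. (x, D, y) \<in> Poly_Mapping.keys f \<Longrightarrow> x \<in> S \<and> y \<in> T \<and> D \<in> tl_diagrams (snd x) (snd y)) \<Longrightarrow>
   f \<in> matrices S T"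
  unfolding matrices_def by auto

lemma single_in_matrices:
  "x \<in> S \<Longrightarrow> y \<in> T \<Longrightarrow> D \<in> tl_diagrams (snd x) (snd y) \<Longrightarrow> Poly_Mapping.single (x, D, y) c \<in> matrices S T"
  by (rule matricesI) (auto split: if_splits)

lemma zero_in_matrices: "0 \<in> matrices S T"
  by (rule matricesI) simp

lemma lin_ext_in_matrices:
  "(\<And>x. x \<in> Poly_Mapping.keys f \<Longrightarrow> F x \<in> matrices S T) \<Longrightarrow> lin_ext F f \<in> matrices S T"
  unfolding matrices_def mem_Collect_eq by (rule keys_lin_ext)

lemma bilin_ext_in_matrices:
  "(\<And>x y. x \<in> Poly_Mapping.keys f \<Longrightarrow> y \<in> Poly_Mapping.keys g \<Longrightarrow> F x y \<in> matrices S T) \<Longrightarrow>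
   bilin_ext F f g \<in> matrices S T"
  unfolding matrices_def mem_Collect_eq by (rule keys_bilin_ext)

lemma sum_in_matrices: "(\<And>x. x \<in> A \<Longrightarrow> F x \<in> matrices S T) \<Longrightarrow> (\<Sum>x\<in>A. F x) \<in> matrices S T"
  unfolding matrices_def mem_Collect_eq by (rule keys_sum_subset)

lemma mor_comp_in:
  assumes "f \<in> matrices S T" "g \<in> matrices T R"
  shows "mor_comp \<delta> g f \<in> matrices S R"
  unfolding mor_comp_eq
proof (rule bilin_ext_in_matrices)
  fix a b assume ab: "a \<in> Poly_Mapping.keys g" "b \<in> Poly_Mapping.keys f"
  obtain y' E z x D y where e: "a = (y', E, z)" "b = (x, D, y)" by (cases a, cases b) blast
  show "comp_basis \<delta> a b \<in> matrices S R"
    using matricesD[OF assms(2), of y' E z] matricesD[OF assms(1), of x D y] ab stack_tl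
    by (auto simp: e comp_basis_def zero_in_matrices intro!: single_in_matrices)
qed

lemma mor_comp_assoc:
  assumes f: "f \<in> matrices S T" and g: "g \<in> matrices T R" and h: "h \<in> matrices R Q"
  shows "mor_comp \<delta> h (mor_comp \<delta> g f) = mor_comp \<delta> (mor_comp \<delta> h g) f"
  unfolding mor_comp_eq
proof (rule bilin_ext_assoc)
  fix a b c assume k: "a \<in> Poly_Mapping.keys f" "b \<in> Poly_Mapping.keys g" "c \<in> Poly_Mapping.keys h"
  obtain x D y y' E z z' F w where e: "a = (x, D, y)" "b = (y', E, z)" "c = (z', F, w)"
    by (cases a, cases b, cases c) blast
  have D: "two_level D" "two_level E" "two_level F"
    using k matricesD[OF f, of x D y] matricesD[OF g, of y' E z] matricesD[OF h, of z' F w] tl_two_level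
    unfolding e by blast+
  have "circles D E + circles (stack D E) F = circles E F + circles D (stack E F)"
    using circles_assoc[OF D] by simp
  then show "bilin_ext (comp_basis \<delta>) (Poly_Mapping.single c 1) (comp_basis \<delta> b a) =
      bilin_ext (comp_basis \<delta>) (comp_basis \<delta> c b) (Poly_Mapping.single a 1)"
    using stack_assoc[OF D]
    by (auto simp: e comp_basis_def power_add[symmetric] of_real_mult[symmetric] simp del: of_real_mult of_real_power)
qed

text \<open>The identity of a formal direct sum before a projection is chosen. The pair of
  \<open>S\<close> and this matrix is an object itself, through which \<open>coev\<close>
  factors.\<close>

definition id_matrix :: "summand set \<Rightarrow> tl_mor" where
  "id_matrix S = (\<Sum>x\<in>S. Poly_Mapping.single (x, id_diagram (snd x), x) 1)"

lemma id_matrix_in: "id_matrix S \<in> matrices S S"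
  unfolding id_matrix_def by (intro sum_in_matrices single_in_matrices id_diagram_tl)

lemma mor_comp_id_right:
  assumes "f \<in> matrices S T" "finite S"
  shows "mor_comp \<delta> f (id_matrix S) = f"
proof -
  have "mor_comp \<delta> f (id_matrix S) =
      lin_ext (\<lambda>a. \<Sum>x\<in>S. comp_basis \<delta> a (x, id_diagram (snd x), x)) f"
    unfolding mor_comp_eq id_matrix_def bilin_ext_sum_right
    by (simp add: bilin_ext_def lin_ext_fun_sum)
  also have "\<dots> = lin_ext (\<lambda>a. Poly_Mapping.single a 1) f"
  proof (rule lin_ext_cong)
    fix a assume a: "a \<in> Poly_Mapping.keys f"
    obtain y D z where e: "a = (y, D, z)" by (cases a) blast
    then have y: "y \<in> S" "D \<in> tl_diagrams (snd y) (snd z)" using matricesD[OF assms(1)] a by auto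
    have "(\<Sum>x\<in>S. comp_basis \<delta> a (x, id_diagram (snd x), x)) =
      (\<Sum>x\<in>S. if x = y then Poly_Mapping.single a 1 else 0)"
      \<comment> \<open>The right factor of a composition is applied first, so its identity is the
        first argument of \<open>stack\<close>.\<close>
      by (rule sum.cong) (use stack_id_left[OF y(2)] in \<open>auto simp: comp_basis_def e\<close>)
    then show "(\<Sum>x\<in>S. comp_basis \<delta> a (x, id_diagram (snd x), x)) = Poly_Mapping.single a 1"
      using y(1) assms(2) by simp
  qed
  finally show ?thesis by simp
qed

lemma mor_comp_id_left:
  assumes "f \<in> matrices S T" "finite T"
  shows "mor_comp \<delta> (id_matrix T) f = f"
proof -
  have "mor_comp \<delta> (id_matrix T) f =
      lin_ext (\<lambda>a. \<Sum>x\<in>T. comp_basis \<delta> (x, id_diagram (snd x), x) a) f"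
    unfolding mor_comp_eq id_matrix_def bilin_ext_sum_left
    by (simp add: bilin_ext_def lin_ext_fun_sum)
  also have "\<dots> = lin_ext (\<lambda>a. Poly_Mapping.single a 1) f"
  proof (rule lin_ext_cong)
    fix a assume a: "a \<in> Poly_Mapping.keys f"
    obtain y D z where e: "a = (y, D, z)" by (cases a) blast
    then have y: "z \<in> T" "D \<in> tl_diagrams (snd y) (snd z)" using matricesD[OF assms(1)] a by auto
    have "(\<Sum>x\<in>T. comp_basis \<delta> (x, id_diagram (snd x), x) a) =
      (\<Sum>x\<in>T. if x = z then Poly_Mapping.single a 1 else 0)"
      by (rule sum.cong) (use stack_id_right[OF y(2)] in \<open>auto simp: comp_basis_def e\<close>)
    then show "(\<Sum>x\<in>T. comp_basis \<delta> (x, id_diagram (snd x), x) a) = Poly_Mapping.single a 1"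
      using y(1) assms(2) by simp
  qed
  finally show ?thesis by simp
qed

section \<open>Tensor products, adjoints and conjugates of morphisms\<close>

abbreviation tensor_set :: "summand set \<Rightarrow> summand set \<Rightarrow> summand set" where
  "tensor_set S T \<equiv> (\<lambda>(x, y). summand_tensor x y) ` (S \<times> T)"

definition uniform :: "summand set \<Rightarrow> bool" where
  "uniform S \<longleftrightarrow> finite S \<and> inj_on fst S \<and> (\<exists>l. \<forall>x\<in>S. length (fst x) = l)"

text \<open>Labels of a common length can be recovered from their concatenation. This excludes cross
  terms when tensor products of morphisms are composed.\<close>

lemma tensor_inject:
  assumes "uniform S" "uniform T" "x \<in> S" "x' \<in> S" "y \<in> T" "y' \<in> T"
  shows "summand_tensor x y = summand_tensor x' y' \<longleftrightarrow> x = x' \<and> y = y'"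
proof
  assume eq: "summand_tensor x y = summand_tensor x' y'"
  have "length (fst x) = length (fst x')" using assms unfolding uniform_def by metis
  then have "fst x = fst x'" "fst y = fst y'" using eq by (auto simp: summand_tensor_def)
  then show "x = x' \<and> y = y'" using assms unfolding uniform_def inj_on_def by blast
qed simp

lemma uniform_tensor:
  assumes "uniform S" "uniform T"
  shows "uniform (tensor_set S T)"
  unfolding uniform_def
proof (intro conjI)
  show "finite (tensor_set S T)" using assms by (auto simp: uniform_def)
  obtain l l' where l: "\<forall>x\<in>S. length (fst x) = l" "\<forall>x\<in>T. length (fst x) = l'"
    using assms unfolding uniform_def by blast
  have "\<forall>x\<in>tensor_set S T. length (fst x) = l + l'"
    using l by (auto simp: summand_tensor_def)
  then show "\<exists>l. \<forall>x\<in>tensor_set S T. length (fst x) = l" by blast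
  show "inj_on fst (tensor_set S T)"
  proof (rule inj_onI)
    fix u v assume "u \<in> tensor_set S T" "v \<in> tensor_set S T" and eq: "fst u = fst v"
    then obtain x y x' y' where *: "x \<in> S" "y \<in> T" "x' \<in> S" "y' \<in> T"
      "u = summand_tensor x y" "v = summand_tensor x' y'" by auto
    then have "length (fst x) = length (fst x')" using l by simp
    then have "fst x = fst x'" "fst y = fst y'" using eq * by (auto simp: summand_tensor_def)
    then have "x = x'" "y = y'" using assms * unfolding uniform_def inj_on_def by blast+
    then show "u = v" using * by simp
  qed
qed

lemma uniform_bar: "uniform S \<Longrightarrow> uniform (summand_bar ` S)"
  unfolding uniform_def inj_on_def by (auto simp: summand_bar_def)

lemma mor_tensor_in:
  assumes "f \<in> matrices S T" "g \<in> matrices S' T'"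
  shows "mor_tensor f g \<in> matrices (tensor_set S S') (tensor_set T T')"
  unfolding mor_tensor_eq
proof (rule bilin_ext_in_matrices)
  fix a b assume ab: "a \<in> Poly_Mapping.keys f" "b \<in> Poly_Mapping.keys g"
  obtain x D y x' E y' where e: "a = (x, D, y)" "b = (x', E, y')" by (cases a, cases b) blast
  show "tensor_basis a b \<in> matrices (tensor_set S S') (tensor_set T T')"
    using matricesD[OF assms(1), of x D y] matricesD[OF assms(2), of x' E y'] ab
    unfolding e tensor_basis_def prod.case
    by (intro single_in_matrices) (auto intro: juxtapose_tl)
qed

lemma mor_comp_tensor:
  assumes f: "f \<in> matrices S T" and g: "g \<in> matrices T R"
    and f': "f' \<in> matrices S' T'" and g': "g' \<in> matrices T' R'"
    and T: "uniform T" "uniform T'"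
  shows "mor_comp \<delta> (mor_tensor g g') (mor_tensor f f') = mor_tensor (mor_comp \<delta> g f) (mor_comp \<delta> g' f')"
  unfolding mor_comp_eq mor_tensor_eq
proof (rule bilin_ext_interchange)
  fix a a' b b' assume k: "a \<in> Poly_Mapping.keys g" "a' \<in> Poly_Mapping.keys g'"
    "b \<in> Poly_Mapping.keys f" "b' \<in> Poly_Mapping.keys f'"
  obtain y1 E z y1' E' z' where e: "a = (y1, E, z)" "a' = (y1', E', z')" by (cases a, cases a') blast
  obtain x D y x' D' y' where e': "b = (x, D, y)" "b' = (x', D', y')" by (cases b, cases b') blast
  have E: "y1 \<in> T" "E \<in> tl_diagrams (snd y1) (snd z)" "y1' \<in> T'" "E' \<in> tl_diagrams (snd y1') (snd z')"
    using matricesD[OF g, of y1 E z] matricesD[OF g', of y1' E' z'] k e by auto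
  have D: "y \<in> T" "D \<in> tl_diagrams (snd x) (snd y)" "y' \<in> T'" "D' \<in> tl_diagrams (snd x') (snd y')"
    using matricesD[OF f, of x D y] matricesD[OF f', of x' D' y'] k e' by auto
  have eq: "summand_tensor y y' = summand_tensor y1 y1' \<longleftrightarrow> y = y1 \<and> y' = y1'"
    using tensor_inject[OF T] E D by blast
  show "bilin_ext (comp_basis \<delta>) (tensor_basis a a') (tensor_basis b b') =
      bilin_ext tensor_basis (comp_basis \<delta> a b) (comp_basis \<delta> a' b')"
  proof (cases "y = y1 \<and> y' = y1'")
    case True
    then have E': "E \<in> tl_diagrams (snd y) (snd z)" "E' \<in> tl_diagrams (snd y') (snd z')" using E by auto
    show ?thesis
      using stack_juxtapose[OF D(2) E'(1) D(4) E'(2)] circles_juxtapose[OF D(2) E'(1) D(4) E'(2)] True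
      by (simp add: e e' comp_basis_def tensor_basis_def power_add)
  next
    case False
    then show ?thesis using eq by (auto simp: e e' comp_basis_def tensor_basis_def)
  qed
qed

lemma mor_star_star: "f \<in> matrices S T \<Longrightarrow> mor_star (mor_star f) = f"
proof -
  assume f: "f \<in> matrices S T"
  have "mor_star (mor_star f) = lin_ext (\<lambda>a. lin_ext star_basis (pm_cnj (star_basis a))) f"
    by (simp add: mor_star_eq pm_cnj_lin_ext lin_ext_lin_ext)
  also have "\<dots> = lin_ext (\<lambda>a. Poly_Mapping.single a 1) f"
  proof (rule lin_ext_cong)
    fix a assume a: "a \<in> Poly_Mapping.keys f"
    obtain x D y where e: "a = (x, D, y)" by (cases a) blast
    then have "D \<in> tl_diagrams (snd x) (snd y)" using matricesD[OF f] a by auto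
    from flip_flip[OF this] show "lin_ext star_basis (pm_cnj (star_basis a)) = Poly_Mapping.single a 1"
      by (simp add: e star_basis_def)
  qed
  finally show ?thesis by simp
qed

lemma mor_star_tensor:
  assumes "f \<in> matrices S T" "g \<in> matrices S' T'"
  shows "mor_star (mor_tensor f g) = mor_tensor (mor_star f) (mor_star g)"
  unfolding mor_star_eq mor_tensor_eq pm_cnj_bilin_ext lin_ext_bilin bilin_ext_of_lin
proof (rule bilin_ext_cong)
  fix a b assume ab: "a \<in> Poly_Mapping.keys (pm_cnj f)" "b \<in> Poly_Mapping.keys (pm_cnj g)"
  obtain x D y x' E y' where e: "a = (x, D, y)" "b = (x', E, y')" by (cases a, cases b) blast
  then have D: "D \<in> tl_diagrams (snd x) (snd y)" "E \<in> tl_diagrams (snd x') (snd y')"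
    using matricesD[OF assms(1), of x D y] matricesD[OF assms(2), of x' E y'] ab by auto
  show "lin_ext star_basis (pm_cnj (tensor_basis a b)) = bilin_ext tensor_basis (star_basis a) (star_basis b)"
    using flip_juxtapose[OF D] by (simp add: e tensor_basis_def star_basis_def)
qed

lemma mor_bar_in:
  assumes "f \<in> matrices S T"
  shows "mor_bar f \<in> matrices (summand_bar ` S) (summand_bar ` T)"
  unfolding mor_bar_eq
proof (rule lin_ext_in_matrices)
  fix a assume a: "a \<in> Poly_Mapping.keys (pm_cnj f)"
  obtain x D y where e: "a = (x, D, y)" by (cases a) blast
  show "bar_basis a \<in> matrices (summand_bar ` S) (summand_bar ` T)"
    using matricesD[OF assms, of x D y] a unfolding e bar_basis_def prod.case
    by (intro single_in_matrices) (auto intro: mirror_tl)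
qed

lemma mor_bar_bar: 
  assumes f: "f \<in> matrices S T"
  shows "mor_bar (mor_bar f) = f"
proof -
  have "mor_bar (mor_bar f) = lin_ext (\<lambda>a. lin_ext bar_basis (pm_cnj (bar_basis a))) f"
    by (simp add: mor_bar_eq pm_cnj_lin_ext lin_ext_lin_ext)
  also have "\<dots> = lin_ext (\<lambda>a. Poly_Mapping.single a 1) f"
  proof (rule lin_ext_cong)
    fix a assume a: "a \<in> Poly_Mapping.keys f"
    obtain x D y where e: "a = (x, D, y)" by (cases a) blast
    then have "D \<in> tl_diagrams (snd x) (snd y)" using matricesD[OF f] a by auto
    from mirror_mirror[OF this] show "lin_ext bar_basis (pm_cnj (bar_basis a)) = Poly_Mapping.single a 1"
      by (simp add: e bar_basis_def)
  qed
  finally show ?thesis by simp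
qed

lemma mor_star_bar:
  assumes f: "f \<in> matrices S T"
  shows "mor_star (mor_bar f) = mor_bar (mor_star f)"
proof -
  have "lin_ext (\<lambda>a. lin_ext star_basis (pm_cnj (bar_basis a))) f = lin_ext (\<lambda>a. lin_ext bar_basis (pm_cnj (star_basis a))) f"
  proof (rule lin_ext_cong)
    fix a assume a: "a \<in> Poly_Mapping.keys f"
    obtain x D y where e: "a = (x, D, y)" by (cases a) blast
    then have "D \<in> tl_diagrams (snd x) (snd y)" using matricesD[OF f] a by auto
    from flip_mirror[OF this] show "lin_ext star_basis (pm_cnj (bar_basis a)) = lin_ext bar_basis (pm_cnj (star_basis a))"
      by (simp add: e bar_basis_def star_basis_def)
  qed
  then show ?thesis by (simp add: mor_bar_eq mor_star_eq pm_cnj_lin_ext lin_ext_lin_ext)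
qed

lemma mor_bar_comp:
  assumes f: "f \<in> matrices S T" and g: "g \<in> matrices T R"
  shows "mor_bar (mor_comp \<delta> g f) = mor_comp \<delta> (mor_bar g) (mor_bar f)"
  unfolding mor_bar_eq mor_comp_eq pm_cnj_bilin_ext lin_ext_bilin bilin_ext_of_lin
proof (rule bilin_ext_cong)
  fix a b assume ab: "a \<in> Poly_Mapping.keys (pm_cnj g)" "b \<in> Poly_Mapping.keys (pm_cnj f)"
  obtain x D y y' E z where e: "b = (x, D, y)" "a = (y', E, z)" by (cases a, cases b) blast
  then have D: "D \<in> tl_diagrams (snd x) (snd y)" "E \<in> tl_diagrams (snd y') (snd z)"
    using matricesD[OF f, of x D y] matricesD[OF g, of y' E z] ab by auto
  show "lin_ext bar_basis (pm_cnj (comp_basis \<delta> a b)) = bilin_ext (comp_basis \<delta>) (bar_basis a) (bar_basis b)"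
  proof (cases "y = y'")
    case True
    then have "E \<in> tl_diagrams (snd y) (snd z)" using D by simp
    from stack_mirror[OF D(1) this] circles_mirror[OF D(1) this] show ?thesis
      using True by (simp add: e bar_basis_def comp_basis_def)
  next
    case False
    then show ?thesis by (simp add: e bar_basis_def comp_basis_def)
  qed
qed

lemma mor_bar_tensor:
  assumes f: "f \<in> matrices S T" and g: "g \<in> matrices S' T'"
  shows "mor_bar (mor_tensor f g) = mor_tensor (mor_bar g) (mor_bar f)"
proof -
  have "mor_bar (mor_tensor f g) = bilin_ext (\<lambda>x y. lin_ext bar_basis (pm_cnj (tensor_basis x y))) (pm_cnj f) (pm_cnj g)"
    unfolding mor_bar_eq mor_tensor_eq pm_cnj_bilin_ext lin_ext_bilin ..
  also have "\<dots> = bilin_ext (\<lambda>x y. bilin_ext tensor_basis (bar_basis y) (bar_basis x)) (pm_cnj f) (pm_cnj g)"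
  proof (rule bilin_ext_cong)
    fix a b assume ab: "a \<in> Poly_Mapping.keys (pm_cnj f)" "b \<in> Poly_Mapping.keys (pm_cnj g)"
    obtain x D y x' E y' where e: "a = (x, D, y)" "b = (x', E, y')" by (cases a, cases b) blast
    then have D: "D \<in> tl_diagrams (snd x) (snd y)" "E \<in> tl_diagrams (snd x') (snd y')"
      using matricesD[OF f, of x D y] matricesD[OF g, of x' E y'] ab by auto
    show "lin_ext bar_basis (pm_cnj (tensor_basis a b)) = bilin_ext tensor_basis (bar_basis b) (bar_basis a)"
      using mirror_juxtapose[OF D] by (simp add: e tensor_basis_def bar_basis_def summand_bar_tensor)
  qed
  also have "\<dots> = bilin_ext (\<lambda>y x. bilin_ext tensor_basis (bar_basis y) (bar_basis x)) (pm_cnj g) (pm_cnj f)"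
    by (rule bilin_ext_swap)
  also have "\<dots> = mor_tensor (mor_bar g) (mor_bar f)"
    unfolding mor_bar_eq mor_tensor_eq bilin_ext_of_lin ..
  finally show ?thesis .
qed

lemma mor_tensor_assoc: "mor_tensor (mor_tensor f g) h = mor_tensor f (mor_tensor g h)"
  unfolding mor_tensor_eq
proof (rule bilin_ext_assoc[symmetric])
  fix x y z
  show "bilin_ext tensor_basis (Poly_Mapping.single z 1) (tensor_basis y x) =
      bilin_ext tensor_basis (tensor_basis z y) (Poly_Mapping.single x 1)"
    by (cases x, cases y, cases z) (simp add: tensor_basis_def summand_tensor_assoc juxtapose_assoc)
qed

lemma mor_tensor_unit:
  "mor_tensor (Poly_Mapping.single (([], 0), {}, ([], 0)) 1) f = f"
  "mor_tensor f (Poly_Mapping.single (([], 0), {}, ([], 0)) 1) = f"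
proof -
  have *: "tensor_basis (([], 0), {}, ([], 0)) = (\<lambda>a. Poly_Mapping.single a 1)"
    "(\<lambda>a. tensor_basis a (([], 0), {}, ([], 0))) = (\<lambda>a. Poly_Mapping.single a 1)"
    by (auto simp: tensor_basis_def juxtapose_empty_left juxtapose_empty_right)
  show "mor_tensor (Poly_Mapping.single (([], 0), {}, ([], 0)) 1) f = f"
    "mor_tensor f (Poly_Mapping.single (([], 0), {}, ([], 0)) 1) = f"
    by (simp_all add: mor_tensor_eq bilin_ext_def *)
qed

section \<open>Objects and morphisms of the Karoubi completion\<close>

lemma tlj_objects_iff:
  "a \<in> tlj_objects \<delta> \<longleftrightarrow> uniform (fst a) \<and> snd a \<in> matrices (fst a) (fst a) \<and>
     mor_comp \<delta> (snd a) (snd a) = snd a \<and> mor_star (snd a) = snd a"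
  by (cases a) (auto simp: tlj_objects_def uniform_def)

lemma tlj_homD:
  assumes "f \<in> tlj_hom \<delta> a b"
  shows "f \<in> matrices (fst a) (fst b)" "mor_comp \<delta> (snd b) f = f" "mor_comp \<delta> f (snd a) = f"
  using assms by (auto simp: tlj_hom_def)

lemma tlj_homI:
  "f \<in> matrices (fst a) (fst b) \<Longrightarrow> mor_comp \<delta> (snd b) f = f \<Longrightarrow> mor_comp \<delta> f (snd a) = f \<Longrightarrow> f \<in> tlj_hom \<delta> a b"
  by (simp add: tlj_hom_def)

lemma id_hom: "a \<in> tlj_objects \<delta> \<Longrightarrow> tlj_id a \<in> tlj_hom \<delta> a a"
  by (simp add: tlj_objects_iff tlj_hom_def tlj_id_def)

lemma fst_obj_tensor: "fst (obj_tensor a b) = tensor_set (fst a) (fst b)"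
  and snd_obj_tensor: "snd (obj_tensor a b) = mor_tensor (snd a) (snd b)"
  and fst_obj_bar: "fst (obj_bar a) = summand_bar ` fst a"
  and snd_obj_bar: "snd (obj_bar a) = mor_bar (snd a)"
  by (simp_all add: obj_tensor_def obj_bar_def)

lemma obj_tensor_in:
  assumes "a \<in> tlj_objects \<delta>" "b \<in> tlj_objects \<delta>"
  shows "obj_tensor a b \<in> tlj_objects \<delta>"
proof -
  note A = assms[unfolded tlj_objects_iff]
  show ?thesis
    unfolding tlj_objects_iff fst_obj_tensor snd_obj_tensor
    using A uniform_tensor mor_tensor_in mor_comp_tensor[of "snd a" _ _ "snd a" _ "snd b" _ _ "snd b"]
      mor_star_tensor[of "snd a" _ _ "snd b"]
    by metis
qed

lemma obj_bar_in:
  assumes "a \<in> tlj_objects \<delta>"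
  shows "obj_bar a \<in> tlj_objects \<delta>"
proof -
  have A: "uniform (fst a)" "snd a \<in> matrices (fst a) (fst a)"
     "mor_comp \<delta> (snd a) (snd a) = snd a" "mor_star (snd a) = snd a" using assms[unfolded tlj_objects_iff] by auto
  show ?thesis
    unfolding tlj_objects_iff fst_obj_bar snd_obj_bar
    using uniform_bar[OF A(1)] mor_bar_in[OF A(2)] mor_bar_comp[OF A(2) A(2), of \<delta>] mor_star_bar[OF A(2)] A(3,4)
    by simp
qed

lemma id_object_in:
  assumes "uniform S"
  shows "(S, id_matrix S) \<in> tlj_objects \<delta>"
proof -
  have fin: "finite S" using assms by (simp add: uniform_def)
  have "mor_star (id_matrix S) = id_matrix S"
    by (simp add: mor_star_eq id_matrix_def pm_cnj_sum lin_ext_sum star_basis_def flip_id_diagram)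
  then show ?thesis
    using assms id_matrix_in mor_comp_id_left[OF id_matrix_in fin] by (simp add: tlj_objects_iff)
qed

lemma tl_object_eq: "tl_object n = ({([], n)}, id_matrix {([], n)})"
  by (simp add: tl_object_def id_matrix_def)

lemma unit_in: "tlj_unit \<in> tlj_objects \<delta>"
  unfolding tlj_unit_def tl_object_eq by (rule id_object_in) (simp add: uniform_def)

lemma tlj_unit_eq: "tlj_unit = ({([], 0)}, Poly_Mapping.single (([], 0), {}, ([], 0)) 1)"
  by (simp add: tlj_unit_def tl_object_def id_diagram_0)

lemma obj_tensor_assoc: "obj_tensor (obj_tensor a b) c = obj_tensor a (obj_tensor b c)"
proof (rule prod_eqI)
  show "snd (obj_tensor (obj_tensor a b) c) = snd (obj_tensor a (obj_tensor b c))"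
    by (simp add: snd_obj_tensor mor_tensor_assoc)
  show "fst (obj_tensor (obj_tensor a b) c) = fst (obj_tensor a (obj_tensor b c))"
    unfolding fst_obj_tensor
  proof (intro set_eqI iffI)
    fix u assume "u \<in> tensor_set (tensor_set (fst a) (fst b)) (fst c)"
    then obtain x y z where "x \<in> fst a" "y \<in> fst b" "z \<in> fst c" "u = summand_tensor x (summand_tensor y z)"
      by (auto simp: summand_tensor_assoc)
    then show "u \<in> tensor_set (fst a) (tensor_set (fst b) (fst c))" by force
  next
    fix u assume "u \<in> tensor_set (fst a) (tensor_set (fst b) (fst c))"
    then obtain x y z where "x \<in> fst a" "y \<in> fst b" "z \<in> fst c" "u = summand_tensor (summand_tensor x y) z"
      by (auto simp: summand_tensor_assoc)
    then show "u \<in> tensor_set (tensor_set (fst a) (fst b)) (fst c)" by force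
  qed
qed

lemma obj_tensor_unit [simp]: "obj_tensor tlj_unit a = a" "obj_tensor a tlj_unit = a"
  by (rule prod_eqI; simp add: fst_obj_tensor snd_obj_tensor tlj_unit_eq mor_tensor_unit image_iff; force)+

lemma obj_bar_bar:
  assumes "a \<in> tlj_objects \<delta>"
  shows "obj_bar (obj_bar a) = a"
  by (rule prod_eqI) (use assms in \<open>simp_all add: fst_obj_bar snd_obj_bar image_image tlj_objects_iff mor_bar_bar[of "snd a" "fst a" "fst a"]\<close>)

lemma obj_bar_tensor:
  assumes "a \<in> tlj_objects \<delta>" "b \<in> tlj_objects \<delta>"
  shows "obj_bar (obj_tensor a b) = obj_tensor (obj_bar b) (obj_bar a)"
proof (rule prod_eqI)
  show "snd (obj_bar (obj_tensor a b)) = snd (obj_tensor (obj_bar b) (obj_bar a))"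
    using assms mor_bar_tensor unfolding tlj_objects_iff snd_obj_bar snd_obj_tensor by blast
  show "fst (obj_bar (obj_tensor a b)) = fst (obj_tensor (obj_bar b) (obj_bar a))"
    unfolding fst_obj_bar fst_obj_tensor
  proof (intro set_eqI iffI)
    fix u assume "u \<in> summand_bar ` tensor_set (fst a) (fst b)"
    then obtain x y where "x \<in> fst a" "y \<in> fst b" "u = summand_tensor (summand_bar y) (summand_bar x)"
      by (auto simp: summand_bar_tensor)
    then show "u \<in> tensor_set (summand_bar ` fst b) (summand_bar ` fst a)" by force
  next
    fix u assume "u \<in> tensor_set (summand_bar ` fst b) (summand_bar ` fst a)"
    then obtain x y where "x \<in> fst a" "y \<in> fst b" "u = summand_bar (summand_tensor x y)"
      by (auto simp: summand_bar_tensor)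
    then show "u \<in> summand_bar ` tensor_set (fst a) (fst b)" by force
  qed
qed

lemma mor_comp_hom:
  assumes "a \<in> tlj_objects \<delta>" "b \<in> tlj_objects \<delta>" "c \<in> tlj_objects \<delta>" "f \<in> tlj_hom \<delta> a b" "g \<in> tlj_hom \<delta> b c"
  shows "mor_comp \<delta> g f \<in> tlj_hom \<delta> a c"
proof (rule tlj_homI)
  note f = tlj_homD[OF assms(4)] and g = tlj_homD[OF assms(5)]
  have p: "snd a \<in> matrices (fst a) (fst a)" "snd c \<in> matrices (fst c) (fst c)"
    using assms by (auto simp: tlj_objects_iff)
  show "mor_comp \<delta> g f \<in> matrices (fst a) (fst c)" by (rule mor_comp_in[OF f(1) g(1)])
  show "mor_comp \<delta> (snd c) (mor_comp \<delta> g f) = mor_comp \<delta> g f"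
    using mor_comp_assoc[OF f(1) g(1) p(2), of \<delta>] g(2) by simp
  show "mor_comp \<delta> (mor_comp \<delta> g f) (snd a) = mor_comp \<delta> g f"
    using mor_comp_assoc[OF p(1) f(1) g(1), of \<delta>] f(3) by simp
qed

lemma mor_tensor_hom:
  assumes "a \<in> tlj_objects \<delta>" "b \<in> tlj_objects \<delta>" "a' \<in> tlj_objects \<delta>" "b' \<in> tlj_objects \<delta>"
    "f \<in> tlj_hom \<delta> a b" "g \<in> tlj_hom \<delta> a' b'"
  shows "mor_tensor f g \<in> tlj_hom \<delta> (obj_tensor a a') (obj_tensor b b')"
proof (rule tlj_homI)
  note f = tlj_homD[OF assms(5)] and g = tlj_homD[OF assms(6)]
  have p: "snd x \<in> matrices (fst x) (fst x)" "uniform (fst x)" if "x \<in> tlj_objects \<delta>" for x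
    using that by (auto simp: tlj_objects_iff)
  show "mor_tensor f g \<in> matrices (fst (obj_tensor a a')) (fst (obj_tensor b b'))"
    unfolding fst_obj_tensor by (rule mor_tensor_in[OF f(1) g(1)])
  show "mor_comp \<delta> (snd (obj_tensor b b')) (mor_tensor f g) = mor_tensor f g"
    unfolding snd_obj_tensor
    using mor_comp_tensor[OF f(1) p(1)[OF assms(2)] g(1) p(1)[OF assms(4)] p(2)[OF assms(2)] p(2)[OF assms(4)]] f(2) g(2)
    by simp
  show "mor_comp \<delta> (mor_tensor f g) (snd (obj_tensor a a')) = mor_tensor f g"
    unfolding snd_obj_tensor
    using mor_comp_tensor[OF p(1)[OF assms(1)] f(1) p(1)[OF assms(3)] g(1) p(2)[OF assms(1)] p(2)[OF assms(3)]] f(3) g(3)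
    by simp
qed

lemma mor_bar_hom:
  assumes "a \<in> tlj_objects \<delta>" "b \<in> tlj_objects \<delta>" "f \<in> tlj_hom \<delta> a b"
  shows "mor_bar f \<in> tlj_hom \<delta> (obj_bar a) (obj_bar b)"
proof (rule tlj_homI)
  note f = tlj_homD[OF assms(3)]
  have p: "snd x \<in> matrices (fst x) (fst x)" if "x \<in> tlj_objects \<delta>" for x
    using that by (auto simp: tlj_objects_iff)
  show "mor_bar f \<in> matrices (fst (obj_bar a)) (fst (obj_bar b))"
    unfolding fst_obj_bar by (rule mor_bar_in[OF f(1)])
  show "mor_comp \<delta> (snd (obj_bar b)) (mor_bar f) = mor_bar f"
    unfolding snd_obj_bar using mor_bar_comp[OF f(1) p[OF assms(2)], of \<delta>] f(2) by simp
  show "mor_comp \<delta> (mor_bar f) (snd (obj_bar a)) = mor_bar f"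
    unfolding snd_obj_bar using mor_bar_comp[OF p[OF assms(1)] f(1), of \<delta>] f(3) by simp
qed

text \<open>The part of \<open>coev\<close> that precedes compression by the projection. It acts on
  loops by an explicit formula, whereas the projection is arbitrary.\<close>

definition cups :: "summand set \<Rightarrow> tl_mor" where
  "cups S = (\<Sum>x\<in>S. Poly_Mapping.single (([], 0), nested_cups (snd x), summand_tensor x (summand_bar x)) 1)"

lemma coev_eq: "coev \<delta> a = mor_comp \<delta> (snd (obj_tensor a (obj_bar a))) (cups (fst a))"
  by (simp add: coev_def tlj_id_def cups_def)

lemma cups_in: "cups S \<in> matrices {([], 0)} (tensor_set S (summand_bar ` S))"
  unfolding cups_def by (intro sum_in_matrices single_in_matrices) (auto intro: nested_cups_tl)

lemma cups_hom:
  assumes "uniform S"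
  defines "T \<equiv> tensor_set S (summand_bar ` S)"
  shows "cups S \<in> tlj_hom \<delta> tlj_unit (T, id_matrix T)"
proof (rule tlj_homI)
  have "finite T" using uniform_tensor[OF assms(1) uniform_bar[OF assms(1)]] by (simp add: uniform_def T_def)
  then show "mor_comp \<delta> (snd (T, id_matrix T)) (cups S) = cups S"
    using mor_comp_id_left[OF cups_in] by (simp add: T_def)
  show "mor_comp \<delta> (cups S) (snd tlj_unit) = cups S"
    using mor_comp_id_right[OF cups_in] by (simp add: tlj_unit_def tl_object_eq)
  show "cups S \<in> matrices (fst tlj_unit) (fst (T, id_matrix T))"
    using cups_in by (simp add: tlj_unit_def tl_object_eq T_def)
qed

text \<open>Read as a morphism from the full direct sum onto the object, the projection makes
  \<open>coev\<close> a composite of two morphisms of the category, to which functoriality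
  applies.\<close>

lemma projection_hom:
  assumes "a \<in> tlj_objects \<delta>"
  shows "snd a \<in> tlj_hom \<delta> (fst a, id_matrix (fst a)) a"
  using assms mor_comp_id_right[of "snd a" "fst a" "fst a" \<delta>]
  by (intro tlj_homI) (auto simp: tlj_objects_iff uniform_def)

lemma coev_hom:
  assumes "a \<in> tlj_objects \<delta>"
  shows "coev \<delta> a \<in> tlj_hom \<delta> tlj_unit (obj_tensor a (obj_bar a))"
proof -
  let ?b = "obj_tensor a (obj_bar a)"
  have b: "?b \<in> tlj_objects \<delta>" by (intro obj_tensor_in obj_bar_in assms)
  have u: "uniform (fst a)" using assms by (simp add: tlj_objects_iff)
  have T: "tensor_set (fst a) (summand_bar ` fst a) = fst ?b" by (simp add: fst_obj_tensor fst_obj_bar)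
  have "uniform (fst ?b)" using b by (simp add: tlj_objects_iff)
  from mor_comp_hom[OF unit_in id_object_in[OF this] b _ projection_hom[OF b]] cups_hom[OF u]
  show ?thesis unfolding T coev_eq by blast
qed

text \<open>Hence the right inner product is evaluated by the same cups as the left one, for the
  conjugate object.\<close>

lemma mor_star_ev:
  assumes "a \<in> tlj_objects \<delta>"
  shows "mor_star (ev \<delta> a) = coev \<delta> (obj_bar a)"
  unfolding ev_def using tlj_homD(1)[OF coev_hom[OF obj_bar_in[OF assms]]] by (rule mor_star_star)


section \<open>W*-categories and faithful embeddings\<close>

lemma (in vector_space) finite_basis_of_subspace:
  assumes "subspace W" "W \<subseteq> span B" "finite B"
  obtains B' where "finite B'" "B' \<subseteq> W" "independent B'" "W = span B'"
proof -
  obtain B' where B': "B' \<subseteq> W" "independent B'" "W \<subseteq> span B'"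
    using basis_exists[of W] by metis
  have "finite B'" using independent_span_bound[of B B'] assms B' by auto
  moreover have "span B' \<subseteq> W" using B'(1) assms(1) by (rule span_minimal)
  ultimately show ?thesis using that B' by blast
qed

text \<open>Dimension count: the image of a basis \<open>B\<close> of \<open>W\<close> is
  independent with as many elements as \<open>B\<close>, so a vector of \<open>W\<close> outside its
  span would produce an independent set in \<open>W\<close> that is too large.\<close>

lemma lin_map_injective_imp_surjective:
  fixes s :: "complex \<Rightarrow> 'v::ab_group_add \<Rightarrow> 'v"
  assumes s: "vector_space s" and W: "module.subspace s W" "W \<subseteq> module.span s B" "finite B"
    and f: "lin_map s W s W f" and inj: "inj_on f W"
  shows "f ` W = W"
proof
  show "f ` W \<subseteq> W" using f by (auto simp: lin_map_def)
  interpret vector_space s by (rule s)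
  obtain B where B: "finite B" "B \<subseteq> W" "independent B" "W = span B"
    using finite_basis_of_subspace[OF W] by metis
  interpret pair: vector_space_pair s s ..
  \<comment> \<open>\<open>f\<close> is only known to be linear on \<open>W\<close>. It is replaced
    by a map which is linear on the whole type and agrees with it on a basis, hence on
    \<open>W\<close>.\<close>
  obtain g where g: "Vector_Spaces.linear s s g" "\<And>x. x \<in> B \<Longrightarrow> g x = f x"
    using pair.linear_independent_extend[OF B(3), of f] by blast
  interpret g: Vector_Spaces.linear s s g by (rule g(1))
  have f0: "f 0 = 0"
  proof -
    have "0 \<in> W" using W(1) by (rule subspace_0)
    then have "f (s 0 0) = s 0 (f 0)" using f unfolding lin_map_def by blast
    then show ?thesis by simp
  qed
  have gf: "g x = f x" if "x \<in> W" for x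
  proof -
    have "x \<in> span B" using that B(4) by simp
    then have "g x = f x \<and> x \<in> W"
    proof (induction rule: span_induct_alt)
      case base
      then show ?case using f0 g.zero subspace_0[OF W(1)] by simp
    next
      case (step c x y)
      have "x \<in> W" using step B(2) by blast
      moreover have "s c x \<in> W" using \<open>x \<in> W\<close> W(1) by (simp add: subspace_scale)
      ultimately have "f (s c x + y) = s c (f x) + f y"
        using f step unfolding lin_map_def by metis
      moreover have "s c x + y \<in> W"
        using \<open>s c x \<in> W\<close> step W(1) by (simp add: subspace_add)
      ultimately show ?case using step g(2) by (simp add: g.add g.scale)
    qed
    then show ?thesis by simp
  qed
  have injg: "inj_on g (span B)"
    using inj gf unfolding B(4) inj_on_def by metis
  have ind: "independent (g ` B)"
    using pair.linear_independent_injective_image[OF g(1) B(3) injg] .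
  have gW: "g ` span B \<subseteq> W"
    using gf f unfolding lin_map_def B(4)[symmetric] by auto
  show "W \<subseteq> f ` W"
  proof
    fix v assume v: "v \<in> W"
    have "v \<in> span (g ` B)"
    proof (rule ccontr)
      assume nv: "v \<notin> span (g ` B)"
      then have "independent (insert v (g ` B))" using ind by (rule independent_insertI)
      moreover have "g ` B \<subseteq> span B" using gW B(4) span_superset by blast
      then have "insert v (g ` B) \<subseteq> span B" using v B(4) by blast
      ultimately have "card (insert v (g ` B)) \<le> card B"
        using independent_span_bound[OF B(1)] by blast
      moreover have "card (g ` B) = card B"
        using injg span_superset by (meson card_image inj_on_subset)
      moreover have "v \<notin> g ` B" using nv span_superset by blast
      ultimately show False using B(1) by simp
    qed
    also have "span (g ` B) = g ` span B" by (rule g.span_image)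
    finally show "v \<in> f ` W" using gf B(4) by auto
  qed
qed

section \<open>Linear maps on subspaces, and separation by functionals\<close>

lemma lin_mapD:
  assumes "lin_map s V t W f"
  shows "u \<in> V \<Longrightarrow> f u \<in> W" "u \<in> V \<Longrightarrow> v \<in> V \<Longrightarrow> f (u + v) = f u + f v"
    "u \<in> V \<Longrightarrow> f (s c u) = t c (f u)"
  using assms by (auto simp: lin_map_def)

lemma lin_map_subset: "lin_map s V t W f \<Longrightarrow> U \<subseteq> V \<Longrightarrow> f ` U \<subseteq> X \<Longrightarrow> lin_map s U t X f"
  unfolding lin_map_def by blast

lemma lin_map_diff:
  assumes "vector_space s" "vector_space t" "module.subspace s V" "lin_map s V t W f" "u \<in> V" "v \<in> V"
  shows "f (u - v) = f u - f v"
proof -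
  interpret s: vector_space s by fact
  interpret t: vector_space t by fact
  have "s (-1) v \<in> V" using assms by (simp add: s.subspace_scale del: s.scale_minus_left)
  then have "f (u + s (-1) v) = f u + t (-1) (f v)"
    using lin_mapD(2,3)[OF assms(4)] assms(5,6) by metis
  then show ?thesis by simp
qed

lemma lin_map_zero:
  assumes "vector_space s" "vector_space t" "module.subspace s V" "lin_map s V t W f"
  shows "f 0 = 0"
proof -
  interpret s: vector_space s by fact
  have "0 \<in> V" using assms(3) by (rule s.subspace_0)
  from lin_map_diff[OF assms this this] show ?thesis by simp
qed

lemma lin_map_image_subspace:
  assumes "vector_space s" "vector_space t" "module.subspace s V" "lin_map s V t W f"
  shows "module.subspace t (f ` V)"
proof -
  interpret s: vector_space s by fact
  interpret t: vector_space t by fact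
  show ?thesis
  proof (rule t.subspaceI)
    have "0 \<in> V" using assms(3) by (rule s.subspace_0)
    then show "0 \<in> f ` V" using lin_map_zero[OF assms] by (metis imageI)
    fix x y assume "x \<in> f ` V" "y \<in> f ` V"
    then obtain u v where uv: "u \<in> V" "v \<in> V" "x = f u" "y = f v" by blast
    then have "x + y = f (u + v)" using lin_mapD(2)[OF assms(4)] by simp
    then show "x + y \<in> f ` V" using s.subspace_add[OF assms(3) uv(1,2)] by blast
  next
    fix c x assume "x \<in> f ` V"
    then obtain u where u: "u \<in> V" "x = f u" by blast
    then have "t c x = f (s c u)" using lin_mapD(3)[OF assms(4)] by simp
    then show "t c x \<in> f ` V" using s.subspace_scale[OF assms(3) u(1)] by blast
  qed
qed

text \<open>
  A separating space of functionals separates points from finite-dimensional subspaces, which are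
  therefore norm closed and weak* closed.
\<close>

lemma separating_functional:
  fixes s :: "complex \<Rightarrow> 'v::ab_group_add \<Rightarrow> 'v"
  assumes s: "vector_space s" and X: "module.subspace s X"
    and P: "\<And>\<phi> \<psi>. \<phi> \<in> P \<Longrightarrow> \<psi> \<in> P \<Longrightarrow> (\<lambda>x. \<phi> x + \<psi> x) \<in> P"
      "\<And>c \<phi>. \<phi> \<in> P \<Longrightarrow> (\<lambda>x. c * \<phi> x) \<in> P"
      "\<And>\<phi>. \<phi> \<in> P \<Longrightarrow> lin_map s X (*) UNIV \<phi>"
    and sep: "\<And>x. x \<in> X \<Longrightarrow> (\<forall>\<phi>\<in>P. \<phi> x = 0) \<Longrightarrow> x = 0"
    and B: "finite B" "B \<subseteq> X"
    and x: "x \<in> X" "x \<notin> module.span s B"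
  shows "\<exists>\<phi>\<in>P. (\<forall>y\<in>module.span s B. \<phi> y = 0) \<and> \<phi> x \<noteq> 0"
proof -
  interpret vector_space s by (rule s)
  show ?thesis using B x
proof (induction B arbitrary: x rule: finite_induct)
  case empty
  then have "x \<noteq> 0" by auto
  then obtain \<phi> where \<phi>: "\<phi> \<in> P" "\<phi> x \<noteq> 0" using sep empty by blast
  then have "\<phi> (s 0 x) = 0 * \<phi> x" using lin_mapD(3)[OF P(3)] empty by blast
  then show ?case using \<phi> by auto
next
  case (insert b B)
  have bX: "b \<in> X" and BX: "B \<subseteq> X" using insert by auto
  show ?case
  proof (cases "b \<in> span B")
    case True
    then have "span (insert b B) = span B" by (rule span_redundant)
    then show ?thesis using insert.IH[OF BX] insert.prems by simp
  next
    case False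
    obtain \<psi> where \<psi>: "\<psi> \<in> P" "\<forall>y\<in>span B. \<psi> y = 0" "\<psi> b \<noteq> 0"
      using insert.IH[OF BX bX False] by blast
    \<comment> \<open>Subtracting a multiple of \<open>b\<close> moves \<open>x\<close> into the
      kernel of \<open>\<psi>\<close>; the result is still outside the span of \<open>B\<close>, so
      the induction hypothesis applies to it.\<close>
    define y where "y = x - s (\<psi> x / \<psi> b) b"
    have yX: "y \<in> X" using insert.prems bX X by (simp add: y_def subspace_diff subspace_scale)
    have "y \<notin> span B" using insert.prems(3) by (auto simp: y_def span_breakdown_eq)
    then obtain \<phi> where \<phi>: "\<phi> \<in> P" "\<forall>y\<in>span B. \<phi> y = 0" "\<phi> y \<noteq> 0"
      using insert.IH[OF BX yX] by blast
    \<comment> \<open>Correcting \<open>\<phi>\<close> by a multiple of \<open>\<psi>\<close> kills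
      \<open>b\<close>, and both vanish on the span of \<open>B\<close>. As \<open>\<psi>\<close>
      vanishes at \<open>y\<close>, the value at \<open>x\<close> is still the nonzero
      \<open>\<phi> y\<close>.\<close>
    let ?\<chi> = "\<lambda>z. \<phi> z + (- (\<phi> b / \<psi> b)) * \<psi> z"
    have \<chi>: "?\<chi> \<in> P" by (intro P(1) P(2) \<phi>(1) \<psi>(1))
    note lin = lin_mapD[OF P(3)[OF \<chi>]]
    have b0: "?\<chi> b = 0" using \<psi>(3) by simp
    have \<chi>0: "?\<chi> z = 0" if z: "z \<in> span (insert b B)" for z
    proof -
      obtain k where k: "z - s k b \<in> span B" using z span_breakdown_eq by blast
      have "span B \<subseteq> X" using BX X by (rule span_minimal)
      then have "?\<chi> ((z - s k b) + s k b) = ?\<chi> (z - s k b) + ?\<chi> (s k b)"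
        using k bX X by (intro lin(2)) (auto simp: subspace_scale)
      moreover have "?\<chi> (s k b) = 0" using lin(3)[OF bX, of k] b0 by simp
      ultimately show ?thesis using k \<phi>(2) \<psi>(2) by simp
    qed
    have "?\<chi> x \<noteq> 0"
    proof -
      have "?\<chi> (y + s (\<psi> x / \<psi> b) b) = ?\<chi> y + ?\<chi> (s (\<psi> x / \<psi> b) b)"
        using yX bX X by (intro lin(2)) (auto simp: subspace_scale)
      moreover have "?\<chi> (s (\<psi> x / \<psi> b) b) = 0" using lin(3)[OF bX] b0 by simp
      moreover have "\<psi> y = 0"
      proof -
        have "\<psi> (y + s (\<psi> x / \<psi> b) b) = \<psi> y + (\<psi> x / \<psi> b) * \<psi> b"
          using lin_mapD(2,3)[OF P(3)[OF \<psi>(1)]] yX bX subspace_scale[OF X bX] by metis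
        then show ?thesis using \<psi>(3) by (simp add: y_def)
      qed
      ultimately show ?thesis using \<phi>(3) by (simp add: y_def)
    qed
    then show ?thesis
      by (intro bexI[OF _ \<chi>] conjI ballI \<chi>0)
  qed
qed
qed

section \<open>Norms, functional norms and preduals\<close>

lemma banach_normD:
  assumes "banach_norm s X nrm"
  shows "x \<in> X \<Longrightarrow> nrm x \<ge> 0" "x \<in> X \<Longrightarrow> nrm x = 0 \<longleftrightarrow> x = 0"
    "x \<in> X \<Longrightarrow> y \<in> X \<Longrightarrow> nrm (x + y) \<le> nrm x + nrm y"
    "x \<in> X \<Longrightarrow> nrm (s c x) = cmod c * nrm x"
  using assms unfolding banach_norm_def by blast+

lemma banach_norm_complete:
  assumes "banach_norm s X nrm" "\<forall>n. u n \<in> X"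
    "\<forall>e>0. \<exists>N. \<forall>m\<ge>N. \<forall>n\<ge>N. nrm (u m - u n) < e"
  shows "\<exists>x\<in>X. (\<lambda>n. nrm (u n - x)) \<longlonglongrightarrow> 0"
  using assms(1) unfolding banach_norm_def by (elim conjE allE[of _ u]) (use assms(2,3) in simp)

text \<open>The supremum in \<open>functional_norm\<close> is conditional, and every estimate of it
  needs this upper bound. The absolute value is taken because a bounding constant could be negative
  on the zero space.\<close>

lemma functional_norm_bdd:
  assumes "\<And>x. x \<in> X \<Longrightarrow> cmod (\<phi> x) \<le> C * nrm x" "\<And>x. x \<in> X \<Longrightarrow> nrm x \<ge> 0"
  shows "bdd_above {cmod (\<phi> x) | x. x \<in> X \<and> nrm x \<le> 1}"
proof (rule bdd_aboveI[of _ "\<bar>C\<bar>"])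
  fix r assume "r \<in> {cmod (\<phi> x) | x. x \<in> X \<and> nrm x \<le> 1}"
  then obtain x where x: "r = cmod (\<phi> x)" "x \<in> X" "nrm x \<le> 1" by blast
  have "r \<le> C * nrm x" using assms(1)[OF x(2)] x(1) by simp
  also have "\<dots> \<le> \<bar>C\<bar> * nrm x" using assms(2)[OF x(2)] by (simp add: mult_right_mono)
  also have "\<dots> \<le> \<bar>C\<bar> * 1" using x(3) by (intro mult_left_mono) auto
  finally show "r \<le> \<bar>C\<bar>" by simp
qed

lemma functional_norm_bound:
  assumes lin: "lin_map s X (*) UNIV \<phi>" and nrm: "banach_norm s X nrm"
    and sub: "vector_space s" "module.subspace s X"
    and C: "\<And>x. x \<in> X \<Longrightarrow> cmod (\<phi> x) \<le> C * nrm x" and x: "x \<in> X"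
  shows "cmod (\<phi> x) \<le> functional_norm X nrm \<phi> * nrm x"
proof (cases "x = 0")
  case True
  interpret vector_space s by fact
  have "\<phi> (s 0 x) = 0 * \<phi> x" using lin_mapD(3)[OF lin x] .
  then show ?thesis using True banach_normD(2)[OF nrm x] by simp
next
  case False
  interpret vector_space s by fact
  have pos: "nrm x > 0" using banach_normD(1,2)[OF nrm x] False by simp
  let ?y = "s (of_real (inverse (nrm x))) x"
  have y: "?y \<in> X" using subspace_scale[OF sub(2) x] .
  have "nrm ?y = 1" using banach_normD(4)[OF nrm x] pos by (simp add: norm_inverse)
  then have "cmod (\<phi> ?y) \<le> functional_norm X nrm \<phi>"
    unfolding functional_norm_def
    using y functional_norm_bdd[OF C banach_normD(1)[OF nrm]] by (intro cSup_upper) auto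
  moreover have "cmod (\<phi> ?y) = inverse (nrm x) * cmod (\<phi> x)"
    using lin_mapD(3)[OF lin x] pos by (simp add: norm_mult norm_inverse)
  ultimately have "nrm x * (inverse (nrm x) * cmod (\<phi> x)) \<le> nrm x * functional_norm X nrm \<phi>"
    using pos by (intro mult_left_mono) auto
  moreover have "nrm x * (inverse (nrm x) * cmod (\<phi> x)) = cmod (\<phi> x)"
    using pos by (simp add: mult.assoc[symmetric])
  ultimately show ?thesis by (simp only: mult.commute)
qed

text \<open>Of \<open>K\<close> only hom subspaces closed under the operations are assumed: its
  equations will hold because they hold in \<open>L\<close> after the injective
  \<open>\<theta>\<close>. Analytic structure is assumed for \<open>L\<close> alone, and finite
  dimension for the hom spaces of \<open>L\<close> that receive those of \<open>K\<close>.\<close>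

locale cat_embedding =
  fixes K :: "('o, 'v::ab_group_add) star_cat" and L :: "('p, 'w::ab_group_add) star_cat"
    and F :: "'o \<Rightarrow> 'p" and \<theta> :: "'o \<Rightarrow> 'o \<Rightarrow> 'v \<Rightarrow> 'w"
  assumes L: "W_star_category L"
    and vs: "vector_space (smul K)"
    and sub: "\<And>A B. A \<in> obs K \<Longrightarrow> B \<in> obs K \<Longrightarrow> module.subspace (smul K) (hom K A B)"
    and F: "\<And>A. A \<in> obs K \<Longrightarrow> F A \<in> obs L"
    and lin: "\<And>A B. A \<in> obs K \<Longrightarrow> B \<in> obs K \<Longrightarrow>
       lin_map (smul K) (hom K A B) (smul L) (hom L (F A) (F B)) (\<theta> A B)"
    and inj: "\<And>A B. A \<in> obs K \<Longrightarrow> B \<in> obs K \<Longrightarrow> inj_on (\<theta> A B) (hom K A B)"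
    and cmp_mem: "\<And>A B C f g. A \<in> obs K \<Longrightarrow> B \<in> obs K \<Longrightarrow> C \<in> obs K \<Longrightarrow> f \<in> hom K A B \<Longrightarrow>
       g \<in> hom K B C \<Longrightarrow> cmp K A B C g f \<in> hom K A C"
    and cmp: "\<And>A B C f g. A \<in> obs K \<Longrightarrow> B \<in> obs K \<Longrightarrow> C \<in> obs K \<Longrightarrow> f \<in> hom K A B \<Longrightarrow>
       g \<in> hom K B C \<Longrightarrow> \<theta> A C (cmp K A B C g f) = cmp L (F A) (F B) (F C) (\<theta> B C g) (\<theta> A B f)"
    and idn_mem: "\<And>A. A \<in> obs K \<Longrightarrow> idn K A \<in> hom K A A"
    and idn: "\<And>A. A \<in> obs K \<Longrightarrow> \<theta> A A (idn K A) = idn L (F A)"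
    and dag_mem: "\<And>A B f. A \<in> obs K \<Longrightarrow> B \<in> obs K \<Longrightarrow> f \<in> hom K A B \<Longrightarrow> dag K A B f \<in> hom K B A"
    and dag: "\<And>A B f. A \<in> obs K \<Longrightarrow> B \<in> obs K \<Longrightarrow> f \<in> hom K A B \<Longrightarrow>
       \<theta> B A (dag K A B f) = dag L (F A) (F B) (\<theta> A B f)"
    and fin: "\<And>A B. A \<in> obs K \<Longrightarrow> B \<in> obs K \<Longrightarrow>
       \<exists>S. finite S \<and> hom L (F A) (F B) \<subseteq> module.span (smul L) S"
begin

sublocale L: star_category L
  using L by (simp add: W_star_category_def)

sublocale vK: vector_space "smul K" by (rule vs)

sublocale vL: vector_space "smul L" by (rule L.vector_space)

lemma eqI: "A \<in> obs K \<Longrightarrow> B \<in> obs K \<Longrightarrow> f \<in> hom K A B \<Longrightarrow> g \<in> hom K A B \<Longrightarrow> \<theta> A B f = \<theta> A B g \<Longrightarrow> f = g"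
  using inj by (meson inj_onD)

lemmas mem = lin_mapD(1)[OF lin] and add = lin_mapD(2)[OF lin] and scale = lin_mapD(3)[OF lin]

lemma add_mem: "A \<in> obs K \<Longrightarrow> B \<in> obs K \<Longrightarrow> f \<in> hom K A B \<Longrightarrow> g \<in> hom K A B \<Longrightarrow> f + g \<in> hom K A B"
  using vK.subspace_add[OF sub] .

lemma scale_mem: "A \<in> obs K \<Longrightarrow> B \<in> obs K \<Longrightarrow> f \<in> hom K A B \<Longrightarrow> smul K c f \<in> hom K A B"
  using vK.subspace_scale[OF sub] .

lemma star_category: "star_category K"
proof
  fix A B C f assume o: "A \<in> obs K" "B \<in> obs K" "C \<in> obs K" and f: "f \<in> hom K A B"
  note Lin = lin_mapD[OF L.cmp_linear_left[OF F[OF o(1)] F[OF o(2)] F[OF o(3)] mem[OF o(1,2) f]]]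
  show "lin_map (smul K) (hom K B C) (smul K) (hom K A C) (\<lambda>g. cmp K A B C g f)"
    unfolding lin_map_def
  proof (intro conjI ballI allI)
    fix g h c assume g: "g \<in> hom K B C"
    show "cmp K A B C g f \<in> hom K A C" using cmp_mem o f g by simp
    show "cmp K A B C (smul K c g) f = smul K c (cmp K A B C g f)"
      by (rule eqI[of A C]) (use o f g Lin(3)[OF mem[OF o(2,3) g]] in
        \<open>simp_all add: cmp scale scale_mem cmp_mem\<close>)
    assume h: "h \<in> hom K B C"
    show "cmp K A B C (g + h) f = cmp K A B C g f + cmp K A B C h f"
      by (rule eqI[of A C]) (use o f g h Lin(2)[OF mem[OF o(2,3) g] mem[OF o(2,3) h]] in
        \<open>simp_all add: cmp add add_mem cmp_mem\<close>)
  qed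
next
  fix A B C g assume o: "A \<in> obs K" "B \<in> obs K" "C \<in> obs K" and g: "g \<in> hom K B C"
  note Lin = lin_mapD[OF L.cmp_linear_right[OF F[OF o(1)] F[OF o(2)] F[OF o(3)] mem[OF o(2,3) g]]]
  show "lin_map (smul K) (hom K A B) (smul K) (hom K A C) (\<lambda>f. cmp K A B C g f)"
    unfolding lin_map_def
  proof (intro conjI ballI allI)
    fix f h c assume f: "f \<in> hom K A B"
    show "cmp K A B C g f \<in> hom K A C" using cmp_mem o f g by simp
    show "cmp K A B C g (smul K c f) = smul K c (cmp K A B C g f)"
      by (rule eqI[of A C]) (use o f g Lin(3)[OF mem[OF o(1,2) f]] in
        \<open>simp_all add: cmp scale scale_mem cmp_mem\<close>)
    assume h: "h \<in> hom K A B"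
    show "cmp K A B C g (f + h) = cmp K A B C g f + cmp K A B C g h"
      by (rule eqI[of A C]) (use o f g h Lin(2)[OF mem[OF o(1,2) f] mem[OF o(1,2) h]] in
        \<open>simp_all add: cmp add add_mem cmp_mem\<close>)
  qed
next
  fix A B C D f g h
  assume o: "A \<in> obs K" "B \<in> obs K" "C \<in> obs K" "D \<in> obs K"
    and f: "f \<in> hom K A B" "g \<in> hom K B C" "h \<in> hom K C D"
  show "cmp K A B D (cmp K B C D h g) f = cmp K A C D h (cmp K A B C g f)"
    by (rule eqI[of A D]) (use o f L.cmp_assoc[OF F[OF o(1)] F[OF o(2)] F[OF o(3)] F[OF o(4)]
        mem[OF o(1,2) f(1)] mem[OF o(2,3) f(2)] mem[OF o(3,4) f(3)]] in \<open>simp_all add: cmp cmp_mem\<close>)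
next
  fix A B f assume o: "A \<in> obs K" "B \<in> obs K" and f: "f \<in> hom K A B"
  show "cmp K A B B (idn K B) f = f"
    by (rule eqI[of A B]) (use o f in \<open>simp_all add: cmp cmp_mem idn_mem idn L.cmp_idn_left F mem\<close>)
  show "cmp K A A B f (idn K A) = f"
    by (rule eqI[of A B]) (use o f in \<open>simp_all add: cmp cmp_mem idn_mem idn L.cmp_idn_right F mem\<close>)
  show "dag K B A (dag K A B f) = f"
    by (rule eqI[of A B]) (use o f in \<open>simp_all add: dag dag_mem L.dag_dag F mem\<close>)
next
  fix A B assume o: "A \<in> obs K" "B \<in> obs K"
  note Lin = lin_mapD[OF L.dag_antilinear[OF F[OF o(1)] F[OF o(2)], unfolded antilin_map_def]]
  show "antilin_map (smul K) (hom K A B) (smul K) (hom K B A) (dag K A B)"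
    unfolding antilin_map_def lin_map_def
  proof (intro conjI ballI allI)
    fix f h c assume f: "f \<in> hom K A B"
    show "dag K A B f \<in> hom K B A" using dag_mem o f by simp
    show "dag K A B (smul K c f) = smul K (cnj c) (dag K A B f)"
      by (rule eqI[of B A]) (use o f Lin(3)[OF mem[OF o f]] in
        \<open>simp_all add: dag dag_mem scale scale_mem\<close>)
    assume h: "h \<in> hom K A B"
    show "dag K A B (f + h) = dag K A B f + dag K A B h"
      by (rule eqI[of B A]) (use o f h Lin(2)[OF mem[OF o f] mem[OF o h]] in
        \<open>simp_all add: dag dag_mem add add_mem\<close>)
  qed
next
  fix A B C f g assume o: "A \<in> obs K" "B \<in> obs K" "C \<in> obs K" and f: "f \<in> hom K A B" "g \<in> hom K B C"
  show "dag K A C (cmp K A B C g f) = cmp K C B A (dag K A B f) (dag K B C g)"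
    by (rule eqI[of C A]) (use o f L.dag_cmp[OF F[OF o(1)] F[OF o(2)] F[OF o(3)] mem[OF o(1,2) f(1)] mem[OF o(2,3) f(2)]] in
        \<open>simp_all add: cmp cmp_mem dag dag_mem\<close>)
qed (use vs sub idn_mem in auto)

lemma image_subspace:
  assumes "A \<in> obs K" "B \<in> obs K"
  shows "vL.subspace (\<theta> A B ` hom K A B)"
  by (rule lin_map_image_subspace[OF vs L.vector_space sub lin]) (use assms in auto)

text \<open>If \<open>X\<close>, the image of \<open>x - z\<close>, has an inverse \<open>y\<close>
  in \<open>L\<close>, composition with \<open>X\<close> maps the image of \<open>hom K A A\<close>
  injectively into itself, hence onto. The identity is then \<open>X\<close> times some
  \<open>\<theta> h\<close>, and \<open>y = \<theta> h\<close> comes from \<open>K\<close>.\<close>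

lemma spectrum:
  assumes A: "A \<in> obs K" and x: "x \<in> hom K A A"
  shows "end_spectrum K A x \<subseteq> end_spectrum L (F A) (\<theta> A A x)"
proof -
  have "z \<notin> end_spectrum K A x" if z: "z \<notin> end_spectrum L (F A) (\<theta> A A x)" for z
  proof -
    let ?x = "x - smul K z (idn K A)" and ?W = "\<theta> A A ` hom K A A"
    define X where "X = \<theta> A A x - smul L z (idn L (F A))"
    have FA: "F A \<in> obs L" using F A by simp
    have x': "?x \<in> hom K A A" using vK.subspace_diff[OF sub[OF A A] x scale_mem[OF A A idn_mem[OF A]]] .
    have X: "\<theta> A A ?x = X"
      using lin_map_diff[OF vs L.vector_space sub[OF A A] lin[OF A A] x scale_mem[OF A A idn_mem[OF A]]]
      by (simp add: X_def scale A idn_mem idn)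
    obtain y where y: "y \<in> hom L (F A) (F A)" "cmp L (F A) (F A) (F A) X y = idn L (F A)"
        "cmp L (F A) (F A) (F A) y X = idn L (F A)"
      using z unfolding end_spectrum_def X_def by blast
    have WL: "?W \<subseteq> hom L (F A) (F A)" using mem[OF A A] by blast
    have XL: "X \<in> hom L (F A) (F A)" using X mem[OF A A x'] by simp
    let ?f = "\<lambda>g. cmp L (F A) (F A) (F A) X g"
    have "?f ` ?W \<subseteq> ?W"
    proof
      fix g assume "g \<in> ?f ` ?W"
      then obtain h where h: "h \<in> hom K A A" "g = ?f (\<theta> A A h)" by blast
      then have "g = \<theta> A A (cmp K A A A ?x h)" using cmp[OF A A A h(1) x'] X by simp
      then show "g \<in> ?W" using cmp_mem[OF A A A h(1) x'] by blast
    qed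
    then have f: "lin_map (smul L) ?W (smul L) ?W ?f"
      by (rule lin_map_subset[OF L.cmp_linear_right[OF FA FA FA XL] WL])
    have yX: "cmp L (F A) (F A) (F A) y (?f g) = g" if "g \<in> hom L (F A) (F A)" for g
      using L.cmp_assoc[OF FA FA FA FA that XL y(1)] L.cmp_idn_left[OF FA FA that] y(3) by simp
    then have "inj_on ?f ?W" using WL by (intro inj_onI) (metis subsetD)
    moreover obtain S where "finite S" "hom L (F A) (F A) \<subseteq> vL.span S" using fin[OF A A] by blast
    ultimately have "?f ` ?W = ?W"
      using lin_map_injective_imp_surjective[OF L.vector_space image_subspace[OF A A] _ _ f] WL by blast
    moreover have "idn L (F A) \<in> ?W" using idn[OF A] idn_mem[OF A] by (metis imageI)
    ultimately obtain h where h: "h \<in> hom K A A" "?f (\<theta> A A h) = idn L (F A)" by (metis imageE)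
    have "y = \<theta> A A h"
      using yX[OF mem[OF A A h(1)]] h(2) L.cmp_idn_right[OF FA FA y(1)] by simp
    then have "cmp K A A A ?x h = idn K A" "cmp K A A A h ?x = idn K A"
      using y(3) by (auto intro!: eqI[OF A A] simp: cmp_mem idn_mem A h x' cmp X idn)
    then show ?thesis using h(1) unfolding end_spectrum_def by blast
  qed
  then show ?thesis by blast
qed

text \<open>The norm is pulled back along \<open>\<theta>\<close>, and the predual consists of the
  functionals of the old predual composed with \<open>\<theta>\<close>. Completeness and the duality
  condition both produce an element of the larger hom space, which has to be placed in the image;
  \<open>kill\<close> does this in either case.\<close>

lemma W_star_category: "W_star_category K"
proof -
  obtain nrm where
    ban: "\<And>A B. A \<in> obs L \<Longrightarrow> B \<in> obs L \<Longrightarrow> banach_norm (smul L) (hom L A B) (nrm A B)" and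
    sm: "\<And>A B C f g. A \<in> obs L \<Longrightarrow> B \<in> obs L \<Longrightarrow> C \<in> obs L \<Longrightarrow> f \<in> hom L A B \<Longrightarrow> g \<in> hom L B C \<Longrightarrow>
       nrm A C (cmp L A B C g f) \<le> nrm B C g * nrm A B f" and
    cst: "\<And>A B f. A \<in> obs L \<Longrightarrow> B \<in> obs L \<Longrightarrow> f \<in> hom L A B \<Longrightarrow>
       nrm A A (cmp L A B A (dag L A B f) f) = (nrm A B f)\<^sup>2" and
    pos: "\<And>A B f. A \<in> obs L \<Longrightarrow> B \<in> obs L \<Longrightarrow> f \<in> hom L A B \<Longrightarrow>
       end_spectrum L A (cmp L A B A (dag L A B f) f) \<subseteq> {of_real r | r. r \<ge> 0}" and
    pre: "\<And>A B. A \<in> obs L \<Longrightarrow> B \<in> obs L \<Longrightarrow> has_predual (smul L) (hom L A B) (nrm A B)"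
  proof -
    from L obtain nrm where *:
      "\<forall>A\<in>obs L. \<forall>B\<in>obs L. banach_norm (smul L) (hom L A B) (nrm A B)"
      "\<forall>A\<in>obs L. \<forall>B\<in>obs L. \<forall>C\<in>obs L. \<forall>f\<in>hom L A B. \<forall>g\<in>hom L B C.
          nrm A C (cmp L A B C g f) \<le> nrm B C g * nrm A B f"
      "\<forall>A\<in>obs L. \<forall>B\<in>obs L. \<forall>f\<in>hom L A B.
          nrm A A (cmp L A B A (dag L A B f) f) = (nrm A B f)\<^sup>2"
      "\<forall>A\<in>obs L. \<forall>B\<in>obs L. \<forall>f\<in>hom L A B.
          end_spectrum L A (cmp L A B A (dag L A B f) f) \<subseteq> {of_real r | r. r \<ge> 0}"
      "\<forall>A\<in>obs L. \<forall>B\<in>obs L. has_predual (smul L) (hom L A B) (nrm A B)"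
      unfolding W_star_category_def by (elim conjE exE) rule
    show thesis by (rule that[of nrm]) (use * in \<open>simp_all\<close>)
  qed
  define nK where "nK A B f = nrm (F A) (F B) (\<theta> A B f)" for A B f
  have main: "banach_norm (smul K) (hom K A B) (nK A B) \<and> has_predual (smul K) (hom K A B) (nK A B)"
    if o: "A \<in> obs K" "B \<in> obs K" for A B
  proof -
    let ?X = "hom K A B" and ?Y = "hom L (F A) (F B)" and ?n = "nrm (F A) (F B)" and ?t = "\<theta> A B"
    let ?W = "?t ` ?X"
    have o': "F A \<in> obs L" "F B \<in> obs L" using F o by auto
    have subY: "vL.subspace ?Y" using L.subspace[OF o'] .
    note subX = sub[OF o] and mem = mem[OF o] and bY = ban[OF o'] and lin = lin[OF o]
    note t_add = lin_mapD(2)[OF lin] and t_scale = lin_mapD(3)[OF lin]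
    have t_diff: "?t (u - v) = ?t u - ?t v" if "u \<in> ?X" "v \<in> ?X" for u v
      using lin_map_diff[OF vs L.vector_space subX lin that] .
    have t0: "?t 0 = 0" using lin_map_zero[OF vs L.vector_space subX lin] .
    have WY: "?W \<subseteq> ?Y" using mem by blast
    obtain S where S: "finite S" "?Y \<subseteq> vL.span S" using fin[OF o] by blast
    obtain S' where S': "finite S'" "S' \<subseteq> ?W" "?W = vL.span S'"
      using vL.finite_basis_of_subspace[OF image_subspace[OF o] subset_trans[OF WY S(2)] S(1)] by metis
    obtain P where P0: "(\<lambda>x. 0) \<in> P" and
      Padd: "\<And>\<phi> \<psi>. \<phi> \<in> P \<Longrightarrow> \<psi> \<in> P \<Longrightarrow> (\<lambda>x. \<phi> x + \<psi> x) \<in> P" and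
      Pscale: "\<And>c \<phi>. \<phi> \<in> P \<Longrightarrow> (\<lambda>x. c * \<phi> x) \<in> P" and
      Plin: "\<And>\<phi>. \<phi> \<in> P \<Longrightarrow> lin_map (smul L) ?Y (*) UNIV \<phi>" and
      Pbd: "\<And>\<phi>. \<phi> \<in> P \<Longrightarrow> \<exists>C. \<forall>x\<in>?Y. cmod (\<phi> x) \<le> C * ?n x" and
      Psup: "\<And>x. x \<in> ?Y \<Longrightarrow> ?n x = Sup {cmod (\<phi> x) | \<phi>. \<phi> \<in> P \<and> functional_norm ?Y ?n \<phi> \<le> 1}" and
      Pdual: "\<And>G. (\<forall>\<phi>\<in>P. \<forall>\<psi>\<in>P. G (\<lambda>x. \<phi> x + \<psi> x) = G \<phi> + G \<psi>) \<Longrightarrow>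
        (\<forall>c. \<forall>\<phi>\<in>P. G (\<lambda>x. c * \<phi> x) = c * G \<phi>) \<Longrightarrow>
        (\<exists>C. \<forall>\<phi>\<in>P. cmod (G \<phi>) \<le> C * functional_norm ?Y ?n \<phi>) \<Longrightarrow> \<exists>x\<in>?Y. \<forall>\<phi>\<in>P. G \<phi> = \<phi> x"
    proof -
      from pre[OF o'] obtain P where *: "(\<lambda>x. 0) \<in> P"
        "\<forall>\<phi>\<in>P. \<forall>\<psi>\<in>P. (\<lambda>x. \<phi> x + \<psi> x) \<in> P" "\<forall>c. \<forall>\<phi>\<in>P. (\<lambda>x. c * \<phi> x) \<in> P"
        "\<forall>\<phi>\<in>P. lin_map (smul L) ?Y (*) UNIV \<phi> \<and> (\<exists>C. \<forall>x\<in>?Y. cmod (\<phi> x) \<le> C * ?n x)"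
        "\<forall>x\<in>?Y. ?n x = Sup {cmod (\<phi> x) | \<phi>. \<phi> \<in> P \<and> functional_norm ?Y ?n \<phi> \<le> 1}"
        "\<forall>G. (\<forall>\<phi>\<in>P. \<forall>\<psi>\<in>P. G (\<lambda>x. \<phi> x + \<psi> x) = G \<phi> + G \<psi>) \<and>
        (\<forall>c. \<forall>\<phi>\<in>P. G (\<lambda>x. c * \<phi> x) = c * G \<phi>) \<and>
        (\<exists>C. \<forall>\<phi>\<in>P. cmod (G \<phi>) \<le> C * functional_norm ?Y ?n \<phi>) \<longrightarrow> (\<exists>x\<in>?Y. \<forall>\<phi>\<in>P. G \<phi> = \<phi> x)"
        unfolding has_predual_def by blast
      show thesis
        by (rule that[of P]) (use * in \<open>simp_all\<close>)
    qed
    have n0: "?n x \<ge> 0" if "x \<in> ?Y" for x using banach_normD(1)[OF bY that] .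
    have nI: "?n x = 0 \<longleftrightarrow> x = 0" if "x \<in> ?Y" for x using banach_normD(2)[OF bY that] .
    have fn0: "functional_norm X n \<phi> = 0"
      if "0 \<in> X" "n 0 = 0" "\<And>x. x \<in> X \<Longrightarrow> \<phi> x = 0" for X :: "'z::zero set" and n \<phi>
    proof -
      have "{cmod (\<phi> x) | x. x \<in> X \<and> n x \<le> 1} = {0}"
        using that by (auto intro!: exI[of _ 0])
      then show ?thesis by (simp add: functional_norm_def)
    qed
    have zY: "0 \<in> ?Y" using vL.subspace_0[OF subY] .
    have zX: "0 \<in> ?X" using vK.subspace_0[OF subX] .
    \<comment> \<open>The functionals of norm at most 1 compute the norm of \<open>x\<close>, so an
      element annihilated by all of \<open>P\<close> has norm zero. The zero functional ensures that
      the supremum is taken over a nonempty set.\<close>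
    have sep: "x = 0" if x: "x \<in> ?Y" "\<forall>\<phi>\<in>P. \<phi> x = 0" for x
    proof -
      have "functional_norm ?Y ?n (\<lambda>x. 0) = 0" using fn0[OF zY] nI[OF zY] by simp
      then have "{cmod (\<phi> x) | \<phi>. \<phi> \<in> P \<and> functional_norm ?Y ?n \<phi> \<le> 1} = {0}"
        using x(2) P0 by (auto intro!: exI[of _ "\<lambda>x. 0"])
      then have "?n x = 0" using Psup[OF x(1)] by simp
      then show ?thesis using nI x by simp
    qed
    have kill: "\<exists>\<phi>\<in>P. (\<forall>y\<in>?W. \<phi> y = 0) \<and> \<phi> x \<noteq> 0" if "x \<in> ?Y" "x \<notin> ?W" for x
      using separating_functional[OF L.vector_space subY Padd Pscale Plin sep S'(1) _ that(1)] that(2) S'(2,3) WY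
      by blast
    have banK: "banach_norm (smul K) ?X (nK A B)"
      unfolding banach_norm_def
    proof (intro conjI ballI allI impI; (elim conjE)?)
      fix x assume x: "x \<in> ?X"
      show "0 \<le> nK A B x" using n0[OF mem[OF x]] by (simp add: nK_def)
      show "(nK A B x = 0) = (x = 0)"
        using nI[OF mem[OF x]] eqI[OF o x zX] t0 by (auto simp: nK_def)
      show "nK A B (smul K c x) = cmod c * nK A B x" for c
        using banach_normD(4)[OF bY mem[OF x]] by (simp add: nK_def t_scale x)
      fix y assume y: "y \<in> ?X"
      show "nK A B (x + y) \<le> nK A B x + nK A B y"
        using banach_normD(3)[OF bY mem[OF x] mem[OF y]] by (simp add: nK_def t_add x y)
    next
      fix u :: "nat \<Rightarrow> 'v" assume u: "\<forall>n. u n \<in> ?X"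
        and cauchy: "\<forall>e>0. \<exists>N. \<forall>m\<ge>N. \<forall>n\<ge>N. nK A B (u m - u n) < e"
      have "\<forall>n. ?t (u n) \<in> ?Y" using u mem by blast
      moreover have "\<forall>e>0. \<exists>N. \<forall>m\<ge>N. \<forall>n\<ge>N. ?n (?t (u m) - ?t (u n)) < e"
        using cauchy u by (simp add: nK_def t_diff)
      ultimately obtain x where x: "x \<in> ?Y" "(\<lambda>n. ?n (?t (u n) - x)) \<longlonglongrightarrow> 0"
        using banach_norm_complete[OF bY, of "\<lambda>n. ?t (u n)"] by blast
      \<comment> \<open>The limit stays in the image: a bounded functional killing the image but not
        \<open>x\<close> would be bounded at \<open>x\<close> by a multiple of distances tending to
        0.\<close>
      have "x \<in> ?W"
      proof (rule ccontr)
        assume "x \<notin> ?W"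
        then obtain \<phi> where \<phi>: "\<phi> \<in> P" "\<forall>y\<in>?W. \<phi> y = 0" "\<phi> x \<noteq> 0" using kill x(1) by blast
        obtain C where C: "\<forall>x\<in>?Y. cmod (\<phi> x) \<le> C * ?n x" using Pbd[OF \<phi>(1)] by blast
        have "cmod (\<phi> x) \<le> C * ?n (?t (u n) - x)" for n
        proof -
          have un: "?t (u n) \<in> ?Y" using u mem by blast
          have vc: "vector_space ((*) :: complex \<Rightarrow> complex \<Rightarrow> complex)"
            by unfold_locales (simp_all add: algebra_simps)
          have "\<phi> (?t (u n) - x) = \<phi> (?t (u n)) - \<phi> x"
            by (rule lin_map_diff[OF L.vector_space vc subY Plin[OF \<phi>(1)] un x(1)])
          then have "cmod (\<phi> x) = cmod (\<phi> (?t (u n) - x))" using \<phi>(2) u by simp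
          also have "\<dots> \<le> C * ?n (?t (u n) - x)"
            using C vL.subspace_diff[OF subY un x(1)] by blast
          finally show ?thesis .
        qed
        moreover have "(\<lambda>n. C * ?n (?t (u n) - x)) \<longlonglongrightarrow> C * 0"
          by (intro tendsto_intros x(2))
        ultimately have "cmod (\<phi> x) \<le> C * 0"
          by (intro LIMSEQ_le_const[of "\<lambda>n. C * ?n (?t (u n) - x)"]) auto
        then show False using \<phi>(3) by simp
      qed
      then obtain y where y: "y \<in> ?X" "x = ?t y" by blast
      have "(\<lambda>n. nK A B (u n - y)) \<longlonglongrightarrow> 0" using x(2) u y by (simp add: nK_def t_diff)
      then show "\<exists>x\<in>?X. (\<lambda>n. nK A B (u n - x)) \<longlonglongrightarrow> 0" using y(1) by blast
    qed
    have linK: "lin_map (smul K) ?X (*) UNIV (\<lambda>v. \<phi> (?t v))" if "\<phi> \<in> P" for \<phi>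
      unfolding lin_map_def using lin_mapD(2,3)[OF Plin[OF that]] mem by (simp add: t_add t_scale)
    have bdK: "\<exists>C. \<forall>x\<in>?X. cmod (\<phi> (?t x)) \<le> C * nK A B x" if "\<phi> \<in> P" for \<phi>
      using Pbd[OF that] mem unfolding nK_def by blast
    have nK0: "nK A B x \<ge> 0" if "x \<in> ?X" for x using banach_normD(1)[OF banK that] .
    \<comment> \<open>Restriction tests a functional on fewer vectors of the unit ball, so its norm
      can only drop.\<close>
    have fnK: "functional_norm ?X (nK A B) (\<lambda>v. \<phi> (?t v)) \<le> functional_norm ?Y ?n \<phi>" if \<phi>: "\<phi> \<in> P" for \<phi>
    proof -
      obtain C where C: "\<And>x. x \<in> ?Y \<Longrightarrow> cmod (\<phi> x) \<le> C * ?n x" using Pbd[OF \<phi>] by blast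
      show ?thesis unfolding functional_norm_def
      proof (rule cSup_subset_mono)
        show "{cmod (\<phi> (?t x)) | x. x \<in> ?X \<and> nK A B x \<le> 1} \<noteq> {}"
          using zX banach_normD(2)[OF banK zX] by (auto intro!: exI[of _ 0])
        show "bdd_above {cmod (\<phi> x) | x. x \<in> ?Y \<and> ?n x \<le> 1}"
          by (rule functional_norm_bdd[OF C n0])
        show "{cmod (\<phi> (?t x)) | x. x \<in> ?X \<and> nK A B x \<le> 1} \<subseteq> {cmod (\<phi> x) | x. x \<in> ?Y \<and> ?n x \<le> 1}"
          using mem unfolding nK_def by blast
      qed
    qed
    have fnK_bound: "cmod (\<phi> (?t x)) \<le> functional_norm ?X (nK A B) (\<lambda>v. \<phi> (?t v)) * nK A B x"
      if \<phi>: "\<phi> \<in> P" and x: "x \<in> ?X" for \<phi> x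
    proof -
      obtain C where C: "\<And>x. x \<in> ?X \<Longrightarrow> cmod (\<phi> (?t x)) \<le> C * nK A B x" using bdK[OF \<phi>] by blast
      show ?thesis by (rule functional_norm_bound[OF linK[OF \<phi>] banK vs subX C x])
    qed
    have fnK_nonneg: "functional_norm ?X (nK A B) (\<lambda>v. \<phi> (?t v)) \<ge> 0" if \<phi>: "\<phi> \<in> P" for \<phi>
    proof -
      obtain C where C: "\<And>x. x \<in> ?X \<Longrightarrow> cmod (\<phi> (?t x)) \<le> C * nK A B x" using bdK[OF \<phi>] by blast
      have "cmod (\<phi> (?t 0)) \<le> functional_norm ?X (nK A B) (\<lambda>v. \<phi> (?t v))"
        unfolding functional_norm_def using zX banach_normD(2)[OF banK zX]
        by (intro cSup_upper functional_norm_bdd[OF C nK0]) (auto intro!: exI[of _ 0])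
      then show ?thesis by (rule order_trans[OF norm_ge_zero])
    qed
    let ?Q = "(\<lambda>\<phi> v. \<phi> (?t v)) ` P"
    have preK: "has_predual (smul K) ?X (nK A B)"
      unfolding has_predual_def
    proof (intro exI[of _ ?Q] conjI ballI allI impI)
      show "(\<lambda>x. 0) \<in> ?Q" using P0 by (rule image_eqI[rotated]) simp
    next
      fix \<phi> \<psi> assume "\<phi> \<in> ?Q" "\<psi> \<in> ?Q"
      then obtain a b where ab: "a \<in> P" "b \<in> P" "\<phi> = (\<lambda>v. a (?t v))" "\<psi> = (\<lambda>v. b (?t v))" by blast
      show "(\<lambda>x. \<phi> x + \<psi> x) \<in> ?Q" using Padd[OF ab(1,2)] by (rule image_eqI[rotated]) (simp add: ab)
    next
      fix c \<phi> assume "\<phi> \<in> ?Q"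
      then obtain a where a: "a \<in> P" "\<phi> = (\<lambda>v. a (?t v))" by blast
      show "(\<lambda>x. c * \<phi> x) \<in> ?Q" using Pscale[OF a(1)] by (rule image_eqI[rotated]) (simp add: a)
    next
      fix \<phi> assume "\<phi> \<in> ?Q"
      then obtain a where a: "a \<in> P" "\<phi> = (\<lambda>v. a (?t v))" by blast
      show "lin_map (smul K) ?X (*) UNIV \<phi>" using linK a by simp
      show "\<exists>C. \<forall>x\<in>?X. cmod (\<phi> x) \<le> C * nK A B x" using bdK a by simp
    next
      fix x assume x: "x \<in> ?X"
      let ?SY = "{cmod (\<phi> (?t x)) | \<phi>. \<phi> \<in> P \<and> functional_norm ?Y ?n \<phi> \<le> 1}"
      let ?SX = "{cmod (\<phi> x) | \<phi>. \<phi> \<in> ?Q \<and> functional_norm ?X (nK A B) \<phi> \<le> 1}"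
      have ub: "r \<le> nK A B x" if r: "r \<in> ?SX" for r
      proof -
        obtain a where a: "a \<in> P" "r = cmod (a (?t x))" "functional_norm ?X (nK A B) (\<lambda>v. a (?t v)) \<le> 1"
          using r by blast
        have "r \<le> functional_norm ?X (nK A B) (\<lambda>v. a (?t v)) * nK A B x" using fnK_bound[OF a(1) x] a(2) by simp
        also have "\<dots> \<le> 1 * nK A B x" using a(3) nK0[OF x] by (rule mult_right_mono)
        finally show ?thesis by simp
      qed
      have sub: "?SY \<subseteq> ?SX"
      proof
        fix r assume "r \<in> ?SY"
        then obtain a where a: "a \<in> P" "r = cmod (a (?t x))" "functional_norm ?Y ?n a \<le> 1" by blast
        then have "functional_norm ?X (nK A B) (\<lambda>v. a (?t v)) \<le> 1" using fnK[OF a(1)] by simp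
        moreover have "(\<lambda>v. a (?t v)) \<in> ?Q" using a(1) by (rule imageI)
        ultimately show "r \<in> ?SX" using a(2) by (intro CollectI exI[of _ "\<lambda>v. a (?t v)"] conjI)
      qed
      have "functional_norm ?Y ?n (\<lambda>x. 0) = 0" using fn0[OF zY] nI[OF zY] by simp
      then have ne: "?SY \<noteq> {}" using P0 by (auto intro!: exI[of _ "\<lambda>x. 0"])
      \<comment> \<open>Since norms drop under restriction, the unit ball of the new predual
        contains the restrictions of the old one and the supremum cannot decrease; \<open>ub\<close>
        keeps it from increasing.\<close>
      show "nK A B x = Sup ?SX"
      proof (rule antisym)
        have "nK A B x = Sup ?SY" unfolding nK_def by (rule Psup[OF mem[OF x]])
        also have "\<dots> \<le> Sup ?SX" using ne sub ub by (intro cSup_subset_mono bdd_aboveI) auto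
        finally show "nK A B x \<le> Sup ?SX" .
        have "?SX \<noteq> {}" using ne sub by blast
        then show "Sup ?SX \<le> nK A B x" using ub by (rule cSup_least)
      qed
    next
      fix G assume G: "(\<forall>\<phi>\<in>?Q. \<forall>\<psi>\<in>?Q. G (\<lambda>x. \<phi> x + \<psi> x) = G \<phi> + G \<psi>) \<and>
        (\<forall>c. \<forall>\<phi>\<in>?Q. G (\<lambda>x. c * \<phi> x) = c * G \<phi>) \<and>
        (\<exists>C. \<forall>\<phi>\<in>?Q. cmod (G \<phi>) \<le> C * functional_norm ?X (nK A B) \<phi>)"
      then obtain C where C0: "\<forall>\<phi>\<in>?Q. cmod (G \<phi>) \<le> C * functional_norm ?X (nK A B) \<phi>"
        by (elim conjE exE) rule
      have C: "cmod (G (\<lambda>v. \<phi> (?t v))) \<le> C * functional_norm ?X (nK A B) (\<lambda>v. \<phi> (?t v))"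
        if "\<phi> \<in> P" for \<phi>
        using bspec[OF C0 imageI[OF that]] .
      have "\<exists>x\<in>?Y. \<forall>\<phi>\<in>P. G (\<lambda>v. \<phi> (?t v)) = \<phi> x"
      proof (rule Pdual)
        show "\<forall>\<phi>\<in>P. \<forall>\<psi>\<in>P. G (\<lambda>v. \<phi> (?t v) + \<psi> (?t v)) = G (\<lambda>v. \<phi> (?t v)) + G (\<lambda>v. \<psi> (?t v))"
          using G by simp
        show "\<forall>c. \<forall>\<phi>\<in>P. G (\<lambda>v. c * \<phi> (?t v)) = c * G (\<lambda>v. \<phi> (?t v))"
          using G by simp
        \<comment> \<open>Multiplying \<open>fnK\<close> by a constant needs a nonnegative factor,
          so \<open>C\<close> is replaced by its absolute value before returning to the larger
          space.\<close>
        have "cmod (G (\<lambda>v. \<phi> (?t v))) \<le> \<bar>C\<bar> * functional_norm ?Y ?n \<phi>" if \<phi>: "\<phi> \<in> P" for \<phi>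
        proof -
          have "cmod (G (\<lambda>v. \<phi> (?t v))) \<le> C * functional_norm ?X (nK A B) (\<lambda>v. \<phi> (?t v))" by (rule C[OF \<phi>])
          also have "\<dots> \<le> \<bar>C\<bar> * functional_norm ?X (nK A B) (\<lambda>v. \<phi> (?t v))"
            using fnK_nonneg[OF \<phi>] by (intro mult_right_mono) auto
          also have "\<dots> \<le> \<bar>C\<bar> * functional_norm ?Y ?n \<phi>" using fnK[OF \<phi>] by (rule mult_left_mono) simp
          finally show ?thesis .
        qed
        then show "\<exists>C. \<forall>\<phi>\<in>P. cmod (G (\<lambda>v. \<phi> (?t v))) \<le> C * functional_norm ?Y ?n \<phi>" by blast
      qed
      then obtain x where x: "x \<in> ?Y" "\<And>\<phi>. \<phi> \<in> P \<Longrightarrow> G (\<lambda>v. \<phi> (?t v)) = \<phi> x" by blast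
      \<comment> \<open>The same separation for the weak* topology: a functional vanishing on the
        image restricts to one of norm zero, on which \<open>G\<close> must vanish, although
        \<open>G\<close> takes there the value of the functional at \<open>x\<close>.\<close>
      have "x \<in> ?W"
      proof (rule ccontr)
        assume "x \<notin> ?W"
        then obtain \<phi> where \<phi>: "\<phi> \<in> P" "\<forall>y\<in>?W. \<phi> y = 0" "\<phi> x \<noteq> 0" using kill x(1) by blast
        have "functional_norm ?X (nK A B) (\<lambda>v. \<phi> (?t v)) = 0"
          using fn0[OF zX] banach_normD(2)[OF banK zX] \<phi>(2) by simp
        then have "cmod (G (\<lambda>v. \<phi> (?t v))) \<le> 0" using C[OF \<phi>(1)] by simp
        then show False using x(2)[OF \<phi>(1)] \<phi>(3) by simp
      qed
      then obtain y where y: "y \<in> ?X" "x = ?t y" by blast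
      then have "\<forall>\<phi>\<in>?Q. G \<phi> = \<phi> y" using x(2) by simp
      then show "\<exists>x\<in>?X. \<forall>\<phi>\<in>?Q. G \<phi> = \<phi> x" using y(1) by blast
    qed
    show ?thesis using banK preK by simp
  qed
  show ?thesis unfolding W_star_category_def
  proof (intro conjI exI[of _ nK] ballI)
    show "star_category K" by (rule star_category)
  next
    fix A B assume o: "A \<in> obs K" "B \<in> obs K"
    show "banach_norm (smul K) (hom K A B) (nK A B)" "has_predual (smul K) (hom K A B) (nK A B)"
      using main[OF o] by auto
  next
    fix A B f assume o: "A \<in> obs K" "B \<in> obs K" and f: "f \<in> hom K A B"
    show "nK A A (cmp K A B A (dag K A B f) f) = (nK A B f)\<^sup>2"
      unfolding nK_def using o f cst[OF F[OF o(1)] F[OF o(2)] mem[OF o f]] by (simp add: cmp dag dag_mem)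
    have "end_spectrum K A (cmp K A B A (dag K A B f) f) \<subseteq>
        end_spectrum L (F A) (\<theta> A A (cmp K A B A (dag K A B f) f))"
      using o f by (intro spectrum cmp_mem dag_mem)
    also have "\<theta> A A (cmp K A B A (dag K A B f) f) = cmp L (F A) (F B) (F A) (dag L (F A) (F B) (\<theta> A B f)) (\<theta> A B f)"
      using o f by (simp add: cmp dag dag_mem)
    also have "end_spectrum L (F A) \<dots> \<subseteq> {of_real r | r. r \<ge> 0}"
      by (rule pos[OF F[OF o(1)] F[OF o(2)] mem[OF o f]])
    finally show "end_spectrum K A (cmp K A B A (dag K A B f) f) \<subseteq> {of_real r | r. r \<ge> 0}" .
  next
    fix A B C f g assume o: "A \<in> obs K" "B \<in> obs K" "C \<in> obs K" and f: "f \<in> hom K A B" "g \<in> hom K B C"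
    show "nK A C (cmp K A B C g f) \<le> nK B C g * nK A B f"
      unfolding nK_def using sm[OF F[OF o(1)] F[OF o(2)] F[OF o(3)] mem[OF o(1,2) f(1)] mem[OF o(2,3) f(2)]] o f
      by (simp add: cmp)
  qed
qed

end


section \<open>Embeddings of algebra objects\<close>

text \<open>As for categories, \<open>T\<close> is only assumed to have subspaces closed under the
  operations. There are two instances with the same target: the tracial subalgebra and the algebra
  of the cover.\<close>

locale algebra_embedding =
  fixes \<delta> :: real and T :: "'v::ab_group_add alg_object" and N :: "'w::ab_group_add alg_object"
    and \<theta> :: "tlj_object \<Rightarrow> 'v \<Rightarrow> 'w"
  assumes N: "W_star_algebra \<delta> N"
    and vs: "vector_space (vscale T)"
    and sub: "\<And>a. a \<in> tlj_objects \<delta> \<Longrightarrow> module.subspace (vscale T) (space_at T a)"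
    and lin: "\<And>a. a \<in> tlj_objects \<delta> \<Longrightarrow> lin_map (vscale T) (space_at T a) (vscale N) (space_at N a) (\<theta> a)"
    and inj: "\<And>a. a \<in> tlj_objects \<delta> \<Longrightarrow> inj_on (\<theta> a) (space_at T a)"
    and act_mem: "\<And>a b f u. a \<in> tlj_objects \<delta> \<Longrightarrow> b \<in> tlj_objects \<delta> \<Longrightarrow> f \<in> tlj_hom \<delta> a b \<Longrightarrow>
       u \<in> space_at T b \<Longrightarrow> act T a b f u \<in> space_at T a"
    and act: "\<And>a b f u. a \<in> tlj_objects \<delta> \<Longrightarrow> b \<in> tlj_objects \<delta> \<Longrightarrow> f \<in> tlj_hom \<delta> a b \<Longrightarrow>
       u \<in> space_at T b \<Longrightarrow> \<theta> a (act T a b f u) = act N a b f (\<theta> b u)"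
    and mult_mem: "\<And>a b u v. a \<in> tlj_objects \<delta> \<Longrightarrow> b \<in> tlj_objects \<delta> \<Longrightarrow> u \<in> space_at T a \<Longrightarrow>
       v \<in> space_at T b \<Longrightarrow> mult T a b u v \<in> space_at T (obj_tensor a b)"
    and mult: "\<And>a b u v. a \<in> tlj_objects \<delta> \<Longrightarrow> b \<in> tlj_objects \<delta> \<Longrightarrow> u \<in> space_at T a \<Longrightarrow>
       v \<in> space_at T b \<Longrightarrow> \<theta> (obj_tensor a b) (mult T a b u v) = mult N a b (\<theta> a u) (\<theta> b v)"
    and unit_mem: "unit_vec T \<in> space_at T tlj_unit"
    and unit: "\<theta> tlj_unit (unit_vec T) = unit_vec N"
    and invol_mem: "\<And>a u. a \<in> tlj_objects \<delta> \<Longrightarrow> u \<in> space_at T a \<Longrightarrow> invol T a u \<in> space_at T (obj_bar a)"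
    and invol: "\<And>a u. a \<in> tlj_objects \<delta> \<Longrightarrow> u \<in> space_at T a \<Longrightarrow>
       \<theta> (obj_bar a) (invol T a u) = invol N a (\<theta> a u)"
    and fin: "\<And>a. a \<in> tlj_objects \<delta> \<Longrightarrow> \<exists>S. finite S \<and> space_at N a \<subseteq> module.span (vscale N) S"
begin

sublocale N: W_star_algebra \<delta> N by (rule N)

sublocale vT: vector_space "vscale T" by (rule vs)

sublocale vN: vector_space "vscale N" by (rule N.vector_space)

lemma eqI: "a \<in> tlj_objects \<delta> \<Longrightarrow> u \<in> space_at T a \<Longrightarrow> v \<in> space_at T a \<Longrightarrow> \<theta> a u = \<theta> a v \<Longrightarrow> u = v"
  using inj by (meson inj_onD)

lemmas mem = lin_mapD(1)[OF lin] and add = lin_mapD(2)[OF lin] and scale = lin_mapD(3)[OF lin]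

lemma add_mem: "a \<in> tlj_objects \<delta> \<Longrightarrow> u \<in> space_at T a \<Longrightarrow> v \<in> space_at T a \<Longrightarrow> u + v \<in> space_at T a"
  using vT.subspace_add[OF sub] .

lemma scale_mem: "a \<in> tlj_objects \<delta> \<Longrightarrow> u \<in> space_at T a \<Longrightarrow> vscale T c u \<in> space_at T a"
  using vT.subspace_scale[OF sub] .

lemma hom_add: "f \<in> tlj_hom \<delta> a b \<Longrightarrow> g \<in> tlj_hom \<delta> a b \<Longrightarrow> f + g \<in> tlj_hom \<delta> a b"
  unfolding tlj_hom_def matrices_def mor_comp_eq
  using Poly_Mapping.keys_add[of f g] by (auto simp: bilin_ext_add_left bilin_ext_add_right)

lemma hom_scale: "f \<in> tlj_hom \<delta> a b \<Longrightarrow> pm_scale c f \<in> tlj_hom \<delta> a b"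
  unfolding tlj_hom_def matrices_def mor_comp_eq
  using keys_pm_scale[of c f] by (auto simp: bilin_ext_scale_left bilin_ext_scale_right)

lemma star_algebra: "star_algebra \<delta> T"
proof
  fix a b f assume o: "a \<in> tlj_objects \<delta>" "b \<in> tlj_objects \<delta>" and f: "f \<in> tlj_hom \<delta> a b"
  note Lin = lin_mapD[OF N.act_linear[OF o f]]
  show "lin_map (vscale T) (space_at T b) (vscale T) (space_at T a) (act T a b f)"
    unfolding lin_map_def
  proof (intro conjI ballI allI)
    fix u v c assume u: "u \<in> space_at T b"
    show "act T a b f u \<in> space_at T a" by (rule act_mem[OF o f u])
    show "act T a b f (vscale T c u) = vscale T c (act T a b f u)"
      by (rule eqI[OF o(1)]) (use o f u Lin(3)[OF mem[OF o(2) u]] in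
        \<open>simp_all add: act act_mem scale scale_mem\<close>)
    assume v: "v \<in> space_at T b"
    show "act T a b f (u + v) = act T a b f u + act T a b f v"
      by (rule eqI[OF o(1)]) (use o f u v Lin(2)[OF mem[OF o(2) u] mem[OF o(2) v]] in
        \<open>simp_all add: act act_mem add add_mem\<close>)
  qed
  fix u assume u: "u \<in> space_at T b"
  show "act T a b (pm_scale c f) u = vscale T c (act T a b f u)" for c
    by (rule eqI[OF o(1)]) (use o f u N.act_scale[OF o f mem[OF o(2) u]] hom_scale[OF f] in
      \<open>simp_all add: act act_mem scale scale_mem\<close>)
  fix g assume g: "g \<in> tlj_hom \<delta> a b"
  show "act T a b (f + g) u = act T a b f u + act T a b g u"
    by (rule eqI[OF o(1)]) (use o f g u N.act_add[OF o f g mem[OF o(2) u]] hom_add[OF f g] in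
      \<open>simp_all add: act act_mem add add_mem\<close>)
next
  fix a u assume o: "a \<in> tlj_objects \<delta>" and u: "u \<in> space_at T a"
  show "act T a a (tlj_id a) u = u"
    by (rule eqI[OF o]) (use o u N.act_id[OF o mem[OF o u]] id_hom[OF o] in \<open>simp_all add: act act_mem\<close>)
  show "mult T tlj_unit a (unit_vec T) u = u"
    by (rule eqI[OF o]) (use mult_mem[OF unit_in o unit_mem u] mult[OF unit_in o unit_mem u] u
       N.mult_unit_left[OF o mem[OF o u]] in \<open>simp_all add: unit\<close>)
  show "mult T a tlj_unit u (unit_vec T) = u"
    by (rule eqI[OF o]) (use mult_mem[OF o unit_in u unit_mem] mult[OF o unit_in u unit_mem] u
       N.mult_unit_right[OF o mem[OF o u]] in \<open>simp_all add: unit\<close>)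
  show "invol T (obj_bar a) (invol T a u) = u"
  proof (rule eqI[OF o])
    note ob = obj_bar_in[OF o]
    show "invol T (obj_bar a) (invol T a u) \<in> space_at T a"
      using invol_mem[OF ob invol_mem[OF o u]] by (simp add: obj_bar_bar[OF o])
    show "\<theta> a (invol T (obj_bar a) (invol T a u)) = \<theta> a u"
      using invol[OF ob invol_mem[OF o u]] N.invol_invol[OF o mem[OF o u]]
      by (simp add: obj_bar_bar[OF o] invol[OF o u])
  qed fact
next
  fix a b c f g u assume o: "a \<in> tlj_objects \<delta>" "b \<in> tlj_objects \<delta>" "c \<in> tlj_objects \<delta>"
    and fg: "f \<in> tlj_hom \<delta> a b" "g \<in> tlj_hom \<delta> b c" and u: "u \<in> space_at T c"
  show "act T a c (mor_comp \<delta> g f) u = act T a b f (act T b c g u)"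
    by (rule eqI[OF o(1)]) (use o fg u N.act_comp[OF o fg mem[OF o(3) u]] mor_comp_hom[OF o fg] in
      \<open>simp_all add: act act_mem\<close>)
next
  fix a b v assume o: "a \<in> tlj_objects \<delta>" "b \<in> tlj_objects \<delta>" and v: "v \<in> space_at T b"
  note ot = obj_tensor_in[OF o]
  note Lin = lin_mapD[OF N.mult_linear_left[OF o mem[OF o(2) v]]]
  show "lin_map (vscale T) (space_at T a) (vscale T) (space_at T (obj_tensor a b)) (\<lambda>u. mult T a b u v)"
    unfolding lin_map_def
  proof (intro conjI ballI allI)
    fix u w c assume u: "u \<in> space_at T a"
    show "mult T a b u v \<in> space_at T (obj_tensor a b)" by (rule mult_mem[OF o u v])
    show "mult T a b (vscale T c u) v = vscale T c (mult T a b u v)"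
      by (rule eqI[OF ot]) (use o ot u v Lin(3)[OF mem[OF o(1) u]] in
        \<open>simp_all add: mult mult_mem scale scale_mem\<close>)
    assume w: "w \<in> space_at T a"
    show "mult T a b (u + w) v = mult T a b u v + mult T a b w v"
      by (rule eqI[OF ot]) (use o ot u w v Lin(2)[OF mem[OF o(1) u] mem[OF o(1) w]] in
        \<open>simp_all add: mult mult_mem add add_mem\<close>)
  qed
next
  fix a b v assume o: "a \<in> tlj_objects \<delta>" "b \<in> tlj_objects \<delta>" and v: "v \<in> space_at T a"
  note ot = obj_tensor_in[OF o]
  note Lin = lin_mapD[OF N.mult_linear_right[OF o mem[OF o(1) v]]]
  show "lin_map (vscale T) (space_at T b) (vscale T) (space_at T (obj_tensor a b)) (\<lambda>u. mult T a b v u)"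
    unfolding lin_map_def
  proof (intro conjI ballI allI)
    fix u w c assume u: "u \<in> space_at T b"
    show "mult T a b v u \<in> space_at T (obj_tensor a b)" by (rule mult_mem[OF o v u])
    show "mult T a b v (vscale T c u) = vscale T c (mult T a b v u)"
      by (rule eqI[OF ot]) (use o ot u v Lin(3)[OF mem[OF o(2) u]] in
        \<open>simp_all add: mult mult_mem scale scale_mem\<close>)
    assume w: "w \<in> space_at T b"
    show "mult T a b v (u + w) = mult T a b v u + mult T a b v w"
      by (rule eqI[OF ot]) (use o ot u w v Lin(2)[OF mem[OF o(2) u] mem[OF o(2) w]] in
        \<open>simp_all add: mult mult_mem add add_mem\<close>)
  qed
next
  fix a a' b b' f g u v
  assume o: "a \<in> tlj_objects \<delta>" "a' \<in> tlj_objects \<delta>" "b \<in> tlj_objects \<delta>" "b' \<in> tlj_objects \<delta>"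
    and fg: "f \<in> tlj_hom \<delta> a a'" "g \<in> tlj_hom \<delta> b b'" and u: "u \<in> space_at T a'" and v: "v \<in> space_at T b'"
  note ot = obj_tensor_in[OF o(1,3)] obj_tensor_in[OF o(2,4)]
  note h = mor_tensor_hom[OF o fg]
  show "act T (obj_tensor a b) (obj_tensor a' b') (mor_tensor f g) (mult T a' b' u v) =
        mult T a b (act T a a' f u) (act T b b' g v)"
    by (rule eqI[OF ot(1)]) (use o ot h fg u v N.mult_natural[OF o fg mem[OF o(2) u] mem[OF o(4) v]] in
      \<open>simp_all add: act act_mem mult mult_mem\<close>)
next
  fix a b c u v w assume o: "a \<in> tlj_objects \<delta>" "b \<in> tlj_objects \<delta>" "c \<in> tlj_objects \<delta>"
    and u: "u \<in> space_at T a" "v \<in> space_at T b" "w \<in> space_at T c"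
  note ot = obj_tensor_in[OF o(1,2)] obj_tensor_in[OF o(2,3)]
  show "mult T (obj_tensor a b) c (mult T a b u v) w = mult T a (obj_tensor b c) u (mult T b c v w)"
  proof (rule eqI[OF obj_tensor_in[OF ot(1) o(3)]])
    show "mult T (obj_tensor a b) c (mult T a b u v) w \<in> space_at T (obj_tensor (obj_tensor a b) c)"
      by (intro mult_mem ot o u)
    have m: "mult T b c v w \<in> space_at T (obj_tensor b c)" by (intro mult_mem o u)
    show "mult T a (obj_tensor b c) u (mult T b c v w) \<in> space_at T (obj_tensor (obj_tensor a b) c)"
      unfolding obj_tensor_assoc by (intro mult_mem ot o u m)
    have "\<theta> (obj_tensor a (obj_tensor b c)) (mult T a (obj_tensor b c) u (mult T b c v w)) =
        mult N a (obj_tensor b c) (\<theta> a u) (mult N b c (\<theta> b v) (\<theta> c w))"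
      using mult[OF o(1) ot(2) u(1) m] mult[OF o(2,3) u(2,3)] by simp
    then show "\<theta> (obj_tensor (obj_tensor a b) c) (mult T (obj_tensor a b) c (mult T a b u v) w) =
       \<theta> (obj_tensor (obj_tensor a b) c) (mult T a (obj_tensor b c) u (mult T b c v w))"
      using mult[OF ot(1) o(3) mult_mem[OF o(1,2) u(1,2)] u(3)] mult[OF o(1,2) u(1,2)]
        N.mult_assoc[OF o mem[OF o(1) u(1)] mem[OF o(2) u(2)] mem[OF o(3) u(3)]]
      by (simp add: obj_tensor_assoc)
  qed
next
  fix a assume o: "a \<in> tlj_objects \<delta>"
  note ob = obj_bar_in[OF o]
  note Lin = lin_mapD[OF N.invol_antilinear[OF o, unfolded antilin_map_def]]
  show "antilin_map (vscale T) (space_at T a) (vscale T) (space_at T (obj_bar a)) (invol T a)"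
    unfolding antilin_map_def lin_map_def
  proof (intro conjI ballI allI)
    fix u v c assume u: "u \<in> space_at T a"
    show "invol T a u \<in> space_at T (obj_bar a)" by (rule invol_mem[OF o u])
    show "invol T a (vscale T c u) = vscale T (cnj c) (invol T a u)"
      by (rule eqI[OF ob]) (use o ob u Lin(3)[OF mem[OF o u]] in
        \<open>simp_all add: invol invol_mem scale scale_mem\<close>)
    assume v: "v \<in> space_at T a"
    show "invol T a (u + v) = invol T a u + invol T a v"
      by (rule eqI[OF ob]) (use o ob u v Lin(2)[OF mem[OF o u] mem[OF o v]] in
        \<open>simp_all add: invol invol_mem add add_mem\<close>)
  qed
next
  fix a b f u assume o: "a \<in> tlj_objects \<delta>" "b \<in> tlj_objects \<delta>" and f: "f \<in> tlj_hom \<delta> a b"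
    and u: "u \<in> space_at T b"
  note ob = obj_bar_in[OF o(1)] obj_bar_in[OF o(2)]
  show "invol T a (act T a b f u) = act T (obj_bar a) (obj_bar b) (mor_bar f) (invol T b u)"
    by (rule eqI[OF ob(1)]) (use o ob f u N.invol_natural[OF o f mem[OF o(2) u]] mor_bar_hom[OF o f] in
      \<open>simp_all add: act act_mem invol invol_mem\<close>)
next
  fix a b u v assume o: "a \<in> tlj_objects \<delta>" "b \<in> tlj_objects \<delta>"
    and u: "u \<in> space_at T a" and v: "v \<in> space_at T b"
  note ob = obj_bar_in[OF o(1)] obj_bar_in[OF o(2)]
  note ot = obj_tensor_in[OF o]
  note m = mult_mem[OF ob(2,1) invol_mem[OF o(2) v] invol_mem[OF o(1) u]]
  show "invol T (obj_tensor a b) (mult T a b u v) = mult T (obj_bar b) (obj_bar a) (invol T b v) (invol T a u)"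
  proof (rule eqI[OF obj_bar_in[OF ot]])
    show "invol T (obj_tensor a b) (mult T a b u v) \<in> space_at T (obj_bar (obj_tensor a b))"
      by (intro invol_mem mult_mem o ot u v)
    show "mult T (obj_bar b) (obj_bar a) (invol T b v) (invol T a u) \<in> space_at T (obj_bar (obj_tensor a b))"
      using m by (simp add: obj_bar_tensor[OF o])
    show "\<theta> (obj_bar (obj_tensor a b)) (invol T (obj_tensor a b) (mult T a b u v)) =
        \<theta> (obj_bar (obj_tensor a b)) (mult T (obj_bar b) (obj_bar a) (invol T b v) (invol T a u))"
      using invol[OF ot mult_mem[OF o u v]] mult[OF o u v] N.invol_mult[OF o mem[OF o(1) u] mem[OF o(2) v]]
        mult[OF ob(2,1) invol_mem[OF o(2) v] invol_mem[OF o(1) u]] invol[OF o(1) u] invol[OF o(2) v]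
      by (simp add: obj_bar_tensor[OF o])
  qed
qed (rule sub, assumption, rule unit_mem)

section \<open>The category of projective modules under an embedding\<close>

lemma contraction_hom:
  assumes "a \<in> tlj_objects \<delta>" "b \<in> tlj_objects \<delta>" "c \<in> tlj_objects \<delta>"
  shows "mor_tensor (tlj_id (obj_bar c)) (mor_tensor (coev \<delta> b) (tlj_id a)) \<in>
    tlj_hom \<delta> (obj_tensor (obj_bar c) a) (obj_tensor (obj_tensor (obj_bar c) b) (obj_tensor (obj_bar b) a))"
proof -
  note o = assms obj_bar_in[OF assms(2)] obj_bar_in[OF assms(3)]
  have bb: "obj_tensor b (obj_bar b) \<in> tlj_objects \<delta>" by (intro obj_tensor_in o)
  have "mor_tensor (coev \<delta> b) (tlj_id a) \<in>
      tlj_hom \<delta> (obj_tensor tlj_unit a) (obj_tensor (obj_tensor b (obj_bar b)) a)"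
    by (intro mor_tensor_hom unit_in bb o coev_hom id_hom)
  then have "mor_tensor (coev \<delta> b) (tlj_id a) \<in> tlj_hom \<delta> a (obj_tensor (obj_tensor b (obj_bar b)) a)"
    by simp
  then have "mor_tensor (tlj_id (obj_bar c)) (mor_tensor (coev \<delta> b) (tlj_id a)) \<in>
      tlj_hom \<delta> (obj_tensor (obj_bar c) a) (obj_tensor (obj_bar c) (obj_tensor (obj_tensor b (obj_bar b)) a))"
    by (intro mor_tensor_hom obj_tensor_in bb o id_hom)
  then show ?thesis by (simp only: obj_tensor_assoc)
qed

lemma free_comp:
  assumes "a \<in> tlj_objects \<delta>" "b \<in> tlj_objects \<delta>" "c \<in> tlj_objects \<delta>"
    and "f \<in> free_hom T a b" "g \<in> free_hom T b c"
  shows "free_comp \<delta> T a b c g f \<in> free_hom T a c"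
    "\<theta> (obj_tensor (obj_bar c) a) (free_comp \<delta> T a b c g f) =
       free_comp \<delta> N a b c (\<theta> (obj_tensor (obj_bar c) b) g) (\<theta> (obj_tensor (obj_bar b) a) f)"
proof -
  note o = assms(1-3) obj_bar_in[OF assms(2)] obj_bar_in[OF assms(3)]
  note f = assms(4)[unfolded free_hom_def] and g = assms(5)[unfolded free_hom_def]
  note h = contraction_hom[OF assms(1-3)]
  have ot: "obj_tensor (obj_bar c) b \<in> tlj_objects \<delta>" "obj_tensor (obj_bar b) a \<in> tlj_objects \<delta>"
    "obj_tensor (obj_bar c) a \<in> tlj_objects \<delta>" by (intro obj_tensor_in o)+
  note ott = obj_tensor_in[OF ot(1,2)] and m = mult_mem[OF ot(1,2) g f]
  show "free_comp \<delta> T a b c g f \<in> free_hom T a c"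
    unfolding free_comp_def free_hom_def by (rule act_mem[OF ot(3) ott h m])
  show "\<theta> (obj_tensor (obj_bar c) a) (free_comp \<delta> T a b c g f) =
       free_comp \<delta> N a b c (\<theta> (obj_tensor (obj_bar c) b) g) (\<theta> (obj_tensor (obj_bar b) a) f)"
    unfolding free_comp_def act[OF ot(3) ott h m] mult[OF ot(1,2) g f] ..
qed

lemma free_dag:
  assumes "a \<in> tlj_objects \<delta>" "b \<in> tlj_objects \<delta>" "f \<in> free_hom T a b"
  shows "free_dag T a b f \<in> free_hom T b a"
    "\<theta> (obj_tensor (obj_bar a) b) (free_dag T a b f) = free_dag N a b (\<theta> (obj_tensor (obj_bar b) a) f)"
proof -
  note ob = obj_bar_in[OF assms(2)]
  have e: "obj_bar (obj_tensor (obj_bar b) a) = obj_tensor (obj_bar a) b"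
    by (simp add: obj_bar_tensor[OF ob assms(1)] obj_bar_bar[OF assms(2)])
  note ot = obj_tensor_in[OF ob assms(1)] and f = assms(3)[unfolded free_hom_def]
  show "free_dag T a b f \<in> free_hom T b a"
    using invol_mem[OF ot f] unfolding free_dag_def free_hom_def e .
  show "\<theta> (obj_tensor (obj_bar a) b) (free_dag T a b f) = free_dag N a b (\<theta> (obj_tensor (obj_bar b) a) f)"
    using invol[OF ot f] unfolding free_dag_def e .
qed

definition module_map :: "tlj_object \<times> 'v \<Rightarrow> tlj_object \<times> 'w" where
  "module_map A = (fst A, \<theta> (obj_tensor (obj_bar (fst A)) (fst A)) (snd A))"

definition hom_map :: "tlj_object \<times> 'v \<Rightarrow> tlj_object \<times> 'v \<Rightarrow> 'v \<Rightarrow> 'w" where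
  "hom_map A B = \<theta> (obj_tensor (obj_bar (fst B)) (fst A))"

lemma obs_iff: "A \<in> obs (fgp_modules \<delta> T) \<longleftrightarrow> fst A \<in> tlj_objects \<delta> \<and> snd A \<in> free_hom T (fst A) (fst A) \<and>
    free_comp \<delta> T (fst A) (fst A) (fst A) (snd A) (snd A) = snd A \<and> free_dag T (fst A) (fst A) (snd A) = snd A"
  by (cases A) (simp add: fgp_modules_def)

lemma obs_N_iff: "A \<in> obs (fgp_modules \<delta> N) \<longleftrightarrow> fst A \<in> tlj_objects \<delta> \<and> snd A \<in> free_hom N (fst A) (fst A) \<and>
    free_comp \<delta> N (fst A) (fst A) (fst A) (snd A) (snd A) = snd A \<and> free_dag N (fst A) (fst A) (snd A) = snd A"
  by (cases A) (simp add: fgp_modules_def)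

lemma hom_eq: "hom (fgp_modules \<delta> T) A B = {f \<in> free_hom T (fst A) (fst B).
    free_comp \<delta> T (fst A) (fst B) (fst B) (snd B) f = f \<and> free_comp \<delta> T (fst A) (fst A) (fst B) f (snd A) = f}"
  by (cases A, cases B) (simp add: fgp_modules_def)

lemma hom_N_eq: "hom (fgp_modules \<delta> N) A B = {f \<in> free_hom N (fst A) (fst B).
    free_comp \<delta> N (fst A) (fst B) (fst B) (snd B) f = f \<and> free_comp \<delta> N (fst A) (fst A) (fst B) f (snd A) = f}"
  by (cases A, cases B) (simp add: fgp_modules_def)

lemma fgp_simps:
  "smul (fgp_modules \<delta> X) = vscale X"
  "cmp (fgp_modules \<delta> X) A B C = free_comp \<delta> X (fst A) (fst B) (fst C)"
  "idn (fgp_modules \<delta> X) A = snd A"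
  "dag (fgp_modules \<delta> X) A B = free_dag X (fst A) (fst B)"
  by (cases A, cases B, cases C, simp add: fgp_modules_def)+

lemma free_hom_object: "a \<in> tlj_objects \<delta> \<Longrightarrow> b \<in> tlj_objects \<delta> \<Longrightarrow> obj_tensor (obj_bar b) a \<in> tlj_objects \<delta>"
  by (intro obj_tensor_in obj_bar_in)

text \<open>The two equations cutting out a hom space compare elements of a single space of
  \<open>T\<close>, on which \<open>\<theta>\<close> is injective; they can therefore be tested in
  \<open>N\<close>. Closure of these hom spaces under sums, composition and adjoints is then
  inherited from \<open>N\<close>.\<close>

lemma hom_iff:
  assumes A: "A \<in> obs (fgp_modules \<delta> T)" and B: "B \<in> obs (fgp_modules \<delta> T)"
  shows "f \<in> hom (fgp_modules \<delta> T) A B \<longleftrightarrow> f \<in> free_hom T (fst A) (fst B) \<and>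
    hom_map A B f \<in> hom (fgp_modules \<delta> N) (module_map A) (module_map B)"
proof (cases "f \<in> free_hom T (fst A) (fst B)")
  case True
  note a = A[unfolded obs_iff] and b = B[unfolded obs_iff]
  have o: "fst A \<in> tlj_objects \<delta>" "fst B \<in> tlj_objects \<delta>" using a b by auto
  have r: "snd A \<in> free_hom T (fst A) (fst A)" "snd B \<in> free_hom T (fst B) (fst B)" using a b by auto
  note ot = free_hom_object[OF o]
  have f: "f \<in> space_at T (obj_tensor (obj_bar (fst B)) (fst A))" using True by (simp add: free_hom_def)
  note c1 = free_comp[OF o(1) o(2) o(2) True r(2)] and c2 = free_comp[OF o(1) o(1) o(2) r(1) True]
  have "free_comp \<delta> T (fst A) (fst B) (fst B) (snd B) f = f \<longleftrightarrow>
      \<theta> (obj_tensor (obj_bar (fst B)) (fst A)) (free_comp \<delta> T (fst A) (fst B) (fst B) (snd B) f) =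
      \<theta> (obj_tensor (obj_bar (fst B)) (fst A)) f"
    using eqI[OF ot c1(1)[unfolded free_hom_def] f] by auto
  moreover have "free_comp \<delta> T (fst A) (fst A) (fst B) f (snd A) = f \<longleftrightarrow>
      \<theta> (obj_tensor (obj_bar (fst B)) (fst A)) (free_comp \<delta> T (fst A) (fst A) (fst B) f (snd A)) =
      \<theta> (obj_tensor (obj_bar (fst B)) (fst A)) f"
    using eqI[OF ot c2(1)[unfolded free_hom_def] f] by auto
  ultimately show ?thesis
    using True mem[OF ot f] unfolding hom_eq hom_N_eq hom_map_def module_map_def
    by (simp add: c1(2) c2(2) free_hom_def)
qed (simp add: hom_eq)

lemma hom_free: "f \<in> hom (fgp_modules \<delta> T) A B \<Longrightarrow> f \<in> free_hom T (fst A) (fst B)"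
  by (simp add: hom_eq)

lemma module_map_obs:
  assumes "A \<in> obs (fgp_modules \<delta> T)"
  shows "module_map A \<in> obs (fgp_modules \<delta> N)"
proof -
  have a: "fst A \<in> tlj_objects \<delta>" "snd A \<in> free_hom T (fst A) (fst A)"
    "free_comp \<delta> T (fst A) (fst A) (fst A) (snd A) (snd A) = snd A" "free_dag T (fst A) (fst A) (snd A) = snd A"
    using assms by (auto simp: obs_iff)
  show ?thesis
    unfolding obs_N_iff module_map_def
    using a(1) mem[OF free_hom_object[OF a(1,1)] a(2)[unfolded free_hom_def]]
      free_comp(2)[OF a(1,1,1,2,2)] free_dag(2)[OF a(1,1,2)] a(3,4)
    by (simp add: free_hom_def)
qed

lemma cat_embedding: "cat_embedding (fgp_modules \<delta> T) (fgp_modules \<delta> N) module_map hom_map"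
proof -
  let ?K = "fgp_modules \<delta> T" and ?L = "fgp_modules \<delta> N"
  interpret L: star_category ?L using N.W_star by (simp add: W_star_category_def)
  have obj: "fst A \<in> tlj_objects \<delta>" if "A \<in> obs ?K" for A using that by (simp add: obs_iff)
  have fst_map: "fst (module_map A) = fst A" for A by (simp add: module_map_def)
  have lin': "lin_map (vscale T) (free_hom T (fst A) (fst B)) (vscale N) (free_hom N (fst A) (fst B)) (hom_map A B)"
    if "A \<in> obs ?K" "B \<in> obs ?K" for A B
    unfolding hom_map_def free_hom_def by (rule lin[OF free_hom_object[OF obj[OF that(1)] obj[OF that(2)]]])
  have sub': "vT.subspace (free_hom T (fst A) (fst B))" if "A \<in> obs ?K" "B \<in> obs ?K" for A B
    unfolding free_hom_def by (rule sub[OF free_hom_object[OF obj[OF that(1)] obj[OF that(2)]]])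
  show ?thesis
  proof (rule cat_embedding.intro)
    show "W_star_category ?L" by (rule N.W_star)
    show "vector_space (smul ?K)" unfolding fgp_simps by (rule vs)
    show "module_map A \<in> obs ?L" if "A \<in> obs ?K" for A by (rule module_map_obs[OF that])
    fix A B assume AB: "A \<in> obs ?K" "B \<in> obs ?K"
    note FA = module_map_obs[OF AB(1)] module_map_obs[OF AB(2)]
    note ot = free_hom_object[OF obj[OF AB(1)] obj[OF AB(2)]]
    note Lin = lin_mapD[OF lin'[OF AB]]
    note subN = L.subspace[OF FA, unfolded fgp_simps]
    show "module.subspace (smul ?K) (hom ?K A B)"
      unfolding fgp_simps
    proof (rule vT.subspaceI)
      show "0 \<in> hom ?K A B"
        unfolding hom_iff[OF AB]
        using vT.subspace_0[OF sub'[OF AB]] lin_map_zero[OF vs N.vector_space sub'[OF AB] lin'[OF AB]]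
          vN.subspace_0[OF subN] by simp
      fix x y c assume x: "x \<in> hom ?K A B"
      show "vscale T c x \<in> hom ?K A B"
        using x vT.subspace_scale[OF sub'[OF AB]] vN.subspace_scale[OF subN]
        unfolding hom_iff[OF AB] by (simp add: Lin(3))
      assume y: "y \<in> hom ?K A B"
      show "x + y \<in> hom ?K A B"
        using x y vT.subspace_add[OF sub'[OF AB]] vN.subspace_add[OF subN]
        unfolding hom_iff[OF AB] by (simp add: Lin(2))
    qed
    show "lin_map (smul ?K) (hom ?K A B) (smul ?L) (hom ?L (module_map A) (module_map B)) (hom_map A B)"
      unfolding fgp_simps
      by (rule lin_map_subset[OF lin'[OF AB]]) (auto simp: hom_iff[OF AB])
    show "inj_on (hom_map A B) (hom ?K A B)"
      unfolding hom_map_def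
      by (rule inj_on_subset[OF inj[OF ot]]) (auto simp: hom_eq free_hom_def)
    show "\<exists>S. finite S \<and> hom ?L (module_map A) (module_map B) \<subseteq> module.span (smul ?L) S"
      using fin[OF ot] unfolding fgp_simps hom_N_eq free_hom_def fst_map by blast
    have dag_lin: "dag ?L (module_map A) (module_map B) g \<in> hom ?L (module_map B) (module_map A)"
      if "g \<in> hom ?L (module_map A) (module_map B)" for g
      using lin_mapD(1)[OF L.dag_antilinear[OF FA, unfolded antilin_map_def] that] .
    fix f assume f: "f \<in> hom ?K A B"
    note d = free_dag[OF obj[OF AB(1)] obj[OF AB(2)] hom_free[OF f]]
    show dag: "hom_map B A (dag ?K A B f) = dag ?L (module_map A) (module_map B) (hom_map A B f)"
      unfolding hom_map_def fgp_simps fst_map by (rule d(2))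
    show "dag ?K A B f \<in> hom ?K B A"
      unfolding hom_iff[OF AB(2,1)] dag
      using d(1) dag_lin f[unfolded hom_iff[OF AB]] by (simp add: fgp_simps)
    fix C g assume C: "C \<in> obs ?K" and g: "g \<in> hom ?K B C"
    note FC = module_map_obs[OF C]
    note c = free_comp[OF obj[OF AB(1)] obj[OF AB(2)] obj[OF C] hom_free[OF f] hom_free[OF g]]
    show cmp: "hom_map A C (cmp ?K A B C g f) =
        cmp ?L (module_map A) (module_map B) (module_map C) (hom_map B C g) (hom_map A B f)"
      unfolding hom_map_def fgp_simps fst_map by (rule c(2))
    have "cmp ?L (module_map A) (module_map B) (module_map C) (hom_map B C g) (hom_map A B f)
        \<in> hom ?L (module_map A) (module_map C)"
      using lin_mapD(1)[OF L.cmp_linear_left[OF FA FC]] f g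
      unfolding hom_iff[OF AB] hom_iff[OF AB(2) C] by blast
    then show "cmp ?K A B C g f \<in> hom ?K A C"
      unfolding hom_iff[OF AB(1) C] cmp using c(1) by (simp add: fgp_simps)
  next
    fix A assume A: "A \<in> obs ?K"
    show "idn ?K A \<in> hom ?K A A" using A by (simp add: obs_iff hom_eq fgp_simps)
    show "hom_map A A (idn ?K A) = idn ?L (module_map A)"
      by (simp add: hom_map_def fgp_simps module_map_def)
  qed
qed

lemma W_star_algebra: "W_star_algebra \<delta> T"
proof -
  interpret star_algebra \<delta> T by (rule star_algebra)
  show ?thesis
    by unfold_locales (rule cat_embedding.W_star_category[OF cat_embedding])
qed

end

text \<open>Equality of the images makes \<open>\<theta>\<close> followed by the inverse of
  \<open>\<theta>'\<close> a bijection. Each compatibility is checked after applying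
  \<open>\<theta>'\<close>, where both sides become the same expression in \<open>N\<close>.\<close>

lemma iso_of_embeddings:
  assumes T: "algebra_embedding \<delta> T N \<theta>" and T': "algebra_embedding \<delta> T' N \<theta>'"
    and img: "\<And>a. a \<in> tlj_objects \<delta> \<Longrightarrow> \<theta> a ` space_at T a = \<theta>' a ` space_at T' a"
  shows "star_algebra_iso \<delta> T T' (\<lambda>a u. inv_into (space_at T' a) (\<theta>' a) (\<theta> a u))"
proof -
  interpret T: algebra_embedding \<delta> T N \<theta> by fact
  interpret T': algebra_embedding \<delta> T' N \<theta>' by fact
  define \<psi> where "\<psi> a u = inv_into (space_at T' a) (\<theta>' a) (\<theta> a u)" for a u
  have p: "\<psi> a u \<in> space_at T' a" "\<theta>' a (\<psi> a u) = \<theta> a u" if "a \<in> tlj_objects \<delta>" "u \<in> space_at T a" for a u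
  proof -
    have "\<theta> a u \<in> \<theta>' a ` space_at T' a" using img[OF that(1)] that(2) by blast
    then show "\<psi> a u \<in> space_at T' a" "\<theta>' a (\<psi> a u) = \<theta> a u"
      unfolding \<psi>_def by (rule inv_into_into, rule f_inv_into_f)
  qed
  show ?thesis
    unfolding star_algebra_iso_def \<psi>_def[symmetric]
  proof (intro conjI ballI)
    fix a assume a: "a \<in> tlj_objects \<delta>"
    show "lin_map (vscale T) (space_at T a) (vscale T') (space_at T' a) (\<psi> a)"
      unfolding lin_map_def
    proof (intro conjI ballI allI)
      fix u v c assume u: "u \<in> space_at T a"
      show "\<psi> a u \<in> space_at T' a" using p a u by simp
      show "\<psi> a (vscale T c u) = vscale T' c (\<psi> a u)"
        by (rule T'.eqI[OF a]) (use a u T.scale_mem[OF a u] in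
          \<open>simp_all add: p T.scale T'.scale T'.scale_mem\<close>)
      assume v: "v \<in> space_at T a"
      show "\<psi> a (u + v) = \<psi> a u + \<psi> a v"
        by (rule T'.eqI[OF a]) (use a u v T.add_mem[OF a u v] in
          \<open>simp_all add: p T.add T'.add T'.add_mem\<close>)
    qed
    show "bij_betw (\<psi> a) (space_at T a) (space_at T' a)"
      unfolding bij_betw_def
    proof
      show "inj_on (\<psi> a) (space_at T a)"
        by (rule inj_onI) (metis T.eqI a p(2))
      show "\<psi> a ` space_at T a = space_at T' a"
      proof
        show "\<psi> a ` space_at T a \<subseteq> space_at T' a" using p a by blast
        show "space_at T' a \<subseteq> \<psi> a ` space_at T a"
        proof
          fix v assume v: "v \<in> space_at T' a"
          then obtain u where u: "u \<in> space_at T a" "\<theta>' a v = \<theta> a u" using img[OF a] by blast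
          then have "v = \<psi> a u" using T'.eqI[OF a v p(1)[OF a u(1)]] p(2)[OF a u(1)] by simp
          then show "v \<in> \<psi> a ` space_at T a" using u(1) by blast
        qed
      qed
    qed
    fix b assume b: "b \<in> tlj_objects \<delta>"
    show "\<psi> a (act T a b f u) = act T' a b f (\<psi> b u)" if "f \<in> tlj_hom \<delta> a b" "u \<in> space_at T b" for f u
      by (rule T'.eqI[OF a]) (use a b that in \<open>simp_all add: p T.act T.act_mem T'.act T'.act_mem\<close>)
    show "\<psi> (obj_tensor a b) (mult T a b u v) = mult T' a b (\<psi> a u) (\<psi> b v)"
      if "u \<in> space_at T a" "v \<in> space_at T b" for u v
      by (rule T'.eqI[OF obj_tensor_in[OF a b]]) (use a b that obj_tensor_in[OF a b] in
        \<open>simp_all add: p T.mult T.mult_mem T'.mult T'.mult_mem\<close>)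
    show "\<psi> (obj_bar a) (invol T a u) = invol T' a (\<psi> a u)" if "u \<in> space_at T a" for u
      by (rule T'.eqI[OF obj_bar_in[OF a]]) (use a that obj_bar_in[OF a] in
        \<open>simp_all add: p T.invol T.invol_mem T'.invol T'.invol_mem\<close>)
  next
    show "\<psi> tlj_unit (unit_vec T) = unit_vec T'"
      by (rule T'.eqI[OF unit_in[of \<delta>]])
         (simp_all add: p[OF unit_in[of \<delta>] T.unit_mem] T.unit T'.unit T'.unit_mem)
  qed
qed


section \<open>State sums and path weights\<close>

definition act_basis :: "('a, 'e) weighted_graph \<Rightarrow> summand \<times> diagram \<times> summand \<Rightarrow> summand \<times> 'e list \<Rightarrow>
    (summand \<times> 'e list \<Rightarrow>\<^sub>0 complex)" where
  "act_basis \<Gamma> = (\<lambda>(x, D, y) (y', q).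
     if y = y' then \<Sum>p\<in>loops \<Gamma> (snd x). Poly_Mapping.single (x, p) (of_real (state \<Gamma> D (label p q)))
     else 0)"

lemma graph_act_eq: "graph_act \<Gamma> = bilin_ext (act_basis \<Gamma>)"
  by (simp add: graph_act_def act_basis_def)

definition mult_basis :: "summand \<times> 'e list \<Rightarrow> summand \<times> 'e list \<Rightarrow> (summand \<times> 'e list \<Rightarrow>\<^sub>0 complex)" where
  "mult_basis = (\<lambda>(x, p) (y, q). Poly_Mapping.single (summand_tensor x y, p @ q) 1)"

definition invol_basis :: "('a, 'e) weighted_graph \<Rightarrow> summand \<times> 'e list \<Rightarrow> (summand \<times> 'e list \<Rightarrow>\<^sub>0 complex)" where
  "invol_basis \<Gamma> = (\<lambda>(x, p).
     Poly_Mapping.single (summand_bar x, path_bar \<Gamma> p) (of_real (sqrt (path_wt \<Gamma> (path_bar \<Gamma> p)))))"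

definition loop_support :: "('a, 'e) weighted_graph \<Rightarrow> summand set \<Rightarrow> (summand \<times> 'e list) set" where
  "loop_support \<Gamma> S = {(x, q). x \<in> S \<and> q \<in> loops \<Gamma> (snd x)}"

lemma graph_algebra_simps:
  "vscale (graph_algebra \<Gamma>) = pm_scale"
  "space_at (graph_algebra \<Gamma>) a = {u. Poly_Mapping.keys u \<subseteq> loop_support \<Gamma> (fst a) \<and> graph_act \<Gamma> (snd a) u = u}"
  "act (graph_algebra \<Gamma>) a b f = graph_act \<Gamma> f"
  "mult (graph_algebra \<Gamma>) a b = bilin_ext mult_basis"
  "unit_vec (graph_algebra \<Gamma>) = Poly_Mapping.single (([], 0), []) 1"
  "invol (graph_algebra \<Gamma>) a u = lin_ext (invol_basis \<Gamma>) (pm_cnj u)"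
  by (cases a; simp add: graph_algebra_def mult_basis_def invol_basis_def conj_ext_eq loop_support_def)+

lemma act_basis_keys: "x \<in> S \<Longrightarrow> Poly_Mapping.keys (act_basis \<Gamma> (x, D, y) l) \<subseteq> loop_support \<Gamma> S"
  by (cases l) (auto simp: act_basis_def loop_support_def intro!: keys_sum_subset split: if_splits)

lemma keys_graph_act: "f \<in> matrices S T \<Longrightarrow> Poly_Mapping.keys (graph_act \<Gamma> f u) \<subseteq> loop_support \<Gamma> S"
  unfolding graph_act_eq
  by (rule keys_bilin_ext) (metis act_basis_keys matricesD prod.exhaust)

lemma path_wt_Nil [simp]: "path_wt \<Gamma> [] = 1"
  by (simp add: path_wt_def)

lemma path_wt_Cons [simp]: "path_wt \<Gamma> (e # p) = wt \<Gamma> e * path_wt \<Gamma> p"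
  by (simp add: path_wt_def)

lemma path_wt_append: "path_wt \<Gamma> (p @ q) = path_wt \<Gamma> p * path_wt \<Gamma> q"
  by (simp add: path_wt_def)

text \<open>Prefix weights are the heights of a path, the first coordinates of the vertices of its
  lift; an interval of edges multiplies the height by its weight.\<close>

lemma path_wt_take:
  assumes "i \<le> j" "j \<le> length p"
  shows "path_wt \<Gamma> (take j p) = path_wt \<Gamma> (take i p) * prod_list (map (\<lambda>t. wt \<Gamma> (p ! t)) [i..<j])"
proof -
  have "take j p = take i p @ map ((!) p) [i..<j]"
    by (rule nth_equalityI) (use assms in \<open>auto simp: nth_append\<close>)
  then show ?thesis by (simp add: path_wt_append) (simp add: path_wt_def comp_def)
qed

lemma prod_list_inverse: "prod_list (map (\<lambda>t. inverse (f t)) xs) = inverse (prod_list (map f xs) :: real)"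
  by (induction xs) simp_all

lemma prod_list_rev: "prod_list (rev xs) = (prod_list xs :: real)"
  by (induction xs) simp_all

text \<open>Translates the cancellation of words into statements about products of edge
  weights.\<close>

lemma word_mult: "word (\<lambda>t x. \<omega> t * x) xs = (\<lambda>x. prod_list (map \<omega> xs) * (x::real))"
  by (induction xs) (auto simp: fun_eq_iff mult.assoc)

lemma map_rev_interval: "b \<le> n + m \<Longrightarrow> map (\<lambda>t. n + m - 1 - t) [a..<b] = rev [n + m - b..<n + m - a]"
  by (rule nth_equalityI) (auto simp: rev_nth)

section \<open>Weights and heights of loops joined by a diagram\<close>

context fair_balanced
begin

abbreviation "V \<equiv> verts (dgraph \<Gamma>)"
abbreviation "R \<equiv> arcs (dgraph \<Gamma>)"
abbreviation "src \<equiv> tail (dgraph \<Gamma>)"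
abbreviation "tgt \<equiv> head (dgraph \<Gamma>)"

lemma loopsD: "p \<in> loops \<Gamma> n \<Longrightarrow> length p = n \<and> awalk (base \<Gamma>) p (base \<Gamma>) \<and> set p \<subseteq> R"
  by (auto simp: loops_def awalk_def)

lemma loop_arc: "p \<in> loops \<Gamma> n \<Longrightarrow> i < n \<Longrightarrow> p ! i \<in> R"
  using loopsD[of p n] nth_mem[of i p] by auto

lemma loops_0: "loops \<Gamma> 0 = {[]}"
  using base_vert by (auto simp: loops_def awalk_Nil_iff)

lemma awalk_snoc: "awalk u (p @ [e]) v \<longleftrightarrow> awalk u p (src e) \<and> e \<in> R \<and> tgt e = v"
proof
  assume a: "awalk u (p @ [e]) v"
  then obtain w where w: "awalk u p w" "awalk w [e] v" by auto
  then show "awalk u p (src e) \<and> e \<in> R \<and> tgt e = v" by (auto simp: awalk_Cons_iff awalk_Nil_iff)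
next
  assume a: "awalk u p (src e) \<and> e \<in> R \<and> tgt e = v"
  then have "awalk (src e) [e] v" by (auto simp: awalk_Cons_iff awalk_Nil_iff)
  with a show "awalk u (p @ [e]) v" by (auto intro: awalk_appendI)
qed

lemma path_wt_pos: "set p \<subseteq> R \<Longrightarrow> path_wt \<Gamma> p > 0"
  by (induction p) (auto simp: wt_pos)

lemma path_bar_bar: "set p \<subseteq> R \<Longrightarrow> path_bar \<Gamma> (path_bar \<Gamma> p) = p"
  by (induction p) (auto simp: path_bar_def ebar_ebar)

lemma path_wt_bar: "set p \<subseteq> R \<Longrightarrow> path_wt \<Gamma> p * path_wt \<Gamma> (path_bar \<Gamma> p) = 1"
proof (induction p)
  case (Cons e p)
  have "path_wt \<Gamma> (path_bar \<Gamma> (e # p)) = path_wt \<Gamma> (path_bar \<Gamma> p) * wt \<Gamma> (ebar \<Gamma> e)"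
    by (simp add: path_bar_def path_wt_append)
  moreover have "wt \<Gamma> e * wt \<Gamma> (ebar \<Gamma> e) = 1" using Cons.prems wt_ebar by simp
  moreover have "path_wt \<Gamma> p * path_wt \<Gamma> (path_bar \<Gamma> p) = 1" using Cons by simp
  moreover have "wt \<Gamma> e * path_wt \<Gamma> p * (path_wt \<Gamma> (path_bar \<Gamma> p) * wt \<Gamma> (ebar \<Gamma> e)) =
    (wt \<Gamma> e * wt \<Gamma> (ebar \<Gamma> e)) * (path_wt \<Gamma> p * path_wt \<Gamma> (path_bar \<Gamma> p))" by (simp add: mult_ac)
  ultimately show ?case by simp
qed (simp add: path_bar_def)

lemma path_wt_bar_eq: "set p \<subseteq> R \<Longrightarrow> path_wt \<Gamma> (path_bar \<Gamma> p) = inverse (path_wt \<Gamma> p)"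
  using path_wt_bar[of p] path_wt_pos[of p] by (simp add: field_simps)

lemma awalk_path_bar: "awalk u p v \<Longrightarrow> awalk v (path_bar \<Gamma> p) u"
proof (induction p arbitrary: u)
  case Nil
  then show ?case by (auto simp: path_bar_def awalk_Nil_iff)
next
  case (Cons e p)
  then have e: "e \<in> R" "src e = u" "awalk (tgt e) p v" by (auto simp: awalk_Cons_iff)
  then have "awalk v (path_bar \<Gamma> p) (tgt e)" using Cons.IH by simp
  then have "awalk v (path_bar \<Gamma> p @ [ebar \<Gamma> e]) u"
    unfolding awalk_snoc using e by (simp add: tail_ebar head_ebar ebar_arc)
  then show ?case by (simp add: path_bar_def)
qed

lemma path_bar_loop: "p \<in> loops \<Gamma> n \<Longrightarrow> path_bar \<Gamma> p \<in> loops \<Gamma> n"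
  using awalk_path_bar by (auto simp: loops_def path_bar_def)

lemma append_loop: "p \<in> loops \<Gamma> n \<Longrightarrow> q \<in> loops \<Gamma> m \<Longrightarrow> p @ q \<in> loops \<Gamma> (n + m)"
  by (auto simp: loops_def intro: awalk_appendI)

context
  fixes D :: diagram and n m :: nat and p q :: "'e list"
  assumes D: "D \<in> tl_diagrams n m" and p: "p \<in> loops \<Gamma> n" and q: "q \<in> loops \<Gamma> m"
    and adm: "admissible \<Gamma> D (label p q)"
begin

text \<open>Weights are inverted on the target so that the two ends of any strand have product 1: a
  turning strand carries edges of reciprocal weights, a through strand the same edge at both
  ends.\<close>

private definition "\<omega> P = (if fst P = 0 then wt \<Gamma> (p ! snd P) else inverse (wt \<Gamma> (q ! snd P)))" for P :: point

private lemma turn: "i < j \<Longrightarrow> {(l, i), (l, j)} \<in> D \<Longrightarrow> \<omega> (l, i) * \<omega> (l, j) = 1"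
proof -
  assume ij: "i < j" and d: "{(l, i), (l, j)} \<in> D"
  have P: "(l, i) \<in> points n m" "(l, j) \<in> points n m" using tl_mem[OF D d] by auto
  have e: "label p q (l, i) = ebar \<Gamma> (label p q (l, j))"
    using adm ij d unfolding admissible_def by blast
  have "label p q (l, j) \<in> R" using P loop_arc[OF p] loop_arc[OF q] by (auto simp: label_def mem_points)
  then have "wt \<Gamma> (label p q (l, i)) * wt \<Gamma> (label p q (l, j)) = 1"
    using wt_ebar e by (simp add: mult.commute)
  then show "\<omega> (l, i) * \<omega> (l, j) = 1"
    by (auto simp: \<omega>_def label_def inverse_mult_distrib[symmetric] simp del: inverse_mult_distrib split: if_splits)
qed

private lemma through: "{(0, i), (1, j)} \<in> D \<Longrightarrow> \<omega> (0, i) * \<omega> (1, j) = 1"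
proof -
  assume d: "{(0, i), (1, j)} \<in> D"
  have "(1, j) \<in> points n m" using tl_mem[OF D d] by auto
  then have "q ! j \<in> R" using loop_arc[OF q] by (auto simp: mem_points)
  moreover have "p ! i = q ! j" using adm d by (auto simp: admissible_def label_def)
  ultimately show ?thesis using wt_pos[of "q ! j"] by (simp add: \<omega>_def)
qed

private lemma pair: "{P, Q} \<in> D \<Longrightarrow> \<omega> P * \<omega> Q = 1"
proof -
  assume d: "{P, Q} \<in> D"
  obtain l i l' j where e: "P = (l, i)" "Q = (l', j)" by (cases P, cases Q) blast
  have pts: "(l, i) \<in> points n m" "(l', j) \<in> points n m" using tl_mem[OF D d] e by auto
  have ne: "(l, i) \<noteq> (l', j)" using mate_eq(2)[OF D d] e by simp
  consider "l = l'" "i < j" | "l = l'" "j < i" | "l = 0" "l' = 1" | "l = 1" "l' = 0"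
    using pts ne nat_neq_iff[of i j] by (auto simp: mem_points)
  then show ?thesis
  proof cases
    case 1 then show ?thesis using turn[of i j l] d e by simp
  next
    case 2 then show ?thesis using turn[of j i l] d e by (simp add: insert_commute mult.commute)
  next
    case 3 then show ?thesis using through[of i j] d e by simp
  next
    case 4 then show ?thesis using through[of j i] d e by (simp add: insert_commute mult.commute)
  qed
qed

private lemma \<sigma>: "{P, Q} \<in> D \<Longrightarrow>
   (\<lambda>x. \<omega> (pos_point n m (circle_pos n m P)) * x) \<circ> (\<lambda>x. \<omega> (pos_point n m (circle_pos n m Q)) * x) = id"
proof -
  assume d: "{P, Q} \<in> D"
  have "P \<in> points n m" "Q \<in> points n m" using tl_mem[OF D d] by auto
  then show ?thesis using pair[OF d] by (auto simp: pos_point_circle_pos fun_eq_iff mult.assoc[symmetric])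
qed

private lemma chord:
  assumes "{P, Q} \<in> D" "circle_pos n m P < circle_pos n m Q"
  shows "prod_list (map (\<lambda>t. \<omega> (pos_point n m t)) [Suc (circle_pos n m P)..<circle_pos n m Q]) = 1"
proof -
  have "word (\<lambda>t x. \<omega> (pos_point n m t) * x) [Suc (circle_pos n m P)..<circle_pos n m Q] = id"
    by (rule word_tl_chord[OF D _ assms]) (rule \<sigma>)
  then have "word (\<lambda>t x. \<omega> (pos_point n m t) * x) [Suc (circle_pos n m P)..<circle_pos n m Q] 1 = 1" by simp
  then show ?thesis by (simp add: word_mult)
qed

private lemma source_interval:
  assumes "b \<le> n"
  shows "map (\<lambda>t. \<omega> (pos_point n m t)) [a..<b] = map (\<lambda>t. wt \<Gamma> (p ! t)) [a..<b]"
  using assms by (simp add: pos_point_def \<omega>_def)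

text \<open>Place \<open>t\<close> of the circle is the target point \<open>n + m - 1 - t\<close>,
  so the places from \<open>a\<close> up to \<open>b - 1\<close> are the target points from
  \<open>n + m - b\<close> up to \<open>n + m - a - 1\<close> in reverse order, which does not
  change the product.\<close>

private lemma target_interval:
  assumes "n \<le> a" "b \<le> n + m"
  shows "prod_list (map (\<lambda>t. \<omega> (pos_point n m t)) [a..<b]) =
    inverse (prod_list (map (\<lambda>t. wt \<Gamma> (q ! t)) [n + m - b..<n + m - a]))"
proof -
  have "map (\<lambda>t. \<omega> (pos_point n m t)) [a..<b] = map (\<lambda>i. inverse (wt \<Gamma> (q ! i))) (map (\<lambda>t. n + m - 1 - t) [a..<b])"
    using assms by (simp add: pos_point_def \<omega>_def)
  also have "\<dots> = rev (map (\<lambda>i. inverse (wt \<Gamma> (q ! i))) [n + m - b..<n + m - a])"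
    by (simp only: map_rev_interval[OF assms(2)] rev_map)
  finally show ?thesis by (simp only: prod_list_rev prod_list_inverse)
qed

text \<open>The product of all weights around the circle is 1, and the target enters it
  inversely.\<close>

lemma admissible_path_wt: "path_wt \<Gamma> p = path_wt \<Gamma> q"
proof -
  have "word (\<lambda>t x. \<omega> (pos_point n m t) * x) [0..<n + m] = id" by (rule word_tl_circle[OF D]) (rule \<sigma>)
  then have "word (\<lambda>t x. \<omega> (pos_point n m t) * x) [0..<n + m] 1 = 1" by simp
  then have "prod_list (map (\<lambda>t. \<omega> (pos_point n m t)) ([0..<n] @ [n..<n + m])) = 1"
    using upt_add_eq_append[of 0 n m] by (simp add: word_mult)
  then have "prod_list (map (\<lambda>t. wt \<Gamma> (p ! t)) [0..<n]) * inverse (prod_list (map (\<lambda>t. wt \<Gamma> (q ! t)) [0..<m])) = 1"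
    using target_interval[of n "n + m"] by (simp add: source_interval)
  moreover have "path_wt \<Gamma> p = prod_list (map (\<lambda>t. wt \<Gamma> (p ! t)) [0..<n])"
    using path_wt_take[of 0 n p \<Gamma>] loopsD[OF p] by simp
  moreover have "path_wt \<Gamma> q = prod_list (map (\<lambda>t. wt \<Gamma> (q ! t)) [0..<m])"
    using path_wt_take[of 0 m q \<Gamma>] loopsD[OF q] by simp
  moreover have "path_wt \<Gamma> q > 0" using path_wt_pos loopsD[OF q] by simp
  ultimately show ?thesis by (simp add: field_simps)
qed

text \<open>A through strand encloses, on its right, the edges of \<open>p\<close> after
  \<open>i\<close> and those of \<open>q\<close> after \<open>j\<close>, so these suffixes have
  equal weight. The total weights and the edges carried by the strand agree as well; dividing leaves
  the prefixes.\<close>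

lemma admissible_through_height:
  assumes d: "{(0, i), (1, j)} \<in> D"
  shows "path_wt \<Gamma> (take i p) = path_wt \<Gamma> (take j q)"
proof -
  have ij: "i < n" "j < m" using tl_mem[OF D d, of "(0, i)"] tl_mem[OF D d, of "(1, j)"] by (auto simp: mem_points)
  have lt: "circle_pos n m (0, i) < circle_pos n m (1, j)" using ij by (simp add: circle_pos_def)
  have "[Suc i..<n + (m - 1 - j)] = [Suc i..<n] @ [n..<n + (m - 1 - j)]"
    using ij upt_add_eq_append[of "Suc i" n "m - 1 - j"] by simp
  then have "prod_list (map (\<lambda>t. \<omega> (pos_point n m t)) ([Suc i..<n] @ [n..<n + (m - 1 - j)])) = 1"
    using chord[OF d lt] by (simp add: circle_pos_def)
  then have *: "prod_list (map (\<lambda>t. wt \<Gamma> (p ! t)) [Suc i..<n]) *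
      inverse (prod_list (map (\<lambda>t. wt \<Gamma> (q ! t)) [Suc j..<m])) = 1"
    using target_interval[of n "n + (m - 1 - j)"] ij by (simp add: source_interval)
  have lp: "length p = n" "length q = m" using loopsD p q by auto
  have P: "path_wt \<Gamma> p = path_wt \<Gamma> (take (Suc i) p) * prod_list (map (\<lambda>t. wt \<Gamma> (p ! t)) [Suc i..<n])"
    using path_wt_take[of "Suc i" n p \<Gamma>] ij lp by simp
  have Q: "path_wt \<Gamma> q = path_wt \<Gamma> (take (Suc j) q) * prod_list (map (\<lambda>t. wt \<Gamma> (q ! t)) [Suc j..<m])"
    using path_wt_take[of "Suc j" m q \<Gamma>] ij lp by simp
  have pos: "path_wt \<Gamma> q > 0" using path_wt_pos loopsD[OF q] by simp
  then have q0: "prod_list (map (\<lambda>t. wt \<Gamma> (q ! t)) [Suc j..<m]) \<noteq> 0" using Q by auto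
  then have "prod_list (map (\<lambda>t. wt \<Gamma> (p ! t)) [Suc i..<n]) = prod_list (map (\<lambda>t. wt \<Gamma> (q ! t)) [Suc j..<m])"
    using * by (simp add: field_simps)
  then have "path_wt \<Gamma> (take (Suc i) p) = path_wt \<Gamma> (take (Suc j) q)"
    using P Q admissible_path_wt q0 by simp
  moreover have "path_wt \<Gamma> (take (Suc i) p) = path_wt \<Gamma> (take i p) * wt \<Gamma> (p ! i)"
    using path_wt_take[of i "Suc i" p \<Gamma>] ij lp by simp
  moreover have "path_wt \<Gamma> (take (Suc j) q) = path_wt \<Gamma> (take j q) * wt \<Gamma> (q ! j)"
    using path_wt_take[of j "Suc j" q \<Gamma>] ij lp by simp
  moreover have "p ! i = q ! j" using adm d by (auto simp: admissible_def label_def)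
  moreover have "wt \<Gamma> (q ! j) > 0" using wt_pos loop_arc[OF q ij(2)] by simp
  ultimately show ?thesis by simp
qed

text \<open>The edges strictly between \<open>i\<close> and \<open>j\<close> have total weight 1. So
  the height after the left edge, at \<open>Suc i\<close>, is the one before the right edge, at
  \<open>j\<close>: the walk turns back from the same height.\<close>

lemma admissible_source_height:
  assumes d: "{(0, i), (0, j)} \<in> D" and ij: "i < j"
  shows "path_wt \<Gamma> (take (Suc i) p) = path_wt \<Gamma> (take j p)"
proof -
  have j: "j < n" using tl_mem[OF D d, of "(0, j)"] by (auto simp: mem_points)
  have "prod_list (map (\<lambda>t. wt \<Gamma> (p ! t)) [Suc i..<j]) = 1"
    using chord[OF d] ij j source_interval[of j "Suc i"] by (simp add: circle_pos_def)
  then show ?thesis using path_wt_take[of "Suc i" j p \<Gamma>] ij j loopsD[OF p] by simp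
qed

lemma admissible_target_height:
  assumes d: "{(1, i), (1, j)} \<in> D" and ij: "i < j"
  shows "path_wt \<Gamma> (take (Suc i) q) = path_wt \<Gamma> (take j q)"
proof -
  have j: "j < m" using tl_mem[OF D d, of "(1, j)"] by (auto simp: mem_points)
  \<comment> \<open>On the circle the target is passed from right to left, so the right end
    \<open>j\<close> comes first.\<close>
  have d': "{(1, j), (1, i)} \<in> D" using d by (simp add: insert_commute)
  have "prod_list (map (\<lambda>t. \<omega> (pos_point n m t)) [Suc (n + (m - 1 - j))..<n + (m - 1 - i)]) = 1"
    using chord[OF d'] ij j by (simp add: circle_pos_def)
  then have "inverse (prod_list (map (\<lambda>t. wt \<Gamma> (q ! t)) [n + m - (n + (m - 1 - i))..<n + m - Suc (n + (m - 1 - j))])) = 1"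
    using target_interval[of "Suc (n + (m - 1 - j))" "n + (m - 1 - i)"] by simp
  moreover have "n + m - (n + (m - 1 - i)) = Suc i" "n + m - Suc (n + (m - 1 - j)) = j" using ij j by auto
  ultimately have "prod_list (map (\<lambda>t. wt \<Gamma> (q ! t)) [Suc i..<j]) = 1" by simp
  then show ?thesis using path_wt_take[of "Suc i" j q \<Gamma>] ij j loopsD[OF q] by simp
qed

end

section \<open>The operator of path weights\<close>

lemma state_nonzero_path_wt:
  "D \<in> tl_diagrams n m \<Longrightarrow> p \<in> loops \<Gamma> n \<Longrightarrow> q \<in> loops \<Gamma> m \<Longrightarrow> state \<Gamma> D (label p q) \<noteq> 0 \<Longrightarrow>
    path_wt \<Gamma> p = path_wt \<Gamma> q"
  using admissible_path_wt by (auto simp: state_def split: if_splits)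

text \<open>The modular operator in the basis of loops; \<open>modular_op_eq\<close> identifies it
  with the one defined by the inner products.\<close>

definition modular :: "(summand \<times> 'e list \<Rightarrow>\<^sub>0 complex) \<Rightarrow> (summand \<times> 'e list \<Rightarrow>\<^sub>0 complex)" where
  "modular u = lin_ext (\<lambda>k. Poly_Mapping.single k (of_real (path_wt \<Gamma> (snd k)))) u"

lemma lookup_modular: "Poly_Mapping.lookup (modular u) k = of_real (path_wt \<Gamma> (snd k)) * Poly_Mapping.lookup u k"
proof -
  have "Poly_Mapping.lookup (modular u) k = (\<Sum>x\<in>Poly_Mapping.keys u.
      if x = k then Poly_Mapping.lookup u k * of_real (path_wt \<Gamma> (snd k)) else 0)"
    unfolding modular_def lookup_lin_ext by (rule sum.cong) (auto simp: lookup_single when_def)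
  then show ?thesis by (simp add: in_keys_iff mult.commute)
qed

lemma modular_fixed_iff: "modular u = u \<longleftrightarrow> (\<forall>k\<in>Poly_Mapping.keys u. path_wt \<Gamma> (snd k) = 1)"
proof
  assume eq: "modular u = u"
  show "\<forall>k\<in>Poly_Mapping.keys u. path_wt \<Gamma> (snd k) = 1"
  proof
    fix k assume k: "k \<in> Poly_Mapping.keys u"
    have "of_real (path_wt \<Gamma> (snd k)) * Poly_Mapping.lookup u k = Poly_Mapping.lookup u k"
      using lookup_modular[of u k] eq by simp
    then show "path_wt \<Gamma> (snd k) = 1" using k by (simp add: in_keys_iff)
  qed
next
  assume "\<forall>k\<in>Poly_Mapping.keys u. path_wt \<Gamma> (snd k) = 1"
  then show "modular u = u"
    by (intro poly_mapping_eqI) (auto simp: lookup_modular in_keys_iff)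
qed

text \<open>A nonzero matrix coefficient of a diagram joins loops of equal weight. Hence the
  weight-one part is stable under all morphisms, and the operator preserves the range of each
  projection.\<close>

lemma graph_act_modular:
  assumes f: "f \<in> matrices S T" and u: "Poly_Mapping.keys u \<subseteq> loop_support \<Gamma> T"
  shows "graph_act \<Gamma> f (modular u) = modular (graph_act \<Gamma> f u)"
proof -
  have "graph_act \<Gamma> f (modular u) =
      bilin_ext (\<lambda>k l. pm_scale (of_real (path_wt \<Gamma> (snd l))) (act_basis \<Gamma> k l)) f u"
    unfolding graph_act_eq modular_def bilin_ext_lin_right
    by (subst bilin_ext_swap) (simp add: bilin_ext_def)
  also have "\<dots> = bilin_ext (\<lambda>k l. modular (act_basis \<Gamma> k l)) f u"
  proof (rule bilin_ext_cong)
    fix k l assume k: "k \<in> Poly_Mapping.keys f" and l: "l \<in> Poly_Mapping.keys u"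
    obtain x D y y' q where e: "k = (x, D, y)" "l = (y', q)" by (cases k, cases l) blast
    have D: "D \<in> tl_diagrams (snd x) (snd y)" using matricesD[OF f] k e by auto
    have q: "q \<in> loops \<Gamma> (snd y')" using l u e by (auto simp: loop_support_def)
    show "pm_scale (of_real (path_wt \<Gamma> (snd l))) (act_basis \<Gamma> k l) = modular (act_basis \<Gamma> k l)"
    proof (cases "y = y'")
      case True
      have "pm_scale (of_real (path_wt \<Gamma> q)) (Poly_Mapping.single (x, p) (of_real (state \<Gamma> D (label p q)))) =
          modular (Poly_Mapping.single (x, p) (of_real (state \<Gamma> D (label p q))))" if p: "p \<in> loops \<Gamma> (snd x)" for p
        using state_nonzero_path_wt[OF D p] q True
        by (cases "state \<Gamma> D (label p q) = 0") (simp_all add: modular_def mult.commute)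
      then show ?thesis
        using True by (simp add: e act_basis_def pm_scale_sum modular_def lin_ext_sum cong: sum.cong)
    qed (simp add: e act_basis_def modular_def)
  qed
  also have "\<dots> = modular (graph_act \<Gamma> f u)"
    unfolding graph_act_eq modular_def by (rule lin_ext_bilin[symmetric])
  finally show ?thesis .
qed

section \<open>The two inner products in the basis of loops\<close>

lemma left_ends_nested: "left_ends (nested_cups n) = Pair 1 ` {..<n}"
proof
  show "left_ends (nested_cups n) \<subseteq> Pair 1 ` {..<n}"
    by (auto simp: left_ends_def nested_cups_def doubleton_eq_iff)
  show "Pair 1 ` {..<n} \<subseteq> left_ends (nested_cups n)"
  proof
    fix P :: point assume "P \<in> Pair 1 ` {..<n}"
    then obtain i where i: "P = (1, i)" "i < n" by auto
    then have "{(1, i), (1, 2 * n - 1 - i)} \<in> nested_cups n" "i < 2 * n - 1 - i"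
      by (auto simp: nested_cups_def)
    then show "P \<in> left_ends (nested_cups n)" unfolding left_ends_def i(1) by blast
  qed
qed

lemma admissible_nested:
  "admissible \<Gamma> (nested_cups n) lab \<longleftrightarrow> (\<forall>i<n. lab (1, i) = ebar \<Gamma> (lab (1, 2 * n - 1 - i)))"
proof -
  have "{(l, i), (l, j)} \<in> nested_cups n \<longleftrightarrow> l = 1 \<and> i < n \<and> j = 2 * n - 1 - i" if "i < j" for l i j
    using that by (auto simp: nested_cups_def doubleton_eq_iff)
  moreover have "{(0, i), (1, j)} \<notin> nested_cups n" for i j
    by (auto simp: nested_cups_def doubleton_eq_iff)
  ultimately show ?thesis unfolding admissible_def by auto
qed

lemma sqrt_prod: "(\<Prod>i<n. sqrt (f i)) = sqrt (\<Prod>i<(n::nat). f i)"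
  by (induction n) (simp_all add: real_sqrt_mult)

text \<open>The left ends of the nested cups are the first \<open>n\<close> points, which carry
  \<open>P\<close>. So the root of the weight of the first factor appears; this asymmetry makes the
  two inner products differ.\<close>

lemma state_nested:
  assumes P: "length P = n" "set P \<subseteq> R" and Q: "length Q = n" "set Q \<subseteq> R"
  shows "state \<Gamma> (nested_cups n) (label [] (P @ Q)) = (if Q = path_bar \<Gamma> P then sqrt (path_wt \<Gamma> P) else 0)"
proof -
  have idx: "(P @ Q) ! (2 * n - 1 - i) = Q ! (n - 1 - i)" if "i < n" for i
    using that P by (auto simp: nth_append intro: arg_cong[of _ _ "(!) Q"])
  have "admissible \<Gamma> (nested_cups n) (label [] (P @ Q)) \<longleftrightarrow> (\<forall>i<n. P ! i = ebar \<Gamma> (Q ! (n - 1 - i)))"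
    unfolding admissible_nested using idx P by (simp add: label_def nth_append)
  also have "\<dots> \<longleftrightarrow> (\<forall>i<n. Q ! (n - 1 - i) = ebar \<Gamma> (P ! i))"
  proof -
    have "P ! i \<in> R" "Q ! (n - 1 - i) \<in> R" if "i < n" for i
      using that P Q nth_mem[of i P] nth_mem[of "n - 1 - i" Q] by auto
    then show ?thesis using ebar_ebar by metis
  qed
  also have "\<dots> \<longleftrightarrow> (\<forall>k<n. Q ! k = ebar \<Gamma> (P ! (n - 1 - k)))"
  proof (intro iffI allI impI)
    fix k assume a: "\<forall>i<n. Q ! (n - 1 - i) = ebar \<Gamma> (P ! i)" "k < n"
    then have "Q ! (n - 1 - (n - 1 - k)) = ebar \<Gamma> (P ! (n - 1 - k))" by (intro a(1)[rule_format]) auto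
    then show "Q ! k = ebar \<Gamma> (P ! (n - 1 - k))" using a(2) by simp
  next
    fix k assume a: "\<forall>i<n. Q ! i = ebar \<Gamma> (P ! (n - 1 - i))" "k < n"
    then have "Q ! (n - 1 - k) = ebar \<Gamma> (P ! (n - 1 - (n - 1 - k)))" by (intro a(1)[rule_format]) auto
    then show "Q ! (n - 1 - k) = ebar \<Gamma> (P ! k)" using a(2) by simp
  qed
  also have "\<dots> \<longleftrightarrow> Q = path_bar \<Gamma> P"
    using P Q by (auto simp: list_eq_iff_nth_eq path_bar_def rev_nth)
  finally have adm: "admissible \<Gamma> (nested_cups n) (label [] (P @ Q)) \<longleftrightarrow> Q = path_bar \<Gamma> P" .
  have "(\<Prod>X\<in>left_ends (nested_cups n). sqrt (wt \<Gamma> (label [] (P @ Q) X))) = (\<Prod>i<n. sqrt (wt \<Gamma> (P ! i)))"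
    unfolding left_ends_nested using P
    by (subst prod.reindex) (auto simp: inj_on_def label_def nth_append intro!: prod.cong)
  also have "\<dots> = sqrt (\<Prod>i<n. wt \<Gamma> (P ! i))" by (rule sqrt_prod)
  also have "(\<Prod>i<n. wt \<Gamma> (P ! i)) = path_wt \<Gamma> P"
    using P by (simp add: path_wt_def prod.list_conv_set_nth atLeast0LessThan)
  finally show ?thesis unfolding state_def adm by (simp only:)
qed

text \<open>By \<open>tensor_inject\<close> only the cup of the summand \<open>x\<close> itself can
  meet the given tensor factor; its source carries only the empty loop.\<close>

lemma graph_act_cups:
  assumes S: "uniform S" and x: "x \<in> S" and y: "y \<in> summand_bar ` S"
    and P: "P \<in> loops \<Gamma> (snd x)" and Q: "Q \<in> loops \<Gamma> (snd y)"
  shows "graph_act \<Gamma> (cups S) (Poly_Mapping.single (summand_tensor x y, P @ Q) c) =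
    (if y = summand_bar x \<and> Q = path_bar \<Gamma> P
     then Poly_Mapping.single (([], 0), []) (c * of_real (sqrt (path_wt \<Gamma> P))) else 0)"
proof -
  have fin: "finite S" using S by (simp add: uniform_def)
  have "graph_act \<Gamma> (cups S) (Poly_Mapping.single (summand_tensor x y, P @ Q) c) =
    (\<Sum>z\<in>S. pm_scale c (act_basis \<Gamma> (([], 0), nested_cups (snd z), summand_tensor z (summand_bar z)) (summand_tensor x y, P @ Q)))"
    by (simp add: graph_act_eq cups_def bilin_ext_sum_left)
  also have "\<dots> = (\<Sum>z\<in>S. if z = x then (if y = summand_bar x \<and> Q = path_bar \<Gamma> P
     then Poly_Mapping.single (([], 0), []) (c * of_real (sqrt (path_wt \<Gamma> P))) else 0) else 0)"
  proof (rule sum.cong[OF refl])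
    fix z assume z: "z \<in> S"
    have eq: "summand_tensor z (summand_bar z) = summand_tensor x y \<longleftrightarrow> z = x \<and> summand_bar z = y"
      by (rule tensor_inject[OF S uniform_bar[OF S]]) (use x y z in auto)
    have len: "length P = snd x" "set P \<subseteq> R" "length Q = snd y" "set Q \<subseteq> R"
      using loopsD[OF P] loopsD[OF Q] by auto
    show "pm_scale c (act_basis \<Gamma> (([], 0), nested_cups (snd z), summand_tensor z (summand_bar z)) (summand_tensor x y, P @ Q)) =
      (if z = x then (if y = summand_bar x \<and> Q = path_bar \<Gamma> P
       then Poly_Mapping.single (([], 0), []) (c * of_real (sqrt (path_wt \<Gamma> P))) else 0) else 0)"
    proof (cases "z = x \<and> summand_bar z = y")
      case True
      then show ?thesis using state_nested[OF len(1,2) _ len(4)] len by (auto simp: act_basis_def loops_0)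
    next
      case False
      then show ?thesis using eq by (auto simp: act_basis_def)
    qed
  qed
  also have "\<dots> = (if y = summand_bar x \<and> Q = path_bar \<Gamma> P
     then Poly_Mapping.single (([], 0), []) (c * of_real (sqrt (path_wt \<Gamma> P))) else 0)"
    using x fin by simp
  finally show ?thesis .
qed

lemma lin_ext_diagonal:
  "lin_ext (\<lambda>k. lin_ext (\<lambda>l. if k = l then Poly_Mapping.single z (c k) else 0) (pm_cnj g)) f =
    Poly_Mapping.single z (\<Sum>k\<in>Poly_Mapping.keys f. Poly_Mapping.lookup f k * cnj (Poly_Mapping.lookup g k) * c k)"
proof -
  have "lin_ext (\<lambda>l. if k = l then Poly_Mapping.single z (c k) else 0) (pm_cnj g) =
      Poly_Mapping.single z (cnj (Poly_Mapping.lookup g k) * c k)" for k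
  proof -
    have "lin_ext (\<lambda>l. if k = l then Poly_Mapping.single z (c k) else 0) (pm_cnj g) =
        (\<Sum>l\<in>Poly_Mapping.keys g. if k = l then Poly_Mapping.single z (cnj (Poly_Mapping.lookup g k) * c k) else 0)"
      unfolding lin_ext_def by (rule sum.cong) auto
    then show ?thesis by (simp add: in_keys_iff)
  qed
  then have "lin_ext (\<lambda>k. lin_ext (\<lambda>l. if k = l then Poly_Mapping.single z (c k) else 0) (pm_cnj g)) f =
     (\<Sum>k\<in>Poly_Mapping.keys f. Poly_Mapping.single z (Poly_Mapping.lookup f k * cnj (Poly_Mapping.lookup g k) * c k))"
    by (simp add: lin_ext_def mult.assoc)
  also have "\<dots> = Poly_Mapping.single z (\<Sum>k\<in>Poly_Mapping.keys f. Poly_Mapping.lookup f k * cnj (Poly_Mapping.lookup g k) * c k)"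
    by (rule poly_mapping_eqI) (simp add: lookup_sum lookup_single when_def)
  finally show ?thesis .
qed

text \<open>The product of \<open>p\<close> with its involute has \<open>p\<close> on the left, so
  the cups contribute the root of the weight of \<open>p\<close>. The involution contributed the
  root of the weight of the reversed loop, and the two are inverse to each other.\<close>

lemma graph_left_inner:
  assumes S: "uniform S" and f: "Poly_Mapping.keys f \<subseteq> loop_support \<Gamma> S" and g: "Poly_Mapping.keys g \<subseteq> loop_support \<Gamma> S"
  shows "graph_act \<Gamma> (cups S) (bilin_ext mult_basis f (lin_ext (invol_basis \<Gamma>) (pm_cnj g))) =
    Poly_Mapping.single (([], 0), []) (\<Sum>k\<in>Poly_Mapping.keys f. Poly_Mapping.lookup f k * cnj (Poly_Mapping.lookup g k))"
proof -
  have "graph_act \<Gamma> (cups S) (bilin_ext mult_basis f (lin_ext (invol_basis \<Gamma>) (pm_cnj g))) =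
     lin_ext (\<lambda>k. lin_ext (\<lambda>l. graph_act \<Gamma> (cups S) (bilin_ext mult_basis (Poly_Mapping.single k 1) (invol_basis \<Gamma> l))) (pm_cnj g)) f"
    unfolding graph_act_eq bilin_ext_lin_right
    by (subst bilin_ext_def[of mult_basis]) (simp add: bilin_ext_lin_right bilin_ext_def[of mult_basis] lin_ext_swap[of _ "pm_cnj g" f])
  also have "\<dots> = lin_ext (\<lambda>k. lin_ext (\<lambda>l. if k = l then Poly_Mapping.single (([], 0), []) 1 else 0) (pm_cnj g)) f"
  proof (intro lin_ext_cong)
    fix k l assume k: "k \<in> Poly_Mapping.keys f" and l: "l \<in> Poly_Mapping.keys (pm_cnj g)"
    obtain x p y r where e: "k = (x, p)" "l = (y, r)" by (cases k, cases l) blast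
    have x: "x \<in> S" "p \<in> loops \<Gamma> (snd x)" and y: "y \<in> S" "r \<in> loops \<Gamma> (snd y)"
      using f g k l e by (auto simp: loop_support_def)
    have arc: "set p \<subseteq> R" "set r \<subseteq> R" using loopsD x y by blast+
    have "path_bar \<Gamma> r = path_bar \<Gamma> p \<longleftrightarrow> r = p" using path_bar_bar arc by metis
    moreover have "sqrt (path_wt \<Gamma> (path_bar \<Gamma> p)) * sqrt (path_wt \<Gamma> p) = 1"
      using path_wt_bar[OF arc(1)] by (simp add: real_sqrt_mult[symmetric] mult.commute)
    then have "complex_of_real (sqrt (path_wt \<Gamma> (path_bar \<Gamma> p))) * of_real (sqrt (path_wt \<Gamma> p)) = 1"
      by (metis of_real_1 of_real_mult)
    ultimately show "graph_act \<Gamma> (cups S) (bilin_ext mult_basis (Poly_Mapping.single k 1) (invol_basis \<Gamma> l)) =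
        (if k = l then Poly_Mapping.single (([], 0), []) 1 else 0)"
      using graph_act_cups[OF S x(1) imageI[OF y(1)] x(2), of "path_bar \<Gamma> r"] path_bar_loop[OF y(2)]
      by (auto simp: e invol_basis_def mult_basis_def)
  qed
  also have "\<dots> = Poly_Mapping.single (([], 0), []) (\<Sum>k\<in>Poly_Mapping.keys f. Poly_Mapping.lookup f k * cnj (Poly_Mapping.lookup g k))"
    using lin_ext_diagonal[of "(([], 0), [])" "\<lambda>k. 1" g f] by simp
  finally show ?thesis .
qed

text \<open>Now the reversed loop stands on the left, so the involution and the cups both contribute
  the root of its weight; together they give the inverse weight of \<open>p\<close>.\<close>

lemma graph_right_inner:
  assumes S: "uniform S" and f: "Poly_Mapping.keys f \<subseteq> loop_support \<Gamma> S" and g: "Poly_Mapping.keys g \<subseteq> loop_support \<Gamma> S"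
  shows "graph_act \<Gamma> (cups (summand_bar ` S)) (bilin_ext mult_basis (lin_ext (invol_basis \<Gamma>) (pm_cnj g)) f) =
    Poly_Mapping.single (([], 0), []) (\<Sum>k\<in>Poly_Mapping.keys f.
      Poly_Mapping.lookup f k * cnj (Poly_Mapping.lookup g k) * of_real (inverse (path_wt \<Gamma> (snd k))))"
proof -
  have "graph_act \<Gamma> (cups (summand_bar ` S)) (bilin_ext mult_basis (lin_ext (invol_basis \<Gamma>) (pm_cnj g)) f) =
     lin_ext (\<lambda>k. lin_ext (\<lambda>l. graph_act \<Gamma> (cups (summand_bar ` S)) (bilin_ext mult_basis (invol_basis \<Gamma> l) (Poly_Mapping.single k 1))) (pm_cnj g)) f"
  proof -
    have 1: "bilin_ext mult_basis v f = lin_ext (\<lambda>k. bilin_ext mult_basis v (Poly_Mapping.single k 1)) f" for v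
      using bilin_ext_lin_right[of mult_basis v "\<lambda>k. Poly_Mapping.single k 1" f] by simp
    show ?thesis
      unfolding graph_act_eq by (subst 1) (simp only: bilin_ext_lin_left bilin_ext_lin_right)
  qed
  also have "\<dots> = lin_ext (\<lambda>k. lin_ext (\<lambda>l. if k = l then Poly_Mapping.single (([], 0), []) (of_real (inverse (path_wt \<Gamma> (snd k)))) else 0) (pm_cnj g)) f"
  proof (intro lin_ext_cong)
    fix k l assume k: "k \<in> Poly_Mapping.keys f" and l: "l \<in> Poly_Mapping.keys (pm_cnj g)"
    obtain x p y r where e: "k = (x, p)" "l = (y, r)" by (cases k, cases l) blast
    have x: "x \<in> S" "p \<in> loops \<Gamma> (snd x)" and y: "y \<in> S" "r \<in> loops \<Gamma> (snd y)"
      using f g k l e by (auto simp: loop_support_def)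
    have arc: "set p \<subseteq> R" "set r \<subseteq> R" using loopsD x y by blast+
    have r: "p = path_bar \<Gamma> (path_bar \<Gamma> r) \<longleftrightarrow> r = p" using path_bar_bar arc by metis
    have pos: "path_wt \<Gamma> p > 0" using path_wt_pos arc by simp
    have "sqrt (path_wt \<Gamma> (path_bar \<Gamma> p)) * sqrt (path_wt \<Gamma> (path_bar \<Gamma> p)) = inverse (path_wt \<Gamma> p)"
      using path_wt_bar_eq[OF arc(1)] pos by simp
    then have w: "complex_of_real (sqrt (path_wt \<Gamma> (path_bar \<Gamma> p))) * of_real (sqrt (path_wt \<Gamma> (path_bar \<Gamma> p))) =
        of_real (inverse (path_wt \<Gamma> p))"
      by (simp only: of_real_mult[symmetric])
    have "graph_act \<Gamma> (cups (summand_bar ` S)) (Poly_Mapping.single (summand_tensor (summand_bar y) x, path_bar \<Gamma> r @ p) c) =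
      (if x = summand_bar (summand_bar y) \<and> p = path_bar \<Gamma> (path_bar \<Gamma> r)
       then Poly_Mapping.single (([], 0), []) (c * of_real (sqrt (path_wt \<Gamma> (path_bar \<Gamma> r)))) else 0)" for c
      by (rule graph_act_cups[OF uniform_bar[OF S]]) (use x y path_bar_loop[OF y(2)] in \<open>auto simp: image_image\<close>)
    then show "graph_act \<Gamma> (cups (summand_bar ` S)) (bilin_ext mult_basis (invol_basis \<Gamma> l) (Poly_Mapping.single k 1)) =
        (if k = l then Poly_Mapping.single (([], 0), []) (of_real (inverse (path_wt \<Gamma> (snd k)))) else 0)"
      using w r by (auto simp: e invol_basis_def mult_basis_def)
  qed
  also have "\<dots> = Poly_Mapping.single (([], 0), []) (\<Sum>k\<in>Poly_Mapping.keys f.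
      Poly_Mapping.lookup f k * cnj (Poly_Mapping.lookup g k) * of_real (inverse (path_wt \<Gamma> (snd k))))"
    by (rule lin_ext_diagonal)
  finally show ?thesis .
qed

end


section \<open>The tracial cover\<close>

definition path_proj :: "((real \<times> 'a) \<times> 'e \<times> (real \<times> 'a)) list \<Rightarrow> 'e list" where
  "path_proj = map (\<lambda>(x, e, y). e)"

text \<open>The lift starting at the base vertex of the cover: the height begins at 1 and is
  multiplied by each edge weight, so it is always the weight of the prefix.\<close>

definition path_lift :: "('a, 'e) weighted_graph \<Rightarrow> 'e list \<Rightarrow> ((real \<times> 'a) \<times> 'e \<times> (real \<times> 'a)) list" where
  "path_lift \<Gamma> p = map (\<lambda>i. ((path_wt \<Gamma> (take i p), tail (dgraph \<Gamma>) (p ! i)), p ! i,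
     (path_wt \<Gamma> (take (Suc i) p), head (dgraph \<Gamma>) (p ! i)))) [0..<length p]"

lemma length_path_lift [simp]: "length (path_lift \<Gamma> p) = length p"
  by (simp add: path_lift_def)

lemma nth_path_lift: "i < length p \<Longrightarrow> path_lift \<Gamma> p ! i =
    ((path_wt \<Gamma> (take i p), tail (dgraph \<Gamma>) (p ! i)), p ! i, (path_wt \<Gamma> (take (Suc i) p), head (dgraph \<Gamma>) (p ! i)))"
  by (simp add: path_lift_def)

lemma path_lift_Nil [simp]: "path_lift \<Gamma> [] = []"
  by (simp add: path_lift_def)

lemma path_lift_snoc: "path_lift \<Gamma> (p @ [e]) = path_lift \<Gamma> p @
    [((path_wt \<Gamma> p, tail (dgraph \<Gamma>) e), e, (path_wt \<Gamma> p * wt \<Gamma> e, head (dgraph \<Gamma>) e))]"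
  by (rule nth_equalityI) (auto simp: nth_path_lift nth_append less_Suc_eq path_wt_append)

lemma path_proj_lift [simp]: "path_proj (path_lift \<Gamma> p) = p"
  by (rule nth_equalityI) (simp_all add: path_proj_def path_lift_def)

lemma path_proj_append: "path_proj (p @ q) = path_proj p @ path_proj q"
  by (simp add: path_proj_def)

lemma cover_simps:
  "base (tracial_cover \<Gamma>) = (1, base \<Gamma>)"
  "wt (tracial_cover \<Gamma>) (x, e, y) = wt \<Gamma> e"
  "ebar (tracial_cover \<Gamma>) (x, e, y) = (y, ebar \<Gamma> e, x)"
  "verts (dgraph (tracial_cover \<Gamma>)) = tracial_cover_verts \<Gamma>"
  "tail (dgraph (tracial_cover \<Gamma>)) (x, e, y) = x"
  "head (dgraph (tracial_cover \<Gamma>)) (x, e, y) = y"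
  by (simp_all add: tracial_cover_def)

lemma cover_arc_iff:
  "((r, v), e, (r', v')) \<in> arcs (dgraph (tracial_cover \<Gamma>)) \<longleftrightarrow>
     (r, v) \<in> tracial_cover_verts \<Gamma> \<and> (r', v') \<in> tracial_cover_verts \<Gamma> \<and> e \<in> arcs (dgraph \<Gamma>) \<and>
     tail (dgraph \<Gamma>) e = v \<and> head (dgraph \<Gamma>) e = v' \<and> wt \<Gamma> e = r' / r"
  by (simp add: tracial_cover_def)

lemma path_wt_cover: "path_wt (tracial_cover \<Gamma>) p = path_wt \<Gamma> (path_proj p)"
  by (induction p) (auto simp: path_proj_def cover_simps)

lemma path_bar_cover: "path_proj (path_bar (tracial_cover \<Gamma>) p) = path_bar \<Gamma> (path_proj p)"
  unfolding path_bar_def path_proj_def rev_map[symmetric] map_map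
  by (rule arg_cong[of _ _ rev], rule map_cong) (auto simp: cover_simps)

definition proj_map :: "(summand \<times> ((real \<times> 'a) \<times> 'e \<times> (real \<times> 'a)) list \<Rightarrow>\<^sub>0 complex) \<Rightarrow>
    (summand \<times> 'e list \<Rightarrow>\<^sub>0 complex)" where
  "proj_map = lin_ext (\<lambda>k. Poly_Mapping.single (fst k, path_proj (snd k)) 1)"

definition lift_map :: "('a, 'e) weighted_graph \<Rightarrow> (summand \<times> 'e list \<Rightarrow>\<^sub>0 complex) \<Rightarrow>
    (summand \<times> ((real \<times> 'a) \<times> 'e \<times> (real \<times> 'a)) list \<Rightarrow>\<^sub>0 complex)" where
  "lift_map \<Gamma> = lin_ext (\<lambda>k. Poly_Mapping.single (fst k, path_lift \<Gamma> (snd k)) 1)"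

lemma proj_map_lift_map: "proj_map (lift_map \<Gamma> u) = u"
  unfolding proj_map_def lift_map_def by (simp add: lin_ext_lin_ext)

lemma proj_map_single [simp]: "proj_map (Poly_Mapping.single (x, p) c) = Poly_Mapping.single (x, path_proj p) c"
  by (simp add: proj_map_def)

lemma proj_map_mult: "proj_map (bilin_ext mult_basis u v) = bilin_ext mult_basis (proj_map u) (proj_map v)"
  unfolding proj_map_def lin_ext_bilin bilin_ext_of_lin
  by (rule bilin_ext_cong) (auto simp: mult_basis_def path_proj_append)

lemma proj_map_invol:
  "proj_map (lin_ext (invol_basis (tracial_cover \<Gamma>)) (pm_cnj u)) = lin_ext (invol_basis \<Gamma>) (pm_cnj (proj_map u))"
  unfolding proj_map_def pm_cnj_lin_ext lin_ext_lin_ext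
  by (rule lin_ext_cong) (auto simp: invol_basis_def path_wt_cover path_bar_cover)

section \<open>The cover as a fair and balanced graph, and lifting of paths\<close>

context fair_balanced
begin

abbreviation "\<Gamma>' \<equiv> tracial_cover \<Gamma>"

lemma cover_vert_iff: "(r, v) \<in> tracial_cover_verts \<Gamma> \<longleftrightarrow> (\<exists>p. awalk (base \<Gamma>) p v \<and> r = path_wt \<Gamma> p)"
  by (auto simp: tracial_cover_verts_def)

lemma cover_vert_pos: "(r, v) \<in> tracial_cover_verts \<Gamma> \<Longrightarrow> r > 0"
  unfolding cover_vert_iff using path_wt_pos by (auto simp: awalk_def)

lemma cover_vert_step:
  assumes "(r, v) \<in> tracial_cover_verts \<Gamma>" "e \<in> R" "src e = v"
  shows "(r * wt \<Gamma> e, tgt e) \<in> tracial_cover_verts \<Gamma>"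
proof -
  obtain p where p: "awalk (base \<Gamma>) p v" "r = path_wt \<Gamma> p" using assms(1) unfolding cover_vert_iff by blast
  then have "awalk (base \<Gamma>) (p @ [e]) (tgt e)" unfolding awalk_snoc using assms by simp
  moreover have "r * wt \<Gamma> e = path_wt \<Gamma> (p @ [e])" by (simp add: p(2) path_wt_append)
  ultimately show ?thesis unfolding cover_vert_iff by blast
qed

text \<open>Heights are positive, so the condition on the weight of an edge determines the final
  height from the initial one: an arc of the cover amounts to an initial height and an edge of
  \<open>\<Gamma>\<close>.\<close>

lemma cover_arcE:
  assumes "a \<in> arcs (dgraph \<Gamma>')"
  obtains r e where "a = ((r, src e), e, (r * wt \<Gamma> e, tgt e))" "(r, src e) \<in> tracial_cover_verts \<Gamma>"
    "(r * wt \<Gamma> e, tgt e) \<in> tracial_cover_verts \<Gamma>" "e \<in> R" "r > 0"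
proof -
  obtain r v e r' v' where a: "a = ((r, v), e, (r', v'))" by (metis prod.exhaust)
  then have *: "(r, v) \<in> tracial_cover_verts \<Gamma>" "(r', v') \<in> tracial_cover_verts \<Gamma>" "e \<in> R"
    "src e = v" "tgt e = v'" "wt \<Gamma> e = r' / r" using assms by (auto simp: cover_arc_iff)
  have "r > 0" using cover_vert_pos *(1) .
  then have "r' = r * wt \<Gamma> e" using *(6) by simp
  then show thesis using that[of r e] a * \<open>r > 0\<close> by simp
qed

lemma cover_arcI:
  assumes "(r, src e) \<in> tracial_cover_verts \<Gamma>" "e \<in> R"
  shows "((r, src e), e, (r * wt \<Gamma> e, tgt e)) \<in> arcs (dgraph \<Gamma>')"
  using cover_vert_step[OF assms(1,2)] assms cover_vert_pos[OF assms(1)] by (simp add: cover_arc_iff)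

text \<open>Given the initial vertex, an edge of \<open>\<Gamma>\<close> lifts in exactly one way.
  Through this bijection, which preserves weights, the balancing sum is carried over.\<close>

lemma cover_out_arcs:
  assumes "(r, v) \<in> tracial_cover_verts \<Gamma>"
  shows "out_arcs (dgraph \<Gamma>') (r, v) = (\<lambda>e. ((r, v), e, (r * wt \<Gamma> e, tgt e))) ` out_arcs (dgraph \<Gamma>) v"
proof
  show "out_arcs (dgraph \<Gamma>') (r, v) \<subseteq> (\<lambda>e. ((r, v), e, (r * wt \<Gamma> e, tgt e))) ` out_arcs (dgraph \<Gamma>) v"
  proof
    fix a assume a: "a \<in> out_arcs (dgraph \<Gamma>') (r, v)"
    then have "a \<in> arcs (dgraph \<Gamma>')" by simp
    then obtain r' e where e: "a = ((r', src e), e, (r' * wt \<Gamma> e, tgt e))" "e \<in> R" by (rule cover_arcE)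
    then have "r' = r" "src e = v" using a by (auto simp: cover_simps)
    then show "a \<in> (\<lambda>e. ((r, v), e, (r * wt \<Gamma> e, tgt e))) ` out_arcs (dgraph \<Gamma>) v" using e by auto
  qed
  show "(\<lambda>e. ((r, v), e, (r * wt \<Gamma> e, tgt e))) ` out_arcs (dgraph \<Gamma>) v \<subseteq> out_arcs (dgraph \<Gamma>') (r, v)"
    using cover_arcI assms by (auto simp: cover_simps)
qed

lemma fair_balanced_tracial_cover: "fair_balanced \<delta> \<Gamma>'"
proof unfold_locales
  fix a assume a: "a \<in> arcs (dgraph \<Gamma>')"
  then obtain r e where e: "a = ((r, src e), e, (r * wt \<Gamma> e, tgt e))" "(r, src e) \<in> tracial_cover_verts \<Gamma>"
    "(r * wt \<Gamma> e, tgt e) \<in> tracial_cover_verts \<Gamma>" "e \<in> R" "r > 0" by (rule cover_arcE)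
  show "tail (dgraph \<Gamma>') a \<in> verts (dgraph \<Gamma>')" "head (dgraph \<Gamma>') a \<in> verts (dgraph \<Gamma>')"
    using e by (simp_all add: cover_simps)
  show "wt \<Gamma>' a > 0" using e wt_pos by (simp add: cover_simps)
  have w: "wt \<Gamma> e * wt \<Gamma> (ebar \<Gamma> e) = 1" using wt_ebar e by simp
  then have r: "r * wt \<Gamma> e * wt \<Gamma> (ebar \<Gamma> e) = r" by (simp add: mult.assoc)
  have "((r * wt \<Gamma> e, tgt e), ebar \<Gamma> e, (r * wt \<Gamma> e * wt \<Gamma> (ebar \<Gamma> e), src e)) \<in> arcs (dgraph \<Gamma>')"
    using cover_arcI[of "r * wt \<Gamma> e" "ebar \<Gamma> e"] e by (simp add: tail_ebar head_ebar ebar_arc)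
  then show "ebar \<Gamma>' a \<in> arcs (dgraph \<Gamma>')" unfolding r by (simp add: e(1) cover_simps)
  show "ebar \<Gamma>' (ebar \<Gamma>' a) = a" using e by (simp add: cover_simps ebar_ebar)
  show "tail (dgraph \<Gamma>') (ebar \<Gamma>' a) = head (dgraph \<Gamma>') a" "head (dgraph \<Gamma>') (ebar \<Gamma>' a) = tail (dgraph \<Gamma>') a"
    using e by (simp_all add: cover_simps)
  show "wt \<Gamma>' a * wt \<Gamma>' (ebar \<Gamma>' a) = 1" using e w by (simp add: cover_simps)
next
  have "awalk (base \<Gamma>) [] (base \<Gamma>)" using base_vert by (simp add: awalk_Nil_iff)
  then have "(1, base \<Gamma>) \<in> tracial_cover_verts \<Gamma>" unfolding cover_vert_iff by (metis path_wt_Nil)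
  then show "base \<Gamma>' \<in> verts (dgraph \<Gamma>')" by (simp add: cover_simps)
next
  fix x assume "x \<in> verts (dgraph \<Gamma>')"
  then obtain r v where x: "x = (r, v)" "(r, v) \<in> tracial_cover_verts \<Gamma>"
    by (cases x) (simp add: cover_simps)
  then have v: "v \<in> V" by (auto simp: tracial_cover_verts_def)
  have "finite (out_arcs (dgraph \<Gamma>') x)"
    unfolding x(1) cover_out_arcs[OF x(2)] using locally_finite[OF v] by blast
  moreover have "in_arcs (dgraph \<Gamma>') x \<subseteq> (\<lambda>e. ((r / wt \<Gamma> e, src e), e, (r, v))) ` in_arcs (dgraph \<Gamma>) v"
  proof
    fix a assume a: "a \<in> in_arcs (dgraph \<Gamma>') x"
    then have "a \<in> arcs (dgraph \<Gamma>')" by simp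
    then obtain s e where e: "a = ((s, src e), e, (s * wt \<Gamma> e, tgt e))" "e \<in> R" by (rule cover_arcE)
    then have "s * wt \<Gamma> e = r" "tgt e = v" using a x by (auto simp: cover_simps)
    then show "a \<in> (\<lambda>e. ((r / wt \<Gamma> e, src e), e, (r, v))) ` in_arcs (dgraph \<Gamma>) v"
      using e wt_pos[of e] by (intro image_eqI[of _ _ e]) auto
  qed
  then have "finite (in_arcs (dgraph \<Gamma>') x)"
    by (rule finite_subset) (use locally_finite[OF v] in blast)
  ultimately show "finite (out_arcs (dgraph \<Gamma>') x) \<and> finite (in_arcs (dgraph \<Gamma>') x)" ..
  have "(\<Sum>a\<in>out_arcs (dgraph \<Gamma>') x. wt \<Gamma>' a) = (\<Sum>e\<in>out_arcs (dgraph \<Gamma>) v. wt \<Gamma> e)"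
    unfolding x(1) cover_out_arcs[OF x(2)] by (subst sum.reindex) (auto simp: inj_on_def cover_simps)
  then show "(\<Sum>a\<in>out_arcs (dgraph \<Gamma>') x. wt \<Gamma>' a) = \<delta>" using balanced[OF v] by simp
qed

lemma awalk_path_lift:
  "awalk (base \<Gamma>) p v \<Longrightarrow> pre_digraph.awalk (dgraph \<Gamma>') (base \<Gamma>') (path_lift \<Gamma> p) (path_wt \<Gamma> p, v)"
proof (induction p arbitrary: v rule: rev_induct)
  case Nil
  interpret C: fair_balanced \<delta> \<Gamma>' by (rule fair_balanced_tracial_cover)
  show ?case using Nil C.base_vert by (simp add: awalk_Nil_iff C.awalk_Nil_iff cover_simps)
next
  case (snoc e p)
  interpret C: fair_balanced \<delta> \<Gamma>' by (rule fair_balanced_tracial_cover)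
  have e: "awalk (base \<Gamma>) p (src e)" "e \<in> R" "tgt e = v" using snoc.prems by (auto simp: awalk_snoc)
  then have "(path_wt \<Gamma> p, src e) \<in> tracial_cover_verts \<Gamma>" unfolding cover_vert_iff by blast
  from cover_arcI[OF this e(2)] snoc.IH[OF e(1)] e(3) show ?case
    unfolding path_lift_snoc C.awalk_snoc by (simp add: cover_simps path_wt_append)
qed

text \<open>Lifts are unique, and the height of the end point is the weight of the projected path.
  In particular a walk of the cover returns to its base only when its projection has weight
  1.\<close>

lemma awalk_path_proj:
  "pre_digraph.awalk (dgraph \<Gamma>') (base \<Gamma>') p x \<Longrightarrow>
    awalk (base \<Gamma>) (path_proj p) (snd x) \<and> fst x = path_wt \<Gamma> (path_proj p) \<and> path_lift \<Gamma> (path_proj p) = p"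
proof (induction p arbitrary: x rule: rev_induct)
  case Nil
  interpret C: fair_balanced \<delta> \<Gamma>' by (rule fair_balanced_tracial_cover)
  show ?case using Nil base_vert by (auto simp: awalk_Nil_iff C.awalk_Nil_iff cover_simps path_proj_def)
next
  case (snoc a p)
  interpret C: fair_balanced \<delta> \<Gamma>' by (rule fair_balanced_tracial_cover)
  have a: "C.awalk (base \<Gamma>') p (tail (dgraph \<Gamma>') a)" "a \<in> arcs (dgraph \<Gamma>')" "head (dgraph \<Gamma>') a = x"
    using snoc.prems by (auto simp: C.awalk_snoc)
  obtain r e where e: "a = ((r, src e), e, (r * wt \<Gamma> e, tgt e))" "e \<in> R" using a(2) by (rule cover_arcE)
  have "path_proj (p @ [a]) = path_proj p @ [e]" by (simp add: path_proj_def e)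
  moreover have "x = (r * wt \<Gamma> e, tgt e)" "tail (dgraph \<Gamma>') a = (r, src e)" using a(3) e by (simp_all add: cover_simps)
  ultimately show ?case using snoc.IH[OF a(1)] e
    unfolding awalk_snoc by (simp add: awalk_snoc path_lift_snoc path_wt_append del: awalk_append_iff)
qed

lemma loops_cover: "loops \<Gamma>' n = path_lift \<Gamma> ` {p \<in> loops \<Gamma> n. path_wt \<Gamma> p = 1}"
proof
  show "loops \<Gamma>' n \<subseteq> path_lift \<Gamma> ` {p \<in> loops \<Gamma> n. path_wt \<Gamma> p = 1}"
  proof
    fix p assume p: "p \<in> loops \<Gamma>' n"
    then have "pre_digraph.awalk (dgraph \<Gamma>') (base \<Gamma>') p (base \<Gamma>')" "length p = n" by (auto simp: loops_def)
    from awalk_path_proj[OF this(1)] this(2)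
    have "path_proj p \<in> {p \<in> loops \<Gamma> n. path_wt \<Gamma> p = 1}" "p = path_lift \<Gamma> (path_proj p)"
      by (auto simp: loops_def cover_simps path_proj_def)
    then show "p \<in> path_lift \<Gamma> ` {p \<in> loops \<Gamma> n. path_wt \<Gamma> p = 1}" by blast
  qed
  show "path_lift \<Gamma> ` {p \<in> loops \<Gamma> n. path_wt \<Gamma> p = 1} \<subseteq> loops \<Gamma>' n"
  proof
    fix a assume "a \<in> path_lift \<Gamma> ` {p \<in> loops \<Gamma> n. path_wt \<Gamma> p = 1}"
    then obtain p where p: "a = path_lift \<Gamma> p" "p \<in> loops \<Gamma> n" "path_wt \<Gamma> p = 1" by blast
    then show "a \<in> loops \<Gamma>' n" using awalk_path_lift[of p "base \<Gamma>"] by (simp add: loops_def cover_simps)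
  qed
qed

section \<open>State sums on lifted loops\<close>

lemma inj_path_lift: "inj_on (path_lift \<Gamma>) A"
  by (rule inj_on_inverseI[of _ path_proj]) simp

text \<open>Forgetting heights gives one direction. Conversely, matching of lifted edges also
  requires equal heights at both of their ends: the height lemmas supply one end, and the edge
  weights then supply the other.\<close>

lemma admissible_cover:
  assumes D: "D \<in> tl_diagrams n m" and p: "p \<in> loops \<Gamma> n" and q: "q \<in> loops \<Gamma> m"
  shows "admissible \<Gamma>' D (label (path_lift \<Gamma> p) (path_lift \<Gamma> q)) \<longleftrightarrow> admissible \<Gamma> D (label p q)"
    (is "?L \<longleftrightarrow> ?R")
proof -
  have len: "length p = n" "length q = m" using loopsD p q by auto
  define edge where "edge = (\<lambda>(x :: real \<times> 'a, e :: 'e, y :: real \<times> 'a). e)"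
  have edge: "edge (label (path_lift \<Gamma> p) (path_lift \<Gamma> q) P) = label p q P" if "P \<in> points n m" for P
    using that by (auto simp: points_def label_def nth_path_lift len edge_def)
  have edge_bar: "edge (ebar \<Gamma>' a) = ebar \<Gamma> (edge a)" for a
    by (cases a) (auto simp: cover_simps edge_def)
  show ?thesis
  proof
    assume L: ?L
    show ?R unfolding admissible_def
    proof (intro conjI allI impI)
      fix i j assume d: "{(0, i), (1, j)} \<in> D"
      have "label (path_lift \<Gamma> p) (path_lift \<Gamma> q) (0, i) = label (path_lift \<Gamma> p) (path_lift \<Gamma> q) (1, j)"
        using L d unfolding admissible_def by blast
      then show "label p q (0, i) = label p q (1, j)"
        using edge tl_mem[OF D d] by (metis insertI1 insertI2)
    next
      fix l i j assume d: "i < j \<and> {(l, i), (l, j)} \<in> D"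
      have "label (path_lift \<Gamma> p) (path_lift \<Gamma> q) (l, i) = ebar \<Gamma>' (label (path_lift \<Gamma> p) (path_lift \<Gamma> q) (l, j))"
        using L d unfolding admissible_def by blast
      then show "label p q (l, i) = ebar \<Gamma> (label p q (l, j))"
        using edge edge_bar tl_mem[OF D conjunct2[OF d]] by (metis insertI1 insertI2)
    qed
  next
    assume A: ?R
    note hts = admissible_through_height[OF D p q A] admissible_source_height[OF D p q A]
      admissible_target_height[OF D p q A]
    have step: "path_wt \<Gamma> (take (Suc i) r) = path_wt \<Gamma> (take i r) * wt \<Gamma> (r ! i)" if "i < length r" for r i
      using path_wt_take[of i "Suc i" r \<Gamma>] that by simp
    \<comment> \<open>The height after edge \<open>j\<close> is the one after edge \<open>i\<close>
      times the weight of \<open>j\<close>; as the weights of \<open>i\<close> and \<open>j\<close>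
      are reciprocal, it equals the height before \<open>i\<close>. So the lifted edges are reverse
      to each other.\<close>
    have turn: "path_lift \<Gamma> r ! i = ebar \<Gamma>' (path_lift \<Gamma> r ! j)"
      if "i < j" "j < k" "r \<in> loops \<Gamma> k" and e: "r ! i = ebar \<Gamma> (r ! j)"
        and h: "path_wt \<Gamma> (take (Suc i) r) = path_wt \<Gamma> (take j r)" for r i j k
    proof -
      have l: "length r = k" using loopsD that by auto
      have a: "r ! j \<in> R" using loop_arc that by simp
      have "wt \<Gamma> (r ! i) * wt \<Gamma> (r ! j) = 1" using wt_ebar[OF a] e by (simp add: mult.commute)
      then have "path_wt \<Gamma> (take (Suc j) r) = path_wt \<Gamma> (take i r)"
        using h step[of i r] step[of j r] that l by (simp add: mult.assoc[symmetric])
      then show ?thesis using that l h tail_ebar[OF a] head_ebar[OF a] e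
        by (simp add: nth_path_lift cover_simps)
    qed
    show ?L unfolding admissible_def
    proof (intro conjI allI impI)
      fix i j assume d: "{(0, i), (1, j)} \<in> D"
      have ij: "i < n" "j < m" using tl_mem[OF D d, of "(0, i)"] tl_mem[OF D d, of "(1, j)"] by (auto simp: mem_points)
      have e: "p ! i = q ! j" using A d by (auto simp: admissible_def label_def)
      show "label (path_lift \<Gamma> p) (path_lift \<Gamma> q) (0, i) = label (path_lift \<Gamma> p) (path_lift \<Gamma> q) (1, j)"
        using ij len e hts(1)[OF d] step[of i p] step[of j q] by (simp add: label_def nth_path_lift)
    next
      fix l i j assume d: "i < j \<and> {(l, i), (l, j)} \<in> D"
      then have e: "label p q (l, i) = ebar \<Gamma> (label p q (l, j))" using A unfolding admissible_def by blast
      have "(l, j) \<in> points n m" using tl_mem[OF D conjunct2[OF d]] by simp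
      then consider "l = 0" "j < n" | "l = 1" "j < m" by (auto simp: mem_points)
      then show "label (path_lift \<Gamma> p) (path_lift \<Gamma> q) (l, i) = ebar \<Gamma>' (label (path_lift \<Gamma> p) (path_lift \<Gamma> q) (l, j))"
      proof cases
        case 1
        then show ?thesis using turn[of i j n p] d e hts(2)[of i j] p by (simp add: label_def)
      next
        case 2
        then show ?thesis using turn[of i j m q] d e hts(3)[of i j] q by (simp add: label_def)
      qed
    qed
  qed
qed

lemma state_cover:
  assumes D: "D \<in> tl_diagrams n m" and p: "p \<in> loops \<Gamma> n" and q: "q \<in> loops \<Gamma> m"
  shows "state \<Gamma>' D (label (path_lift \<Gamma> p) (path_lift \<Gamma> q)) = state \<Gamma> D (label p q)"
proof -
  have len: "length p = n" "length q = m" using loopsD p q by auto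
  have "(\<Prod>P\<in>left_ends D. sqrt (wt \<Gamma>' (label (path_lift \<Gamma> p) (path_lift \<Gamma> q) P))) =
      (\<Prod>P\<in>left_ends D. sqrt (wt \<Gamma> (label p q P)))"
  proof (rule prod.cong[OF refl])
    fix P assume "P \<in> left_ends D"
    then obtain l i j where "P = (l, i)" "{(l, i), (l, j)} \<in> D" by (auto simp: left_ends_def)
    then have "P \<in> points n m" using tl_mem[OF D] by blast
    then show "sqrt (wt \<Gamma>' (label (path_lift \<Gamma> p) (path_lift \<Gamma> q) P)) = sqrt (wt \<Gamma> (label p q P))"
      by (auto simp: points_def label_def nth_path_lift len cover_simps)
  qed
  then show ?thesis unfolding state_def admissible_cover[OF assms] by (simp only:)
qed

lemma cover_support: "loop_support \<Gamma>' S = (\<lambda>k. (fst k, path_lift \<Gamma> (snd k))) ` {k \<in> loop_support \<Gamma> S. path_wt \<Gamma> (snd k) = 1}"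
  by (force simp: loop_support_def loops_cover image_iff)

lemma lift_map_proj_map:
  assumes "Poly_Mapping.keys u \<subseteq> loop_support \<Gamma>' S"
  shows "lift_map \<Gamma> (proj_map u) = u"
proof -
  have "lift_map \<Gamma> (proj_map u) = lin_ext (\<lambda>k. Poly_Mapping.single k 1) u"
    unfolding lift_map_def proj_map_def lin_ext_lin_ext
    by (rule lin_ext_cong) (use assms in \<open>auto simp: cover_support\<close>)
  then show ?thesis by simp
qed

lemma keys_proj_map:
  assumes "Poly_Mapping.keys u \<subseteq> loop_support \<Gamma>' S"
  shows "Poly_Mapping.keys (proj_map u) \<subseteq> {k \<in> loop_support \<Gamma> S. path_wt \<Gamma> (snd k) = 1}"
  unfolding proj_map_def
proof (rule keys_lin_ext)
  fix k assume "k \<in> Poly_Mapping.keys u"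
  then obtain x p where "k = (x, path_lift \<Gamma> p)" "(x, p) \<in> loop_support \<Gamma> S" "path_wt \<Gamma> p = 1"
    using assms unfolding cover_support by auto
  then show "Poly_Mapping.keys (Poly_Mapping.single (fst k, path_proj (snd k)) (1::complex)) \<subseteq>
      {k \<in> loop_support \<Gamma> S. path_wt \<Gamma> (snd k) = 1}" by simp
qed

lemma keys_lift_map:
  assumes "Poly_Mapping.keys u \<subseteq> {k \<in> loop_support \<Gamma> S. path_wt \<Gamma> (snd k) = 1}"
  shows "Poly_Mapping.keys (lift_map \<Gamma> u) \<subseteq> loop_support \<Gamma>' S"
  unfolding lift_map_def cover_support by (rule keys_lin_ext) (use assms in auto)

text \<open>The state sum over the cover ranges over loops of weight 1 only. Acting on a loop of
  weight 1, the state sum over \<open>\<Gamma>\<close> has coefficient zero at all other loops, so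
  nothing is lost.\<close>

lemma proj_map_act:
  assumes f: "f \<in> matrices S T" and u: "Poly_Mapping.keys u \<subseteq> loop_support \<Gamma>' T"
  shows "proj_map (graph_act \<Gamma>' f u) = graph_act \<Gamma> f (proj_map u)"
proof -
  have "proj_map (graph_act \<Gamma>' f u) = bilin_ext (\<lambda>k l. proj_map (act_basis \<Gamma>' k l)) f u"
    unfolding graph_act_eq proj_map_def by (rule lin_ext_bilin)
  also have "\<dots> = bilin_ext (\<lambda>k l. act_basis \<Gamma> k (fst l, path_proj (snd l))) f u"
  proof (rule bilin_ext_cong)
    fix k l assume k: "k \<in> Poly_Mapping.keys f" and l: "l \<in> Poly_Mapping.keys u"
    obtain x D y where e: "k = (x, D, y)" by (cases k) blast
    have D: "D \<in> tl_diagrams (snd x) (snd y)" using matricesD[OF f] k e by auto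
    obtain y' q where q: "l = (y', path_lift \<Gamma> q)" "q \<in> loops \<Gamma> (snd y')" "path_wt \<Gamma> q = 1"
      using l u unfolding cover_support by (auto simp: loop_support_def)
    show "proj_map (act_basis \<Gamma>' k l) = act_basis \<Gamma> k (fst l, path_proj (snd l))"
    proof (cases "y = y'")
      case True
      have q': "q \<in> loops \<Gamma> (snd y)" using q True by simp
      let ?A = "{p \<in> loops \<Gamma> (snd x). path_wt \<Gamma> p = 1}"
      have "proj_map (act_basis \<Gamma>' k l) = (\<Sum>p\<in>loops \<Gamma>' (snd x).
          Poly_Mapping.single (x, path_proj p) (of_real (state \<Gamma>' D (label p (path_lift \<Gamma> q)))))"
        using True by (simp add: e q(1) act_basis_def proj_map_def lin_ext_sum)
      also have "\<dots> = (\<Sum>p\<in>?A. Poly_Mapping.single (x, p) (of_real (state \<Gamma>' D (label (path_lift \<Gamma> p) (path_lift \<Gamma> q)))))"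
        unfolding loops_cover by (subst sum.reindex[OF inj_path_lift]) simp
      also have "\<dots> = (\<Sum>p\<in>?A. Poly_Mapping.single (x, p) (of_real (state \<Gamma> D (label p q))))"
        by (rule sum.cong[OF refl]) (use state_cover[OF D _ q'] in simp)
      also have "\<dots> = (\<Sum>p\<in>loops \<Gamma> (snd x). Poly_Mapping.single (x, p) (of_real (state \<Gamma> D (label p q))))"
      proof (rule sum.mono_neutral_left)
        show "\<forall>p\<in>loops \<Gamma> (snd x) - ?A. Poly_Mapping.single (x, p) (complex_of_real (state \<Gamma> D (label p q))) = 0"
        proof
          fix p assume "p \<in> loops \<Gamma> (snd x) - ?A"
          then have "state \<Gamma> D (label p q) = 0" using state_nonzero_path_wt[OF D _ q', of p] q(3) by auto
          then show "Poly_Mapping.single (x, p) (complex_of_real (state \<Gamma> D (label p q))) = 0" by simp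
        qed
      qed (use finite_loops in auto)
      also have "\<dots> = act_basis \<Gamma> k (fst l, path_proj (snd l))"
        using True by (simp add: e q(1) act_basis_def)
      finally show ?thesis .
    qed (simp add: e q(1) act_basis_def proj_map_def)
  qed
  also have "\<dots> = graph_act \<Gamma> f (proj_map u)"
    unfolding graph_act_eq proj_map_def bilin_ext_lin_right
    by (subst bilin_ext_swap) (simp add: bilin_ext_def)
  finally show ?thesis .
qed

section \<open>Supports and the weight-one part under the operations\<close>

lemma mult_support:
  assumes "Poly_Mapping.keys u \<subseteq> loop_support \<Gamma> S" "Poly_Mapping.keys v \<subseteq> loop_support \<Gamma> T"
  shows "Poly_Mapping.keys (bilin_ext mult_basis u v) \<subseteq> loop_support \<Gamma> (tensor_set S T)"
proof (rule keys_bilin_ext)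
  fix k l assume *: "k \<in> Poly_Mapping.keys u" "l \<in> Poly_Mapping.keys v"
  obtain x p y q where e: "k = (x, p)" "l = (y, q)" by (cases k, cases l) blast
  have "x \<in> S" "p \<in> loops \<Gamma> (snd x)" "y \<in> T" "q \<in> loops \<Gamma> (snd y)"
    using assms * e by (auto simp: loop_support_def)
  then show "Poly_Mapping.keys (mult_basis k l) \<subseteq> loop_support \<Gamma> (tensor_set S T)"
    using append_loop by (auto simp: e mult_basis_def loop_support_def)
qed

lemma invol_support:
  assumes "Poly_Mapping.keys u \<subseteq> loop_support \<Gamma> S"
  shows "Poly_Mapping.keys (lin_ext (invol_basis \<Gamma>) (pm_cnj u)) \<subseteq> loop_support \<Gamma> (summand_bar ` S)"
proof (rule keys_lin_ext)
  fix k assume *: "k \<in> Poly_Mapping.keys (pm_cnj u)"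
  obtain x p where e: "k = (x, p)" by (cases k) blast
  have "x \<in> S" "p \<in> loops \<Gamma> (snd x)" using assms * e by (auto simp: loop_support_def)
  then show "Poly_Mapping.keys (invol_basis \<Gamma> k) \<subseteq> loop_support \<Gamma> (summand_bar ` S)"
    using path_bar_loop by (auto simp: e invol_basis_def loop_support_def)
qed

lemma modular_mult_fixed:
  assumes "modular u = u" "modular v = v"
  shows "modular (bilin_ext mult_basis u v) = bilin_ext mult_basis u v"
proof -
  have "Poly_Mapping.keys (bilin_ext mult_basis u v) \<subseteq> {k. path_wt \<Gamma> (snd k) = 1}"
    by (rule keys_bilin_ext) (use assms[unfolded modular_fixed_iff] in \<open>fastforce simp: mult_basis_def path_wt_append\<close>)
  then show ?thesis unfolding modular_fixed_iff by blast
qed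

lemma modular_invol_fixed:
  assumes "modular u = u" "Poly_Mapping.keys u \<subseteq> loop_support \<Gamma> S"
  shows "modular (lin_ext (invol_basis \<Gamma>) (pm_cnj u)) = lin_ext (invol_basis \<Gamma>) (pm_cnj u)"
proof -
  have "Poly_Mapping.keys (lin_ext (invol_basis \<Gamma>) (pm_cnj u)) \<subseteq> {k. path_wt \<Gamma> (snd k) = 1}"
  proof (rule keys_lin_ext)
    fix k assume *: "k \<in> Poly_Mapping.keys (pm_cnj u)"
    obtain x p where e: "k = (x, p)" by (cases k) blast
    have "p \<in> loops \<Gamma> (snd x)" "path_wt \<Gamma> p = 1"
      using assms(2) * e assms(1)[unfolded modular_fixed_iff] by (auto simp: loop_support_def)
    then show "Poly_Mapping.keys (invol_basis \<Gamma> k) \<subseteq> {k. path_wt \<Gamma> (snd k) = 1}"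
      using path_wt_bar_eq[of p] loopsD by (auto simp: e invol_basis_def)
  qed
  then show ?thesis unfolding modular_fixed_iff by blast
qed

lemma finite_loop_support: "finite S \<Longrightarrow> finite (loop_support \<Gamma> S)"
  by (rule finite_subset[of _ "Sigma S (\<lambda>x. loops \<Gamma> (snd x))"]) (auto simp: loop_support_def finite_loops)

lemma loop_support_spanned:
  "{u. Poly_Mapping.keys u \<subseteq> loop_support \<Gamma> S} \<subseteq> module.span pm_scale ((\<lambda>k. Poly_Mapping.single k 1) ` loop_support \<Gamma> S)"
proof
  interpret vector_space "pm_scale :: complex \<Rightarrow> (summand \<times> 'e list \<Rightarrow>\<^sub>0 complex) \<Rightarrow> _" by (rule vector_space_pm_scale)
  fix u :: "summand \<times> 'e list \<Rightarrow>\<^sub>0 complex" assume "u \<in> {u. Poly_Mapping.keys u \<subseteq> loop_support \<Gamma> S}"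
  then have "(\<Sum>k\<in>Poly_Mapping.keys u. pm_scale (Poly_Mapping.lookup u k) (Poly_Mapping.single k 1)) \<in>
      span ((\<lambda>k. Poly_Mapping.single k 1) ` loop_support \<Gamma> S)"
    by (intro span_sum span_scale span_base) auto
  then show "u \<in> span ((\<lambda>k. Poly_Mapping.single k 1) ` loop_support \<Gamma> S)"
    using lin_ext_unit[of u] unfolding lin_ext_def by simp
qed

end


section \<open>The tracial subalgebra\<close>

lemma star_algebra_isoD:
  assumes "star_algebra_iso \<delta> M N \<phi>"
  shows "a \<in> tlj_objects \<delta> \<Longrightarrow> lin_map (vscale M) (space_at M a) (vscale N) (space_at N a) (\<phi> a)"
    "a \<in> tlj_objects \<delta> \<Longrightarrow> bij_betw (\<phi> a) (space_at M a) (space_at N a)"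
    "a \<in> tlj_objects \<delta> \<Longrightarrow> b \<in> tlj_objects \<delta> \<Longrightarrow> f \<in> tlj_hom \<delta> a b \<Longrightarrow> u \<in> space_at M b \<Longrightarrow>
       \<phi> a (act M a b f u) = act N a b f (\<phi> b u)"
    "a \<in> tlj_objects \<delta> \<Longrightarrow> b \<in> tlj_objects \<delta> \<Longrightarrow> u \<in> space_at M a \<Longrightarrow> v \<in> space_at M b \<Longrightarrow>
       \<phi> (obj_tensor a b) (mult M a b u v) = mult N a b (\<phi> a u) (\<phi> b v)"
    "\<phi> tlj_unit (unit_vec M) = unit_vec N"
    "a \<in> tlj_objects \<delta> \<Longrightarrow> u \<in> space_at M a \<Longrightarrow> \<phi> (obj_bar a) (invol M a u) = invol N a (\<phi> a u)"
  using assms unfolding star_algebra_iso_def by simp_all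

lemma graph_space_iff:
  "u \<in> space_at (graph_algebra \<Gamma>) a \<longleftrightarrow> Poly_Mapping.keys u \<subseteq> loop_support \<Gamma> (fst a) \<and> graph_act \<Gamma> (snd a) u = u"
  by (simp add: graph_algebra_simps)

lemma (in fair_balanced) loop_support_pos: "k \<in> loop_support \<Gamma> S \<Longrightarrow> path_wt \<Gamma> (snd k) > 0"
  using path_wt_pos loopsD[of "snd k" "snd (fst k)"] by (cases k) (simp add: loop_support_def)

text \<open>The W*-algebra axioms for the algebra of \<open>\<Gamma>\<close> come from the given
  isomorphism statement, which includes them for both of its objects.\<close>

locale graph_star_algebra = fair_balanced \<delta> \<Gamma> + N: W_star_algebra \<delta> "graph_algebra \<Gamma>"
  for \<delta> :: real and \<Gamma> :: "('a, 'e) weighted_graph"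
begin

abbreviation "N \<equiv> graph_algebra \<Gamma>"

lemma act_mem: "a \<in> tlj_objects \<delta> \<Longrightarrow> b \<in> tlj_objects \<delta> \<Longrightarrow> f \<in> tlj_hom \<delta> a b \<Longrightarrow> u \<in> space_at N b \<Longrightarrow>
    graph_act \<Gamma> f u \<in> space_at N a"
  using lin_mapD(1)[OF N.act_linear] by (simp add: graph_algebra_simps(3))

lemma mult_mem: "a \<in> tlj_objects \<delta> \<Longrightarrow> b \<in> tlj_objects \<delta> \<Longrightarrow> u \<in> space_at N a \<Longrightarrow> v \<in> space_at N b \<Longrightarrow>
    bilin_ext mult_basis u v \<in> space_at N (obj_tensor a b)"
  using lin_mapD(1)[OF N.mult_linear_left] by (simp add: graph_algebra_simps(4))

lemma invol_mem: "a \<in> tlj_objects \<delta> \<Longrightarrow> u \<in> space_at N a \<Longrightarrow>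
    lin_ext (invol_basis \<Gamma>) (pm_cnj u) \<in> space_at N (obj_bar a)"
  using lin_mapD(1)[OF N.invol_antilinear[unfolded antilin_map_def]] by (simp add: graph_algebra_simps(6))

lemma unit_mem: "Poly_Mapping.single (([], 0), []) 1 \<in> space_at N tlj_unit"
  using N.unit_mem by (simp add: graph_algebra_simps(5))

lemma space_spanned:
  assumes "a \<in> tlj_objects \<delta>"
  shows "\<exists>S. finite S \<and> space_at N a \<subseteq> module.span (vscale N) S"
proof (intro exI conjI)
  have "finite (fst a)" using assms by (simp add: tlj_objects_iff uniform_def)
  then show "finite ((\<lambda>k. Poly_Mapping.single k (1::complex)) ` loop_support \<Gamma> (fst a))"
    by (intro finite_imageI finite_loop_support)
  have "space_at N a \<subseteq> {u. Poly_Mapping.keys u \<subseteq> loop_support \<Gamma> (fst a)}"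
    by (auto simp: graph_space_iff)
  also note loop_support_spanned
  finally show "space_at N a \<subseteq> module.span (vscale N) ((\<lambda>k. Poly_Mapping.single k (1::complex)) ` loop_support \<Gamma> (fst a))"
    unfolding graph_algebra_simps(1) .
qed

text \<open>Vectors of a space are fixed by the projection of its object, so compressing the cups by
  that projection makes no difference on them.\<close>

lemma graph_act_coev:
  assumes a: "a \<in> tlj_objects \<delta>" and u: "u \<in> space_at N (obj_tensor a (obj_bar a))"
  shows "graph_act \<Gamma> (coev \<delta> a) u = graph_act \<Gamma> (cups (fst a)) u"
proof -
  let ?b = "obj_tensor a (obj_bar a)"
  have b: "?b \<in> tlj_objects \<delta>" by (intro obj_tensor_in obj_bar_in a)
  have S: "uniform (fst a)" "uniform (fst ?b)" using a b by (auto simp: tlj_objects_iff)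
  have T: "tensor_set (fst a) (summand_bar ` fst a) = fst ?b" by (simp add: fst_obj_tensor fst_obj_bar)
  have "graph_act \<Gamma> (mor_comp \<delta> (snd ?b) (cups (fst a))) u = graph_act \<Gamma> (cups (fst a)) (graph_act \<Gamma> (snd ?b) u)"
    using N.act_comp[OF unit_in id_object_in[OF S(2)] b cups_hom[OF S(1), unfolded T] projection_hom[OF b] u]
    by (simp add: graph_algebra_simps(3))
  also have "graph_act \<Gamma> (snd ?b) u = u" using u by (simp add: graph_space_iff)
  finally show ?thesis by (simp only: coev_eq)
qed

lemma cover_embedding: "algebra_embedding \<delta> (graph_algebra \<Gamma>') N (\<lambda>a. proj_map)"
  and cover_image: "a \<in> tlj_objects \<delta> \<Longrightarrow>
    proj_map ` space_at (graph_algebra \<Gamma>') a = {u \<in> space_at N a. modular u = u}"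
proof -
  interpret C: fair_balanced \<delta> \<Gamma>' by (rule fair_balanced_tracial_cover)
  let ?T = "graph_algebra \<Gamma>'"
  interpret vT: vector_space "vscale ?T" unfolding graph_algebra_simps by (rule vector_space_pm_scale)
  have mat: "snd a \<in> matrices (fst a) (fst a)" if "a \<in> tlj_objects \<delta>" for a using that by (simp add: tlj_objects_iff)
  \<comment> \<open>Being fixed by the projection can be tested after forgetting heights, since
    \<open>lift_map\<close> recovers a combination of lifted loops from its image.\<close>
  have space: "u \<in> space_at ?T a \<longleftrightarrow> Poly_Mapping.keys u \<subseteq> loop_support \<Gamma>' (fst a) \<and> proj_map u \<in> space_at N a"
    if a: "a \<in> tlj_objects \<delta>" for a u
  proof (cases "Poly_Mapping.keys u \<subseteq> loop_support \<Gamma>' (fst a)")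
    case True
    have "graph_act \<Gamma>' (snd a) u = u \<longleftrightarrow> proj_map (graph_act \<Gamma>' (snd a) u) = proj_map u"
      using lift_map_proj_map[OF True] lift_map_proj_map[OF keys_graph_act[OF mat[OF a], of \<Gamma>' u]] by metis
    also have "\<dots> \<longleftrightarrow> graph_act \<Gamma> (snd a) (proj_map u) = proj_map u"
      by (simp add: proj_map_act[OF mat[OF a] True])
    finally show ?thesis using True keys_proj_map[OF True] by (auto simp: graph_space_iff)
  qed (simp add: graph_space_iff)
  have supp: "Poly_Mapping.keys u \<subseteq> loop_support \<Gamma>' (fst a)" if "u \<in> space_at ?T a" for u a
    using that by (simp add: graph_space_iff)
  have proj: "proj_map u \<in> space_at N a" if "a \<in> tlj_objects \<delta>" "u \<in> space_at ?T a" for u a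
    using that space by blast
  have padd: "proj_map (u + v) = proj_map u + proj_map v" "proj_map (pm_scale c u) = pm_scale c (proj_map u)"
    for u v :: "summand \<times> ((real \<times> 'a) \<times> 'e \<times> (real \<times> 'a)) list \<Rightarrow>\<^sub>0 complex" and c
    by (simp_all add: proj_map_def lin_ext_add lin_ext_scale)
  show "algebra_embedding \<delta> ?T N (\<lambda>a. proj_map)"
  proof (rule algebra_embedding.intro)
    show "W_star_algebra \<delta> N" by unfold_locales
    show "vector_space (vscale ?T)" by unfold_locales
    fix a assume a: "a \<in> tlj_objects \<delta>"
    show "module.subspace (vscale ?T) (space_at ?T a)"
    proof (rule vT.subspaceI)
      show "0 \<in> space_at ?T a" unfolding graph_space_iff by (simp add: graph_act_eq)
      fix x y c assume x: "x \<in> space_at ?T a"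
      show "vscale ?T c x \<in> space_at ?T a"
        using x keys_pm_scale[of c x] by (auto simp: graph_space_iff graph_act_eq bilin_ext_scale_right graph_algebra_simps(1))
      assume y: "y \<in> space_at ?T a"
      show "x + y \<in> space_at ?T a"
        using x y Poly_Mapping.keys_add[of x y] by (auto simp: graph_space_iff graph_act_eq bilin_ext_add_right)
    qed
    show "lin_map (vscale ?T) (space_at ?T a) (vscale N) (space_at N a) proj_map"
      unfolding lin_map_def graph_algebra_simps(1) using padd proj[OF a] by auto
    show "inj_on proj_map (space_at ?T a)"
      by (rule inj_on_inverseI[of _ "lift_map \<Gamma>"]) (rule lift_map_proj_map[OF supp])
    show "\<exists>S. finite S \<and> space_at N a \<subseteq> module.span (vscale N) S" by (rule space_spanned[OF a])
    fix u assume u: "u \<in> space_at ?T a"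
    show "proj_map (invol ?T a u) = invol N a (proj_map u)"
      by (simp add: graph_algebra_simps proj_map_invol)
    show "invol ?T a u \<in> space_at ?T (obj_bar a)"
      unfolding space[OF obj_bar_in[OF a]] graph_algebra_simps(6) proj_map_invol fst_obj_bar
      using C.invol_support[OF supp[OF u]] invol_mem[OF a proj[OF a u]] by simp
    fix b v assume b: "b \<in> tlj_objects \<delta>" and v: "v \<in> space_at ?T b"
    show "proj_map (mult ?T a b u v) = mult N a b (proj_map u) (proj_map v)"
      by (simp add: graph_algebra_simps proj_map_mult)
    show "mult ?T a b u v \<in> space_at ?T (obj_tensor a b)"
      unfolding space[OF obj_tensor_in[OF a b]] graph_algebra_simps(4) proj_map_mult fst_obj_tensor
      using C.mult_support[OF supp[OF u] supp[OF v]] mult_mem[OF a b proj[OF a u] proj[OF b v]] by simp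
  next
    fix a b f u assume ab: "a \<in> tlj_objects \<delta>" "b \<in> tlj_objects \<delta>" and f: "f \<in> tlj_hom \<delta> a b" and u: "u \<in> space_at ?T b"
    note fm = tlj_homD(1)[OF f]
    show eq: "proj_map (act ?T a b f u) = act N a b f (proj_map u)"
      unfolding graph_algebra_simps(3) by (rule proj_map_act[OF fm supp[OF u]])
    show "act ?T a b f u \<in> space_at ?T a"
      unfolding space[OF ab(1)] graph_algebra_simps(3) proj_map_act[OF fm supp[OF u]]
      using keys_graph_act[OF fm] act_mem[OF ab f proj[OF ab(2) u]] by blast
  next
    show "proj_map (unit_vec ?T) = unit_vec N" by (simp add: graph_algebra_simps(5) path_proj_def)
    show "unit_vec ?T \<in> space_at ?T tlj_unit"
      unfolding space[OF unit_in] using N.unit_mem C.loops_0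
      by (auto simp: graph_algebra_simps(5) path_proj_def loop_support_def tlj_unit_eq)
  qed
  show "proj_map ` space_at ?T a = {u \<in> space_at N a. modular u = u}" if a: "a \<in> tlj_objects \<delta>"
  proof
    show "proj_map ` space_at ?T a \<subseteq> {u \<in> space_at N a. modular u = u}"
    proof
      fix v assume "v \<in> proj_map ` space_at ?T a"
      then obtain u where u: "u \<in> space_at ?T a" "v = proj_map u" by blast
      then have "modular v = v" unfolding modular_fixed_iff using keys_proj_map[OF supp[OF u(1)]] by blast
      then show "v \<in> {u \<in> space_at N a. modular u = u}" using proj[OF a u(1)] u(2) by simp
    qed
    show "{u \<in> space_at N a. modular u = u} \<subseteq> proj_map ` space_at ?T a"
    proof
      fix v assume "v \<in> {u \<in> space_at N a. modular u = u}"
      then have v: "v \<in> space_at N a" "\<forall>k\<in>Poly_Mapping.keys v. path_wt \<Gamma> (snd k) = 1"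
        by (auto simp: modular_fixed_iff)
      then have "Poly_Mapping.keys v \<subseteq> {k \<in> loop_support \<Gamma> (fst a). path_wt \<Gamma> (snd k) = 1}"
        by (auto simp: graph_space_iff)
      then have "lift_map \<Gamma> v \<in> space_at ?T a"
        unfolding space[OF a] using keys_lift_map v(1) by (simp add: proj_map_lift_map)
      then show "v \<in> proj_map ` space_at ?T a" using proj_map_lift_map[of \<Gamma> v] by (metis imageI)
    qed
  qed
qed

end

section \<open>Transport of the modular operator along the given isomorphism\<close>

locale graph_iso = graph_star_algebra \<delta> \<Gamma> + M: star_algebra \<delta> M
  for \<delta> :: real and \<Gamma> :: "('a, 'e) weighted_graph" and M :: "'v::ab_group_add alg_object" +
  fixes \<phi> :: "tlj_object \<Rightarrow> 'v \<Rightarrow> (summand \<times> 'e list \<Rightarrow>\<^sub>0 complex)"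
  assumes iso: "star_algebra_iso \<delta> M (graph_algebra \<Gamma>) \<phi>"
begin

sublocale vM: vector_space "vscale M" by (rule M.vector_space)

sublocale vN: vector_space "vscale N" by (rule N.vector_space)

lemmas lin = star_algebra_isoD(1)[OF iso] and bij = star_algebra_isoD(2)[OF iso]
  and act = star_algebra_isoD(3)[OF iso, unfolded graph_algebra_simps]
  and mult = star_algebra_isoD(4)[OF iso, unfolded graph_algebra_simps]
  and unit = star_algebra_isoD(5)[OF iso, unfolded graph_algebra_simps]
  and invol = star_algebra_isoD(6)[OF iso, unfolded graph_algebra_simps]

lemma mem: "a \<in> tlj_objects \<delta> \<Longrightarrow> u \<in> space_at M a \<Longrightarrow> \<phi> a u \<in> space_at N a"
  by (rule lin_mapD(1)[OF lin])

lemma inj: "a \<in> tlj_objects \<delta> \<Longrightarrow> inj_on (\<phi> a) (space_at M a)"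
  using bij by (rule bij_betw_imp_inj_on)

lemma image: "a \<in> tlj_objects \<delta> \<Longrightarrow> \<phi> a ` space_at M a = space_at N a"
  using bij by (rule bij_betw_imp_surj_on)

lemma support: "a \<in> tlj_objects \<delta> \<Longrightarrow> u \<in> space_at M a \<Longrightarrow> Poly_Mapping.keys (\<phi> a u) \<subseteq> loop_support \<Gamma> (fst a)"
  using mem by (simp add: graph_space_iff)

lemma M_act_mem: "a \<in> tlj_objects \<delta> \<Longrightarrow> b \<in> tlj_objects \<delta> \<Longrightarrow> f \<in> tlj_hom \<delta> a b \<Longrightarrow> u \<in> space_at M b \<Longrightarrow>
    act M a b f u \<in> space_at M a"
  by (rule lin_mapD(1)[OF M.act_linear])

lemma M_mult_mem: "a \<in> tlj_objects \<delta> \<Longrightarrow> b \<in> tlj_objects \<delta> \<Longrightarrow> u \<in> space_at M a \<Longrightarrow> v \<in> space_at M b \<Longrightarrow>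
    mult M a b u v \<in> space_at M (obj_tensor a b)"
  by (rule lin_mapD(1)[OF M.mult_linear_left])

lemma M_invol_mem: "a \<in> tlj_objects \<delta> \<Longrightarrow> u \<in> space_at M a \<Longrightarrow> invol M a u \<in> space_at M (obj_bar a)"
  by (rule lin_mapD(1)[OF M.invol_antilinear[unfolded antilin_map_def]])

text \<open>The isomorphism sends the unit to the empty loop, so the scalar picked by
  \<open>THE\<close> is the coefficient of the empty loop, and injectivity makes it well
  defined.\<close>

lemma unit_coeff_eq:
  assumes z: "z \<in> space_at M tlj_unit" and c: "\<phi> tlj_unit z = Poly_Mapping.single (([], 0), []) c"
  shows "unit_coeff M z = c"
  unfolding unit_coeff_def
proof (rule the_equality)
  note u = unit_in[of \<delta>]
  have scale: "\<phi> tlj_unit (vscale M d (unit_vec M)) = Poly_Mapping.single (([], 0), []) d" for d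
    using lin_mapD(3)[OF lin[OF u] M.unit_mem, of d] unit by (simp add: graph_algebra_simps(1))
  show "z = vscale M c (unit_vec M)"
    by (rule inj_onD[OF inj[OF u]]) (use z c scale vM.subspace_scale[OF M.subspace[OF u] M.unit_mem] in simp_all)
  fix d assume "z = vscale M d (unit_vec M)"
  then have "Poly_Mapping.single (([], 0) :: summand, [] :: 'e list) d = Poly_Mapping.single (([], 0), []) c"
    using c scale[of d] by simp
  then have "Poly_Mapping.lookup (Poly_Mapping.single (([], 0) :: summand, [] :: 'e list) d) (([], 0), []) =
      Poly_Mapping.lookup (Poly_Mapping.single (([], 0), []) c) (([], 0), [])" by simp
  then show "d = c" by simp
qed

lemma left_inner_eq:
  assumes a: "a \<in> tlj_objects \<delta>" and f: "f \<in> space_at M a" and g: "g \<in> space_at M a"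
  shows "left_inner \<delta> M a f g = (\<Sum>k\<in>Poly_Mapping.keys (\<phi> a f).
    Poly_Mapping.lookup (\<phi> a f) k * cnj (Poly_Mapping.lookup (\<phi> a g) k))"
  unfolding left_inner_def
proof (rule unit_coeff_eq)
  let ?b = "obj_tensor a (obj_bar a)" and ?m = "mult M a (obj_bar a) f (invol M a g)"
  have oa: "obj_bar a \<in> tlj_objects \<delta>" and b: "?b \<in> tlj_objects \<delta>" by (intro obj_tensor_in obj_bar_in a)+
  have m: "?m \<in> space_at M ?b" by (intro M_mult_mem M_invol_mem oa a f g)
  show "act M tlj_unit ?b (coev \<delta> a) ?m \<in> space_at M tlj_unit"
    by (intro M_act_mem unit_in b coev_hom a m)
  have S: "uniform (fst a)" using a by (simp add: tlj_objects_iff)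
  have pm: "\<phi> ?b ?m = bilin_ext mult_basis (\<phi> a f) (lin_ext (invol_basis \<Gamma>) (pm_cnj (\<phi> a g)))"
    using mult[OF a oa f M_invol_mem[OF a g]] invol[OF a g] by simp
  have "\<phi> tlj_unit (act M tlj_unit ?b (coev \<delta> a) ?m) = graph_act \<Gamma> (coev \<delta> a) (\<phi> ?b ?m)"
    by (rule act[OF unit_in b coev_hom[OF a] m])
  also have "\<dots> = graph_act \<Gamma> (cups (fst a)) (\<phi> ?b ?m)" by (rule graph_act_coev[OF a mem[OF b m]])
  finally show "\<phi> tlj_unit (act M tlj_unit ?b (coev \<delta> a) ?m) = Poly_Mapping.single (([], 0), [])
      (\<Sum>k\<in>Poly_Mapping.keys (\<phi> a f). Poly_Mapping.lookup (\<phi> a f) k * cnj (Poly_Mapping.lookup (\<phi> a g) k))"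
    unfolding pm graph_left_inner[OF S support[OF a f] support[OF a g]] .
qed

lemma right_inner_eq:
  assumes a: "a \<in> tlj_objects \<delta>" and f: "f \<in> space_at M a" and g: "g \<in> space_at M a"
  shows "right_inner \<delta> M a g f = (\<Sum>k\<in>Poly_Mapping.keys (\<phi> a f).
    Poly_Mapping.lookup (\<phi> a f) k * cnj (Poly_Mapping.lookup (\<phi> a g) k) * of_real (inverse (path_wt \<Gamma> (snd k))))"
  unfolding right_inner_def mor_star_ev[OF a]
proof (rule unit_coeff_eq)
  let ?b = "obj_tensor (obj_bar a) a" and ?m = "mult M (obj_bar a) a (invol M a g) f"
  have oa: "obj_bar a \<in> tlj_objects \<delta>" and b: "?b \<in> tlj_objects \<delta>" by (intro obj_tensor_in obj_bar_in a)+
  have bb: "obj_tensor (obj_bar a) (obj_bar (obj_bar a)) = ?b" by (simp add: obj_bar_bar[OF a])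
  have c: "coev \<delta> (obj_bar a) \<in> tlj_hom \<delta> tlj_unit ?b" using coev_hom[OF oa] unfolding bb .
  have m: "?m \<in> space_at M ?b" by (intro M_mult_mem M_invol_mem oa a f g)
  show "act M tlj_unit ?b (coev \<delta> (obj_bar a)) ?m \<in> space_at M tlj_unit"
    by (intro M_act_mem unit_in b c m)
  have S: "uniform (fst a)" using a by (simp add: tlj_objects_iff)
  have pm: "\<phi> ?b ?m = bilin_ext mult_basis (lin_ext (invol_basis \<Gamma>) (pm_cnj (\<phi> a g))) (\<phi> a f)"
    using mult[OF oa a M_invol_mem[OF a g] f] invol[OF a g] by simp
  have "\<phi> tlj_unit (act M tlj_unit ?b (coev \<delta> (obj_bar a)) ?m) = graph_act \<Gamma> (coev \<delta> (obj_bar a)) (\<phi> ?b ?m)"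
    by (rule act[OF unit_in b c m])
  also have "\<dots> = graph_act \<Gamma> (cups (fst (obj_bar a))) (\<phi> ?b ?m)"
    by (rule graph_act_coev[OF oa]) (use mem[OF b m] in \<open>simp only: bb\<close>)
  finally show "\<phi> tlj_unit (act M tlj_unit ?b (coev \<delta> (obj_bar a)) ?m) = Poly_Mapping.single (([], 0), [])
      (\<Sum>k\<in>Poly_Mapping.keys (\<phi> a f). Poly_Mapping.lookup (\<phi> a f) k * cnj (Poly_Mapping.lookup (\<phi> a g) k) *
        of_real (inverse (path_wt \<Gamma> (snd k))))"
    unfolding pm fst_obj_bar graph_right_inner[OF S support[OF a f] support[OF a g]] .
qed

lemma modular_add: "modular (u + v) = modular u + modular v"
  and modular_scale: "modular (pm_scale c u) = pm_scale c (modular u)"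
  and modular_zero: "modular 0 = 0"
  by (simp_all add: modular_def lin_ext_add lin_ext_scale)

lemma modular_mem:
  assumes a: "a \<in> tlj_objects \<delta>" and u: "u \<in> space_at N a"
  shows "modular u \<in> space_at N a"
proof -
  have *: "snd a \<in> matrices (fst a) (fst a)" using a by (simp add: tlj_objects_iff)
  have "Poly_Mapping.keys (modular u) \<subseteq> Poly_Mapping.keys u"
    by (auto simp: in_keys_iff lookup_modular)
  then show ?thesis
    using u graph_act_modular[OF *, of u] by (auto simp: graph_space_iff)
qed

text \<open>All weights are positive, so the form at \<open>w\<close> is a sum of nonnegative terms.
  This is what makes the modular operator unique.\<close>

lemma weighted_form_nondegenerate:
  assumes "Poly_Mapping.keys w \<subseteq> loop_support \<Gamma> S"
    and "(\<Sum>k\<in>Poly_Mapping.keys w. Poly_Mapping.lookup w k * cnj (Poly_Mapping.lookup w k) *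
       of_real (inverse (path_wt \<Gamma> (snd k)))) = 0"
  shows "w = 0"
proof -
  have pos: "path_wt \<Gamma> (snd k) > 0" if "k \<in> Poly_Mapping.keys w" for k
    using assms(1) that loop_support_pos by blast
  let ?t = "\<lambda>k. (cmod (Poly_Mapping.lookup w k))\<^sup>2 * inverse (path_wt \<Gamma> (snd k))"
  have "complex_of_real (\<Sum>k\<in>Poly_Mapping.keys w. ?t k) = 0"
    using assms(2) by (simp only: of_real_sum of_real_mult complex_norm_square)
  then have "(\<Sum>k\<in>Poly_Mapping.keys w. ?t k) = 0" by (simp only: of_real_eq_0_iff)
  moreover have "?t k \<ge> 0" if "k \<in> Poly_Mapping.keys w" for k using pos[OF that] by simp
  ultimately have z: "\<forall>k\<in>Poly_Mapping.keys w. ?t k = 0" by (simp only: sum_nonneg_eq_0_iff finite_keys)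
  have "Poly_Mapping.lookup w k = 0" for k
  proof (rule ccontr)
    assume "Poly_Mapping.lookup w k \<noteq> 0"
    then have "k \<in> Poly_Mapping.keys w" by (simp add: in_keys_iff)
    then have "?t k = 0" "path_wt \<Gamma> (snd k) > 0" using z pos by auto
    then show False using \<open>Poly_Mapping.lookup w k \<noteq> 0\<close> by simp
  qed
  then show ?thesis by (intro poly_mapping_eqI) simp
qed

lemma modular_op_eq:
  assumes a: "a \<in> tlj_objects \<delta>" and v: "v \<in> space_at M a"
  shows "\<phi> a (modular_op \<delta> M a v) = modular (\<phi> a v) \<and> modular_op \<delta> M a v \<in> space_at M a"
proof -
  let ?X = "space_at M a"
  let ?P = "\<lambda>T. T \<in> extensional ?X \<and> lin_map (vscale M) ?X (vscale M) ?X T \<and>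
     (\<forall>f\<in>?X. \<forall>g\<in>?X. left_inner \<delta> M a f g = right_inner \<delta> M a g (T f))"
  \<comment> \<open>The candidate: \<open>modular\<close> carried back along the isomorphism.
    Restricting it makes it undefined outside the space, so that the definite description singles
    out one function.\<close>
  define T where "T = restrict (\<lambda>v. inv_into ?X (\<phi> a) (modular (\<phi> a v))) ?X"
  note linD = lin_mapD[OF lin[OF a], unfolded graph_algebra_simps(1)]
  have sub: "vM.subspace ?X" by (rule M.subspace[OF a])
  have T: "T v \<in> ?X" "\<phi> a (T v) = modular (\<phi> a v)" if "v \<in> ?X" for v
  proof -
    have "modular (\<phi> a v) \<in> \<phi> a ` ?X" using modular_mem[OF a mem[OF a that]] image[OF a] by simp
    then show "T v \<in> ?X" "\<phi> a (T v) = modular (\<phi> a v)"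
      using that by (simp_all add: T_def inv_into_into f_inv_into_f)
  qed
  have eqI: "u = w" if "u \<in> ?X" "w \<in> ?X" "\<phi> a u = \<phi> a w" for u w
    using inj[OF a] that by (meson inj_onD)
  have keys_mod: "Poly_Mapping.keys (modular u) \<subseteq> Poly_Mapping.keys u" for u
    by (auto simp: in_keys_iff lookup_modular)
  have inner: "left_inner \<delta> M a f g = right_inner \<delta> M a g (T f)" if f: "f \<in> ?X" and g: "g \<in> ?X" for f g
  proof -
    let ?f = "\<phi> a f" and ?g = "\<phi> a g"
    have pos: "path_wt \<Gamma> (snd k) > 0" if "k \<in> Poly_Mapping.keys ?f" for k
      using support[OF a f] that loop_support_pos by blast
    have "right_inner \<delta> M a g (T f) = (\<Sum>k\<in>Poly_Mapping.keys (modular ?f). Poly_Mapping.lookup (modular ?f) k *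
        cnj (Poly_Mapping.lookup ?g k) * of_real (inverse (path_wt \<Gamma> (snd k))))"
      using right_inner_eq[OF a T(1)[OF f] g] T(2)[OF f] by simp
    also have "\<dots> = (\<Sum>k\<in>Poly_Mapping.keys ?f. Poly_Mapping.lookup (modular ?f) k *
        cnj (Poly_Mapping.lookup ?g k) * of_real (inverse (path_wt \<Gamma> (snd k))))"
      by (rule sum.mono_neutral_left) (use keys_mod in \<open>auto simp: in_keys_iff\<close>)
    also have "\<dots> = (\<Sum>k\<in>Poly_Mapping.keys ?f. Poly_Mapping.lookup ?f k * cnj (Poly_Mapping.lookup ?g k))"
    proof (rule sum.cong[OF refl])
      fix k assume "k \<in> Poly_Mapping.keys ?f"
      from pos[OF this] have "path_wt \<Gamma> (snd k) \<noteq> 0" by simp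
      then have "complex_of_real (path_wt \<Gamma> (snd k)) * of_real (inverse (path_wt \<Gamma> (snd k))) = 1"
        by (simp only: of_real_mult[symmetric] right_inverse of_real_1 simp_thms)
      then show "Poly_Mapping.lookup (modular ?f) k * cnj (Poly_Mapping.lookup ?g k) * of_real (inverse (path_wt \<Gamma> (snd k))) =
          Poly_Mapping.lookup ?f k * cnj (Poly_Mapping.lookup ?g k)"
        unfolding lookup_modular by (metis (no_types, lifting) mult.assoc mult.commute mult.right_neutral)
    qed
    also have "\<dots> = left_inner \<delta> M a f g" by (rule left_inner_eq[OF a f g, symmetric])
    finally show ?thesis by simp
  qed
  have "?P T"
  proof (intro conjI ballI)
    show "T \<in> extensional ?X" by (simp add: T_def)
    show "lin_map (vscale M) ?X (vscale M) ?X T"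
      unfolding lin_map_def
    proof (intro conjI ballI allI)
      fix u w c assume u: "u \<in> ?X"
      show "T u \<in> ?X" by (rule T(1)[OF u])
      have cu: "vscale M c u \<in> ?X" by (rule vM.subspace_scale[OF sub u])
      show "T (vscale M c u) = vscale M c (T u)"
        by (rule eqI) (use T u cu vM.subspace_scale[OF sub T(1)[OF u]] in \<open>simp_all add: linD(3) modular_scale\<close>)
      assume w: "w \<in> ?X"
      have uw: "u + w \<in> ?X" by (rule vM.subspace_add[OF sub u w])
      show "T (u + w) = T u + T w"
        by (rule eqI) (use T u w uw vM.subspace_add[OF sub T(1)[OF u] T(1)[OF w]] in \<open>simp_all add: linD(2) modular_add\<close>)
    qed
    show "left_inner \<delta> M a f g = right_inner \<delta> M a g (T f)" if "f \<in> ?X" "g \<in> ?X" for f g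
      by (rule inner[OF that])
  qed
  moreover have "T' = T" if P: "?P T'" for T'
  proof (rule extensionalityI[of _ ?X])
    show "T' \<in> extensional ?X" "T \<in> extensional ?X" using P by (auto simp: T_def)
    fix f assume f: "f \<in> ?X"
    have T'f: "T' f \<in> ?X" using P f lin_mapD(1) by blast
    \<comment> \<open>The right inner products of \<open>T' f\<close> and \<open>T f\<close> with
      any vector agree with the left one of \<open>f\<close>; taking their difference as that vector
      gives the form of \<open>h\<close> at itself.\<close>
    define h where "h = T' f - T f"
    have h: "h \<in> ?X" unfolding h_def by (rule vM.subspace_diff[OF sub T'f T(1)[OF f]])
    let ?u = "\<phi> a (T' f)" and ?v = "\<phi> a (T f)" and ?w = "\<phi> a h"
    have w: "?w = ?u - ?v"
      unfolding h_def by (rule lin_map_diff[OF M.vector_space N.vector_space sub lin[OF a] T'f T(1)[OF f]])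
    \<comment> \<open>A common index set is needed before the two sums can be subtracted; the terms
      outside the original keys are zero.\<close>
    let ?K = "Poly_Mapping.keys ?u \<union> Poly_Mapping.keys ?v"
    let ?t = "\<lambda>x k. Poly_Mapping.lookup x k * cnj (Poly_Mapping.lookup ?w k) * of_real (inverse (path_wt \<Gamma> (snd k)))"
    have R: "right_inner \<delta> M a h y = (\<Sum>k\<in>?K. ?t (\<phi> a y) k)"
      if "y \<in> ?X" "Poly_Mapping.keys (\<phi> a y) \<subseteq> ?K" for y
      unfolding right_inner_eq[OF a that(1) h]
      by (rule sum.mono_neutral_left) (use that(2) in \<open>auto simp: in_keys_iff\<close>)
    have "right_inner \<delta> M a h (T' f) = right_inner \<delta> M a h (T f)"
      using P f h inner[OF f h] by simp
    then have "(\<Sum>k\<in>?K. ?t ?u k) - (\<Sum>k\<in>?K. ?t ?v k) = 0"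
      using R[OF T'f] R[OF T(1)[OF f]] by simp
    then have "(\<Sum>k\<in>?K. ?t ?w k) = 0"
      unfolding sum_subtractf[symmetric] by (simp add: w lookup_minus algebra_simps)
    moreover have wK: "Poly_Mapping.keys ?w \<subseteq> ?K" unfolding w by (auto simp: in_keys_iff lookup_minus)
    ultimately have "right_inner \<delta> M a h h = 0" using R[OF h] by simp
    then have "?w = 0"
      using weighted_form_nondegenerate[OF support[OF a h]] unfolding right_inner_eq[OF a h h] by simp
    then show "T' f = T f" using eqI[OF T'f T(1)[OF f]] w by simp
  qed
  ultimately have "modular_op \<delta> M a = T" unfolding modular_op_def by (rule the_equality)
  then show ?thesis using T[OF v] by simp
qed

lemma tracial_space:
  assumes a: "a \<in> tlj_objects \<delta>"
  shows "space_at (tracial_subalgebra \<delta> M) a = {v \<in> space_at M a. modular (\<phi> a v) = \<phi> a v}"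
proof -
  have "modular_op \<delta> M a v = v \<longleftrightarrow> modular (\<phi> a v) = \<phi> a v" if v: "v \<in> space_at M a" for v
    using modular_op_eq[OF a v] inj_onD[OF inj[OF a] _ _ v] by metis
  then show ?thesis by (auto simp: tracial_subalgebra_def)
qed

lemma tracial_simps:
  "vscale (tracial_subalgebra \<delta> M) = vscale M" "act (tracial_subalgebra \<delta> M) = act M"
  "mult (tracial_subalgebra \<delta> M) = mult M" "unit_vec (tracial_subalgebra \<delta> M) = unit_vec M"
  "invol (tracial_subalgebra \<delta> M) = invol M"
  by (simp_all add: tracial_subalgebra_def)

lemma tracial_embedding: "algebra_embedding \<delta> (tracial_subalgebra \<delta> M) N \<phi>"
proof (rule algebra_embedding.intro)
  let ?T = "tracial_subalgebra \<delta> M"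
  show "W_star_algebra \<delta> N" by unfold_locales
  show "vector_space (vscale ?T)" unfolding tracial_simps by unfold_locales
  fix a assume a: "a \<in> tlj_objects \<delta>"
  note linD = lin_mapD[OF lin[OF a], unfolded graph_algebra_simps(1)]
  have sub: "vM.subspace (space_at M a)" by (rule M.subspace[OF a])
  show "module.subspace (vscale ?T) (space_at ?T a)"
    unfolding tracial_simps
  proof (rule vM.subspaceI)
    show "0 \<in> space_at ?T a"
      unfolding tracial_space[OF a]
      using vM.subspace_0[OF sub] lin_map_zero[OF M.vector_space N.vector_space sub lin[OF a]] by (simp add: modular_zero)
    fix x y c assume x: "x \<in> space_at ?T a"
    show "vscale M c x \<in> space_at ?T a"
      using x vM.subspace_scale[OF sub] unfolding tracial_space[OF a] by (simp add: linD(3) modular_scale)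
    assume y: "y \<in> space_at ?T a"
    show "x + y \<in> space_at ?T a"
      using x y vM.subspace_add[OF sub] unfolding tracial_space[OF a] by (simp add: linD(2) modular_add)
  qed
  have subset: "space_at ?T a \<subseteq> space_at M a" unfolding tracial_space[OF a] by blast
  show "lin_map (vscale ?T) (space_at ?T a) (vscale N) (space_at N a) (\<phi> a)"
    unfolding tracial_simps by (rule lin_map_subset[OF lin[OF a] subset]) (use mem[OF a] subset in blast)
  show "inj_on (\<phi> a) (space_at ?T a)" by (rule inj_on_subset[OF inj[OF a] subset])
  show "\<exists>S. finite S \<and> space_at N a \<subseteq> module.span (vscale N) S" by (rule space_spanned[OF a])
  fix u assume "u \<in> space_at ?T a"
  then have u: "u \<in> space_at M a" "modular (\<phi> a u) = \<phi> a u" unfolding tracial_space[OF a] by auto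
  show "\<phi> (obj_bar a) (invol ?T a u) = invol N a (\<phi> a u)"
    unfolding tracial_simps graph_algebra_simps by (rule invol[OF a u(1)])
  show "invol ?T a u \<in> space_at ?T (obj_bar a)"
    unfolding tracial_simps tracial_space[OF obj_bar_in[OF a]]
    using M_invol_mem[OF a u(1)] modular_invol_fixed[OF u(2) support[OF a u(1)]] by (simp add: invol[OF a u(1)])
  fix b v assume b: "b \<in> tlj_objects \<delta>" and "v \<in> space_at ?T b"
  then have v: "v \<in> space_at M b" "modular (\<phi> b v) = \<phi> b v" unfolding tracial_space[OF b] by auto
  show "\<phi> (obj_tensor a b) (mult ?T a b u v) = mult N a b (\<phi> a u) (\<phi> b v)"
    unfolding tracial_simps graph_algebra_simps by (rule mult[OF a b u(1) v(1)])
  show "mult ?T a b u v \<in> space_at ?T (obj_tensor a b)"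
    unfolding tracial_simps tracial_space[OF obj_tensor_in[OF a b]]
    using M_mult_mem[OF a b u(1) v(1)] modular_mult_fixed[OF u(2) v(2)] by (simp add: mult[OF a b u(1) v(1)])
next
  let ?T = "tracial_subalgebra \<delta> M"
  fix a b f u assume ab: "a \<in> tlj_objects \<delta>" "b \<in> tlj_objects \<delta>" and f: "f \<in> tlj_hom \<delta> a b" and "u \<in> space_at ?T b"
  then have u: "u \<in> space_at M b" "modular (\<phi> b u) = \<phi> b u" unfolding tracial_space[OF ab(2)] by auto
  show "\<phi> a (act ?T a b f u) = act N a b f (\<phi> b u)"
    unfolding tracial_simps graph_algebra_simps by (rule act[OF ab f u(1)])
  show "act ?T a b f u \<in> space_at ?T a"
    unfolding tracial_simps tracial_space[OF ab(1)]
    using M_act_mem[OF ab f u(1)] graph_act_modular[OF tlj_homD(1)[OF f] support[OF ab(2) u(1)]] u(2)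
    by (simp add: act[OF ab f u(1)])
next
  let ?T = "tracial_subalgebra \<delta> M"
  show "\<phi> tlj_unit (unit_vec ?T) = unit_vec N" unfolding tracial_simps graph_algebra_simps by (rule unit)
  show "unit_vec ?T \<in> space_at ?T tlj_unit"
    unfolding tracial_simps tracial_space[OF unit_in] using M.unit_mem unit by (simp add: modular_fixed_iff)
qed

lemma tracial_image:
  assumes a: "a \<in> tlj_objects \<delta>"
  shows "\<phi> a ` space_at (tracial_subalgebra \<delta> M) a = {u \<in> space_at N a. modular u = u}"
  unfolding tracial_space[OF a] image[OF a, symmetric] by blast

text \<open>The unit object only sees loops of length 0, and the empty loop has weight 1. So passing
  to the tracial part preserves connectedness.\<close>

lemma tracial_unit_space: "space_at (tracial_subalgebra \<delta> M) tlj_unit = space_at M tlj_unit"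
proof -
  have "modular (\<phi> tlj_unit v) = \<phi> tlj_unit v" if v: "v \<in> space_at M tlj_unit" for v
    unfolding modular_fixed_iff
  proof
    fix k assume k: "k \<in> Poly_Mapping.keys (\<phi> tlj_unit v)"
    have fst_unit: "fst tlj_unit = {([], 0)}" by (simp add: tlj_unit_eq)
    have "k \<in> loop_support \<Gamma> {([], 0)}"
      by (rule subsetD[OF support[OF unit_in v, unfolded fst_unit] k])
    then have e: "fst k = ([], 0) \<and> snd k \<in> loops \<Gamma> (snd (fst k))"
      unfolding loop_support_def mem_Collect_eq case_prod_beta singleton_iff .
    from conjunct2[OF e] have "snd k = []"
      unfolding conjunct1[OF e] snd_conv loops_0 by (rule singletonD)
    then show "path_wt \<Gamma> (snd k) = 1" by simp
  qed
  then show ?thesis unfolding tracial_space[OF unit_in] by blast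
qed

end

theorem theorem3p8:
  fixes q \<delta> :: real
    and M :: "'v::ab_group_add alg_object"
    and \<Gamma> :: "('a, 'e) weighted_graph"
  assumes "0 < q" "q \<le> 1" "\<delta> = q + inverse q"
    and "W_star_algebra \<delta> M"
    and "connected_algebra M"
    and "fair_balanced \<delta> \<Gamma>"
    and "W_star_isomorphic \<delta> M (graph_algebra \<Gamma>)"
  shows "connected_algebra (tracial_subalgebra \<delta> M) \<and>
         fair_balanced \<delta> (tracial_cover \<Gamma>) \<and>
         W_star_isomorphic \<delta> (tracial_subalgebra \<delta> M) (graph_algebra (tracial_cover \<Gamma>))"
proof -
  obtain \<phi> where \<phi>: "star_algebra_iso \<delta> M (graph_algebra \<Gamma>) \<phi>" and W: "W_star_algebra \<delta> (graph_algebra \<Gamma>)"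
    using assms(7) unfolding W_star_isomorphic_def by blast
  interpret M: W_star_algebra \<delta> M by fact
  interpret fair_balanced \<delta> \<Gamma> by fact
  interpret N: W_star_algebra \<delta> "graph_algebra \<Gamma>" by fact
  interpret graph_iso \<delta> \<Gamma> M \<phi> by unfold_locales (rule \<phi>)
  have "connected_algebra (tracial_subalgebra \<delta> M)"
    using assms(5) unfolding connected_algebra_def tracial_unit_space tracial_simps .
  moreover have "star_algebra_iso \<delta> (tracial_subalgebra \<delta> M) (graph_algebra (tracial_cover \<Gamma>))
      (\<lambda>a u. inv_into (space_at (graph_algebra (tracial_cover \<Gamma>)) a) proj_map (\<phi> a u))"
    by (rule iso_of_embeddings[OF tracial_embedding cover_embedding]) (simp add: tracial_image cover_image)
  ultimately show ?thesis
    using fair_balanced_tracial_cover algebra_embedding.W_star_algebra[OF tracial_embedding]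
      algebra_embedding.W_star_algebra[OF cover_embedding]
    unfolding W_star_isomorphic_def by blast
qed

end
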